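(* Let $b\in\mathcal{B}_3$ be a (not necessarily pure) braid which is not a power of $\Delta_3$, write $b=\sigma_j^k\,b_1\,\Delta_3^{\ell}$ in the unique form described in the context, put $\vartheta(b)=\sigma_j^{q(k)}b_1$, and let $w$ be the reduced word in $a_1,a_2$ representing the image of the pure braid $\vartheta(b)$ in $\mathcal{PB}_3/\langle\Delta_3^2\rangle$. Then $$\frac{1}{2\pi}\mathcal{L}(w)\le\Lambda_{tr}(b)\le300\cdot\mathcal{L}(w),$$ except in the case $b=\sigma_j^k\Delta_3^{\ell}$ with $j\in\{1,2\}$, $k\neq0$ an integer and $\ell$ an arbitrary integer; in this case $\Lambda_{tr}(b)=0$.
   Context: $\mathcal{B}_3$ is the fundamental group of $C_3(\mathbb{C})/\mathcal{S}_3$ (unordered triples of distinct complex numbers), with standard generators $\sigma_1,\sigma_2$ and Garside element $\Delta_3=\sigma_1\sigma_2\sigma_1$. Every $b\in\mathcal{B}_3$ that is not a power of $\Delta_3$ can be written uniquely as $b=\sigma_j^k b_1\Delta_3^\ell$ with $j\in\{1,2\}$, $k\ne0$, $\ell\in\mathbb{Z}$, $b_1$ a reduced word in $\sigma_1^2,\sigma_2^2$ whose first term (if $b_1\ne1$) is a nonzero even power of $\sigma_2$ if $j=1$ and of $\sigma_1$ if $j=2$. For an integer $k\ne0$, $q(k)$ is $k$ if $k$ is even and $k-\mathrm{sgn}(k)$ if $k$ is odd. $\mathcal{E}^{tr}=C_3(\mathbb{R})/\mathcal{S}_3$ is connected and simply connected, so $\mathcal{B}_3\cong\pi_1(C_3(\mathbb{C})/\mathcal{S}_3,\mathcal{E}^{tr})$;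 $b_{tr}$ is the image of $b$. A map $f$ from an open rectangle $R$ (sides parallel to the axes), continuous on $\bar R$, represents $b_{tr}$ if it maps the open horizontal sides into $\mathcal{E}^{tr}$ and its restriction to the closure of each maximal vertical segment in $R$ represents $b_{tr}$. $\Lambda_{tr}(b)$ is the infimum of $\lambda(R)=$ (vertical side length)/(horizontal side length) over rectangles admitting a holomorphic map to $C_3(\mathbb{C})/\mathcal{S}_3$ representing $b_{tr}$. $\mathcal{PB}_3/\langle\Delta_3^2\rangle$ is free on $a_1,a_2$, the classes of $\sigma_1^2,\sigma_2^2$. Syllables of a nontrivial reduced word $w=w_1^{n_1}w_2^{n_2}\cdots$ (terms $w_j^{n_j}$, $n_j\ne0$, $w_j$ alternately $a_1,a_2$): (1) each term with $|n_j|\ge2$; (2) each maximal sequence of at least two consecutive terms all with exponent $+1$, or all with exponent $-1$; (3) each remaining term. Degree of a syllable = sum of absolute values of exponents of its terms; $\mathcal{L}(w)=\sum_j\log(4d_j-1)$ over syllables. *)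

theory Defs
  imports "HOL-Complex_Analysis.Complex_Analysis"
begin

type_synonym cfg = "complex \<times> complex \<times> complex"

text \<open>An unordered triple {z1,z2,z3} is identified with the coefficient triple
 (a,b,c) of the monic polynomial (z-z1)(z-z2)(z-z3) = z^3 + a z^2 + b z + c.
 This is the standard biholomorphic identification of the symmetrised
 configuration space with the space of monic cubics with simple roots.\<close>

definition vieta :: "complex \<Rightarrow> complex \<Rightarrow> complex \<Rightarrow> cfg" where
  "vieta z1 z2 z3 = (-(z1 + z2 + z3), z1*z2 + z1*z3 + z2*z3, -(z1*z2*z3))"

definition Conf3 :: "cfg set" where
  "Conf3 = {vieta z1 z2 z3 | z1 z2 z3. z1 \<noteq> z2 \<and> z1 \<noteq> z3 \<and> z2 \<noteq> z3}"

definition Etr :: "cfg set" where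
  "Etr = {vieta (complex_of_real x1) (complex_of_real x2) (complex_of_real x3) | x1 x2 x3.
            x1 \<noteq> x2 \<and> x1 \<noteq> x3 \<and> x2 \<noteq> x3}"

definition base_cfg :: cfg where
  "base_cfg = vieta 1 2 3"

text \<open>sigma_1: the points 1,2 of the base configuration {1,2,3} exchange by a half
 turn (counterclockwise) about 3/2; sigma_2: the same for the points 2,3.\<close>

definition gen_path :: "nat \<Rightarrow> real \<Rightarrow> cfg" where
  "gen_path i t =
     (if i = 1 then vieta (3/2 - exp (\<i> * pi * t) / 2) (3/2 + exp (\<i> * pi * t) / 2) 3
      else vieta 1 (5/2 - exp (\<i> * pi * t) / 2) (5/2 + exp (\<i> * pi * t) / 2))"

definition const_path :: "real \<Rightarrow> cfg" where
  "const_path = (\<lambda>t. base_cfg)"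

fun iter_path :: "(real \<Rightarrow> cfg) \<Rightarrow> nat \<Rightarrow> real \<Rightarrow> cfg" where
  "iter_path g 0 = const_path"
| "iter_path g (Suc n) = g +++ iter_path g n"

definition gen_pow_path :: "nat \<Rightarrow> int \<Rightarrow> real \<Rightarrow> cfg" where
  "gen_pow_path i k =
     (if 0 \<le> k then iter_path (gen_path i) (nat k)
      else iter_path (reversepath (gen_path i)) (nat (-k)))"

fun word_path :: "(nat \<times> int) list \<Rightarrow> real \<Rightarrow> cfg" where
  "word_path [] = const_path"
| "word_path ((i, k) # ws) = gen_pow_path i k +++ word_path ws"

definition delta_word :: "int \<Rightarrow> (nat \<times> int) list" where
  "delta_word l = concat (replicate (nat \<bar>l\<bar>) [(1, sgn l), (2, sgn l), (1, sgn l)])"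

definition other_gen :: "nat \<Rightarrow> nat" where
  "other_gen j = 3 - j"

definition b1_word :: "nat \<Rightarrow> int list \<Rightarrow> (nat \<times> int) list" where
  "b1_word j ms = map (\<lambda>p. (if even p then other_gen j else j, 2 * ms ! p)) [0..<length ms]"

definition braid_word :: "nat \<Rightarrow> int \<Rightarrow> int list \<Rightarrow> int \<Rightarrow> (nat \<times> int) list" where
  "braid_word j k ms l = [(j, k)] @ b1_word j ms @ delta_word l"

text \<open>A path gamma with endpoints in Etr represents the class of rho in
 pi_1(Conf3, Etr) iff it is homotopic with fixed endpoints to alpha + rho + beta
 for paths alpha, beta in Etr (Etr is connected and simply connected).\<close>

definition represents_path :: "(real \<Rightarrow> cfg) \<Rightarrow> (real \<Rightarrow> cfg) \<Rightarrow> bool" where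
  "represents_path \<gamma> \<rho> \<longleftrightarrow>
     path \<gamma> \<and> path_image \<gamma> \<subseteq> Conf3 \<and> pathstart \<gamma> \<in> Etr \<and> pathfinish \<gamma> \<in> Etr \<and>
     (\<exists>\<alpha> \<beta>. path \<alpha> \<and> path_image \<alpha> \<subseteq> Etr \<and> path \<beta> \<and> path_image \<beta> \<subseteq> Etr \<and>
        pathstart \<alpha> = pathstart \<gamma> \<and> pathfinish \<alpha> = pathstart \<rho> \<and>
        pathstart \<beta> = pathfinish \<rho> \<and> pathfinish \<beta> = pathfinish \<gamma> \<and>
        homotopic_paths Conf3 \<gamma> (\<alpha> +++ \<rho> +++ \<beta>))"

definition rect_represents :: "complex \<Rightarrow> complex \<Rightarrow> (complex \<Rightarrow> cfg) \<Rightarrow> (real \<Rightarrow> cfg) \<Rightarrow> bool" where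
  "rect_represents z0 z1 f \<rho> \<longleftrightarrow>
     Re z0 < Re z1 \<and> Im z0 < Im z1 \<and>
     continuous_on (closure (box z0 z1)) f \<and> f ` closure (box z0 z1) \<subseteq> Conf3 \<and>
     (\<forall>x. Re z0 < x \<and> x < Re z1 \<longrightarrow> f (Complex x (Im z0)) \<in> Etr \<and> f (Complex x (Im z1)) \<in> Etr) \<and>
     (\<forall>x. Re z0 < x \<and> x < Re z1 \<longrightarrow>
        represents_path (\<lambda>t. f (Complex x (Im z0 + t * (Im z1 - Im z0)))) \<rho>)"

definition holo_rect_represents :: "complex \<Rightarrow> complex \<Rightarrow> (complex \<Rightarrow> cfg) \<Rightarrow> (real \<Rightarrow> cfg) \<Rightarrow> bool" where
  "holo_rect_represents z0 z1 f \<rho> \<longleftrightarrow>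
     rect_represents z0 z1 f \<rho> \<and>
     (\<lambda>z. fst (f z)) holomorphic_on box z0 z1 \<and>
     (\<lambda>z. fst (snd (f z))) holomorphic_on box z0 z1 \<and>
     (\<lambda>z. snd (snd (f z))) holomorphic_on box z0 z1"

definition Lambda_tr :: "(nat \<times> int) list \<Rightarrow> real" where
  "Lambda_tr ws = Inf {(Im z1 - Im z0) / (Re z1 - Re z0) | z0 z1.
       \<exists>f. holo_rect_represents z0 z1 f (word_path ws)}"

definition q :: "int \<Rightarrow> int" where
  "q k = (if even k then k else k - sgn k)"

text \<open>A reduced word in a_1,a_2 is a list of terms (letter, exponent).  Syllables:\<close>

function syllables :: "(nat \<times> int) list \<Rightarrow> (nat \<times> int) list list" where
  "syllables [] = []"
| "syllables ((a, n) # rest) =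
     (if 2 \<le> \<bar>n\<bar> then [(a, n)] # syllables rest
      else ((a, n) # takeWhile (\<lambda>(b, m). m = n) rest)
           # syllables (dropWhile (\<lambda>(b, m). m = n) rest))"
  by pat_completeness auto
termination
  by (relation "Wellfounded.measure length") (auto simp: le_imp_less_Suc length_dropWhile_le)

definition syl_degree :: "(nat \<times> int) list \<Rightarrow> int" where
  "syl_degree s = (\<Sum>(a, n) \<leftarrow> s. \<bar>n\<bar>)"

definition Lw :: "(nat \<times> int) list \<Rightarrow> real" where
  "Lw w = (\<Sum>s \<leftarrow> syllables w. ln (4 * real_of_int (syl_degree s) - 1))"

text \<open>The reduced word of the image of vartheta(b) = sigma_j^{q(k)} b_1 in PB_3/<Delta^2>,
 where sigma_i^2 maps to a_i.\<close>

definition theta_word :: "nat \<Rightarrow> int \<Rightarrow> int list \<Rightarrow> (nat \<times> int) list" where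
  "theta_word j k ms =
     (if q k = 0 then [] else [(j, q k div 2)]) @
     map (\<lambda>p. (if even p then other_gen j else j, ms ! p)) [0..<length ms]"

end

theory Submission
  imports Defs
begin

text \<open>A cubic with simple roots is a translate by \<open>\<alpha>\<close> and a rescaling by \<open>c\<close> of the cubic whose roots \<open>e1\<close>,
  \<open>e2\<close>, \<open>e3\<close> belong to the lattice \<open>\<int> + \<tau>\<int>\<close>.  Hence the triples \<open>(\<alpha>, c, \<tau>)\<close> with \<open>c \<noteq> 0\<close> and \<open>Im \<tau> > 0\<close> cover
  the configuration space, with deck group \<open>SL\<^sub>2(\<int>)\<close>, and the real configurations come from the imaginary half-axis of the
  upper half-plane.  A map of a rectangle that represents a braid lifts; the component \<open>\<tau>\<close> of the lift
  is holomorphic and takes the horizontal sides to the geodesic \<open>\<i>\<real>\<^sub>+\<close> and to its image under the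
  matrix of the braid, in which \<open>\<sigma>\<^sub>1\<close> and \<open>\<sigma>\<^sub>2\<close> act by unipotent matrices.

  If the two geodesics have distance \<open>\<delta> > 0\<close>, put their common perpendicular on the imaginary axis and take logarithms:
  the horizontal sides then go to two lines at distance \<open>\<delta>\<close> inside a strip of width \<open>\<pi>\<close>, and the flux through the
  rectangle bounds its side ratio from below by \<open>\<delta> / \<pi>\<close>, while the inverse construction
  realises the ratio \<open>2 \<delta> / \<pi>\<close>.  If the geodesics share an end point, rectangles of arbitrarily small
  ratio exist.  Finally \<open>exp \<delta>\<close> is comparable to a product of two matrix entries.  These are
  continuants of the doubled exponents; syllable by syllable they are at least the square root of
  \<open>4 d\<^sub>j - 1\<close> and at most a constant times \<open>4 d\<^sub>j - 1\<close>.\<close>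

section \<open>Elliptic functions from cosecant series\<close>

text \<open>The upper half-plane alone cannot be the covering space: \<open>\<i>\<close> and the
  cube roots of unity in it have stabilisers larger than {1, -1}. The scale removes them, because an
  element other than 1 and -1 of such a stabiliser multiplies it by a root of unity other than 1,
  while -1 acts trivially, the scale having weight two. The scale also carries what the period ratio
  does not see: the full twist moves only its logarithm. Hence the lower bound can be read off from
  the period ratio, whereas the construction of a rectangle must prescribe the logarithm of the
  scale too, so that both horizontal sides become real and the number of twists is right. Series of
  cosecants converge exponentially and are square roots of a Weierstrass function minus one of its
  values at half periods. Reality and order of the roots over the imaginary half-axis therefore
  reduce to the reality of single values of such series. The lower constant is the factor 1/\<pi> of
  the flux estimate times the 1/2 that the square root in the comparison of entries costs.\<close>

lemma norm_sin_ge: 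
  fixes w :: complex
  assumes "1 \<le> \<bar>Im w\<bar>"
  shows "exp \<bar>Im w\<bar> / 4 \<le> norm (sin w)"
proof -
  have e: "2 \<le> exp (2 * \<bar>Im w\<bar>)"
    using exp_ge_add_one_self[of "2 * \<bar>Im w\<bar>"] assms by linarith
  have h: "exp (-\<bar>Im w\<bar>) \<le> exp \<bar>Im w\<bar> / 2"
  proof -
    have "exp \<bar>Im w\<bar> = exp (-\<bar>Im w\<bar>) * exp (2 * \<bar>Im w\<bar>)" by (simp flip: exp_add)
    also have "\<dots> \<ge> exp (-\<bar>Im w\<bar>) * 2" using e by (intro mult_left_mono) auto
    finally show ?thesis by simp
  qed
  have n: "norm (sin w) = norm (exp (\<i> * w) - exp (- (\<i> * w))) / 2"
    by (simp add: sin_exp_eq norm_divide norm_mult)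
  have "exp \<bar>Im w\<bar> - exp (-\<bar>Im w\<bar>) \<le> norm (exp (\<i> * w) - exp (- (\<i> * w)))"
  proof (cases "Im w \<ge> 0")
    case True
    then show ?thesis
      using norm_triangle_ineq3[of "exp (\<i> * w)" "exp (- (\<i> * w))"] by simp
  next
    case False
    then show ?thesis
      using norm_triangle_ineq3[of "exp (\<i> * w)" "exp (- (\<i> * w))"] by simp
  qed
  then show ?thesis using n h by simp
qed

text \<open>The threshold 1/3 makes \<pi> times the imaginary part at least 1, as \<pi> > 3, so that
  the bound for the sine applies.\<close>

lemma csc_term_bound:
  fixes w :: complex
  assumes "1/3 \<le> \<bar>Im w\<bar>"
  shows "norm (pi / sin (pi * w)) \<le> 4 * pi * exp (- pi * \<bar>Im w\<bar>)"
proof -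
  have i: "\<bar>Im (pi * w)\<bar> = pi * \<bar>Im w\<bar>" by (simp add: abs_mult)
  have "1 \<le> pi * (1/3)" using pi_gt3 by simp
  also have "\<dots> \<le> pi * \<bar>Im w\<bar>" using assms by (intro mult_left_mono) auto
  finally have "exp (pi * \<bar>Im w\<bar>) / 4 \<le> norm (sin (pi * w))"
    using norm_sin_ge[of "pi * w"] i by simp
  then have "pi / norm (sin (pi * w)) \<le> pi / (exp (pi * \<bar>Im w\<bar>) / 4)"
    by (intro frac_le) auto
  also have "\<dots> = 4 * pi * exp (- pi * \<bar>Im w\<bar>)"
    by (simp add: exp_minus divide_simps)
  finally show ?thesis by (simp add: norm_divide)
qed

section \<open>Exponentially convergent series over the integers\<close>

lemma summable_exp_abs_int:
  assumes "(0::real) < d"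
  shows "(\<lambda>n::int. exp (- (d * \<bar>real_of_int n\<bar>))) summable_on UNIV"
proof -
  have g: "(\<lambda>n::nat. exp (- (d * real n))) summable_on UNIV"
  proof -
    have "summable (\<lambda>n::nat. (exp (-d)) ^ n)" using assms by (intro summable_geometric) auto
    then have "summable (\<lambda>n::nat. exp (- (d * real n)))"
      by (simp add: exp_of_nat_mult[symmetric] mult.commute)
    then show ?thesis by (intro norm_summable_imp_summable_on) auto
  qed
  have U: "(UNIV::int set) = range int \<union> (\<lambda>n. - int n - 1) ` UNIV"
  proof -
    have "x \<in> range int \<union> (\<lambda>n. - int n - 1) ` UNIV" for x :: int
    proof (cases "x \<ge> 0")
      case True then show ?thesis by (metis UnI1 nonneg_int_cases rangeI)
    next
      case False
      then have "x = - int (nat (-x-1)) - 1" by simp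
      then show ?thesis by blast
    qed
    then show ?thesis by blast
  qed
  have 1: "(\<lambda>n::int. exp (- (d * \<bar>real_of_int n\<bar>))) summable_on range int"
    by (subst summable_on_reindex) (use g in \<open>auto simp: o_def\<close>)
  have 2: "(\<lambda>n::int. exp (- (d * \<bar>real_of_int n\<bar>))) summable_on ((\<lambda>n. - int n - 1) ` UNIV)"
  proof (subst summable_on_reindex)
    show "inj (\<lambda>n. - int n - 1)" by (auto simp: inj_def)
    have "(\<lambda>n::nat. exp (- (d * real n)) * exp (-d)) summable_on UNIV"
      using g by (rule summable_on_cmult_left)
    then show "(\<lambda>n::int. exp (- (d * \<bar>real_of_int n\<bar>))) \<circ> (\<lambda>n. - int n - 1) summable_on UNIV"
      by (simp add: o_def exp_add[symmetric] algebra_simps)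
  qed
  show ?thesis unfolding U using 1 2 by (intro summable_on_Un_disjoint) auto
qed

text \<open>The M-test is applied off a finite set \<open>F\<close> of indices, for which no
  exponential bound is asked; their sum is added back.\<close>

lemma holomorphic_infsum_int:
  fixes g :: "int \<Rightarrow> complex \<Rightarrow> complex"
  assumes "finite F" "\<And>n x. n \<notin> F \<Longrightarrow> x \<in> U \<Longrightarrow> norm (g n x) \<le> C * exp (- (d * \<bar>real_of_int n\<bar>))"
    and "0 < d" "open U" "\<And>n. g n holomorphic_on U"
  shows "x \<in> U \<Longrightarrow> (\<lambda>n. g n x) summable_on UNIV"
    and "(\<lambda>x. \<Sum>\<^sub>\<infinity>n. g n x) holomorphic_on U"
    and "(\<lambda>x. \<Sum>\<^sub>\<infinity>n\<in>-F. g n x) holomorphic_on U"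
    and "x \<in> U \<Longrightarrow> (\<Sum>\<^sub>\<infinity>n. g n x) = sum (\<lambda>n. g n x) F + (\<Sum>\<^sub>\<infinity>n\<in>-F. g n x)"
proof -
  have sM: "(\<lambda>n. C * exp (- (d * \<bar>real_of_int n\<bar>))) summable_on -F"
    by (rule summable_on_cmult_right, rule summable_on_subset_banach[OF summable_exp_abs_int[OF assms(3)]]) auto
  have s: "(\<lambda>n. g n x) summable_on -F" if "x \<in> U" for x
    by (rule abs_summable_summable, rule Infinite_Sum.abs_summable_on_comparison_test'[OF sM]) (use that assms(2) in auto)
  have sF: "(\<lambda>n. g n x) summable_on F" for x using assms(1) by simp
  have UN: "UNIV = F \<union> -F" by auto
  show sU: "(\<lambda>n. g n x) summable_on UNIV" if "x \<in> U" for x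
    unfolding UN using s[OF that] sF by (intro summable_on_Un_disjoint) auto
  show eq: "(\<Sum>\<^sub>\<infinity>n. g n x) = sum (\<lambda>n. g n x) F + (\<Sum>\<^sub>\<infinity>n\<in>-F. g n x)" if "x \<in> U" for x
    unfolding UN using s[OF that] sF by (subst infsum_Un_disjoint) (use assms(1) in auto)
  have ul: "uniform_limit U (\<lambda>X x. \<Sum>n\<in>X. g n x) (\<lambda>x. \<Sum>\<^sub>\<infinity>n\<in>-F. g n x) (finite_subsets_at_top (-F))"
    by (rule Weierstrass_m_test_general[OF _ sM]) (use assms(2) in auto)
  show hF: "(\<lambda>x. \<Sum>\<^sub>\<infinity>n\<in>-F. g n x) holomorphic_on U"
  proof -
    have "(\<lambda>x. \<Sum>\<^sub>\<infinity>n\<in>-F. g n x) field_differentiable at z within U" if z: "z \<in> U" for z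
    proof -
      obtain r where r: "r > 0" "cball z r \<subseteq> U" using assms(4) z open_contains_cball by blast
      have "(\<lambda>x. \<Sum>\<^sub>\<infinity>n\<in>-F. g n x) holomorphic_on ball z r"
      proof (rule holomorphic_uniform_limit[OF _ uniform_limit_on_subset[OF ul r(2)]])
        show "\<forall>\<^sub>F X in finite_subsets_at_top (-F). continuous_on (cball z r) (\<lambda>x. \<Sum>n\<in>X. g n x) \<and>
             (\<lambda>x. \<Sum>n\<in>X. g n x) holomorphic_on ball z r"
          using r(2) assms(5) ball_subset_cball[of z r]
          by (intro always_eventually allI conjI holomorphic_on_imp_continuous_on holomorphic_on_sum)
             (meson holomorphic_on_subset subset_trans)+
      qed auto
      then show ?thesis
        using r(1) by (metis centre_in_ball holomorphic_on_def field_differentiable_at_within at_within_open open_ball)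
    qed
    then show ?thesis by (simp add: holomorphic_on_def)
  qed
  show "(\<lambda>x. \<Sum>\<^sub>\<infinity>n. g n x) holomorphic_on U"
    using assms(5) by (subst holomorphic_cong[OF refl eq]) (auto intro!: holomorphic_intros hF)
qed

section \<open>Lattices, multipliers and a Liouville theorem\<close>

definition Lat :: "complex \<Rightarrow> complex set" where
  "Lat \<tau> = {of_int m + of_int n * \<tau> | m n. True}"

lemma Lat_iff:
  assumes "Im \<tau> \<noteq> 0"
  shows "z \<in> Lat \<tau> \<longleftrightarrow> Im z / Im \<tau> \<in> \<int> \<and> Re z - Im z / Im \<tau> * Re \<tau> \<in> \<int>"
proof
  assume "z \<in> Lat \<tau>"
  then obtain m n where "z = of_int m + of_int n * \<tau>" by (auto simp: Lat_def)
  then show "Im z / Im \<tau> \<in> \<int> \<and> Re z - Im z / Im \<tau> * Re \<tau> \<in> \<int>" using assms by simp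
next
  assume "Im z / Im \<tau> \<in> \<int> \<and> Re z - Im z / Im \<tau> * Re \<tau> \<in> \<int>"
  then obtain m n where "Im z / Im \<tau> = of_int n" "Re z - of_int n * Re \<tau> = of_int m"
    by (metis Ints_cases)
  then have "z = of_int m + of_int n * \<tau>" using assms by (auto simp: complex_eq_iff field_simps)
  then show "z \<in> Lat \<tau>" by (auto simp: Lat_def)
qed

lemma closed_Lat: assumes "Im \<tau> \<noteq> 0" shows "closed (Lat \<tau>)"
proof -
  have "closed ((\<lambda>z. Im z / Im \<tau>) -` \<int> \<inter> (\<lambda>z. Re z - Im z / Im \<tau> * Re \<tau>) -` \<int>)"
    using assms by (intro closed_Int continuous_closed_vimage) (auto intro!: continuous_intros)
  moreover have "Lat \<tau> = (\<lambda>z. Im z / Im \<tau>) -` \<int> \<inter> (\<lambda>z. Re z - Im z / Im \<tau> * Re \<tau>) -` \<int>"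
    using Lat_iff[OF assms] by auto
  ultimately show ?thesis by simp
qed

lemma countable_Lat: "countable (Lat \<tau>)"
proof -
  have "Lat \<tau> = (\<lambda>(m,n). of_int m + of_int n * \<tau>) ` (UNIV :: (int \<times> int) set)"
    by (auto simp: Lat_def)
  then show ?thesis by simp
qed

lemma Lat_zero [simp]: "0 \<in> Lat \<tau>"
  unfolding Lat_def by (auto intro: exI[of _ 0])

lemma Lat_one [simp]: "1 \<in> Lat \<tau>"
proof -
  have "1 = of_int 1 + of_int 0 * \<tau>" by simp
  then show ?thesis unfolding Lat_def by blast
qed

lemma Lat_gen [simp]: "\<tau> \<in> Lat \<tau>"
proof -
  have "\<tau> = of_int 0 + of_int 1 * \<tau>" by simp
  then show ?thesis unfolding Lat_def by blast
qed

lemma Lat_add: "x \<in> Lat \<tau> \<Longrightarrow> y \<in> Lat \<tau> \<Longrightarrow> x + y \<in> Lat \<tau>"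
proof -
  assume "x \<in> Lat \<tau>" "y \<in> Lat \<tau>"
  then obtain m n m' n' where "x = of_int m + of_int n * \<tau>" "y = of_int m' + of_int n' * \<tau>"
    by (auto simp: Lat_def)
  then have "x + y = of_int (m + m') + of_int (n + n') * \<tau>" by (simp add: algebra_simps)
  then show ?thesis unfolding Lat_def by blast
qed

lemma Lat_uminus [simp]: "- x \<in> Lat \<tau> \<longleftrightarrow> x \<in> Lat \<tau>"
proof -
  have "- y \<in> Lat \<tau>" if "y \<in> Lat \<tau>" for y
  proof -
    obtain m n where "y = of_int m + of_int n * \<tau>" using \<open>y \<in> Lat \<tau>\<close> by (auto simp: Lat_def)
    then have "- y = of_int (-m) + of_int (-n) * \<tau>" by (simp add: algebra_simps)
    then show ?thesis unfolding Lat_def by blast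
  qed
  from this[of x] this[of "-x"] show ?thesis by auto
qed

lemma Lat_add_iff: "y \<in> Lat \<tau> \<Longrightarrow> x + y \<in> Lat \<tau> \<longleftrightarrow> x \<in> Lat \<tau>"
  using Lat_add[of "x + y" \<tau> "- y"] Lat_add[of x \<tau> y] by auto

lemma Lat_diff_iff: "y \<in> Lat \<tau> \<Longrightarrow> x - y \<in> Lat \<tau> \<longleftrightarrow> x \<in> Lat \<tau>"
  using Lat_add_iff[of "-y" \<tau> x] by simp

lemma Lat_mult_int: "x \<in> Lat \<tau> \<Longrightarrow> of_int k * x \<in> Lat \<tau>"
proof -
  assume "x \<in> Lat \<tau>"
  then obtain m n where "x = of_int m + of_int n * \<tau>" by (auto simp: Lat_def)
  then have "of_int k * x = of_int (k * m) + of_int (k * n) * \<tau>" by (simp add: algebra_simps)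
  then show ?thesis unfolding Lat_def by blast
qed

text \<open>A lattice point off the real axis has height at least |Im \<tau>|; one on the real axis
  is an integer.\<close>

lemma Lat_discrete:
  assumes "Im \<tau> \<noteq> 0" "z \<in> Lat \<tau>" "norm z < min 1 \<bar>Im \<tau>\<bar>"
  shows "z = 0"
proof -
  obtain m n where z: "z = of_int m + of_int n * \<tau>" using assms by (auto simp: Lat_def)
  have "\<bar>Im z\<bar> < \<bar>Im \<tau>\<bar>" using assms(3) abs_Im_le_cmod[of z] by simp
  then have "\<bar>real_of_int n\<bar> * \<bar>Im \<tau>\<bar> < 1 * \<bar>Im \<tau>\<bar>" using z by (simp add: abs_mult)
  then have "\<bar>real_of_int n\<bar> < 1" using assms(1) by (simp add: mult_less_cancel_right)
  then have n: "n = 0" by linarith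
  then have "\<bar>real_of_int m\<bar> < 1" using z assms(3) by simp
  then have "m = 0" by linarith
  then show ?thesis using z n by simp
qed

lemma Lat_parallelogram:
  assumes "Im \<tau> \<noteq> 0"
  obtains \<omega> where "\<omega> \<in> Lat \<tau>" "z - \<omega> \<in> (\<lambda>(s,t). of_real s + of_real t * \<tau>) ` ({0..1} \<times> {0..1})"
proof -
  define t where "t = Im z / Im \<tau>"
  define s where "s = Re z - t * Re \<tau>"
  have z: "z = of_real s + of_real t * \<tau>" using assms by (simp add: complex_eq_iff s_def t_def)
  have "z - (of_int \<lfloor>s\<rfloor> + of_int \<lfloor>t\<rfloor> * \<tau>) = of_real (frac s) + of_real (frac t) * \<tau>"
    by (simp add: z frac_def algebra_simps)
  moreover have "frac s \<in> {0..1}" "frac t \<in> {0..1}" by (auto simp: frac_lt_1 less_imp_le)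
  ultimately have "z - (of_int \<lfloor>s\<rfloor> + of_int \<lfloor>t\<rfloor> * \<tau>) \<in> (\<lambda>(s,t). of_real s + of_real t * \<tau>) ` ({0..1} \<times> {0..1})"
    by (intro image_eqI[of _ _ "(frac s, frac t)"]) auto
  then show ?thesis by (intro that[of "of_int \<lfloor>s\<rfloor> + of_int \<lfloor>t\<rfloor> * \<tau>"]) (auto simp: Lat_def)
qed

text \<open>The multiplier of a general period stays implicit: its modulus is all that the
  boundedness argument below uses.\<close>

lemma multiplier_int:
  fixes h :: "complex \<Rightarrow> complex"
  assumes "\<And>z. z \<notin> Lat \<tau> \<Longrightarrow> h (z + w) = s * h z" "norm s = 1" "w \<in> Lat \<tau>"
  shows "\<exists>k. norm k = 1 \<and> (\<forall>z. z \<notin> Lat \<tau> \<longrightarrow> h (z + of_int m * w) = k * h z)"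
proof (induction m rule: int_induct[where k = 0])
  case base
  show ?case by (intro exI[of _ 1]) auto
next
  case (step1 i)
  then obtain k where k: "norm k = 1" "\<And>z. z \<notin> Lat \<tau> \<Longrightarrow> h (z + of_int i * w) = k * h z" by blast
  have "h (z + of_int (i+1) * w) = (s * k) * h z" if "z \<notin> Lat \<tau>" for z
  proof -
    have "z + of_int i * w \<notin> Lat \<tau>" using that assms(3) Lat_mult_int Lat_add_iff by blast
    from assms(1)[OF this] k(2)[OF that] show ?thesis by (simp add: algebra_simps)
  qed
  then show ?case using k(1) assms(2) by (intro exI[of _ "s * k"]) (auto simp: norm_mult)
next
  case (step2 i)
  then obtain k where k: "norm k = 1" "\<And>z. z \<notin> Lat \<tau> \<Longrightarrow> h (z + of_int i * w) = k * h z" by blast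
  have s: "s \<noteq> 0" using assms(2) by auto
  have "h (z + of_int (i-1) * w) = (k / s) * h z" if "z \<notin> Lat \<tau>" for z
  proof -
    have "z + of_int (i-1) * w \<notin> Lat \<tau>" using that assms(3) Lat_mult_int Lat_add_iff by blast
    from assms(1)[OF this] k(2)[OF that] have "s * h (z + of_int (i-1) * w) = k * h z"
      by (simp add: algebra_simps)
    then show ?thesis using s by (simp add: field_simps del: of_int_diff)
  qed
  then show ?case using k(1) assms(2) by (intro exI[of _ "k / s"]) (auto simp: norm_divide)
qed

lemma multiplier_Lat:
  fixes h :: "complex \<Rightarrow> complex"
  assumes "\<And>z. z \<notin> Lat \<tau> \<Longrightarrow> h (z + 1) = s * h z" "norm s = 1"
    and "\<And>z. z \<notin> Lat \<tau> \<Longrightarrow> h (z + \<tau>) = t * h z" "norm t = 1" and "w \<in> Lat \<tau>"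
  obtains k where "norm k = 1" "\<And>z. z \<notin> Lat \<tau> \<Longrightarrow> h (z + w) = k * h z"
proof -
  obtain m n where w: "w = of_int m + of_int n * \<tau>" using assms(5) by (auto simp: Lat_def)
  obtain k1 where k1: "norm k1 = 1" "\<And>z. z \<notin> Lat \<tau> \<Longrightarrow> h (z + of_int m * 1) = k1 * h z"
    using multiplier_int[of \<tau> h 1 s m] assms(1,2) by auto
  obtain k2 where k2: "norm k2 = 1" "\<And>z. z \<notin> Lat \<tau> \<Longrightarrow> h (z + of_int n * \<tau>) = k2 * h z"
    using multiplier_int[of \<tau> h \<tau> t n] assms(3,4) by auto
  have "h (z + w) = (k1 * k2) * h z" if "z \<notin> Lat \<tau>" for z
  proof -
    have "z + of_int n * \<tau> \<notin> Lat \<tau>" using that Lat_mult_int[OF Lat_gen] Lat_add_iff by blast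
    from k1(2)[OF this] k2(2)[OF that] show ?thesis by (simp add: w algebra_simps)
  qed
  then show ?thesis using that k1(1) k2(1) by (metis mult_1 norm_mult)
qed

lemma elliptic_const:
  assumes \<tau>: "Im \<tau> \<noteq> 0" and hol: "h holomorphic_on - Lat \<tau>"
    and p1: "\<And>z. z \<notin> Lat \<tau> \<Longrightarrow> h (z + 1) = s * h z" "norm s = 1"
    and p2: "\<And>z. z \<notin> Lat \<tau> \<Longrightarrow> h (z + \<tau>) = t * h z" "norm t = 1"
    and e: "0 < e" "R holomorphic_on ball 0 e" "\<And>z. z \<in> ball 0 e - {0} \<Longrightarrow> h z = R z"
  obtains c where "\<And>z. z \<notin> Lat \<tau> \<Longrightarrow> h z = c"
proof -
  define H where "H = remove_sings h"
  define d where "d = min e (min 1 \<bar>Im \<tau>\<bar>)"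
  have d: "d > 0" "d \<le> e" using e \<tau> by (auto simp: d_def)
  have dL: "z \<notin> Lat \<tau>" if "z \<in> ball p d - {p}" "p \<in> Lat \<tau>" for z p
  proof
    assume "z \<in> Lat \<tau>"
    then have "z - p \<in> Lat \<tau>" using that(2) Lat_diff_iff by blast
    then have "z - p = 0" using that(1) by (intro Lat_discrete[OF \<tau>]) (auto simp: d_def dist_norm norm_minus_commute)
    then show False using that(1) by simp
  qed
  have opn: "open (- Lat \<tau>)" using closed_Lat[OF \<tau>] by (simp add: open_Compl)
  have ana: "h analytic_on {p}" if "p \<notin> Lat \<tau>" for p
    using hol opn that by (auto simp: analytic_at)
  have Heq: "H p = h p" if "p \<notin> Lat \<tau>" for p unfolding H_def using ana[OF that] by simp
  have Hana: "H analytic_on {p}" for p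
  proof (cases "p \<in> Lat \<tau>")
    case False
    then show ?thesis unfolding H_def using ana remove_sings_analytic_on by blast
  next
    case True
    obtain k where k: "norm k = 1" "\<And>z. z \<notin> Lat \<tau> \<Longrightarrow> h (z + (-p)) = k * h z"
      using multiplier_Lat[OF p1 p2, of "-p"] True by auto
    have hR: "h z = (1/k) * R (z - p)" if "z \<in> ball p d - {p}" for z
    proof -
      have "z \<notin> Lat \<tau>" using dL that True by blast
      then have "h (z - p) = k * h z" using k(2)[of z] by simp
      moreover have "h (z - p) = R (z - p)"
        using that d by (intro e(3)) (auto simp: dist_norm norm_minus_commute)
      ultimately show ?thesis using k(1) by (auto simp: field_simps)
    qed
    have "isCont R 0" using e by (metis centre_in_ball continuous_on_eq_continuous_at holomorphic_on_imp_continuous_on open_ball)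
    then have "((\<lambda>z. R (z - p)) \<longlongrightarrow> R 0) (at p)"
      by (intro isCont_tendsto_compose[where g = R]) (auto intro!: tendsto_eq_intros)
    then have "((\<lambda>z. (1/k) * R (z - p)) \<longlongrightarrow> (1/k) * R 0) (at p)" by (intro tendsto_intros)
    moreover have "\<forall>\<^sub>F z in at p. (1/k) * R (z - p) = h z"
      using eventually_at_in_open[of "ball p d" p] d by (auto elim!: eventually_mono simp: hR)
    ultimately have lim: "h \<midarrow>p\<rightarrow> (1/k) * R 0" by (rule Lim_transform_eventually)
    have "h analytic_on ball p d - {p}"
      using hol dL[OF _ True] by (subst analytic_on_open) (auto intro: holomorphic_on_subset)
    then have "isolated_singularity_at h p" using d unfolding isolated_singularity_at_def by blast
    then show ?thesis unfolding H_def using lim by (rule remove_sings_analytic_at)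
  qed
  then have hH: "H holomorphic_on UNIV"
    using analytic_imp_holomorphic analytic_on_analytic_at by blast
  \<comment> \<open>The corners of the closed parallelogram are lattice points, hence the bound is
    taken for the extension \<open>H\<close>.\<close>
  let ?K = "(\<lambda>(s,t). of_real s + of_real t * \<tau>) ` ({0..1} \<times> {0..1::real})"
  have cK: "compact ?K"
    unfolding case_prod_unfold
    by (intro compact_continuous_image compact_Times compact_Icc) (auto intro!: continuous_intros)
  have "bounded (H ` ?K)"
    by (rule compact_imp_bounded, rule compact_continuous_image[OF _ cK])
       (rule holomorphic_on_imp_continuous_on[OF holomorphic_on_subset[OF hH subset_UNIV]])
  then obtain B where B: "\<And>z. z \<in> ?K \<Longrightarrow> norm (H z) \<le> B" unfolding bounded_iff by blast
  have B1: "norm (H z) \<le> B" if z: "z \<notin> Lat \<tau>" for z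
  proof -
    obtain \<omega> where w: "\<omega> \<in> Lat \<tau>" "z - \<omega> \<in> ?K" using Lat_parallelogram[OF \<tau>] by blast
    have "z - \<omega> \<notin> Lat \<tau>" using z w Lat_diff_iff by blast
    moreover obtain k where k: "norm k = 1" "\<And>z. z \<notin> Lat \<tau> \<Longrightarrow> h (z + \<omega>) = k * h z"
      using multiplier_Lat[OF p1 p2, of \<omega>] w by auto
    ultimately have "H z = k * H (z - \<omega>)" using k(2)[of "z - \<omega>"] z by (simp add: Heq)
    then show ?thesis using k(1) B[OF w(2)] by (simp add: norm_mult)
  qed
  have B2: "norm (H p) \<le> B" for p
  proof (cases "p \<in> Lat \<tau>")
    case True
    have "isCont H p" using Hana analytic_at_imp_isCont by blast
    then have "((\<lambda>z. norm (H z)) \<longlongrightarrow> norm (H p)) (at p)" by (intro tendsto_intros) (simp add: isCont_def)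
    moreover have "\<forall>\<^sub>F z in at p. norm (H z) \<le> B"
      using eventually_at_in_open[of "ball p d" p] d dL[OF _ True] B1 by (auto elim!: eventually_mono)
    ultimately show ?thesis by (rule tendsto_upperbound) simp
  qed (use B1 in auto)
  then have "bounded (range H)" by (auto simp: bounded_iff)
  then have "H constant_on UNIV" using hH by (intro Liouville_theorem) auto
  then obtain c where "\<And>z. H z = c" by (auto simp: constant_on_def)
  then show ?thesis using that Heq by metis
qed


section \<open>The cosecant series and the Jacobi functions\<close>

text \<open>Up to scaling this is the Jacobi function ns, with 2K and 2iK' rescaled to 1 and \<tau>:
  it changes sign along 1, is periodic along \<tau> and vanishes at \<tau>/2. Its square is the
  Weierstrass function minus its value at \<tau>/2.\<close>

definition csum :: "complex \<Rightarrow> complex \<Rightarrow> complex" where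
  "csum \<tau> z = (\<Sum>\<^sub>\<infinity>n. of_real pi / sin (of_real pi * (z + of_int n * \<tau>)))"

lemma sin_pi_eq_0_iff: "sin (complex_of_real pi * w) = 0 \<longleftrightarrow> w \<in> \<int>"
  unfolding sin_eq_0 by (auto elim!: Ints_cases simp: mult.commute)

lemma sin_term_nz:
  assumes "z \<notin> Lat \<tau>" shows "sin (complex_of_real pi * (z + of_int n * \<tau>)) \<noteq> 0"
proof
  assume "sin (complex_of_real pi * (z + of_int n * \<tau>)) = 0"
  then obtain m where "z + of_int n * \<tau> = of_int m" by (auto simp: sin_pi_eq_0_iff elim: Ints_cases)
  then have "z = of_int m + of_int (-n) * \<tau>" by (simp add: algebra_simps)
  then show False using assms unfolding Lat_def by blast
qed

text \<open>For the indices outside the finite set, |n Im \<tau>| exceeds 2B, so the shift by z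
  costs at most half of it.\<close>

lemma csum_term_bound:
  fixes n :: int
  assumes \<tau>: "Im \<tau> \<noteq> 0" and z: "\<bar>Im z\<bar> < B" and n: "n \<notin> {n. \<bar>real_of_int n\<bar> * \<bar>Im \<tau>\<bar> < 2 * B + 1}"
  shows "norm (of_real pi / sin (of_real pi * (z + of_int n * \<tau>))) \<le> 4 * pi * exp (- ((\<bar>Im \<tau>\<bar> / 2) * \<bar>real_of_int n\<bar>))"
proof -
  have a: "\<bar>Im (of_int n * \<tau>)\<bar> = \<bar>real_of_int n\<bar> * \<bar>Im \<tau>\<bar>" by (simp add: abs_mult)
  have b: "\<bar>Im (z + of_int n * \<tau>)\<bar> \<ge> \<bar>real_of_int n\<bar> * \<bar>Im \<tau>\<bar> - B"
    using z a by (smt (verit) plus_complex.simps(2))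
  have n': "2 * B + 1 \<le> \<bar>real_of_int n\<bar> * \<bar>Im \<tau>\<bar>" using n by (simp add: not_less)
  have c: "\<bar>Im (z + of_int n * \<tau>)\<bar> \<ge> \<bar>real_of_int n\<bar> * \<bar>Im \<tau>\<bar> / 2" "\<bar>Im (z + of_int n * \<tau>)\<bar> \<ge> 1 / 3"
    using b n' z by linarith+
  have "norm (of_real pi / sin (of_real pi * (z + of_int n * \<tau>))) \<le> 4 * pi * exp (- pi * \<bar>Im (z + of_int n * \<tau>)\<bar>)"
    by (rule csc_term_bound) (use c in auto)
  also have "\<dots> \<le> 4 * pi * exp (- ((\<bar>Im \<tau>\<bar> / 2) * \<bar>real_of_int n\<bar>))"
  proof -
    have "1 * \<bar>Im (z + of_int n * \<tau>)\<bar> \<le> pi * \<bar>Im (z + of_int n * \<tau>)\<bar>"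
      using pi_gt3 by (intro mult_right_mono) auto
    then have "(\<bar>Im \<tau>\<bar> / 2) * \<bar>real_of_int n\<bar> \<le> pi * \<bar>Im (z + of_int n * \<tau>)\<bar>" using c(1) by (simp add: mult.commute)
    then show ?thesis by (intro mult_left_mono) auto
  qed
  finally show ?thesis .
qed

lemma finite_int_bound: "0 < c \<Longrightarrow> finite {n::int. \<bar>real_of_int n\<bar> * c < B}"
proof -
  assume c: "0 < c"
  have "{n::int. \<bar>real_of_int n\<bar> * c < B} \<subseteq> {-\<lceil>B / c\<rceil>..\<lceil>B / c\<rceil>}"
  proof safe
    fix n :: int assume "\<bar>real_of_int n\<bar> * c < B"
    then have "\<bar>real_of_int n\<bar> < B / c" using c by (simp add: field_simps)
    then have "\<bar>real_of_int n\<bar> \<le> of_int \<lceil>B / c\<rceil>" by (meson le_of_int_ceiling less_imp_le order_trans)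
    then have "\<bar>n\<bar> \<le> \<lceil>B / c\<rceil>" by linarith
    then show "n \<in> {-\<lceil>B / c\<rceil>..\<lceil>B / c\<rceil>}" by auto
  qed
  then show ?thesis by (rule finite_subset) auto
qed

lemma csum_holomorphic:
  assumes \<tau>: "Im \<tau> \<noteq> 0"
  shows "csum \<tau> holomorphic_on - Lat \<tau>"
    and "z \<notin> Lat \<tau> \<Longrightarrow> (\<lambda>n::int. of_real pi / sin (of_real pi * (z + of_int n * \<tau>))) summable_on UNIV"
proof -
  have U: "open ({z. \<bar>Im z\<bar> < B} - Lat \<tau>)" for B
    by (intro open_Diff closed_Lat \<tau> open_Collect_less continuous_intros)
  have h: "(\<lambda>z. of_real pi / sin (of_real pi * (z + of_int n * \<tau>))) holomorphic_on ({z. \<bar>Im z\<bar> < B} - Lat \<tau>)" for n B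
    using sin_term_nz by (intro holomorphic_intros) auto
  note facts = holomorphic_infsum_int[OF finite_int_bound csum_term_bound[OF \<tau>] _ U h]
  \<comment> \<open>The estimates are uniform on horizontal strips only; holomorphy is local and the
    strips exhaust the plane.\<close>
  have hB: "csum \<tau> holomorphic_on ({z. \<bar>Im z\<bar> < B} - Lat \<tau>)" for B
    unfolding csum_def[abs_def]
    by (rule holomorphic_infsum_int(2)[OF finite_int_bound[of "\<bar>Im \<tau>\<bar>" "2 * B + 1"], where C = "4 * pi" and d = "\<bar>Im \<tau>\<bar> / 2"])
       (use \<tau> U h csum_term_bound[OF \<tau>] in auto)
  show "csum \<tau> holomorphic_on - Lat \<tau>"
  proof (rule analytic_imp_holomorphic, subst analytic_on_analytic_at, intro ballI)
    fix z assume "z \<in> - Lat \<tau>"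
    then show "csum \<tau> analytic_on {z}"
      using hB[of "\<bar>Im z\<bar> + 1"] U[of "\<bar>Im z\<bar> + 1"] by (auto simp: analytic_at)
  qed
  assume "z \<notin> Lat \<tau>"
  then show "(\<lambda>n::int. of_real pi / sin (of_real pi * (z + of_int n * \<tau>))) summable_on UNIV"
    by (intro holomorphic_infsum_int(1)[OF finite_int_bound[of "\<bar>Im \<tau>\<bar>" "2 * (\<bar>Im z\<bar> + 1) + 1"], where C = "4 * pi" and d = "\<bar>Im \<tau>\<bar> / 2" and U = "{w. \<bar>Im w\<bar> < \<bar>Im z\<bar> + 1} - Lat \<tau>"])
       (use \<tau> U h csum_term_bound[OF \<tau>] in auto)
qed

lemma csum_add_1: "csum \<tau> (z + 1) = - csum \<tau> z"
proof -
  have "sin (of_real pi * (z + 1 + of_int n * \<tau>)) = - sin (of_real pi * (z + of_int n * \<tau>))" for n :: int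
  proof -
    have "of_real pi * (z + 1 + of_int n * \<tau>) = of_real pi * (z + of_int n * \<tau>) + of_real pi"
      by (simp add: algebra_simps)
    then show ?thesis by (simp add: sin_add flip: sin_of_real cos_of_real)
  qed
  then show ?thesis unfolding csum_def by (simp add: infsum_uminus)
qed

lemma csum_add_gen: "csum \<tau> (z + \<tau>) = csum \<tau> z"
proof -
  have b: "bij_betw (\<lambda>n::int. n + 1) UNIV UNIV" by (rule bij_betwI[of _ _ _ "\<lambda>n. n - 1"]) auto
  have "csum \<tau> z = (\<Sum>\<^sub>\<infinity>n::int. of_real pi / sin (of_real pi * (z + of_int (n + 1) * \<tau>)))"
    unfolding csum_def by (rule infsum_reindex_bij_betw[OF b, symmetric])
  then show ?thesis by (simp add: csum_def algebra_simps)
qed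

lemma csum_minus: "csum \<tau> (- z) = - csum \<tau> z"
proof -
  have b: "bij_betw (\<lambda>n::int. - n) UNIV UNIV" by (rule bij_betwI[of _ _ _ "\<lambda>n. - n"]) auto
  have "csum \<tau> z = (\<Sum>\<^sub>\<infinity>n::int. of_real pi / sin (of_real pi * (z + of_int (- n) * \<tau>)))"
    unfolding csum_def by (rule infsum_reindex_bij_betw[OF b, symmetric])
  also have "\<dots> = (\<Sum>\<^sub>\<infinity>n::int. - (of_real pi / sin (of_real pi * (- z + of_int n * \<tau>))))"
  proof -
    have "sin (of_real pi * (z + of_int (-n) * \<tau>)) = - sin (of_real pi * (- z + of_int n * \<tau>))" for n :: int
      by (simp add: algebra_simps flip: sin_minus)
    then show ?thesis by simp
  qed
  finally show ?thesis by (simp add: csum_def infsum_uminus)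
qed

text \<open>Only the term with n = 0 has a pole at 0. Its deviation from 1/z is removable, and the
  oddness of \<open>csum\<close> makes the regular part vanish at 0.\<close>

lemma csum_pole:
  assumes \<tau>: "Im \<tau> \<noteq> 0"
  obtains e R where "0 < e" "R holomorphic_on ball 0 e" "R 0 = 0"
     "\<And>z. z \<in> ball 0 e - {0} \<Longrightarrow> csum \<tau> z = 1 / z + R z"
proof -
  define e where "e = min 1 \<bar>Im \<tau>\<bar>"
  have e: "e > 0" using \<tau> by (simp add: e_def)
  have nL: "z \<notin> Lat \<tau>" if "z \<in> ball 0 e - {0}" for z
    using Lat_discrete[OF \<tau>, of z] that by (auto simp: e_def)
  define g where "g = (\<lambda>(n::int) z. if n = 0 then 0 else of_real pi / sin (of_real pi * (z + of_int n * \<tau>)))"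
  define G where "G = (\<lambda>z. \<Sum>\<^sub>\<infinity>n. g n z)"
  have nz: "sin (of_real pi * (z + of_int n * \<tau>)) \<noteq> 0" if "n \<noteq> 0" "z \<in> ball 0 e" for n :: int and z
  proof
    assume "sin (complex_of_real pi * (z + of_int n * \<tau>)) = 0"
    then obtain m where "z + of_int n * \<tau> = of_int m" by (auto simp: sin_pi_eq_0_iff elim!: Ints_cases)
    then have "Im (z + of_int n * \<tau>) = Im (of_int m)" by simp
    then have "Im (z + of_int n * \<tau>) = 0" by simp
    then have "\<bar>real_of_int n\<bar> * \<bar>Im \<tau>\<bar> = \<bar>Im z\<bar>" by (simp flip: abs_mult)
    also have "\<dots> < \<bar>Im \<tau>\<bar>" using that(2) abs_Im_le_cmod[of z] by (simp add: e_def)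
    finally have "\<bar>real_of_int n\<bar> * \<bar>Im \<tau>\<bar> < 1 * \<bar>Im \<tau>\<bar>" by simp
    then have "\<bar>real_of_int n\<bar> < 1" using \<tau> by (simp add: mult_less_cancel_right)
    then show False using that(1) by linarith
  qed
  have gh: "g n holomorphic_on ball 0 e" for n
    using nz unfolding g_def by (cases "n = 0") (auto intro!: holomorphic_intros)
  have "norm (g n z) \<le> 4 * pi * exp (- ((\<bar>Im \<tau>\<bar> / 2) * \<bar>real_of_int n\<bar>))"
    if "n \<notin> {n. \<bar>real_of_int n\<bar> * \<bar>Im \<tau>\<bar> < 2 * 1 + 1}" "z \<in> ball 0 e" for n z
    using csum_term_bound[OF \<tau>, of z 1 n] that abs_Im_le_cmod[of z] by (auto simp: g_def e_def)
  then have Gh: "G holomorphic_on ball 0 e" unfolding G_def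
    by (intro holomorphic_infsum_int(2)[OF finite_int_bound[of "\<bar>Im \<tau>\<bar>" "2 * 1 + 1"], where C = "4 * pi" and d = "\<bar>Im \<tau>\<bar> / 2"])
       (use \<tau> gh in auto)
  have cs: "csum \<tau> z = of_real pi / sin (of_real pi * z) + G z" if "z \<in> ball 0 e - {0}" for z
  proof -
    let ?t = "\<lambda>n::int. of_real pi / sin (of_real pi * (z + of_int n * \<tau>))"
    have s: "?t summable_on UNIV" using csum_holomorphic(2)[OF \<tau> nL[OF that]] by simp
    have "csum \<tau> z = infsum ?t ({0} \<union> (UNIV - {0}))" by (simp add: csum_def)
    also have "\<dots> = infsum ?t {0} + infsum ?t (UNIV - {0})"
      by (rule infsum_Un_disjoint) (auto intro: summable_on_subset_banach[OF s])
    also have "infsum ?t (UNIV - {0}) = G z"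
      unfolding G_def by (rule infsum_cong_neutral) (auto simp: g_def)
    finally show ?thesis by simp
  qed
  define f where "f = (\<lambda>z. csum \<tau> z - 1 / z)"
  have "((\<lambda>z. sin (of_real pi * z) / z) \<longlongrightarrow> of_real pi) (at (0::complex))"
    using DERIV_D[of "\<lambda>z. sin (of_real pi * z)" "complex_of_real pi" 0]
    by (force intro!: derivative_eq_intros)
  then have "((\<lambda>z. of_real pi / (sin (of_real pi * z) / z) - 1 + z * G z) \<longlongrightarrow> pi / complex_of_real pi - 1 + 0 * G 0) (at (0::complex))"
  proof (intro tendsto_intros)
    have "isCont G 0" using Gh e by (metis centre_in_ball continuous_on_eq_continuous_at holomorphic_on_imp_continuous_on open_ball)
    then show "(G \<longlongrightarrow> G 0) (at 0)" by (simp add: isCont_def)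
  qed auto
  moreover have "\<forall>\<^sub>F z in at 0. of_real pi / (sin (of_real pi * z) / z) - 1 + z * G z = (z - 0) * f z"
    using eventually_at_in_open[of "ball 0 e" 0] e
    by (auto elim!: eventually_mono simp: cs f_def algebra_simps)
  ultimately have "((\<lambda>z. (z - 0) * f z) \<longlongrightarrow> 0) (at 0)"
    by (auto intro: Lim_transform_eventually)
  moreover have fh: "f holomorphic_on ball 0 e - {0}"
    unfolding f_def using csum_holomorphic(1)[OF \<tau>] nL
    by (intro holomorphic_intros) (auto intro: holomorphic_on_subset)
  ultimately obtain R where R: "R holomorphic_on ball 0 e" "\<And>z. z \<in> ball 0 e - {0} \<Longrightarrow> R z = f z"
    using holomorphic_on_extend_lim[of f "ball 0 e" 0] e by auto
  have R0: "R 0 = 0"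
  proof -
    have c: "isCont R 0" using R e by (metis centre_in_ball continuous_on_eq_continuous_at holomorphic_on_imp_continuous_on open_ball)
    have c': "((\<lambda>z. R (- z)) \<longlongrightarrow> R 0) (at 0)"
      by (rule isCont_tendsto_compose[OF c]) (auto intro!: tendsto_eq_intros)
    have "((\<lambda>z. R z + R (- z)) \<longlongrightarrow> R 0 + R 0) (at 0)"
      using c c' by (intro tendsto_intros) (simp_all add: isCont_def)
    moreover have "\<forall>\<^sub>F z in at 0. R z + R (- z) = 0"
      using eventually_at_in_open[of "ball 0 e" 0] e
      by (auto elim!: eventually_mono simp: R(2) f_def csum_minus)
    ultimately have "((\<lambda>z. 0) \<longlongrightarrow> R 0 + R 0) (at (0::complex))"
      by (rule Lim_transform_eventually)
    then have "R 0 + R 0 = 0" by (metis LIM_const_eq tendsto_const)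
    then show ?thesis by (simp add: mult_2[symmetric])
  qed
  show ?thesis using that[OF e R(1) R0] R(2) by (simp add: f_def)
qed

text \<open>Of oddness only the vanishing of the regular part R at 0 is kept: it makes the cross
  term 2 R(z)/z of the square holomorphic.\<close>

definition odd_pole :: "(complex \<Rightarrow> complex) \<Rightarrow> bool" where
  "odd_pole x \<longleftrightarrow> (\<exists>e>0. \<exists>R. R holomorphic_on ball 0 e \<and> R 0 = 0 \<and> (\<forall>z\<in>ball 0 e - {0}. x z = 1 / z + R z))"

lemma odd_pole_csum: "Im \<tau> \<noteq> 0 \<Longrightarrow> odd_pole (csum \<tau>)"
  unfolding odd_pole_def using csum_pole by metis

lemma odd_pole_scale:
  assumes "odd_pole x" "j \<noteq> 0"
  shows "odd_pole (\<lambda>z. x (z / j) / j)"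
proof -
  obtain e R where e: "e > 0" "R holomorphic_on ball 0 e" "R 0 = 0" "\<And>z. z \<in> ball 0 e - {0} \<Longrightarrow> x z = 1 / z + R z"
    using assms(1) unfolding odd_pole_def by metis
  have i: "z / j \<in> ball 0 e" if "z \<in> ball 0 (e * norm j)" for z
    using that assms(2) by (simp add: norm_divide divide_simps)
  have "(\<lambda>z. R (z / j) / j) holomorphic_on ball 0 (e * norm j)"
    using assms(2) i by (intro holomorphic_intros holomorphic_on_compose_gen[OF _ e(2), unfolded o_def]) auto
  moreover have "x (z / j) / j = 1 / z + R (z / j) / j" if "z \<in> ball 0 (e * norm j) - {0}" for z
    using e(4)[of "z / j"] i[of z] that assms(2) by (auto simp: field_simps)
  ultimately show ?thesis unfolding odd_pole_def using e(1,3) assms(2)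
    by (intro exI[of _ "e * norm j"] conjI exI[of _ "\<lambda>z. R (z / j) / j"]) auto
qed

lemma odd_pole_lim:
  assumes "odd_pole x" shows "((\<lambda>z. z * x z) \<longlongrightarrow> 1) (at 0)"
proof -
  obtain e R where e: "e > 0" "R holomorphic_on ball 0 e" "R 0 = 0" "\<And>z. z \<in> ball 0 e - {0} \<Longrightarrow> x z = 1 / z + R z"
    using assms(1) unfolding odd_pole_def by metis
  have "isCont R 0" using e by (metis centre_in_ball continuous_on_eq_continuous_at holomorphic_on_imp_continuous_on open_ball)
  then have "((\<lambda>z. 1 + z * R z) \<longlongrightarrow> 1 + 0 * R 0) (at 0)" by (intro tendsto_intros) (simp add: isCont_def)
  moreover have "\<forall>\<^sub>F z in at 0. 1 + z * R z = z * x z"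
    using eventually_at_in_open[of "ball 0 e" 0] e(1) by (auto elim!: eventually_mono simp: e(4) field_simps)
  ultimately show ?thesis using Lim_transform_eventually by fastforce
qed

lemma holomorphic_div_z:
  assumes "F holomorphic_on ball 0 e" "F 0 = 0" "e > 0"
  obtains G where "G holomorphic_on ball 0 e" "\<And>z. z \<in> ball 0 e - {0} \<Longrightarrow> G z = F z / z"
proof -
  have "isCont F 0" using assms by (metis centre_in_ball continuous_on_eq_continuous_at holomorphic_on_imp_continuous_on open_ball)
  then have "(F \<longlongrightarrow> 0) (at 0)" using assms(2) by (simp add: isCont_def)
  then have "((\<lambda>z. (z - 0) * (F z / z)) \<longlongrightarrow> 0) (at 0)"
    by (rule Lim_transform_eventually) (simp add: eventually_at_filter)
  moreover have "(\<lambda>z. F z / z) holomorphic_on ball 0 e - {0}"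
    using assms(1) by (intro holomorphic_intros) (auto intro: holomorphic_on_subset)
  ultimately show ?thesis using that holomorphic_on_extend_lim[of "\<lambda>z. F z / z" "ball 0 e" 0] assms(3) by auto
qed

lemma csum_sq_add_int: "csum \<tau> (z + of_int m) ^ 2 = csum \<tau> z ^ 2"
proof (induction m rule: int_induct[where k = 0])
  case (step1 i)
  then show ?case using csum_add_1[of \<tau> "z + of_int i"] by (simp add: add.assoc[symmetric])
next
  case (step2 i)
  then show ?case using csum_add_1[of \<tau> "z + of_int (i - 1)"] by simp
qed auto

lemma csum_sq_add_gen: "csum \<tau> (z + of_int n * \<tau>) ^ 2 = csum \<tau> z ^ 2"
proof (induction n rule: int_induct[where k = 0])
  case (step1 i)
  then show ?case using csum_add_gen[of \<tau> "z + of_int i * \<tau>"] by (simp add: algebra_simps)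
next
  case (step2 i)
  then show ?case using csum_add_gen[of \<tau> "z + of_int (i - 1) * \<tau>"] by (simp add: algebra_simps)
qed auto

lemma csum_sq_periodic: "w \<in> Lat \<tau> \<Longrightarrow> csum \<tau> (z + w) ^ 2 = csum \<tau> z ^ 2"
proof -
  assume "w \<in> Lat \<tau>"
  then obtain m n where w: "w = of_int m + of_int n * \<tau>" by (auto simp: Lat_def)
  have "csum \<tau> (z + w) ^ 2 = csum \<tau> (z + of_int m + of_int n * \<tau>) ^ 2" by (simp add: w add.assoc)
  then show ?thesis by (simp add: csum_sq_add_gen csum_sq_add_int)
qed

text \<open>The double poles cancel, and the cross terms are holomorphic because both regular parts
  vanish at 0. What remains is an elliptic function without poles.\<close>

lemma sq_diff_const:
  assumes \<tau>: "Im \<tau> \<noteq> 0" and x: "x holomorphic_on - Lat \<tau>" "odd_pole x" and y: "y holomorphic_on - Lat \<tau>" "odd_pole y"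
    and px: "\<And>z. x (z + 1) ^ 2 = x z ^ 2" "\<And>z. x (z + \<tau>) ^ 2 = x z ^ 2"
    and py: "\<And>z. y (z + 1) ^ 2 = y z ^ 2" "\<And>z. y (z + \<tau>) ^ 2 = y z ^ 2"
  obtains c where "\<And>z. z \<notin> Lat \<tau> \<Longrightarrow> x z ^ 2 - y z ^ 2 = c"
proof -
  obtain e1 R where e1: "e1 > 0" "R holomorphic_on ball 0 e1" "R 0 = 0" "\<And>z. z \<in> ball 0 e1 - {0} \<Longrightarrow> x z = 1 / z + R z"
    using x(2) unfolding odd_pole_def by metis
  obtain e2 Q where e2: "e2 > 0" "Q holomorphic_on ball 0 e2" "Q 0 = 0" "\<And>z. z \<in> ball 0 e2 - {0} \<Longrightarrow> y z = 1 / z + Q z"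
    using y(2) unfolding odd_pole_def by metis
  define e where "e = min e1 e2"
  have e: "e > 0" "ball 0 e \<subseteq> ball (0::complex) e1" "ball 0 e \<subseteq> ball (0::complex) e2" using e1 e2 by (auto simp: e_def)
  have hR: "R holomorphic_on ball 0 e" "Q holomorphic_on ball 0 e"
    using e e1 e2 holomorphic_on_subset by blast+
  obtain G where G: "G holomorphic_on ball 0 e" "\<And>z. z \<in> ball 0 e - {0} \<Longrightarrow> G z = (R z - Q z) / z"
    by (rule holomorphic_div_z[of "\<lambda>z. R z - Q z" e]) (use hR e1 e2 e in \<open>auto intro!: holomorphic_intros\<close>)
  have "x z ^ 2 - y z ^ 2 = 2 * G z + R z ^ 2 - Q z ^ 2" if "z \<in> ball 0 e - {0}" for z
  proof -
    have "x z = 1 / z + R z" "y z = 1 / z + Q z" using that e e1(4) e2(4) by auto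
    moreover have "(1 / z + R z) ^ 2 - (1 / z + Q z) ^ 2 = 2 * ((R z - Q z) / z) + R z ^ 2 - Q z ^ 2"
      by (simp add: power2_eq_square algebra_simps diff_divide_distrib)
    ultimately show ?thesis using G(2)[OF that] by simp
  qed
  note loc = this
  obtain c where "\<And>z. z \<notin> Lat \<tau> \<Longrightarrow> x z ^ 2 - y z ^ 2 = c"
  proof (rule elliptic_const[OF \<tau>, of "\<lambda>z. x z ^ 2 - y z ^ 2" 1 1 e "\<lambda>z. 2 * G z + R z ^ 2 - Q z ^ 2"])
    show "(\<lambda>z. x z ^ 2 - y z ^ 2) holomorphic_on - Lat \<tau>" using x y by (intro holomorphic_intros)
    show "(\<lambda>z. 2 * G z + R z ^ 2 - Q z ^ 2) holomorphic_on ball 0 e" using hR G by (intro holomorphic_intros)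
  qed (use px py e loc in auto)
  then show ?thesis using that by blast
qed

lemma open_nLat: "Im \<tau> \<noteq> 0 \<Longrightarrow> open (- Lat \<tau>)" using closed_Lat by (simp add: open_Compl)

lemma connected_nLat: "connected (- Lat \<tau>)"
  using connected_open_diff_countable[of "UNIV :: complex set" "Lat \<tau>", OF _ open_UNIV connected_UNIV countable_Lat]
  by (simp add: Compl_eq_Diff_UNIV)

lemma eventually_not_Lat: "Im \<tau> \<noteq> 0 \<Longrightarrow> \<forall>\<^sub>F z in at 0. z \<notin> Lat \<tau>"
proof -
  assume \<tau>: "Im \<tau> \<noteq> 0"
  have "\<forall>\<^sub>F z in at 0. z \<in> ball 0 (min 1 \<bar>Im \<tau>\<bar>) - {0}"
    by (rule eventually_at_in_open) (use \<tau> in auto)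
  then show ?thesis by eventually_elim (use Lat_discrete[OF \<tau>] in auto)
qed

text \<open>The common residue fixes the sign near 0, where z (x + y) tends to 2; the complement of
  the lattice is connected, so the equality spreads by analytic continuation.\<close>

lemma sq_eq_imp_eq:
  assumes \<tau>: "Im \<tau> \<noteq> 0" and x: "x holomorphic_on - Lat \<tau>" "odd_pole x" and y: "y holomorphic_on - Lat \<tau>" "odd_pole y"
    and eq: "\<And>z. z \<notin> Lat \<tau> \<Longrightarrow> x z ^ 2 = y z ^ 2"
    and z: "z \<notin> Lat \<tau>"
  shows "x z = y z"
proof -
  have "((\<lambda>z. z * x z + z * y z) \<longlongrightarrow> 1 + 1) (at 0)"
    using x y by (intro tendsto_add odd_pole_lim)
  then have "\<forall>\<^sub>F z in at 0. z * x z + z * y z \<noteq> 0"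
    by (rule tendsto_imp_eventually_ne) simp
  then have "\<forall>\<^sub>F z in at 0. x z = y z" using eventually_not_Lat[OF \<tau>]
  proof eventually_elim
    case (elim z)
    have "(x z - y z) * (x z + y z) = 0" using eq[OF elim(2)] by (simp add: power2_eq_square algebra_simps)
    then show ?case using elim(1) by (auto simp: distrib_left[symmetric])
  qed
  then obtain d where d: "d > 0" "\<And>z. z \<noteq> 0 \<Longrightarrow> dist z 0 < d \<Longrightarrow> x z = y z"
    unfolding eventually_at by auto
  let ?S = "ball 0 d \<inter> - Lat \<tau>"
  have ne: "?S \<noteq> {}"
  proof -
    have "\<forall>\<^sub>F z in at 0. z \<in> ball 0 d - {0::complex}" by (rule eventually_at_in_open) (use d in auto)
    then have "\<forall>\<^sub>F z in at 0. z \<in> ?S" using eventually_not_Lat[OF \<tau>] by eventually_elim auto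
    then show ?thesis using eventually_happens'[OF at_neq_bot] by blast
  qed
  show ?thesis
  proof (rule analytic_continuation_open[of ?S "- Lat \<tau>" x y z])
    show "x w = y w" if "w \<in> ?S" for w
      using that d(2)[of w] by (cases "w = 0") (auto simp: dist_commute)
  qed (use ne x y z open_nLat[OF \<tau>] connected_nLat in auto)
qed

lemma odd_pole_not_zero:
  assumes "Im \<tau> \<noteq> 0" "odd_pole x"
  obtains z where "z \<notin> Lat \<tau>" "x z \<noteq> 0"
proof -
  have "\<forall>\<^sub>F z in at 0. z * x z \<noteq> 0" by (rule tendsto_imp_eventually_ne[OF odd_pole_lim[OF assms(2)]]) simp
  then have "\<forall>\<^sub>F z in at 0. z \<notin> Lat \<tau> \<and> x z \<noteq> 0" using eventually_not_Lat[OF assms(1)]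
    by eventually_elim auto
  then show ?thesis using that eventually_happens'[OF at_neq_bot] by blast
qed

text \<open>With \<open>csum\<close>, these are the three Jacobi functions with simple poles of residue \<open>1\<close> at the lattice points;
  each changes sign under two of the three nonzero classes of periods modulo \<open>2\<close>, so that their squares are elliptic
  and differ by constants.\<close>

definition csum2 :: "complex \<Rightarrow> complex \<Rightarrow> complex" where "csum2 \<tau> z = csum (1 / \<tau>) (z / \<tau>) / \<tau>"
definition csum3 :: "complex \<Rightarrow> complex \<Rightarrow> complex" where "csum3 \<tau> z = csum (1 + \<tau>) z"

lemma Lat_basis_change:
  fixes a b c d :: int
  assumes "a * d - b * c = 1 \<or> a * d - b * c = -1"
    and "of_int c * \<tau> + of_int d \<noteq> 0"
    and "\<tau>' = (of_int a * \<tau> + of_int b) / (of_int c * \<tau> + of_int d)"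
  shows "z / (of_int c * \<tau> + of_int d) \<in> Lat \<tau>' \<longleftrightarrow> z \<in> Lat \<tau>"
proof -
  let ?j = "of_int c * \<tau> + of_int d"
  define e where "e = a * d - b * c"
  have e: "e * e = 1" using assms(1) by (auto simp: e_def)
  have j: "?j * \<tau>' = of_int a * \<tau> + of_int b" using assms by simp
  show ?thesis
  proof
    assume "z / ?j \<in> Lat \<tau>'"
    then obtain m n where "z / ?j = of_int m + of_int n * \<tau>'" by (auto simp: Lat_def)
    then have "z = of_int m * ?j + of_int n * (?j * \<tau>')" using assms(2) by (simp add: field_simps)
    then have "z = of_int (m * d + n * b) + of_int (m * c + n * a) * \<tau>" unfolding j by (simp add: algebra_simps)
    then show "z \<in> Lat \<tau>" unfolding Lat_def by blast
  next
    assume "z \<in> Lat \<tau>"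
    then obtain m n where z: "z = of_int m + of_int n * \<tau>" by (auto simp: Lat_def)
    \<comment> \<open>As \<open>e\<close> is its own inverse, \<open>e\<close> times the adjugate
      matrix is the inverse basis change.\<close>
    have "z = of_int (e * (m * a - n * b)) * ?j + of_int (e * (n * d - m * c)) * (of_int a * \<tau> + of_int b)"
    proof -
      have "e * (m * a - n * b) * d + e * (n * d - m * c) * b = (e * e) * m" by (simp add: e_def algebra_simps)
      moreover have "e * (m * a - n * b) * c + e * (n * d - m * c) * a = (e * e) * n" by (simp add: e_def algebra_simps)
      ultimately have 1: "of_int (e * (m * a - n * b) * d + e * (n * d - m * c) * b) = (of_int m :: complex)"
        "of_int (e * (m * a - n * b) * c + e * (n * d - m * c) * a) = (of_int n :: complex)" unfolding e by simp_all
      have "of_int (e * (m * a - n * b)) * ?j + of_int (e * (n * d - m * c)) * (of_int a * \<tau> + of_int b)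
        = of_int (e * (m * a - n * b) * d + e * (n * d - m * c) * b) + of_int (e * (m * a - n * b) * c + e * (n * d - m * c) * a) * \<tau>"
        by (simp add: algebra_simps)
      then show ?thesis unfolding 1 z by simp
    qed
    then have "z / ?j = of_int (e * (m * a - n * b)) + of_int (e * (n * d - m * c)) * \<tau>'"
      using assms(2) unfolding j[symmetric] by (simp add: field_simps)
    then show "z / ?j \<in> Lat \<tau>'" unfolding Lat_def by blast
  qed
qed

lemma holomorphic_scaled_csum:
  assumes "Im \<tau>' \<noteq> 0" "j \<noteq> 0" "\<And>z. z / j \<in> Lat \<tau>' \<longleftrightarrow> z \<in> Lat \<tau>"
  shows "(\<lambda>z. csum \<tau>' (z / j) / j) holomorphic_on - Lat \<tau>"
  using assms by (intro holomorphic_intros holomorphic_on_compose_gen[OF _ csum_holomorphic(1)[OF assms(1)], unfolded o_def]) auto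

context
  fixes \<tau> :: complex
  assumes \<tau>: "Im \<tau> \<noteq> 0"
begin

lemma csum2_facts: "csum2 \<tau> holomorphic_on - Lat \<tau>" "odd_pole (csum2 \<tau>)"
  "csum2 \<tau> (z + 1) = csum2 \<tau> z" "csum2 \<tau> (z + \<tau>) = - csum2 \<tau> z" "csum2 \<tau> (- z) = - csum2 \<tau> z"
proof -
  have t: "\<tau> \<noteq> 0" using \<tau> by auto
  have i: "Im (1 / \<tau>) \<noteq> 0" using \<tau> by (simp add: Im_divide)
  have L: "z / \<tau> \<in> Lat (1 / \<tau>) \<longleftrightarrow> z \<in> Lat \<tau>" for z
    using Lat_basis_change[of 0 0 1 1 \<tau> "1 / \<tau>" z] t by simp
  show "csum2 \<tau> holomorphic_on - Lat \<tau>"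
    unfolding csum2_def[abs_def] using i t L by (rule holomorphic_scaled_csum)
  show "odd_pole (csum2 \<tau>)"
    unfolding csum2_def[abs_def] using odd_pole_scale[OF odd_pole_csum[OF i] t] .
  show "csum2 \<tau> (z + 1) = csum2 \<tau> z" "csum2 \<tau> (z + \<tau>) = - csum2 \<tau> z" "csum2 \<tau> (- z) = - csum2 \<tau> z"
    using t csum_add_gen[of "1 / \<tau>" "z / \<tau>"] csum_add_1[of "1 / \<tau>" "z / \<tau>"] csum_minus[of "1 / \<tau>" "z / \<tau>"]
    by (simp_all add: csum2_def add_divide_distrib)
qed

lemma csum3_facts: "csum3 \<tau> holomorphic_on - Lat \<tau>" "odd_pole (csum3 \<tau>)"
  "csum3 \<tau> (z + 1) = - csum3 \<tau> z" "csum3 \<tau> (z + \<tau>) = - csum3 \<tau> z" "csum3 \<tau> (- z) = - csum3 \<tau> z"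
proof -
  have i: "Im (1 + \<tau>) \<noteq> 0" using \<tau> by simp
  have L: "z / 1 \<in> Lat (1 + \<tau>) \<longleftrightarrow> z \<in> Lat \<tau>" for z
    using Lat_basis_change[of 1 1 1 0 \<tau> "1 + \<tau>" z] by (simp add: add.commute)
  show "csum3 \<tau> holomorphic_on - Lat \<tau>"
    unfolding csum3_def[abs_def] using holomorphic_scaled_csum[of "1 + \<tau>" 1 \<tau>] i L by simp
  show "odd_pole (csum3 \<tau>)"
    unfolding csum3_def[abs_def] using odd_pole_csum[OF i] .
  show "csum3 \<tau> (z + 1) = - csum3 \<tau> z" "csum3 \<tau> (- z) = - csum3 \<tau> z"
    by (simp_all add: csum3_def csum_add_1 csum_minus)
  have "csum3 \<tau> (z + \<tau>) = csum3 \<tau> ((z - 1) + (1 + \<tau>))" by (simp add: algebra_simps)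
  also have "\<dots> = csum3 \<tau> (z - 1)" unfolding csum3_def by (rule csum_add_gen)
  also have "\<dots> = - csum3 \<tau> z" using csum_add_1[of "1 + \<tau>" "z - 1"] by (simp add: csum3_def)
  finally show "csum3 \<tau> (z + \<tau>) = - csum3 \<tau> z" .
qed

lemma half_Lat_iff: "(of_int m + of_int n * \<tau>) / 2 \<in> Lat \<tau> \<longleftrightarrow> even m \<and> even n"
proof
  assume "(of_int m + of_int n * \<tau>) / 2 \<in> Lat \<tau>"
  then obtain m' n' where "(of_int m + of_int n * \<tau>) / 2 = of_int m' + of_int n' * \<tau>" by (auto simp: Lat_def)
  then have "of_int (m - 2 * m') + of_int (n - 2 * n') * \<tau> = 0" by (simp add: field_simps)
  then have 1: "of_int (m - 2 * m') + of_int (n - 2 * n') * Re \<tau> = 0" "of_int (n - 2 * n') * Im \<tau> = 0"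
    by (simp_all add: complex_eq_iff)
  then have "n - 2 * n' = 0" using \<tau> by (metis mult_eq_0_iff of_int_eq_0_iff)
  then have "m - 2 * m' = 0" using 1(1) by (metis add_0_right mult_zero_left of_int_0 of_int_eq_0_iff)
  then show "even m \<and> even n" using \<open>n - 2 * n' = 0\<close> by presburger
next
  assume "even m \<and> even n"
  then obtain m' n' where "m = 2 * m'" "n = 2 * n'" by (auto elim!: evenE)
  then have "(of_int m + of_int n * \<tau>) / 2 = of_int m' + of_int n' * \<tau>" by (simp add: field_simps)
  then show "(of_int m + of_int n * \<tau>) / 2 \<in> Lat \<tau>" unfolding Lat_def by blast
qed

lemma half_not_Lat: "1 / 2 \<notin> Lat \<tau>" "\<tau> / 2 \<notin> Lat \<tau>" "(1 + \<tau>) / 2 \<notin> Lat \<tau>"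
  using half_Lat_iff[of 1 0] half_Lat_iff[of 0 1] half_Lat_iff[of 1 1] by auto

text \<open>An odd function with period w takes values at w/2 and -w/2 that are both equal and
  opposite.\<close>

lemma csum_half_zero: "csum \<tau> (\<tau> / 2) = 0" "csum2 \<tau> (1 / 2) = 0" "csum3 \<tau> ((1 + \<tau>) / 2) = 0"
proof -
  have "csum \<tau> (\<tau> / 2) = - csum \<tau> (\<tau> / 2)" using csum_add_gen[of \<tau> "- (\<tau> / 2)"] csum_minus[of \<tau> "\<tau> / 2"] by simp
  then show "csum \<tau> (\<tau> / 2) = 0" by simp
  have "csum2 \<tau> (1 / 2) = - csum2 \<tau> (1 / 2)" using csum2_facts(3)[of "- (1 / 2)"] csum2_facts(5)[of "1 / 2"] by simp
  then show "csum2 \<tau> (1 / 2) = 0" by simp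
  have "- ((1 + \<tau>) / 2) + (1 + \<tau>) = (1 + \<tau>) / 2" by (simp add: field_simps)
  from arg_cong[OF this, of "csum (1 + \<tau>)"] have "csum3 \<tau> ((1 + \<tau>) / 2) = csum3 \<tau> (- ((1 + \<tau>) / 2))"
    unfolding csum_add_gen csum3_def by (rule sym)
  also have "\<dots> = - csum3 \<tau> ((1 + \<tau>) / 2)" by (rule csum3_facts(5))
  finally have "csum3 \<tau> ((1 + \<tau>) / 2) = - csum3 \<tau> ((1 + \<tau>) / 2)" .
  then show "csum3 \<tau> ((1 + \<tau>) / 2) = 0" by simp
qed

end

text \<open>Values of the Weierstrass function at 1/2 and at (1 + \<tau>)/2, minus the one at
  \<tau>/2. The quotient \<open>rootb / roota\<close> is the modular lambda function, the squared
  modulus of the Jacobi functions.\<close>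

definition roota :: "complex \<Rightarrow> complex" where "roota \<tau> = csum \<tau> (1 / 2) ^ 2"
definition rootb :: "complex \<Rightarrow> complex" where "rootb \<tau> = csum \<tau> ((1 + \<tau>) / 2) ^ 2"

context
  fixes \<tau> :: complex
  assumes \<tau>: "Im \<tau> \<noteq> 0"
begin

text \<open>The constants are found at 1/2 and (1 + \<tau>)/2, where \<open>csum2\<close> and
  \<open>csum3\<close> vanish.\<close>

lemma csum_sq_diff:
  assumes "z \<notin> Lat \<tau>"
  shows "csum2 \<tau> z ^ 2 = csum \<tau> z ^ 2 - roota \<tau>" "csum3 \<tau> z ^ 2 = csum \<tau> z ^ 2 - rootb \<tau>"
proof -
  obtain c where c: "\<And>z. z \<notin> Lat \<tau> \<Longrightarrow> csum \<tau> z ^ 2 - csum2 \<tau> z ^ 2 = c"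
    using sq_diff_const[OF \<tau> csum_holomorphic(1)[OF \<tau>] odd_pole_csum[OF \<tau>] csum2_facts(1,2)[OF \<tau>]]
      csum_add_1 csum_add_gen csum2_facts(3,4)[OF \<tau>] by (metis power2_minus)
  have "c = roota \<tau>" using c[OF half_not_Lat(1)[OF \<tau>]] csum_half_zero(2)[OF \<tau>] by (simp add: roota_def)
  then show "csum2 \<tau> z ^ 2 = csum \<tau> z ^ 2 - roota \<tau>" using c[OF assms] by (simp add: algebra_simps)
  obtain c where c: "\<And>z. z \<notin> Lat \<tau> \<Longrightarrow> csum \<tau> z ^ 2 - csum3 \<tau> z ^ 2 = c"
    using sq_diff_const[OF \<tau> csum_holomorphic(1)[OF \<tau>] odd_pole_csum[OF \<tau>] csum3_facts(1,2)[OF \<tau>]]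
      csum_add_1 csum_add_gen csum3_facts(3,4)[OF \<tau>] by (metis power2_minus)
  have "c = rootb \<tau>" using c[OF half_not_Lat(3)[OF \<tau>]] csum_half_zero(3)[OF \<tau>] by (simp add: rootb_def)
  then show "csum3 \<tau> z ^ 2 = csum \<tau> z ^ 2 - rootb \<tau>" using c[OF assms] by (simp add: algebra_simps)
qed

text \<open>A coincidence would give two of the three Jacobi functions equal squares, hence make
  them equal, although along some period one of them changes sign and the other does not.\<close>

lemma roots_distinct: "roota \<tau> \<noteq> 0" "rootb \<tau> \<noteq> 0" "roota \<tau> \<noteq> rootb \<tau>"
proof -
  note h1 = csum_holomorphic(1)[OF \<tau>] odd_pole_csum[OF \<tau>]
  note h2 = csum2_facts(1,2)[OF \<tau>]
  note h3 = csum3_facts(1,2)[OF \<tau>]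
  have L: "z + 1 \<notin> Lat \<tau>" "z + \<tau> \<notin> Lat \<tau>" if "z \<notin> Lat \<tau>" for z
    using that Lat_add_iff by auto
  show "roota \<tau> \<noteq> 0"
  proof
    assume "roota \<tau> = 0"
    then have e: "csum \<tau> z = csum2 \<tau> z" if "z \<notin> Lat \<tau>" for z
      using sq_eq_imp_eq[OF \<tau> h1 h2 _ that] csum_sq_diff(1) by simp
    obtain z where z: "z \<notin> Lat \<tau>" "csum \<tau> z \<noteq> 0" using odd_pole_not_zero[OF \<tau> h1(2)] .
    show False using e[OF z(1)] e[OF L(1)[OF z(1)]] csum_add_1[of \<tau> z] csum2_facts(3)[OF \<tau>, of z] z(2) by simp
  qed
  show "rootb \<tau> \<noteq> 0"
  proof
    assume "rootb \<tau> = 0"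
    then have e: "csum \<tau> z = csum3 \<tau> z" if "z \<notin> Lat \<tau>" for z
      using sq_eq_imp_eq[OF \<tau> h1 h3 _ that] csum_sq_diff(2) by simp
    obtain z where z: "z \<notin> Lat \<tau>" "csum \<tau> z \<noteq> 0" using odd_pole_not_zero[OF \<tau> h1(2)] .
    show False using e[OF z(1)] e[OF L(2)[OF z(1)]] csum_add_gen[of \<tau> z] csum3_facts(4)[OF \<tau>, of z] z(2) by simp
  qed
  show "roota \<tau> \<noteq> rootb \<tau>"
  proof
    assume "roota \<tau> = rootb \<tau>"
    then have e: "csum2 \<tau> z = csum3 \<tau> z" if "z \<notin> Lat \<tau>" for z
      using sq_eq_imp_eq[OF \<tau> h2 h3 _ that] csum_sq_diff by simp
    obtain z where z: "z \<notin> Lat \<tau>" "csum2 \<tau> z \<noteq> 0" using odd_pole_not_zero[OF \<tau> h2(2)] .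
    show False using e[OF z(1)] e[OF L(1)[OF z(1)]] csum2_facts(3)[OF \<tau>, of z] csum3_facts(3)[OF \<tau>, of z] z(2) by simp
  qed
qed

text \<open>The sum of the derivative and the product has no pole: the double poles are opposite and
  the regular parts vanish at 0. So it is constant; along the period 1 it changes sign, which leaves
  the constant 0.\<close>

lemma deriv_csum:
  assumes z: "z \<notin> Lat \<tau>"
  shows "deriv (csum \<tau>) z = - csum2 \<tau> z * csum3 \<tau> z"
proof -
  let ?x = "csum \<tau>" and ?y = "csum2 \<tau>" and ?w = "csum3 \<tau>"
  have dx: "(?x has_field_derivative deriv ?x z) (at z)" if "z \<notin> Lat \<tau>" for z
    using csum_holomorphic(1)[OF \<tau>] open_nLat[OF \<tau>] that holomorphic_derivI by blast
  have d1: "deriv ?x (z + 1) = - deriv ?x z" if "z \<notin> Lat \<tau>" for z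
  proof -
    have "((\<lambda>z. ?x (z + 1)) has_field_derivative - deriv ?x z) (at z)"
      unfolding csum_add_1 using dx[OF that] by (rule DERIV_minus)
    then have "(?x has_field_derivative - deriv ?x z) (at (z + 1))" using DERIV_shift by blast
    then show ?thesis by (rule DERIV_imp_deriv)
  qed
  have d2: "deriv ?x (z + \<tau>) = deriv ?x z" if "z \<notin> Lat \<tau>" for z
  proof -
    have "((\<lambda>z. ?x (z + \<tau>)) has_field_derivative deriv ?x z) (at z)"
      unfolding csum_add_gen using dx[OF that] .
    then have "(?x has_field_derivative deriv ?x z) (at (z + \<tau>))" using DERIV_shift by blast
    then show ?thesis by (rule DERIV_imp_deriv)
  qed
  obtain e1 R where e1: "e1 > 0" "R holomorphic_on ball 0 e1" "R 0 = 0" "\<And>z. z \<in> ball 0 e1 - {0} \<Longrightarrow> ?x z = 1 / z + R z"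
    using odd_pole_csum[OF \<tau>] unfolding odd_pole_def by metis
  obtain e2 Q where e2: "e2 > 0" "Q holomorphic_on ball 0 e2" "Q 0 = 0" "\<And>z. z \<in> ball 0 e2 - {0} \<Longrightarrow> ?y z = 1 / z + Q z"
    using csum2_facts(2)[OF \<tau>] unfolding odd_pole_def by metis
  obtain e3 P where e3: "e3 > 0" "P holomorphic_on ball 0 e3" "P 0 = 0" "\<And>z. z \<in> ball 0 e3 - {0} \<Longrightarrow> ?w z = 1 / z + P z"
    using csum3_facts(2)[OF \<tau>] unfolding odd_pole_def by metis
  define e where "e = min e1 (min e2 e3)"
  have e: "e > 0" "ball 0 e \<subseteq> ball (0::complex) e1" "ball 0 e \<subseteq> ball (0::complex) e2" "ball 0 e \<subseteq> ball (0::complex) e3"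
    using e1 e2 e3 by (auto simp: e_def)
  have hR: "R holomorphic_on ball 0 e" "Q holomorphic_on ball 0 e" "P holomorphic_on ball 0 e"
    using e e1 e2 e3 holomorphic_on_subset by blast+
  obtain G where G: "G holomorphic_on ball 0 e" "\<And>z. z \<in> ball 0 e - {0} \<Longrightarrow> G z = (Q z + P z) / z"
    by (rule holomorphic_div_z[of "\<lambda>z. Q z + P z" e]) (use hR e1 e2 e3 e in \<open>auto intro!: holomorphic_intros\<close>)
  have dR: "deriv R holomorphic_on ball 0 e" using hR(1) by (intro holomorphic_deriv) auto
  have loc: "deriv ?x z + ?y z * ?w z = deriv R z + G z + Q z * P z" if "z \<in> ball 0 e - {0}" for z
  proof -
    have D: "((\<lambda>z. 1 / z + R z) has_field_derivative - (1 / z ^ 2) + deriv R z) (at z)"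
      using that hR(1) by (auto intro!: derivative_eq_intros holomorphic_derivI[of R "ball 0 e"] simp: power2_eq_square field_simps)
    have "\<forall>\<^sub>F w in nhds z. w \<in> ball 0 e - {0}"
      using that by (intro eventually_nhds_in_open) auto
    then have "\<forall>\<^sub>F w in nhds z. ?x w = 1 / w + R w" by eventually_elim (use e e1(4) in auto)
    then have "(?x has_field_derivative - (1 / z ^ 2) + deriv R z) (at z)"
      using D by (subst DERIV_cong_ev[OF refl _ refl])
    then have "deriv ?x z = - (1 / z ^ 2) + deriv R z" by (rule DERIV_imp_deriv)
    moreover have "?y z = 1 / z + Q z" "?w z = 1 / z + P z" using that e e2(4) e3(4) by auto
    moreover have "- (1 / z ^ 2) + deriv R z + (1 / z + Q z) * (1 / z + P z) = deriv R z + (Q z + P z) / z + Q z * P z"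
      by (simp add: power2_eq_square algebra_simps add_divide_distrib)
    ultimately show ?thesis using G(2)[OF that] by simp
  qed
  obtain c where c: "\<And>z. z \<notin> Lat \<tau> \<Longrightarrow> deriv ?x z + ?y z * ?w z = c"
  proof (rule elliptic_const[OF \<tau>, of "\<lambda>z. deriv ?x z + ?y z * ?w z" "-1" 1 e "\<lambda>z. deriv R z + G z + Q z * P z"])
    show "(\<lambda>z. deriv ?x z + ?y z * ?w z) holomorphic_on - Lat \<tau>"
      by (intro holomorphic_intros holomorphic_deriv csum_holomorphic(1) csum2_facts csum3_facts \<tau> open_nLat)
    show "(\<lambda>z. deriv R z + G z + Q z * P z) holomorphic_on ball 0 e"
      by (intro holomorphic_on_add holomorphic_on_mult dR hR G)
  qed (use d1 d2 csum2_facts(3,4)[OF \<tau>] csum3_facts(3,4)[OF \<tau>] e loc in \<open>auto simp: algebra_simps\<close>)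
  have "z + 1 \<notin> Lat \<tau>" using z Lat_add_iff[of 1 \<tau> z] by auto
  from c[OF this] have "- (deriv ?x z + ?y z * ?w z) = c"
    unfolding d1[OF z] csum2_facts(3)[OF \<tau>] csum3_facts(3)[OF \<tau>] by simp
  then have "c = - c" unfolding c[OF z] by simp
  then have "c = 0" by simp
  then show ?thesis using c[OF z] by (simp add: add_eq_0_iff)
qed

lemma csum_ode:
  assumes "z \<notin> Lat \<tau>"
  shows "(deriv (csum \<tau>) z) ^ 2 = (csum \<tau> z ^ 2 - roota \<tau>) * (csum \<tau> z ^ 2 - rootb \<tau>)"
  using deriv_csum[OF assms] csum_sq_diff[OF assms] by (simp add: power_mult_distrib)

end

section \<open>The cubic attached to a lattice\<close>

lemma vieta_poly:
  "vieta z1 z2 z3 = (a, b, c) \<Longrightarrow> (t - z1) * (t - z2) * (t - z3) = t ^ 3 + a * t ^ 2 + b * t + c"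
proof -
  assume "vieta z1 z2 z3 = (a, b, c)"
  then have "a = - (z1 + z2 + z3)" "b = z1 * z2 + z1 * z3 + z2 * z3" "c = - (z1 * z2 * z3)" by (auto simp: vieta_def)
  then show ?thesis by (simp only:) (simp add: power2_eq_square power3_eq_cube algebra_simps)
qed

lemma vieta_eq_poly:
  assumes "vieta x1 x2 x3 = vieta y1 y2 y3"
  shows "(t - x1) * (t - x2) * (t - x3) = (t - y1) * (t - y2) * (t - y3)"
proof -
  obtain a b c where "vieta x1 x2 x3 = (a, b, c)" by (metis prod_cases3)
  then show ?thesis using vieta_poly assms by metis
qed

lemma vieta_cong_set:
  assumes "{x1, x2, x3} = {y1, y2, y3}" "x1 \<noteq> x2" "x1 \<noteq> x3" "x2 \<noteq> x3"
  shows "vieta x1 x2 x3 = vieta y1 y2 y3"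
proof -
  have m: "y1 \<in> {x1, x2, x3}" "y2 \<in> {x1, x2, x3}" "y3 \<in> {x1, x2, x3}" using assms(1) by blast+
  have "card {y1, y2, y3} = 3" using assms(2-4) unfolding assms(1)[symmetric] by simp
  then have "y1 \<noteq> y2" "y1 \<noteq> y3" "y2 \<noteq> y3" by (auto simp: card_insert_if split: if_splits)
  with m show ?thesis
    by (elim insertE emptyE) (simp_all add: vieta_def algebra_simps)
qed

text \<open>The values of the Weierstrass function at \<tau>/2, (1 + \<tau>)/2 and 1/2. This
  numbering is increasing when \<tau> lies on the imaginary half-axis.\<close>

definition e1 :: "complex \<Rightarrow> complex" where "e1 \<tau> = - (roota \<tau> + rootb \<tau>) / 3"
definition e2 :: "complex \<Rightarrow> complex" where "e2 \<tau> = (2 * rootb \<tau> - roota \<tau>) / 3"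
definition e3 :: "complex \<Rightarrow> complex" where "e3 \<tau> = (2 * roota \<tau> - rootb \<tau>) / 3"

text \<open>The covering coordinates share the type \<open>cfg\<close> with the configurations, both
  being triples of complex numbers; this lets invariance of domain apply to the covering
  map.\<close>

definition cubic :: "cfg \<Rightarrow> cfg" where
  "cubic = (\<lambda>(\<alpha>, c, \<tau>). vieta (\<alpha> + c * e1 \<tau>) (\<alpha> + c * e2 \<tau>) (\<alpha> + c * e3 \<tau>))"

lemma cubic_eq: "cubic (\<alpha>, c, \<tau>) = vieta (\<alpha> + c * e1 \<tau>) (\<alpha> + c * e2 \<tau>) (\<alpha> + c * e3 \<tau>)"
  by (simp add: cubic_def)

lemma e_distinct:
  assumes "Im \<tau> \<noteq> 0" shows "e1 \<tau> \<noteq> e2 \<tau>" "e1 \<tau> \<noteq> e3 \<tau>" "e2 \<tau> \<noteq> e3 \<tau>"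
proof -
  have "e2 \<tau> - e1 \<tau> = rootb \<tau>" "e3 \<tau> - e1 \<tau> = roota \<tau>" "e3 \<tau> - e2 \<tau> = roota \<tau> - rootb \<tau>"
    by (simp_all add: e1_def e2_def e3_def field_simps)
  then show "e1 \<tau> \<noteq> e2 \<tau>" "e1 \<tau> \<noteq> e3 \<tau>" "e2 \<tau> \<noteq> e3 \<tau>" using roots_distinct[OF assms] by auto
qed

lemma cubic_in_Conf3:
  assumes "Im \<tau> \<noteq> 0" "c \<noteq> 0" shows "cubic (\<alpha>, c, \<tau>) \<in> Conf3"
  using e_distinct[OF assms(1)] assms(2) unfolding cubic_eq Conf3_def by force

section \<open>The modular group and the change of basis\<close>

type_synonym mat = "int \<times> int \<times> int \<times> int"

definition SL2 :: "mat set" where "SL2 = {(a, b, c, d). a * d - b * c = 1}"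
definition autf :: "mat \<Rightarrow> complex \<Rightarrow> complex" where
  "autf = (\<lambda>(a, b, c, d) \<tau>. of_int c * \<tau> + of_int d)"
definition mact :: "mat \<Rightarrow> complex \<Rightarrow> complex" where
  "mact = (\<lambda>(a, b, c, d) \<tau>. (of_int a * \<tau> + of_int b) / (of_int c * \<tau> + of_int d))"
definition mmul :: "mat \<Rightarrow> mat \<Rightarrow> mat" where
  "mmul = (\<lambda>(a, b, c, d) (a', b', c', d'). (a * a' + b * c', a * b' + b * d', c * a' + d * c', c * b' + d * d'))"
definition minv :: "mat \<Rightarrow> mat" where "minv = (\<lambda>(a, b, c, d). (d, - b, - c, a))"

lemma Lat_indep:
  assumes "Im \<tau> \<noteq> 0" "of_int p + of_int k * \<tau> = of_int p' + of_int k' * \<tau>"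
  shows "p = p' \<and> k = k'"
proof -
  have "of_int k * Im \<tau> = of_int k' * Im \<tau>" "of_int p + of_int k * Re \<tau> = of_int p' + of_int k' * Re \<tau>"
    using assms(2) by (simp_all add: complex_eq_iff)
  then show ?thesis using assms(1) by simp
qed

lemma autf_nz: "\<gamma> \<in> SL2 \<Longrightarrow> Im \<tau> \<noteq> 0 \<Longrightarrow> autf \<gamma> \<tau> \<noteq> 0"
proof -
  assume g: "\<gamma> \<in> SL2" and t: "Im \<tau> \<noteq> 0"
  obtain a b c d where \<gamma>: "\<gamma> = (a, b, c, d)" by (metis prod_cases4)
  show ?thesis
  proof
    assume "autf \<gamma> \<tau> = 0"
    then have "of_int d + of_int c * \<tau> = of_int 0 + of_int 0 * \<tau>" by (simp add: \<gamma> autf_def add.commute)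
    then have "d = 0 \<and> c = 0" using Lat_indep[OF t] by blast
    then show False using g by (simp add: \<gamma> SL2_def)
  qed
qed

lemma Im_mact:
  assumes "\<gamma> \<in> SL2" "Im \<tau> \<noteq> 0"
  shows "Im (mact \<gamma> \<tau>) = Im \<tau> / norm (autf \<gamma> \<tau>) ^ 2"
proof -
  obtain a b c d where \<gamma>: "\<gamma> = (a, b, c, d)" by (metis prod_cases4)
  have "a * d - b * c = 1" using assms by (simp add: \<gamma> SL2_def)
  then have dt: "real_of_int a * of_int d - of_int b * of_int c = 1" by (metis of_int_1 of_int_diff of_int_mult)
  have "Im (mact \<gamma> \<tau>) = (of_int a * Im \<tau> * (of_int c * Re \<tau> + of_int d) - (of_int a * Re \<tau> + of_int b) * (of_int c * Im \<tau>)) / norm (autf \<gamma> \<tau>) ^ 2"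
    by (simp add: \<gamma> mact_def autf_def Im_divide cmod_power2)
  also have "of_int a * Im \<tau> * (of_int c * Re \<tau> + of_int d) - (of_int a * Re \<tau> + of_int b) * (of_int c * Im \<tau>) = (of_int a * of_int d - of_int b * of_int c) * Im \<tau>"
    by (simp add: algebra_simps)
  finally show ?thesis using dt by simp
qed

lemma Im_mact_pos: "\<gamma> \<in> SL2 \<Longrightarrow> 0 < Im \<tau> \<Longrightarrow> 0 < Im (mact \<gamma> \<tau>)"
  using Im_mact[of \<gamma> \<tau>] autf_nz[of \<gamma> \<tau>] by simp

lemma mmul_SL2: "\<gamma> \<in> SL2 \<Longrightarrow> \<delta> \<in> SL2 \<Longrightarrow> mmul \<gamma> \<delta> \<in> SL2"
proof -
  obtain a b c d where \<gamma>: "\<gamma> = (a, b, c, d)" by (metis prod_cases4)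
  obtain a' b' c' d' where \<delta>: "\<delta> = (a', b', c', d')" by (metis prod_cases4)
  assume "\<gamma> \<in> SL2" "\<delta> \<in> SL2"
  then have "a * d - b * c = 1" "a' * d' - b' * c' = 1" by (auto simp: \<gamma> \<delta> SL2_def)
  moreover have "(a * a' + b * c') * (c * b' + d * d') - (a * b' + b * d') * (c * a' + d * c') = (a * d - b * c) * (a' * d' - b' * c')"
    by (simp add: algebra_simps)
  ultimately show ?thesis by (simp add: \<gamma> \<delta> SL2_def mmul_def)
qed

lemma minv_SL2: "\<gamma> \<in> SL2 \<Longrightarrow> minv \<gamma> \<in> SL2"
  by (auto simp: SL2_def minv_def algebra_simps)

lemma autf_mmul:
  assumes "\<delta> \<in> SL2" "Im \<tau> \<noteq> 0"
  shows "autf (mmul \<gamma> \<delta>) \<tau> = autf \<gamma> (mact \<delta> \<tau>) * autf \<delta> \<tau>"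
proof -
  obtain a b c d where \<gamma>: "\<gamma> = (a, b, c, d)" by (metis prod_cases4)
  obtain a' b' c' d' where \<delta>: "\<delta> = (a', b', c', d')" by (metis prod_cases4)
  show ?thesis using autf_nz[OF assms] by (simp add: \<gamma> \<delta> autf_def mact_def mmul_def field_simps)
qed

lemma mact_mmul:
  assumes "\<gamma> \<in> SL2" "\<delta> \<in> SL2" "Im \<tau> > 0"
  shows "mact (mmul \<gamma> \<delta>) \<tau> = mact \<gamma> (mact \<delta> \<tau>)"
proof -
  obtain a b c d where \<gamma>: "\<gamma> = (a, b, c, d)" by (metis prod_cases4)
  obtain a' b' c' d' where \<delta>: "\<delta> = (a', b', c', d')" by (metis prod_cases4)
  have 1: "autf \<delta> \<tau> \<noteq> 0" "autf \<gamma> (mact \<delta> \<tau>) \<noteq> 0"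
    using autf_nz[OF assms(2)] autf_nz[OF assms(1)] Im_mact_pos[OF assms(2,3)] assms(3) by auto
  have "mact \<gamma> (mact \<delta> \<tau>) = (of_int a * mact \<delta> \<tau> + of_int b) * autf \<delta> \<tau> / (autf \<gamma> (mact \<delta> \<tau>) * autf \<delta> \<tau>)"
    using 1 by (simp add: \<gamma> mact_def autf_def)
  also have "(of_int a * mact \<delta> \<tau> + of_int b) * autf \<delta> \<tau> = of_int (a * a' + b * c') * \<tau> + of_int (a * b' + b * d')"
    using 1(1) by (simp add: \<delta> mact_def autf_def field_simps)
  also have "autf \<gamma> (mact \<delta> \<tau>) * autf \<delta> \<tau> = autf (mmul \<gamma> \<delta>) \<tau>" using autf_mmul assms by simp
  finally show ?thesis by (simp add: \<gamma> \<delta> autf_def mact_def mmul_def)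
qed

lemma mmul_minv: "\<gamma> \<in> SL2 \<Longrightarrow> mmul \<gamma> (minv \<gamma>) = (1, 0, 0, 1)" "\<gamma> \<in> SL2 \<Longrightarrow> mmul (minv \<gamma>) \<gamma> = (1, 0, 0, 1)"
  by (auto simp: SL2_def minv_def mmul_def algebra_simps)

lemma mact_one [simp]: "mact (1, 0, 0, 1) \<tau> = \<tau>" and autf_one [simp]: "autf (1, 0, 0, 1) \<tau> = 1"
  by (simp_all add: mact_def autf_def)

text \<open>The set of values at half periods refers to the lattice and not to its basis. This
  absorbs the permutation of the three roots by a change of basis.\<close>

lemma half_values:
  assumes \<tau>: "Im \<tau> \<noteq> 0"
  shows "{csum \<tau> (w / 2) ^ 2 | w. w \<in> Lat \<tau> \<and> w / 2 \<notin> Lat \<tau>} = {0, roota \<tau>, rootb \<tau>}"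
proof (intro equalityI subsetI)
  fix v assume "v \<in> {csum \<tau> (w / 2) ^ 2 | w. w \<in> Lat \<tau> \<and> w / 2 \<notin> Lat \<tau>}"
  then obtain w where v: "v = csum \<tau> (w / 2) ^ 2" "w \<in> Lat \<tau>" "w / 2 \<notin> Lat \<tau>" by blast
  then obtain m n where w: "w = of_int m + of_int n * \<tau>" by (auto simp: Lat_def)
  have odd: "\<not> (even m \<and> even n)" using v(3) half_Lat_iff[OF \<tau>] w by simp
  have red: "csum \<tau> ((of_int (2 * p + i) + of_int (2 * p' + kk) * \<tau>) / 2) ^ 2 = csum \<tau> ((of_int i + of_int kk * \<tau>) / 2) ^ 2" for p p' i kk
  proof -
    have e: "(of_int (2 * p + i) + of_int (2 * p' + kk) * \<tau>) / 2 = (of_int i + of_int kk * \<tau>) / 2 + (of_int p + of_int p' * \<tau>)"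
      by (simp add: field_simps)
    show ?thesis unfolding e by (rule csum_sq_periodic) (auto simp: Lat_def)
  qed
  define p p' where "p = m div 2" and "p' = n div 2"
  have "m mod 2 = 0 \<or> m mod 2 = 1" "n mod 2 = 0 \<or> n mod 2 = 1" by auto
  moreover have "m = 2 * p + m mod 2" "n = 2 * p' + n mod 2" by (simp_all add: p_def p'_def)
  ultimately have "v = csum \<tau> ((of_int (m mod 2) + of_int (n mod 2) * \<tau>) / 2) ^ 2" using red[of p "m mod 2" p' "n mod 2"] v(1) w by metis
  moreover have "(m mod 2, n mod 2) \<in> {(1,0),(0,1),(1,1)}" using odd by (auto simp: even_iff_mod_2_eq_zero)
  ultimately show "v \<in> {0, roota \<tau>, rootb \<tau>}" using csum_half_zero(1)[OF \<tau>] by (auto simp: roota_def rootb_def)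
next
  fix v assume "v \<in> {0, roota \<tau>, rootb \<tau>}"
  moreover have "\<tau> \<in> Lat \<tau>" "1 \<in> Lat \<tau>" "1 + \<tau> \<in> Lat \<tau>" by (auto intro: Lat_add)
  ultimately show "v \<in> {csum \<tau> (w / 2) ^ 2 | w. w \<in> Lat \<tau> \<and> w / 2 \<notin> Lat \<tau>}"
    using csum_half_zero(1)[OF \<tau>] half_not_Lat[OF \<tau>] unfolding roota_def rootb_def
    by auto
qed

text \<open>After rescaling by the automorphy factor, the series of
  \<open>mact \<gamma> \<tau>\<close> has its poles on the lattice of \<tau>. The two squares then
  differ by a constant, which is evaluated at the half periods. It need not vanish, since \<gamma>
  may move the half period at which the series is zero.\<close>

lemma roots_mact:
  assumes g: "\<gamma> \<in> SL2" and \<tau>: "0 < Im \<tau>"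
  obtains \<kappa> where "(\<lambda>v. v / autf \<gamma> \<tau> ^ 2) ` {0, roota (mact \<gamma> \<tau>), rootb (mact \<gamma> \<tau>)} = (\<lambda>v. v + \<kappa>) ` {0, roota \<tau>, rootb \<tau>}"
proof -
  obtain a b c d where \<gamma>: "\<gamma> = (a, b, c, d)" by (metis prod_cases4)
  define j where "j = autf \<gamma> \<tau>"
  define \<tau>' where "\<tau>' = mact \<gamma> \<tau>"
  have j: "j \<noteq> 0" "j = of_int c * \<tau> + of_int d" using autf_nz[OF g] \<tau> by (auto simp: j_def \<gamma> autf_def)
  have t: "Im \<tau> \<noteq> 0" "Im \<tau>' \<noteq> 0" using \<tau> Im_mact_pos[OF g \<tau>] by (auto simp: \<tau>'_def)
  have L: "z / j \<in> Lat \<tau>' \<longleftrightarrow> z \<in> Lat \<tau>" for z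
    using Lat_basis_change[of a d b c \<tau> \<tau>' z] g j by (simp add: \<gamma> SL2_def \<tau>'_def mact_def)
  define y where "y = (\<lambda>z. csum \<tau>' (z / j) / j)"
  have yp: "y (z + w) ^ 2 = y z ^ 2" if "w \<in> Lat \<tau>" for z w
    using csum_sq_periodic[of "w / j" \<tau>' "z / j"] that L by (simp add: y_def power_divide add_divide_distrib)
  obtain \<kappa> where k: "\<And>z. z \<notin> Lat \<tau> \<Longrightarrow> y z ^ 2 - csum \<tau> z ^ 2 = \<kappa>"
  proof (rule sq_diff_const[OF t(1), of y "csum \<tau>"])
    show "y holomorphic_on - Lat \<tau>" unfolding y_def by (rule holomorphic_scaled_csum[OF t(2) j(1) L])
    show "odd_pole y" unfolding y_def by (rule odd_pole_scale[OF odd_pole_csum[OF t(2)] j(1)])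
  qed (use csum_holomorphic(1)[OF t(1)] odd_pole_csum[OF t(1)] yp csum_sq_periodic in auto)
  have "(\<lambda>v. v / j ^ 2) ` {0, roota \<tau>', rootb \<tau>'} = (\<lambda>v. v / j ^ 2) ` {csum \<tau>' (w / 2) ^ 2 | w. w \<in> Lat \<tau>' \<and> w / 2 \<notin> Lat \<tau>'}"
    unfolding half_values[OF t(2)] ..
  also have "\<dots> = {y (w / 2) ^ 2 | w. w \<in> Lat \<tau> \<and> w / 2 \<notin> Lat \<tau>}"
  proof (intro equalityI subsetI)
    fix v assume "v \<in> (\<lambda>v. v / j ^ 2) ` {csum \<tau>' (w / 2) ^ 2 | w. w \<in> Lat \<tau>' \<and> w / 2 \<notin> Lat \<tau>'}"
    then obtain w where "v = csum \<tau>' (w / 2) ^ 2 / j ^ 2" "w \<in> Lat \<tau>'" "w / 2 \<notin> Lat \<tau>'" by blast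
    then have "v = y ((j * w) / 2) ^ 2" "j * w \<in> Lat \<tau>" "(j * w) / 2 \<notin> Lat \<tau>"
      using j(1) L[of "j * w"] L[of "j * w / 2"] by (auto simp: y_def power_divide)
    then show "v \<in> {y (w / 2) ^ 2 | w. w \<in> Lat \<tau> \<and> w / 2 \<notin> Lat \<tau>}" by blast
  next
    fix v assume "v \<in> {y (w / 2) ^ 2 | w. w \<in> Lat \<tau> \<and> w / 2 \<notin> Lat \<tau>}"
    then obtain w where "v = y (w / 2) ^ 2" "w \<in> Lat \<tau>" "w / 2 \<notin> Lat \<tau>" by blast
    then have "v = csum \<tau>' ((w / j) / 2) ^ 2 / j ^ 2" "w / j \<in> Lat \<tau>'" "(w / j) / 2 \<notin> Lat \<tau>'"
      using j(1) L[of w] L[of "w / 2"] by (auto simp: y_def power_divide divide_divide_eq_left mult.commute)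
    then show "v \<in> (\<lambda>v. v / j ^ 2) ` {csum \<tau>' (w / 2) ^ 2 | w. w \<in> Lat \<tau>' \<and> w / 2 \<notin> Lat \<tau>'}" by blast
  qed
  also have "\<dots> = (\<lambda>v. v + \<kappa>) ` {csum \<tau> (w / 2) ^ 2 | w. w \<in> Lat \<tau> \<and> w / 2 \<notin> Lat \<tau>}"
  proof -
    have "y (w / 2) ^ 2 = csum \<tau> (w / 2) ^ 2 + \<kappa>" if "w / 2 \<notin> Lat \<tau>" for w using k[OF that] by (simp add: algebra_simps)
    then have "{y (w / 2) ^ 2 | w. w \<in> Lat \<tau> \<and> w / 2 \<notin> Lat \<tau>} = {csum \<tau> (w / 2) ^ 2 + \<kappa> | w. w \<in> Lat \<tau> \<and> w / 2 \<notin> Lat \<tau>}"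
      by metis
    also have "\<dots> = (\<lambda>v. v + \<kappa>) ` {csum \<tau> (w / 2) ^ 2 | w. w \<in> Lat \<tau> \<and> w / 2 \<notin> Lat \<tau>}" by blast
    finally show ?thesis .
  qed
  also have "\<dots> = (\<lambda>v. v + \<kappa>) ` {0, roota \<tau>, rootb \<tau>}" unfolding half_values[OF t(1)] ..
  finally show ?thesis using that by (simp add: j_def \<tau>'_def)
qed

text \<open>The two root sets agree up to a translation, and the translation disappears because both
  triples are centred at their mean.\<close>

lemma cubic_mact:
  assumes g: "\<gamma> \<in> SL2" and \<tau>: "0 < Im \<tau>" and c: "c \<noteq> 0"
  shows "cubic (\<alpha>, c / autf \<gamma> \<tau> ^ 2, mact \<gamma> \<tau>) = cubic (\<alpha>, c, \<tau>)"
proof -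
  define j where "j = autf \<gamma> \<tau> ^ 2"
  define \<tau>' where "\<tau>' = mact \<gamma> \<tau>"
  have j: "j \<noteq> 0" using autf_nz[OF g] \<tau> by (auto simp: j_def)
  have t: "Im \<tau> \<noteq> 0" "Im \<tau>' \<noteq> 0" using \<tau> Im_mact_pos[OF g \<tau>] by (auto simp: \<tau>'_def)
  note d = roots_distinct[OF t(1)] roots_distinct[OF t(2)]
  obtain \<kappa> where k: "(\<lambda>v. v / j) ` {0, roota \<tau>', rootb \<tau>'} = (\<lambda>v. v + \<kappa>) ` {0, roota \<tau>, rootb \<tau>}"
    using roots_mact[OF g \<tau>] unfolding j_def \<tau>'_def by blast
  have "(\<Sum>v\<in>(\<lambda>v. v / j) ` {0, roota \<tau>', rootb \<tau>'}. v) = (roota \<tau>' + rootb \<tau>') / j"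
    using d j by (subst sum.reindex) (auto simp: inj_on_def add_divide_distrib)
  moreover have "(\<Sum>v\<in>(\<lambda>v. v + \<kappa>) ` {0, roota \<tau>, rootb \<tau>}. v) = roota \<tau> + rootb \<tau> + 3 * \<kappa>"
    using d by (subst sum.reindex) (auto simp: inj_on_def)
  ultimately have s: "(roota \<tau>' + rootb \<tau>') / j = roota \<tau> + rootb \<tau> + 3 * \<kappa>" using k by simp
  define F where "F = (\<lambda>v. \<alpha> + c * (v - (roota \<tau> + rootb \<tau> + 3 * \<kappa>) / 3))"
  have 1: "F ` (\<lambda>v. v / j) ` {0, roota \<tau>', rootb \<tau>'} = {\<alpha> + c / j * e1 \<tau>', \<alpha> + c / j * e3 \<tau>', \<alpha> + c / j * e2 \<tau>'}"
    unfolding F_def s[symmetric] e1_def e2_def e3_def using j by (simp add: field_simps)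
  have 2: "F ` (\<lambda>v. v + \<kappa>) ` {0, roota \<tau>, rootb \<tau>} = {\<alpha> + c * e1 \<tau>, \<alpha> + c * e3 \<tau>, \<alpha> + c * e2 \<tau>}"
    unfolding F_def e1_def e2_def e3_def by (simp add: field_simps)
  have "{\<alpha> + c / j * e1 \<tau>', \<alpha> + c / j * e2 \<tau>', \<alpha> + c / j * e3 \<tau>'} = {\<alpha> + c * e1 \<tau>, \<alpha> + c * e2 \<tau>, \<alpha> + c * e3 \<tau>}"
    using trans[OF trans[OF 1[symmetric] arg_cong[OF k, of "image F"]] 2] by (simp only: insert_commute)
  then show ?thesis unfolding cubic_eq j_def[symmetric] \<tau>'_def[symmetric]
    by (rule vieta_cong_set) (use e_distinct[OF t(2)] c j in auto)
qed

section \<open>The lattice is determined by its cubic\<close>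

text \<open>If the two solutions differed by z^m g with g(0) nonzero, subtracting the equations and
  comparing leading terms would give -4 m = 12, which is impossible for m >= 0.\<close>

lemma weierstrass_ode_unique:
  assumes e: "e > 0" and h: "h1 holomorphic_on ball 0 e" "h2 holomorphic_on ball 0 e"
    and W1: "\<And>z. z \<in> ball 0 e - {0} \<Longrightarrow> W1 z = 1 / z ^ 2 + h1 z" 
    and W2: "\<And>z. z \<in> ball 0 e - {0} \<Longrightarrow> W2 z = 1 / z ^ 2 + h2 z"
    and o1: "\<And>z. z \<in> ball 0 e - {0} \<Longrightarrow> (deriv W1 z) ^ 2 = 4 * (W1 z ^ 3 + p2 * W1 z ^ 2 + p * W1 z + q0)"
    and o2: "\<And>z. z \<in> ball 0 e - {0} \<Longrightarrow> (deriv W2 z) ^ 2 = 4 * (W2 z ^ 3 + p2 * W2 z ^ 2 + p * W2 z + q0)"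
    and z: "z \<in> ball 0 e - {0}"
  shows "W1 z = W2 z"
proof (rule ccontr)
  assume ne: "W1 z \<noteq> W2 z"
  \<comment> \<open>The extra factor z makes \<open>E\<close> vanish at 0 even when
    \<open>h1\<close> and \<open>h2\<close> differ there; its zero has order m + 1.\<close>
  define E where "E = (\<lambda>z. z * (h1 z - h2 z))"
  have Eh: "E holomorphic_on ball 0 e" unfolding E_def using h by (intro holomorphic_intros)
  have Ez: "E z \<noteq> 0" using ne W1[OF z] W2[OF z] z by (auto simp: E_def)
  have E0: "E 0 = 0" by (simp add: E_def)
  have nc: "\<not> E constant_on ball 0 e"
  proof
    assume "E constant_on ball 0 e"
    then obtain c where "\<And>x. x \<in> ball 0 e \<Longrightarrow> E x = c" by (auto simp: constant_on_def)
    then show False using Ez E0 e z by (metis DiffD1 centre_in_ball)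
  qed
  obtain g r n where H: "0 < n \<and> 0 < r \<and> ball 0 r \<subseteq> ball (0::complex) e \<and> g holomorphic_on ball 0 r \<and>
    (\<forall>w\<in>ball 0 r. E w = (w - 0) ^ n * g w \<and> g w \<noteq> 0)"
  proof (rule holomorphic_factor_zero_nonconstant[OF Eh open_ball connected_ball _ E0 nc])
    show "0 \<in> ball (0::complex) e" using e by simp
  next
    fix g :: "complex \<Rightarrow> complex" and r :: real and n :: nat
    assume a: "0 < n" "0 < r" "ball 0 r \<subseteq> ball (0::complex) e" "g holomorphic_on ball 0 r"
      "\<And>w. w \<in> ball 0 r \<Longrightarrow> E w = (w - 0) ^ n * g w" "\<And>w. w \<in> ball 0 r \<Longrightarrow> g w \<noteq> 0"
    then show thesis by (intro that[of n r g] conjI ballI)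
  qed
  then have n: "0 < n" "0 < r" "ball 0 r \<subseteq> ball (0::complex) e" "g holomorphic_on ball 0 r"
    "\<And>w. w \<in> ball 0 r \<Longrightarrow> E w = (w - 0) ^ n * g w" "\<And>w. w \<in> ball 0 r \<Longrightarrow> g w \<noteq> 0" by blast+
  define m where "m = n - 1"
  have nm: "n = Suc m" using n(1) by (simp add: m_def)
  have dW: "deriv W w = - 2 / w ^ 3 + deriv h w"
    if W: "\<And>z. z \<in> ball 0 e - {0} \<Longrightarrow> W z = 1 / z ^ 2 + h z" and hh: "h holomorphic_on ball 0 e" and w: "w \<in> ball 0 e - {0}" for W h w
  proof -
    have w0: "w \<noteq> 0" using w by simp
    have "((\<lambda>z. inverse (z ^ 2)) has_field_derivative - (inverse (w ^ 2) * (of_nat 2 * w ^ (2 - 1)) * inverse (w ^ 2))) (at w)"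
      using w0 by (intro DERIV_inverse' DERIV_power[of _ 1, simplified] DERIV_ident) (auto intro!: derivative_eq_intros)
    moreover have "- (inverse (w ^ 2) * (of_nat 2 * w ^ (2 - 1)) * inverse (w ^ 2)) = - 2 / w ^ 3"
      using w0 by (simp add: divide_simps eval_nat_numeral)
    ultimately have "((\<lambda>z. 1 / z ^ 2) has_field_derivative - 2 / w ^ 3) (at w)" by (simp add: inverse_eq_divide)
    moreover have "(h has_field_derivative deriv h w) (at w)" by (rule holomorphic_derivI[OF hh]) (use w in auto)
    ultimately have D: "((\<lambda>z. 1 / z ^ 2 + h z) has_field_derivative - 2 / w ^ 3 + deriv h w) (at w)"
      by (rule DERIV_add)
    have "\<forall>\<^sub>F v in nhds w. v \<in> ball 0 e - {0}"
      using w by (intro eventually_nhds_in_open) auto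
    then have "\<forall>\<^sub>F v in nhds w. W v = 1 / v ^ 2 + h v" by eventually_elim (use W in auto)
    then have "(W has_field_derivative - 2 / w ^ 3 + deriv h w) (at w)"
      using D by (subst DERIV_cong_ev[OF refl _ refl])
    then show ?thesis by (rule DERIV_imp_deriv)
  qed
  \<comment> \<open>\<open>A\<close> and \<open>B\<close> are the two sides of the subtracted
    equation, multiplied by w^4 and divided by w^m. In this form they are holomorphic at 0, where
    they can be compared.\<close>
  define A where "A = (\<lambda>w. (w ^ 3 * (deriv h1 w + deriv h2 w) - 4) * (of_nat m * g w + w * deriv g w))"
  define B where "B = (\<lambda>w. 4 * ((1 + w\<^sup>2 * h1 w) ^ 2 + (1 + w\<^sup>2 * h1 w) * (1 + w\<^sup>2 * h2 w) + (1 + w\<^sup>2 * h2 w) ^ 2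
      + p2 * w\<^sup>2 * (2 + w\<^sup>2 * (h1 w + h2 w)) + p * w ^ 4) * g w)"
  have key: "A w = B w" if w: "w \<in> ball 0 r - {0}" for w
  proof -
    have w': "w \<in> ball 0 e - {0}" "w \<noteq> 0" using w n(3) by auto
    define D where "D = W1 w - W2 w"
    define D' where "D' = deriv W1 w - deriv W2 w"
    have Dg: "D = w ^ m * g w"
    proof -
      have "w * D = E w" using W1[OF w'(1)] W2[OF w'(1)] by (simp add: D_def E_def)
      also have "\<dots> = w * (w ^ m * g w)" using n(5)[of w] w by (simp add: nm)
      finally show ?thesis using w'(2) by simp
    qed
    have D'g: "w * D' = w ^ m * (of_nat m * g w + w * deriv g w)"
    proof -
      have D'h: "D' = deriv h1 w - deriv h2 w"
        using dW[of W1 h1 w, OF W1 h(1) w'(1)] dW[of W2 h2 w, OF W2 h(2) w'(1)] by (simp add: D'_def)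
      have dh: "((\<lambda>z. h1 z - h2 z) has_field_derivative D') (at w)"
        using w' h unfolding D'h
        by (auto intro!: derivative_eq_intros holomorphic_derivI[of h1] holomorphic_derivI[of h2])
      have dg: "((\<lambda>z. z ^ m * g z) has_field_derivative of_nat m * w ^ (m - 1) * g w + w ^ m * deriv g w) (at w)"
        using w by (auto intro!: derivative_eq_intros holomorphic_derivI[OF n(4)] simp: mult_ac)
      have "\<forall>\<^sub>F v in nhds w. v \<in> ball 0 r - {0}"
        using w by (intro eventually_nhds_in_open) auto
      then have "\<forall>\<^sub>F v in nhds w. h1 v - h2 v = v ^ m * g v"
      proof eventually_elim
        case (elim v)
        have "v * (h1 v - h2 v) = v * (v ^ m * g v)" using n(5)[of v] elim by (simp add: nm E_def)
        then show ?case using elim by simp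
      qed
      then have "((\<lambda>z. h1 z - h2 z) has_field_derivative of_nat m * w ^ (m - 1) * g w + w ^ m * deriv g w) (at w)"
        using dg by (subst DERIV_cong_ev[OF refl _ refl])
      then have "D' = of_nat m * w ^ (m - 1) * g w + w ^ m * deriv g w" using dh DERIV_unique by blast
      then show ?thesis by (cases m) (simp_all add: algebra_simps)
    qed
    have "(deriv W1 w) ^ 2 - (deriv W2 w) ^ 2 = (deriv W1 w + deriv W2 w) * D'"
      by (simp add: D'_def power2_eq_square algebra_simps)
    moreover have "(deriv W1 w) ^ 2 - (deriv W2 w) ^ 2 = 4 * (W1 w ^ 2 + W1 w * W2 w + W2 w ^ 2 + p2 * (W1 w + W2 w) + p) * D"
      unfolding o1[OF w'(1)] o2[OF w'(1)] D_def by (simp add: power2_eq_square power3_eq_cube algebra_simps)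
    ultimately have eq: "(deriv W1 w + deriv W2 w) * D' = 4 * (W1 w ^ 2 + W1 w * W2 w + W2 w ^ 2 + p2 * (W1 w + W2 w) + p) * D" by simp
    have l': "w ^ 3 * deriv W1 w = w ^ 3 * deriv h1 w - 2" "w ^ 3 * deriv W2 w = w ^ 3 * deriv h2 w - 2"
      using dW[of W1 h1 w, OF W1 h(1) w'(1)] dW[of W2 h2 w, OF W2 h(2) w'(1)] w'(2) by (simp_all add: field_simps)
    have l: "w ^ 3 * (deriv W1 w + deriv W2 w) = w ^ 3 * (deriv h1 w + deriv h2 w) - 4"
      unfolding distrib_left l' by simp
    have rr: "w\<^sup>2 * W1 w = 1 + w\<^sup>2 * h1 w" "w\<^sup>2 * W2 w = 1 + w\<^sup>2 * h2 w"
      unfolding W1[OF w'(1)] W2[OF w'(1)] using w'(2) by (simp_all add: field_simps)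
    have "w ^ m * A w = (w ^ 3 * (deriv W1 w + deriv W2 w)) * (w * D')"
      unfolding l D'g A_def by (simp add: mult_ac)
    also have "\<dots> = w ^ 4 * ((deriv W1 w + deriv W2 w) * D')" by (simp add: power3_eq_cube power4_eq_xxxx mult_ac)
    also have "\<dots> = 4 * ((w\<^sup>2 * W1 w) ^ 2 + (w\<^sup>2 * W1 w) * (w\<^sup>2 * W2 w) + (w\<^sup>2 * W2 w) ^ 2 + p2 * w\<^sup>2 * (w\<^sup>2 * W1 w + w\<^sup>2 * W2 w) + p * w ^ 4) * D"
      unfolding eq by (simp add: power2_eq_square power4_eq_xxxx algebra_simps)
    also have "\<dots> = w ^ m * B w" unfolding rr Dg B_def by (simp add: algebra_simps)
    finally show ?thesis using w'(2) by simp
  qed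
  have hr: "h1 holomorphic_on ball 0 r" "h2 holomorphic_on ball 0 r" using h n(3) holomorphic_on_subset by blast+
  have "(\<lambda>w. A w - B w) holomorphic_on ball 0 r" unfolding A_def B_def
    using hr n(4) by (intro holomorphic_intros holomorphic_deriv) auto
  then have "isCont (\<lambda>w. A w - B w) 0"
    using n(2) by (metis centre_in_ball continuous_on_eq_continuous_at holomorphic_on_imp_continuous_on open_ball)
  then have "(\<lambda>w. A w - B w) \<midarrow>0\<rightarrow> A 0 - B 0" by (simp add: isCont_def)
  moreover have "\<forall>\<^sub>F w in at 0. A w - B w = 0"
    using eventually_at_in_open[of "ball 0 r" 0] n(2) by (auto elim!: eventually_mono simp: key)
  ultimately have "((\<lambda>w. 0) \<longlongrightarrow> A 0 - B 0) (at (0::complex))" by (rule Lim_transform_eventually)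
  then have "A 0 - B 0 = 0" by (metis LIM_const_eq tendsto_const)
  moreover have "A 0 - B 0 = - 4 * ((of_nat m + 3) * g 0)" by (simp add: A_def B_def algebra_simps)
  ultimately have "(of_nat m + 3) * g 0 = 0" by simp
  moreover have "(of_nat m + 3 :: complex) \<noteq> 0" by (metis of_nat_add of_nat_eq_0_iff of_nat_numeral add_is_0 zero_neq_numeral)
  ultimately show False using n(6)[of 0] n(2) by simp
qed


text \<open>The Weierstrass function of the lattice \<open>Lat \<tau>\<close> divided by
  \<xi>.\<close>

definition wp :: "complex \<Rightarrow> complex \<Rightarrow> complex \<Rightarrow> complex" where
  "wp \<tau> \<xi> z = \<xi>\<^sup>2 * (csum \<tau> (\<xi> * z) ^ 2 - (roota \<tau> + rootb \<tau>) / 3)"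
definition wp_poles :: "complex \<Rightarrow> complex \<Rightarrow> complex set" where
  "wp_poles \<tau> \<xi> = {z. \<xi> * z \<in> Lat \<tau>}"

lemma weierstrass_form:
  assumes t: "Im \<tau> \<noteq> 0" and x: "\<xi> \<noteq> 0"
  defines "L \<equiv> wp_poles \<tau> \<xi>" and "W \<equiv> wp \<tau> \<xi>"
  shows "W holomorphic_on - L" "closed L" "countable L"
    and "\<exists>e>0. \<exists>h. h holomorphic_on ball 0 e \<and> ball 0 e \<inter> L \<subseteq> {0} \<and> (\<forall>z\<in>ball 0 e - {0}. W z = 1 / z ^ 2 + h z)"
    and "z \<notin> L \<Longrightarrow> (deriv W z) ^ 2 = 4 * ((W z - \<xi>\<^sup>2 * e1 \<tau>) * (W z - \<xi>\<^sup>2 * e2 \<tau>) * (W z - \<xi>\<^sup>2 * e3 \<tau>))"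
    and "w \<in> L \<Longrightarrow> W (z + w) = W z"
    and "filterlim W at_infinity (at 0)"
proof -
  have L_def: "L = {z. \<xi> * z \<in> Lat \<tau>}" by (simp add: L_def wp_poles_def)
  have W_def: "W = (\<lambda>z. \<xi>\<^sup>2 * (csum \<tau> (\<xi> * z) ^ 2 - (roota \<tau> + rootb \<tau>) / 3))" by (simp add: W_def wp_def fun_eq_iff)
  have opn: "open (- Lat \<tau>)" using closed_Lat[OF t] by (simp add: open_Compl)
  show cl: "closed L"
  proof -
    have "closed ((\<lambda>z. \<xi> * z) -` Lat \<tau>)"
      by (intro continuous_closed_vimage closed_Lat t) (auto intro!: continuous_intros)
    then show ?thesis by (simp add: L_def vimage_def)
  qed
  have "L = (\<lambda>z. z / \<xi>) ` Lat \<tau>"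
    unfolding L_def using x by (auto simp: image_iff field_simps)
  then show "countable L" using countable_Lat by simp
  have hc: "(\<lambda>z. csum \<tau> (\<xi> * z)) holomorphic_on - L"
    by (intro holomorphic_on_compose_gen[OF _ csum_holomorphic(1)[OF t], unfolded o_def])
       (auto intro!: holomorphic_intros simp: L_def)
  show hW: "W holomorphic_on - L" unfolding W_def using hc by (intro holomorphic_intros)
  show "w \<in> L \<Longrightarrow> W (z + w) = W z" for z w
    using csum_sq_periodic[of "\<xi> * w" \<tau> "\<xi> * z"] by (simp add: L_def W_def distrib_left)
  define m where "m = \<xi>\<^sup>2 * ((roota \<tau> + rootb \<tau>) / 3)"
  define y where "y = (\<lambda>z. csum \<tau> (z / (1/\<xi>)) / (1/\<xi>))"
  have yW: "W z = y z ^ 2 - m" for z by (simp add: W_def y_def m_def power_mult_distrib algebra_simps)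
  have "odd_pole y" unfolding y_def by (rule odd_pole_scale[OF odd_pole_csum[OF t]]) (use x in auto)
  then obtain e R where e: "e > 0" "R holomorphic_on ball 0 e" "R 0 = 0" "\<And>z. z \<in> ball 0 e - {0} \<Longrightarrow> y z = 1 / z + R z"
    unfolding odd_pole_def by metis
  obtain G where G: "G holomorphic_on ball 0 e" "\<And>z. z \<in> ball 0 e - {0} \<Longrightarrow> G z = R z / z"
    using holomorphic_div_z[OF e(2,3,1)] by blast
  define h where "h = (\<lambda>z. 2 * G z + R z ^ 2 - m)"
  have Wh: "W z = 1 / z ^ 2 + h z" if "z \<in> ball 0 e - {0}" for z
  proof -
    have "W z = (1 / z + R z) ^ 2 - m" using yW e(4)[OF that] by simp
    also have "\<dots> = 1 / z ^ 2 + (2 * (R z / z) + R z ^ 2 - m)" by (simp add: power2_eq_square algebra_simps)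
    finally show ?thesis using G(2)[OF that] by (simp add: h_def)
  qed
  define d where "d = min e (min 1 \<bar>Im \<tau>\<bar> / norm \<xi>)"
  have d: "d > 0" "ball 0 d \<subseteq> ball (0::complex) e" using e(1) t x by (auto simp: d_def)
  have "ball 0 d \<inter> L \<subseteq> {0}"
  proof
    fix z assume z: "z \<in> ball 0 d \<inter> L"
    then have "norm (\<xi> * z) < min 1 \<bar>Im \<tau>\<bar>" using x by (simp add: norm_mult d_def field_simps)
    then have "\<xi> * z = 0" using z by (intro Lat_discrete[OF t]) (auto simp: L_def)
    then show "z \<in> {0}" using x by simp
  qed
  moreover have hh: "h holomorphic_on ball 0 e" unfolding h_def using G(1) e(2) by (intro holomorphic_intros)
  ultimately show "\<exists>e>0. \<exists>h. h holomorphic_on ball 0 e \<and> ball 0 e \<inter> L \<subseteq> {0} \<and> (\<forall>z\<in>ball 0 e - {0}. W z = 1 / z ^ 2 + h z)"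
    using d Wh holomorphic_on_subset by blast
  show "filterlim W at_infinity (at 0)"
  proof -
    have "isCont h 0" using hh e(1) by (metis centre_in_ball continuous_on_eq_continuous_at holomorphic_on_imp_continuous_on open_ball)
    then have hl: "(h \<longlongrightarrow> h 0) (at 0)" by (simp add: isCont_def)
    have "filterlim (\<lambda>z::complex. z ^ 2) (at 0) (at 0)"
      unfolding filterlim_at by (auto intro!: tendsto_eq_intros simp: eventually_at_filter)
    then have "filterlim (\<lambda>z::complex. inverse (z ^ 2)) at_infinity (at 0)"
      using filterlim_compose[OF filterlim_inverse_at_infinity] by blast
    then have lim: "filterlim (\<lambda>z. h z + inverse (z ^ 2)) at_infinity (at 0)"
      using hl by (intro tendsto_add_filterlim_at_infinity)
    have ev: "\<forall>\<^sub>F z in at 0. h z + inverse (z ^ 2) = W z"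
      using eventually_at_in_open[of "ball 0 e" 0] e(1) by (auto elim!: eventually_mono simp: Wh inverse_eq_divide)
    show ?thesis by (rule iffD1[OF filterlim_cong[OF refl refl ev] lim])
  qed
  assume z: "z \<notin> L"
  have "(csum \<tau> has_field_derivative deriv (csum \<tau>) (\<xi> * z)) (at (\<xi> * z))"
    using csum_holomorphic(1)[OF t] opn z by (intro holomorphic_derivI) (auto simp: L_def)
  then have "((\<lambda>z. csum \<tau> (\<xi> * z)) has_field_derivative deriv (csum \<tau>) (\<xi> * z) * \<xi>) (at z)"
    by (rule DERIV_chain2) (auto intro!: derivative_eq_intros)
  then have "(W has_field_derivative \<xi>\<^sup>2 * (2 * csum \<tau> (\<xi> * z) * (deriv (csum \<tau>) (\<xi> * z) * \<xi>))) (at z)"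
    unfolding W_def by (auto intro!: derivative_eq_intros simp: power2_eq_square)
  then have "deriv W z = \<xi>\<^sup>2 * (2 * csum \<tau> (\<xi> * z) * (deriv (csum \<tau>) (\<xi> * z) * \<xi>))" by (rule DERIV_imp_deriv)
  then have "(deriv W z) ^ 2 = 4 * \<xi> ^ 6 * csum \<tau> (\<xi> * z) ^ 2 * (deriv (csum \<tau>) (\<xi> * z)) ^ 2"
    by (simp add: power_mult_distrib flip: power_mult power_add)
  also have "\<dots> = 4 * \<xi> ^ 6 * csum \<tau> (\<xi> * z) ^ 2 * ((csum \<tau> (\<xi> * z) ^ 2 - roota \<tau>) * (csum \<tau> (\<xi> * z) ^ 2 - rootb \<tau>))"
    using csum_ode[OF t] z by (simp add: L_def)
  also have "\<dots> = 4 * ((W z - \<xi>\<^sup>2 * e1 \<tau>) * (W z - \<xi>\<^sup>2 * e2 \<tau>) * (W z - \<xi>\<^sup>2 * e3 \<tau>))"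
  proof -
    have "W z - \<xi>\<^sup>2 * e1 \<tau> = \<xi>\<^sup>2 * csum \<tau> (\<xi> * z) ^ 2" "W z - \<xi>\<^sup>2 * e2 \<tau> = \<xi>\<^sup>2 * (csum \<tau> (\<xi> * z) ^ 2 - rootb \<tau>)"
      "W z - \<xi>\<^sup>2 * e3 \<tau> = \<xi>\<^sup>2 * (csum \<tau> (\<xi> * z) ^ 2 - roota \<tau>)"
      by (simp_all add: W_def e1_def e2_def e3_def field_simps)
    then show ?thesis by (simp add: eval_nat_numeral mult_ac)
  qed
  finally show "(deriv W z) ^ 2 = 4 * ((W z - \<xi>\<^sup>2 * e1 \<tau>) * (W z - \<xi>\<^sup>2 * e2 \<tau>) * (W z - \<xi>\<^sup>2 * e3 \<tau>))" .
qed

text \<open>Each basis is integral in the other, so the determinant of the transition is a unit; it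
  is 1 and not -1 because both ratios lie in the upper half-plane.\<close>

lemma same_lattice_SL2:
  assumes t: "0 < Im \<tau>" "0 < Im \<tau>'" and x: "\<xi> \<noteq> 0" "\<xi>' \<noteq> 0"
    and L: "{z. \<xi> * z \<in> Lat \<tau>} = {z. \<xi>' * z \<in> Lat \<tau>'}"
  obtains \<gamma> where "\<gamma> \<in> SL2" "\<tau>' = mact \<gamma> \<tau>" "\<xi>' = \<xi> / autf \<gamma> \<tau>"
proof -
  have iff: "\<xi> * z \<in> Lat \<tau> \<longleftrightarrow> \<xi>' * z \<in> Lat \<tau>'" for z using L by blast
  have "\<xi> * (1 / \<xi>') \<in> Lat \<tau>" "\<xi> * (\<tau>' / \<xi>') \<in> Lat \<tau>" "\<xi>' * (1 / \<xi>) \<in> Lat \<tau>'" "\<xi>' * (\<tau> / \<xi>) \<in> Lat \<tau>'"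
    using iff[of "1 / \<xi>'"] iff[of "\<tau>' / \<xi>'"] iff[of "1 / \<xi>"] iff[of "\<tau> / \<xi>"] x by simp_all
  then obtain d c b a m n m' n' where
    1: "\<xi> * (1 / \<xi>') = of_int d + of_int c * \<tau>" and 2: "\<xi> * (\<tau>' / \<xi>') = of_int b + of_int a * \<tau>"
    and 3: "\<xi>' * (1 / \<xi>) = of_int m + of_int n * \<tau>'" and 4: "\<xi>' * (\<tau> / \<xi>) = of_int m' + of_int n' * \<tau>'"
    unfolding Lat_def by blast
  define j where "j = \<xi> / \<xi>'"
  have "j * \<tau>' = \<xi> * (\<tau>' / \<xi>')" "j = \<xi> * (1 / \<xi>')" by (simp_all add: j_def)
  moreover have "j \<noteq> 0" using x by (simp add: j_def)
  ultimately have j: "j \<noteq> 0" "j = of_int d + of_int c * \<tau>" "j * \<tau>' = of_int b + of_int a * \<tau>"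
    by (simp_all only: 1 2 not_False_eq_True)
  have "1 = j * (\<xi>' * (1 / \<xi>))" using x by (simp add: j_def)
  then have "1 = of_int m * j + of_int n * (j * \<tau>')" unfolding 3 by (simp add: algebra_simps)
  then have "of_int 1 + of_int 0 * \<tau> = of_int (m * d + n * b) + of_int (m * c + n * a) * \<tau>" unfolding j(3) unfolding j(2) by (simp add: algebra_simps)
  then have i1: "1 = m * d + n * b \<and> 0 = m * c + n * a" using Lat_indep t by (metis less_irrefl)
  have "\<tau> = j * (\<xi>' * (\<tau> / \<xi>))" using x by (simp add: j_def)
  then have "\<tau> = of_int m' * j + of_int n' * (j * \<tau>')" unfolding 4 by (simp add: algebra_simps)
  then have "of_int 0 + of_int 1 * \<tau> = of_int (m' * d + n' * b) + of_int (m' * c + n' * a) * \<tau>" unfolding j(3) unfolding j(2) by (simp add: algebra_simps)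
  then have i2: "0 = m' * d + n' * b \<and> 1 = m' * c + n' * a" using Lat_indep t by (metis less_irrefl)
  have "(a * d - b * c) * (m * n' - n * m') = (m * d + n * b) * (m' * c + n' * a) - (m * c + n * a) * (m' * d + n' * b)"
    by (simp add: algebra_simps)
  also have "\<dots> = 1" using i1 i2 by simp
  finally have dt: "a * d - b * c = 1 \<or> a * d - b * c = -1" using zmult_eq_1_iff by blast
  have t': "\<tau>' = (of_int a * \<tau> + of_int b) / j" using j(1,3) by (simp add: field_simps)
  have "Im \<tau>' = of_int (a * d - b * c) * Im \<tau> / norm j ^ 2"
    unfolding t' unfolding j(2) by (simp add: Im_divide cmod_power2 diff_divide_distrib[symmetric] algebra_simps)
  then have "0 < of_int (a * d - b * c) * Im \<tau>" using t j(1) by (simp add: zero_less_divide_iff)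
  then have "0 < a * d - b * c" using t by (simp add: zero_less_mult_iff flip: of_int_diff of_int_mult)
  then have "(a, b, c, d) \<in> SL2" using dt by (auto simp: SL2_def)
  moreover have "autf (a, b, c, d) \<tau> = j" by (simp add: autf_def j(2))
  moreover have "\<tau>' = mact (a, b, c, d) \<tau>" using t' j(2) by (simp add: mact_def add.commute)
  moreover have "\<xi>' = \<xi> / j" using x by (simp add: j_def)
  ultimately show ?thesis using that by blast
qed

text \<open>Near a period of \<open>W\<close> at which \<open>V\<close> is regular, the values of
  \<open>V\<close> converge while those of \<open>W\<close> tend to infinity.\<close>

lemma poles_subset:
  fixes W V :: "complex \<Rightarrow> complex" and L L' :: "complex set"
  assumes inf: "filterlim W at_infinity (at 0)" and per: "\<And>(z::complex) (w::complex). w \<in> L \<Longrightarrow> W (z + w) = W z"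
    and d: "0 < d" "ball 0 d \<inter> L \<subseteq> {0}" and grp: "\<And>(z::complex) (w::complex). w \<in> L \<Longrightarrow> z + w \<in> L \<longleftrightarrow> z \<in> L"
    and V: "V holomorphic_on - L'" "closed L'" and eq: "\<And>z::complex. z \<notin> L \<Longrightarrow> z \<notin> L' \<Longrightarrow> W z = V z"
  shows "L \<subseteq> L'"
proof
  fix w assume w: "w \<in> L"
  show "w \<in> L'"
  proof (rule ccontr)
    assume nw: "w \<notin> L'"
    have o: "open (- L')" using V(2) by (simp add: open_Compl)
    have "isCont V w" using V(1) o nw by (metis ComplI continuous_on_eq_continuous_at holomorphic_on_imp_continuous_on)
    then have l: "((\<lambda>z. V (z + w)) \<longlongrightarrow> V w) (at 0)"
      by (rule isCont_tendsto_compose) (auto intro!: tendsto_eq_intros)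
    have "((\<lambda>z. z + w) \<longlongrightarrow> w) (at 0)" by (auto intro!: tendsto_eq_intros)
    then have "\<forall>\<^sub>F z in at 0. z + w \<in> - L'" using o nw by (metis ComplI topological_tendstoD)
    moreover have "\<forall>\<^sub>F z in at 0. z \<in> ball 0 d - {0}" by (rule eventually_at_in_open) (use d in auto)
    ultimately have "\<forall>\<^sub>F z in at 0. V (z + w) = W z"
    proof eventually_elim
      case (elim z)
      then have "z \<notin> L" using d by auto
      then show ?case using eq[of "z + w"] per[OF w, of z] grp[OF w, of z] elim by auto
    qed
    then have "(W \<longlongrightarrow> V w) (at 0)" using l Lim_transform_eventually by blast
    then show False using inf not_tendsto_and_filterlim_at_infinity[OF at_neq_bot] by blast
  qed
qed

lemma wp_poles_add: "w \<in> wp_poles \<tau> \<xi> \<Longrightarrow> z + w \<in> wp_poles \<tau> \<xi> \<longleftrightarrow> z \<in> wp_poles \<tau> \<xi>"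
  by (simp add: wp_poles_def distrib_left Lat_add_iff)

text \<open>The coefficients of the centred cubic are those of the differential equation of its
  Weierstrass function. Equal cubics thus give equal functions near 0, by continuation everywhere,
  hence the same poles and the same lattice. The centre itself is read off from the sum of the
  roots.\<close>

theorem cubic_fibre:
  assumes t: "0 < Im \<tau>" "0 < Im \<tau>'" and c: "c \<noteq> 0" "c' \<noteq> 0"
    and eq: "cubic (\<alpha>, c, \<tau>) = cubic (\<alpha>', c', \<tau>')"
  obtains \<gamma> where "\<gamma> \<in> SL2" "\<alpha>' = \<alpha>" "\<tau>' = mact \<gamma> \<tau>" "c' = c / autf \<gamma> \<tau> ^ 2"
proof -
  have t0: "Im \<tau> \<noteq> 0" "Im \<tau>' \<noteq> 0" using t by auto
  have s0: "e1 \<tau> + e2 \<tau> + e3 \<tau> = 0" for \<tau> by (simp add: e1_def e2_def e3_def field_simps)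
  have f: "fst (cubic (\<alpha>, c, \<tau>)) = - 3 * \<alpha>" for \<alpha> c \<tau>
  proof -
    have "fst (cubic (\<alpha>, c, \<tau>)) = - 3 * \<alpha> - c * (e1 \<tau> + e2 \<tau> + e3 \<tau>)" by (simp add: cubic_eq vieta_def algebra_simps)
    then show ?thesis using s0 by simp
  qed
  have "- 3 * \<alpha>' = - 3 * \<alpha>" using f[of \<alpha> c \<tau>] f[of \<alpha>' c' \<tau>'] eq by simp
  then have al: "\<alpha>' = \<alpha>" by simp
  \<comment> \<open>With square roots of the scales, the weight-two factor on the scale becomes a
    homothety of lattices.\<close>
  define \<xi> \<xi>' where "\<xi> = csqrt c" and "\<xi>' = csqrt c'"
  have x: "\<xi> \<noteq> 0" "\<xi>' \<noteq> 0" "\<xi>\<^sup>2 = c" "\<xi>'\<^sup>2 = c'" using c by (auto simp: \<xi>_def \<xi>'_def)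
  have poly: "(s - c * e1 \<tau>) * (s - c * e2 \<tau>) * (s - c * e3 \<tau>) = (s - c' * e1 \<tau>') * (s - c' * e2 \<tau>') * (s - c' * e3 \<tau>')" for s
    using vieta_eq_poly[OF eq[unfolded cubic_eq al], of "s + \<alpha>"] by (simp add: algebra_simps)
  obtain p2 p1 p0 where pp: "vieta (c * e1 \<tau>) (c * e2 \<tau>) (c * e3 \<tau>) = (p2, p1, p0)" by (metis prod_cases3)
  note cub = vieta_poly[OF pp]
  define L where "L = wp_poles \<tau> \<xi>"
  define L' where "L' = wp_poles \<tau>' \<xi>'"
  define W where "W = wp \<tau> \<xi>"
  define V where "V = wp \<tau>' \<xi>'"
  note FW = weierstrass_form[OF t0(1) x(1), folded L_def W_def]
  note FV = weierstrass_form[OF t0(2) x(2), folded L'_def V_def]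
  obtain d1 h1 where 1: "d1 > 0" "h1 holomorphic_on ball 0 d1" "ball 0 d1 \<inter> L \<subseteq> {0}" "\<And>z. z \<in> ball 0 d1 - {0} \<Longrightarrow> W z = 1 / z ^ 2 + h1 z"
    using FW(4) by blast
  obtain d2 h2 where 2: "d2 > 0" "h2 holomorphic_on ball 0 d2" "ball 0 d2 \<inter> L' \<subseteq> {0}" "\<And>z. z \<in> ball 0 d2 - {0} \<Longrightarrow> V z = 1 / z ^ 2 + h2 z"
    using FV(4) by blast
  define e where "e = min d1 d2"
  have e: "e > 0" "ball 0 e \<subseteq> ball (0::complex) d1" "ball 0 e \<subseteq> ball (0::complex) d2" using 1 2 by (auto simp: e_def)
  have near: "W z = V z" if z: "z \<in> ball 0 e - {0}" for z
  proof (rule weierstrass_ode_unique[OF e(1), of h1 h2 W V p2 p1 p0])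
    fix z :: complex assume z: "z \<in> ball 0 e - {0}"
    then have nL: "z \<notin> L" "z \<notin> L'" using 1(3) 2(3) e by auto
    show "(deriv W z)\<^sup>2 = 4 * (W z ^ 3 + p2 * (W z)\<^sup>2 + p1 * W z + p0)" using FW(5)[OF nL(1)] cub x by simp
    show "(deriv V z)\<^sup>2 = 4 * (V z ^ 3 + p2 * (V z)\<^sup>2 + p1 * V z + p0)" using FV(5)[OF nL(2)] cub poly x by simp
    show "W z = 1 / z ^ 2 + h1 z" by (rule 1(4)) (use z e in blast)
    show "V z = 1 / z ^ 2 + h2 z" by (rule 2(4)) (use z e in blast)
  next
    show "h1 holomorphic_on ball 0 e" "h2 holomorphic_on ball 0 e"
      using holomorphic_on_subset[OF 1(2) e(2)] holomorphic_on_subset[OF 2(2) e(3)] .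
  qed (rule z)
  define U where "U = - (L \<union> L')"
  have U: "open U" "connected U"
  proof -
    show "open U" unfolding U_def using FW(2) FV(2) closed_Un open_Compl by blast
    have "connected (UNIV - (L \<union> L'))"
      by (rule connected_open_diff_countable) (use FW(3) FV(3) in auto)
    then show "connected U" by (simp add: U_def Compl_eq_Diff_UNIV)
  qed
  have all: "W z = V z" if z: "z \<in> U" for z
  proof (rule analytic_continuation_open[of "ball 0 e - {0}" U W V z])
    have "(of_real (e/2) :: complex) \<in> ball 0 e - {0}" using e(1) by auto
    then show "ball 0 e - {0::complex} \<noteq> {}" by blast
    show "ball 0 e - {0} \<subseteq> U" using 1(3) 2(3) e by (auto simp: U_def)
    show "W holomorphic_on U" "V holomorphic_on U" using FW(1) FV(1) holomorphic_on_subset by (auto simp: U_def)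
  qed (use U z near in auto)
  have grp: "z + w \<in> L \<longleftrightarrow> z \<in> L" if "w \<in> L" for z w using wp_poles_add that unfolding L_def by blast
  have grp': "z + w \<in> L' \<longleftrightarrow> z \<in> L'" if "w \<in> L'" for z w using wp_poles_add that unfolding L'_def by blast
  have eqU: "W z = V z" if "z \<notin> L" "z \<notin> L'" for z using all that by (simp add: U_def)
  have "L \<subseteq> L'"
    by (rule poles_subset[OF FW(7) FW(6) 1(1,3) grp FV(1,2) eqU])
  moreover have "L' \<subseteq> L"
    by (rule poles_subset[OF FV(7) FV(6) 2(1,3) grp' FW(1,2) eqU[symmetric]])
  ultimately have "L = L'" by blast
  then obtain \<gamma> where "\<gamma> \<in> SL2" "\<tau>' = mact \<gamma> \<tau>" "\<xi>' = \<xi> / autf \<gamma> \<tau>"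
    using same_lattice_SL2[OF t x(1,2)] unfolding L_def L'_def wp_poles_def by blast
  moreover from this have "c' = c / autf \<gamma> \<tau> ^ 2" using x by (auto simp: power_divide)
  ultimately show ?thesis using that al by blast
qed

section \<open>Holomorphic dependence on the period ratio\<close>

lemma csc_term_bound_int:
  assumes "0 < D" "D * \<bar>real_of_int n\<bar> \<le> \<bar>Im w\<bar>" "n \<notin> {n. \<bar>real_of_int n\<bar> * D < 1}"
  shows "norm (of_real pi / sin (of_real pi * w)) \<le> 4 * pi * exp (- (D * \<bar>real_of_int n\<bar>))"
proof -
  have "1 \<le> \<bar>Im w\<bar>" using assms(2,3) by (simp add: not_less mult.commute)
  then have "norm (of_real pi / sin (of_real pi * w)) \<le> 4 * pi * exp (- pi * \<bar>Im w\<bar>)" by (intro csc_term_bound) auto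
  also have "1 * \<bar>Im w\<bar> \<le> pi * \<bar>Im w\<bar>" using pi_gt3 by (intro mult_right_mono) auto
  then have "D * \<bar>real_of_int n\<bar> \<le> pi * \<bar>Im w\<bar>" using assms(2) by linarith
  then have "4 * pi * exp (- pi * \<bar>Im w\<bar>) \<le> 4 * pi * exp (- (D * \<bar>real_of_int n\<bar>))"
    by (intro mult_left_mono) auto
  finally show ?thesis .
qed

text \<open>At these half periods the height of the n-th argument is n or n + 1/2 times Im \<tau>.
  Since |n + 1/2| >= |n|/2 for integers, the bound is uniform on every half-plane Im \<tau> > d with
  d > 0.\<close>

lemma csum_holomorphic_param:
  assumes w: "w = (\<lambda>\<tau>. 1 / 2) \<or> w = (\<lambda>\<tau>. (1 + \<tau>) / 2)"
  shows "(\<lambda>\<tau>. csum \<tau> (w \<tau>)) holomorphic_on {\<tau>. 0 < Im \<tau>}"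
proof -
  have op: "open {\<tau>. d < Im \<tau>}" for d by (intro open_Collect_less continuous_intros)
  have nL: "w \<tau> \<notin> Lat \<tau>" if "0 < Im \<tau>" for \<tau> using half_not_Lat[of \<tau>] w that by auto
  have wh: "w holomorphic_on A" for A using w by (auto intro!: holomorphic_intros)
  have "(\<lambda>\<tau>. csum \<tau> (w \<tau>)) holomorphic_on {\<tau>. d < Im \<tau>}" if d: "0 < d" for d
    unfolding csum_def
  proof (rule holomorphic_infsum_int(2)[OF finite_int_bound[of "d / 2" 1] _ _ op])
    show "(\<lambda>\<tau>. of_real pi / sin (of_real pi * (w \<tau> + of_int n * \<tau>))) holomorphic_on {\<tau>. d < Im \<tau>}" for n
      using sin_term_nz[OF nL] d by (intro holomorphic_intros wh) auto
    fix n :: int and \<tau> assume n: "n \<notin> {n. \<bar>real_of_int n\<bar> * (d / 2) < 1}" and t: "\<tau> \<in> {\<tau>. d < Im \<tau>}"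
    have "n \<ge> 0 \<or> n \<le> -1" by linarith
    then have "real_of_int n \<ge> 0 \<or> real_of_int n \<le> -1" by linarith
    then have "\<bar>real_of_int n\<bar> / 2 \<le> \<bar>real_of_int n + 1 / 2\<bar>" by auto
    then have "\<bar>real_of_int n\<bar> / 2 * d \<le> \<bar>real_of_int n + 1 / 2\<bar> * Im \<tau>" "\<bar>real_of_int n\<bar> / 2 * d \<le> \<bar>real_of_int n\<bar> * Im \<tau>"
      using mult_mono[of "\<bar>real_of_int n\<bar> / 2" "\<bar>real_of_int n + 1 / 2\<bar>" d "Im \<tau>"]
        mult_mono[of "\<bar>real_of_int n\<bar> / 2" "\<bar>real_of_int n\<bar>" d "Im \<tau>"] d t by auto
    moreover have "\<bar>(real_of_int n + 1 / 2) * Im \<tau>\<bar> = \<bar>real_of_int n + 1 / 2\<bar> * Im \<tau>" "\<bar>real_of_int n * Im \<tau>\<bar> = \<bar>real_of_int n\<bar> * Im \<tau>"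
      using d t by (simp_all add: abs_mult)
    moreover have "\<bar>Im (w \<tau> + of_int n * \<tau>)\<bar> = \<bar>real_of_int n * Im \<tau>\<bar> \<or> \<bar>Im (w \<tau> + of_int n * \<tau>)\<bar> = \<bar>(real_of_int n + 1 / 2) * Im \<tau>\<bar>"
      using w by (auto simp: algebra_simps)
    ultimately have "(d / 2) * \<bar>real_of_int n\<bar> \<le> \<bar>Im (w \<tau> + of_int n * \<tau>)\<bar>" by (auto simp: mult.commute)
    from csc_term_bound_int[OF _ this n]
    show "norm (of_real pi / sin (of_real pi * (w \<tau> + of_int n * \<tau>))) \<le> 4 * pi * exp (- ((d / 2) * \<bar>real_of_int n\<bar>))"
      using d by simp
  qed (use d in auto)
  then have "(\<lambda>\<tau>. csum \<tau> (w \<tau>)) analytic_on {\<tau>}" if "0 < Im \<tau>" for \<tau>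
    unfolding analytic_at using that op[of "Im \<tau> / 2"] by (intro exI[of _ "{\<tau>'. Im \<tau> / 2 < Im \<tau>'}"]) (simp del: less_divide_eq_numeral1 divide_less_eq_numeral1)
  then show ?thesis by (metis (mono_tags, lifting) analytic_imp_holomorphic analytic_on_analytic_at mem_Collect_eq)
qed

lemma roota_holomorphic: "roota holomorphic_on {\<tau>. 0 < Im \<tau>}"
  unfolding roota_def[abs_def] using csum_holomorphic_param[of "\<lambda>\<tau>. 1 / 2"] by (intro holomorphic_intros) auto

lemma rootb_holomorphic: "rootb holomorphic_on {\<tau>. 0 < Im \<tau>}"
  unfolding rootb_def[abs_def] using csum_holomorphic_param[of "\<lambda>\<tau>. (1 + \<tau>) / 2"] by (intro holomorphic_intros) auto

lemma e_holomorphic: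
  "e1 holomorphic_on {\<tau>. 0 < Im \<tau>}" "e2 holomorphic_on {\<tau>. 0 < Im \<tau>}" "e3 holomorphic_on {\<tau>. 0 < Im \<tau>}"
  unfolding e1_def[abs_def] e2_def[abs_def] e3_def[abs_def]
  by (intro holomorphic_intros roota_holomorphic rootb_holomorphic; simp)+

section \<open>The modular function\<close>

text \<open>Limits along this filter are uniform in the real part; that uniformity confines the
  preimages of bounded values of \<open>jfun\<close> to a bounded height.\<close>

definition cusp :: "complex filter" where "cusp = filtercomap Im at_top"

lemma eventually_cusp: "eventually P cusp \<longleftrightarrow> (\<exists>Y. \<forall>\<tau>. Im \<tau> \<ge> Y \<longrightarrow> P \<tau>)"
  unfolding cusp_def eventually_filtercomap_at_top_linorder ..

lemma cusp_exp: "((\<lambda>\<tau>. exp (- Im \<tau>)) \<longlongrightarrow> 0) cusp"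
proof -
  have "filterlim Im at_top cusp" unfolding cusp_def by (rule filterlim_filtercomap)
  then have "filterlim (\<lambda>\<tau>. - Im \<tau>) at_bot cusp" by (simp add: filterlim_uminus_at_top)
  then show ?thesis by (rule filterlim_compose[OF exp_at_bot])
qed

lemma csum_rest_bound:
  assumes \<tau>: "Im \<tau> \<noteq> 0" and z: "z \<notin> Lat \<tau>" and F: "finite F"
    and b: "\<And>n. n \<notin> F \<Longrightarrow> norm (of_real pi / sin (of_real pi * (z + of_int n * \<tau>))) \<le> C * exp (- \<bar>real_of_int n\<bar>)"
  shows "norm (csum \<tau> z - (\<Sum>n\<in>F. of_real pi / sin (of_real pi * (z + of_int n * \<tau>)))) \<le> C * (\<Sum>\<^sub>\<infinity>n\<in>UNIV. exp (- \<bar>real_of_int n\<bar>))"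
proof -
  let ?t = "\<lambda>n::int. complex_of_real pi / sin (of_real pi * (z + of_int n * \<tau>))"
  have s: "?t summable_on UNIV" by (rule csum_holomorphic(2)[OF \<tau> z])
  have sE: "(\<lambda>n::int. exp (- \<bar>real_of_int n\<bar>)) summable_on UNIV" using summable_exp_abs_int[of 1] by simp
  have sE': "(\<lambda>n::int. exp (- \<bar>real_of_int n\<bar>)) summable_on -F" using sE summable_on_subset_banach by blast
  have C: "0 \<le> C"
  proof -
    obtain n where "n \<notin> F" using F ex_new_if_finite infinite_UNIV_int by metis
    then have "0 \<le> C * exp (- \<bar>real_of_int n\<bar>)" using b[of n] norm_ge_zero order_trans by blast
    then show ?thesis by (simp add: zero_le_mult_iff)
  qed
  have "csum \<tau> z = infsum ?t (F \<union> -F)" by (simp add: csum_def)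
  also have "\<dots> = infsum ?t F + infsum ?t (-F)"
    by (rule infsum_Un_disjoint) (auto intro: summable_on_subset_banach[OF s])
  finally have "csum \<tau> z - sum ?t F = infsum ?t (-F)" using F by simp
  also have "norm \<dots> \<le> infsum (\<lambda>n. C * exp (- \<bar>real_of_int n\<bar>)) (-F)"
    by (rule norm_infsum_le[OF has_sum_infsum has_sum_infsum])
       (use b sE' s in \<open>auto intro: summable_on_subset_banach summable_on_cmult_right\<close>)
  also have "\<dots> = C * infsum (\<lambda>n. exp (- \<bar>real_of_int n\<bar>)) (-F)" by (simp add: infsum_cmult_right')
  also have "\<dots> \<le> C * (\<Sum>\<^sub>\<infinity>n\<in>UNIV. exp (- \<bar>real_of_int n\<bar>))"
    using C sE sE' by (intro mult_left_mono infsum_mono_neutral) auto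
  finally show ?thesis .
qed

text \<open>Only the term n = 0 survives in the limit; it equals \<pi> / sin(\<pi>/2).\<close>

lemma csum_cusp: "((\<lambda>\<tau>. csum \<tau> (1 / 2)) \<longlongrightarrow> of_real pi) cusp"
proof -
  define S where "S = (\<Sum>\<^sub>\<infinity>n::int\<in>UNIV. exp (- \<bar>real_of_int n\<bar>))"
  have "norm (csum \<tau> (1 / 2) - of_real pi) \<le> (4 * pi * S) * exp (- Im \<tau>)" if Y: "Im \<tau> \<ge> 2" for \<tau>
  proof -
    have t: "Im \<tau> \<noteq> 0" using Y by auto
    have b: "norm (of_real pi / sin (of_real pi * (1 / 2 + of_int n * \<tau>))) \<le> (4 * pi * exp (- Im \<tau>)) * exp (- \<bar>real_of_int n\<bar>)" if "n \<notin> {0}" for n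
    proof -
      have n: "1 \<le> \<bar>real_of_int n\<bar>" using that by auto
      have i: "\<bar>Im (1 / 2 + of_int n * \<tau>)\<bar> = \<bar>real_of_int n\<bar> * Im \<tau>" using Y by (simp add: abs_mult)
      have 1: "1 * Im \<tau> \<le> \<bar>real_of_int n\<bar> * Im \<tau>" "\<bar>real_of_int n\<bar> * 1 \<le> \<bar>real_of_int n\<bar> * Im \<tau>" "0 \<le> \<bar>real_of_int n\<bar> * Im \<tau>"
        using n Y by ((intro mult_right_mono mult_left_mono mult_nonneg_nonneg; simp)+)
      have 2: "3 * (\<bar>real_of_int n\<bar> * Im \<tau>) \<le> pi * (\<bar>real_of_int n\<bar> * Im \<tau>)" using pi_gt3 1 by (intro mult_right_mono) auto
      have "norm (of_real pi / sin (of_real pi * (1 / 2 + of_int n * \<tau>))) \<le> 4 * pi * exp (- pi * \<bar>Im (1 / 2 + of_int n * \<tau>)\<bar>)"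
        by (rule csc_term_bound) (use i 1 Y in linarith)
      also have "\<dots> \<le> 4 * pi * exp (- Im \<tau> - \<bar>real_of_int n\<bar>)" unfolding i using 1 2 by (intro mult_left_mono) auto
      also have "\<dots> = (4 * pi * exp (- Im \<tau>)) * exp (- \<bar>real_of_int n\<bar>)" by (simp add: exp_diff exp_minus field_simps)
      finally show ?thesis .
    qed
    have "norm (csum \<tau> (1 / 2) - (\<Sum>n\<in>{0}. of_real pi / sin (of_real pi * (1 / 2 + of_int n * \<tau>)))) \<le> (4 * pi * exp (- Im \<tau>)) * S"
      unfolding S_def by (rule csum_rest_bound[OF t half_not_Lat(1)[OF t] _ b]) auto
    moreover have "sin (complex_of_real pi * (1 / 2)) = 1" using sin_of_real[of "pi / 2"] by simp
    ultimately show ?thesis by (simp add: mult_ac)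
  qed
  then have "\<forall>\<^sub>F \<tau> in cusp. norm (csum \<tau> (1 / 2) - of_real pi) \<le> (4 * pi * S) * exp (- Im \<tau>)"
    unfolding eventually_cusp by blast
  moreover have "((\<lambda>\<tau>. (4 * pi * S) * exp (- Im \<tau>)) \<longlongrightarrow> 0) cusp"
    using tendsto_mult_left[OF cusp_exp, of "4 * pi * S"] by simp
  ultimately have "((\<lambda>\<tau>. csum \<tau> (1 / 2) - of_real pi) \<longlongrightarrow> 0) cusp" by (rule Lim_null_comparison)
  then show ?thesis by (rule LIM_zero_cancel)
qed

text \<open>At (1 + \<tau>)/2 the indices 0 and -1 contribute equal terms, with sum 4 \<pi> u / (1 +
  u^2) for u = exp(\<i> \<pi> \<tau> / 2). All other terms are exponentially smaller than u.\<close>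

lemma csum_cusp': "((\<lambda>\<tau>. csum \<tau> ((1 + \<tau>) / 2) / exp (\<i> * pi * \<tau> / 2)) \<longlongrightarrow> of_real (4 * pi)) cusp"
proof -
  define S where "S = (\<Sum>\<^sub>\<infinity>n::int\<in>UNIV. exp (- \<bar>real_of_int n\<bar>))"
  define u where "u = (\<lambda>\<tau>. exp (\<i> * pi * \<tau> / 2))"
  have nu: "norm (u \<tau>) = exp (- pi * Im \<tau> / 2)" for \<tau> by (simp add: u_def)
  have u0: "u \<tau> \<noteq> 0" for \<tau> by (simp add: u_def)
  have main: "norm (csum \<tau> ((1 + \<tau>) / 2) / u \<tau> - of_real (4 * pi) / (1 + u \<tau> ^ 2)) \<le> (4 * pi * S) * exp (- Im \<tau>)" if Y: "Im \<tau> \<ge> 2" for \<tau>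
  proof -
    have t: "Im \<tau> \<noteq> 0" using Y by auto
    have b: "norm (of_real pi / sin (of_real pi * ((1 + \<tau>) / 2 + of_int n * \<tau>))) \<le> (4 * pi * exp (- pi * Im \<tau> / 2 - Im \<tau>)) * exp (- \<bar>real_of_int n\<bar>)" if "n \<notin> {0, -1}" for n
    proof -
      \<comment> \<open>In |n + 1/2| = x + 1/2 the part 1/2 accounts for the factor u, and x for the
        decay beyond it.\<close>
      define x where "x = \<bar>real_of_int n + 1 / 2\<bar> - 1 / 2"
      have x: "1 \<le> x" "\<bar>real_of_int n\<bar> \<le> 2 * x"
      proof -
        have "n \<ge> 1 \<or> n \<le> -2" using that by auto
        then have "real_of_int n \<ge> 1 \<or> real_of_int n \<le> -2" by linarith
        then show "1 \<le> x" "\<bar>real_of_int n\<bar> \<le> 2 * x" by (auto simp: x_def)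
      qed
      have i: "\<bar>Im ((1 + \<tau>) / 2 + of_int n * \<tau>)\<bar> = (x + 1 / 2) * Im \<tau>"
      proof -
        have "Im ((1 + \<tau>) / 2 + of_int n * \<tau>) = (real_of_int n + 1 / 2) * Im \<tau>" by (simp add: algebra_simps)
        then show ?thesis using Y by (simp add: abs_mult x_def)
      qed
      have 1: "1 * Im \<tau> \<le> x * Im \<tau>" "x * 2 \<le> x * Im \<tau>" "0 \<le> x * Im \<tau>"
        using x Y by ((intro mult_right_mono mult_left_mono mult_nonneg_nonneg; simp)+)
      have 2: "3 * (x * Im \<tau>) \<le> pi * (x * Im \<tau>)" using pi_gt3 1 by (intro mult_right_mono) auto
      have 3: "Im \<tau> + \<bar>real_of_int n\<bar> \<le> pi * (x * Im \<tau>)" using 1 2 x by linarith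
      have "(x + 1 / 2) * Im \<tau> \<ge> 1 / 3" using x Y mult_mono[of 1 "x + 1 / 2" 1 "Im \<tau>"] by linarith
      then have "norm (of_real pi / sin (of_real pi * ((1 + \<tau>) / 2 + of_int n * \<tau>))) \<le> 4 * pi * exp (- pi * \<bar>Im ((1 + \<tau>) / 2 + of_int n * \<tau>)\<bar>)"
        by (intro csc_term_bound) (simp only: i)
      also have "\<dots> \<le> 4 * pi * exp ((- pi * Im \<tau> / 2 - Im \<tau>) + - \<bar>real_of_int n\<bar>)" unfolding i using 3
        by (intro mult_left_mono) (auto simp: algebra_simps)
      also have "\<dots> = (4 * pi * exp (- pi * Im \<tau> / 2 - Im \<tau>)) * exp (- \<bar>real_of_int n\<bar>)" by (simp only: exp_add mult_ac)
      finally show ?thesis .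
    qed
    have r: "norm (csum \<tau> ((1 + \<tau>) / 2) - (\<Sum>n\<in>{0, -1}. of_real pi / sin (of_real pi * ((1 + \<tau>) / 2 + of_int n * \<tau>)))) \<le> (4 * pi * exp (- pi * Im \<tau> / 2 - Im \<tau>)) * S"
      unfolding S_def by (rule csum_rest_bound[OF t half_not_Lat(3)[OF t] _ b]) auto
    have c: "sin (of_real pi * ((1 + \<tau>) / 2)) = (1 + u \<tau> ^ 2) / (2 * u \<tau>)" "sin (of_real pi * ((1 + \<tau>) / 2 - \<tau>)) = (1 + u \<tau> ^ 2) / (2 * u \<tau>)"
    proof -
      have cu: "cos (of_real pi * \<tau> / 2) = (1 + u \<tau> ^ 2) / (2 * u \<tau>)"
        by (simp add: cos_exp_eq u_def exp_minus field_simps power2_eq_square)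
      have E: "of_real pi * ((1 + \<tau>) / 2) = of_real pi / 2 + of_real pi * \<tau> / 2" "of_real pi * ((1 + \<tau>) / 2 - \<tau>) = of_real pi / 2 - of_real pi * \<tau> / 2"
        by (simp_all add: field_simps)
      have sc: "sin (complex_of_real pi / 2) = 1" "cos (complex_of_real pi / 2) = 0"
        using sin_of_real[of "pi / 2"] cos_of_real[of "pi / 2"] by simp_all
      show "sin (of_real pi * ((1 + \<tau>) / 2)) = (1 + u \<tau> ^ 2) / (2 * u \<tau>)" "sin (of_real pi * ((1 + \<tau>) / 2 - \<tau>)) = (1 + u \<tau> ^ 2) / (2 * u \<tau>)"
        unfolding E sin_add sin_diff sc cu by simp_all
    qed
    have s: "(\<Sum>n\<in>{0, -1}. of_real pi / sin (of_real pi * ((1 + \<tau>) / 2 + of_int n * \<tau>))) = of_real (4 * pi) * u \<tau> / (1 + u \<tau> ^ 2)"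
      using c by (simp add: field_simps)
    have "csum \<tau> ((1 + \<tau>) / 2) / u \<tau> - of_real (4 * pi) / (1 + u \<tau> ^ 2) = (csum \<tau> ((1 + \<tau>) / 2) - of_real (4 * pi) * u \<tau> / (1 + u \<tau> ^ 2)) / u \<tau>"
      using u0[of \<tau>] by (simp add: diff_divide_distrib)
    also have "norm \<dots> \<le> ((4 * pi * exp (- pi * Im \<tau> / 2 - Im \<tau>)) * S) / norm (u \<tau>)"
      using r unfolding s norm_divide by (intro divide_right_mono) auto
    also have "\<dots> = (4 * pi * S) * exp (- Im \<tau>)"
    proof -
      have "exp (- pi * Im \<tau> / 2 - Im \<tau>) = exp (- pi * Im \<tau> / 2) * exp (- Im \<tau>)" by (simp flip: exp_add)
      then show ?thesis unfolding nu by simp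
    qed
    finally show ?thesis .
  qed
  have "\<forall>\<^sub>F \<tau> in cusp. norm (csum \<tau> ((1 + \<tau>) / 2) / u \<tau> - of_real (4 * pi) / (1 + u \<tau> ^ 2)) \<le> (4 * pi * S) * exp (- Im \<tau>)"
    unfolding eventually_cusp using main by blast
  moreover have "((\<lambda>\<tau>. (4 * pi * S) * exp (- Im \<tau>)) \<longlongrightarrow> 0) cusp"
    using tendsto_mult_left[OF cusp_exp, of "4 * pi * S"] by simp
  ultimately have 1: "((\<lambda>\<tau>. csum \<tau> ((1 + \<tau>) / 2) / u \<tau> - of_real (4 * pi) / (1 + u \<tau> ^ 2)) \<longlongrightarrow> 0) cusp" by (rule Lim_null_comparison)
  have "(u \<longlongrightarrow> 0) cusp"
  proof (rule Lim_null_comparison[OF _ cusp_exp])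
    have "norm (u \<tau>) \<le> exp (- Im \<tau>)" if "0 \<le> Im \<tau>" for \<tau>
      unfolding nu using that mult_right_mono[of 2 pi "Im \<tau>"] pi_gt3 by simp
    then show "\<forall>\<^sub>F \<tau> in cusp. norm (u \<tau>) \<le> exp (- Im \<tau>)" unfolding eventually_cusp by blast
  qed
  then have "((\<lambda>\<tau>. of_real (4 * pi) / (1 + u \<tau> ^ 2)) \<longlongrightarrow> of_real (4 * pi) / (1 + 0 ^ 2)) cusp"
    by (intro tendsto_intros) auto
  from tendsto_add[OF 1 this] show ?thesis by (simp add: u_def)
qed

lemma roota_cusp: "(roota \<longlongrightarrow> of_real (pi\<^sup>2)) cusp"
  unfolding roota_def[abs_def] using tendsto_power[OF csum_cusp, of 2] by simp

lemma rootb_cusp: "((\<lambda>\<tau>. rootb \<tau> / exp (\<i> * pi * \<tau>)) \<longlongrightarrow> of_real (16 * pi\<^sup>2)) cusp"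
proof -
  have "exp (\<i> * pi * \<tau>) = exp (\<i> * pi * \<tau> / 2) ^ 2" for \<tau> by (simp flip: exp_double)
  then show ?thesis unfolding rootb_def[abs_def] using tendsto_power[OF csum_cusp', of 2]
    by (simp add: power_divide power_mult_distrib)
qed

lemma rootb_cusp_0: "(rootb \<longlongrightarrow> 0) cusp"
proof -
  have "((\<lambda>\<tau>. exp (\<i> * pi * \<tau>)) \<longlongrightarrow> 0) cusp"
  proof (rule Lim_null_comparison[OF _ cusp_exp])
    have "norm (exp (\<i> * pi * \<tau>)) \<le> exp (- Im \<tau>)" if "0 \<le> Im \<tau>" for \<tau>
      using that mult_right_mono[of 1 pi "Im \<tau>"] pi_gt3 by simp
    then show "\<forall>\<^sub>F \<tau> in cusp. norm (exp (\<i> * pi * \<tau>)) \<le> exp (- Im \<tau>)" unfolding eventually_cusp by blast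
  qed
  from tendsto_mult[OF rootb_cusp this] show ?thesis by simp
qed


definition pcoef :: "complex \<Rightarrow> complex" where "pcoef \<tau> = e1 \<tau> * e2 \<tau> + e1 \<tau> * e3 \<tau> + e2 \<tau> * e3 \<tau>"
definition qcoef :: "complex \<Rightarrow> complex" where "qcoef \<tau> = - (e1 \<tau> * e2 \<tau> * e3 \<tau>)"

lemma depressed_disc:
  fixes x y z :: complex
  assumes "x + y + z = 0"
  shows "4 * (x * y + x * z + y * z) ^ 3 + 27 * (- (x * y * z)) ^ 2 = - (((x - y) * (x - z) * (y - z)) ^ 2)"
proof -
  have z: "z = - x - y" using assms by (simp add: eq_neg_iff_add_eq_0 algebra_simps)
  show ?thesis unfolding z by (simp add: power2_eq_square power3_eq_cube algebra_simps)
qed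

lemma vieta_shift:
  assumes "x + y + z = 0"
  shows "vieta (\<alpha> + x) (\<alpha> + y) (\<alpha> + z) =
    (- (3 * \<alpha>), 3 * \<alpha>\<^sup>2 + (x * y + x * z + y * z), - (\<alpha> ^ 3) - \<alpha> * (x * y + x * z + y * z) - x * y * z)"
proof -
  have z: "z = - x - y" using assms by (simp add: eq_neg_iff_add_eq_0 algebra_simps)
  show ?thesis unfolding z vieta_def by (simp add: power2_eq_square power3_eq_cube algebra_simps)
qed

lemma e_sum: "e1 \<tau> + e2 \<tau> + e3 \<tau> = 0" by (simp add: e1_def e2_def e3_def field_simps)

lemma cubic_explicit:
  "cubic (\<alpha>, c, \<tau>) = (- (3 * \<alpha>), 3 * \<alpha>\<^sup>2 + c\<^sup>2 * pcoef \<tau>, - (\<alpha> ^ 3) - \<alpha> * (c\<^sup>2 * pcoef \<tau>) + c ^ 3 * qcoef \<tau>)"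
proof -
  have "c * e1 \<tau> + c * e2 \<tau> + c * e3 \<tau> = 0" using e_sum[of \<tau>] by (simp flip: distrib_left)
  from vieta_shift[OF this] show ?thesis unfolding cubic_eq
    by (simp add: pcoef_def qcoef_def power2_eq_square power3_eq_cube algebra_simps)
qed

lemma disc_nz: "Im \<tau> \<noteq> 0 \<Longrightarrow> 4 * pcoef \<tau> ^ 3 + 27 * qcoef \<tau> ^ 2 \<noteq> 0"
  unfolding pcoef_def qcoef_def depressed_disc[OF e_sum] using e_distinct by simp

text \<open>The j-invariant up to a constant factor: numerator and discriminant have the same
  weight, so rescaling the roots cancels.\<close>

definition jfun :: "complex \<Rightarrow> complex" where
  "jfun \<tau> = pcoef \<tau> ^ 3 / (4 * pcoef \<tau> ^ 3 + 27 * qcoef \<tau> ^ 2)"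

lemma jfun_mact:
  assumes "\<gamma> \<in> SL2" "0 < Im \<tau>"
  shows "jfun (mact \<gamma> \<tau>) = jfun \<tau>"
proof -
  define j where "j = 1 / autf \<gamma> \<tau> ^ 2"
  have j: "j \<noteq> 0" using autf_nz[of \<gamma> \<tau>] assms by (auto simp: j_def)
  have "cubic (0, 1 / autf \<gamma> \<tau> ^ 2, mact \<gamma> \<tau>) = cubic (0, 1, \<tau>)" using cubic_mact[OF assms, of 1 0] by simp
  then have 1: "pcoef \<tau> = j ^ 2 * pcoef (mact \<gamma> \<tau>)" "qcoef \<tau> = j ^ 3 * qcoef (mact \<gamma> \<tau>)"
    unfolding cubic_explicit j_def by simp_all
  have "(j ^ 2 * x) ^ 3 = j ^ 6 * x ^ 3" "(j ^ 3 * x) ^ 2 = j ^ 6 * x ^ 2" for x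
    by (simp_all add: power_mult_distrib flip: power_mult)
  then have "jfun \<tau> = (j ^ 6 * pcoef (mact \<gamma> \<tau>) ^ 3) / (j ^ 6 * (4 * pcoef (mact \<gamma> \<tau>) ^ 3 + 27 * qcoef (mact \<gamma> \<tau>) ^ 2))"
    unfolding jfun_def 1 by (simp add: algebra_simps)
  then show ?thesis using j by (simp add: jfun_def)
qed

lemma jfun_holomorphic: "jfun holomorphic_on {\<tau>. 0 < Im \<tau>}"
  unfolding jfun_def[abs_def] pcoef_def[abs_def] qcoef_def[abs_def]
  using disc_nz by (intro holomorphic_intros e_holomorphic) (auto simp: pcoef_def qcoef_def)

text \<open>At the cusp the roots \<open>e1\<close> and \<open>e2\<close> collide, so the
  discriminant tends to 0 while the coefficient p keeps the nonzero limit -\<pi>^4/3.\<close>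

lemma jfun_cusp: "filterlim jfun at_infinity cusp"
proof -
  have e: "(e1 \<longlongrightarrow> - (of_real (pi\<^sup>2) + 0) / 3) cusp" "(e2 \<longlongrightarrow> (2 * 0 - of_real (pi\<^sup>2)) / 3) cusp" "(e3 \<longlongrightarrow> (2 * of_real (pi\<^sup>2) - 0) / 3) cusp"
    unfolding e1_def[abs_def] e2_def[abs_def] e3_def[abs_def]
    by (intro tendsto_intros roota_cusp rootb_cusp_0; simp)+
  have pp: "(pcoef \<longlongrightarrow> - (of_real pi ^ 4) / 3) cusp" unfolding pcoef_def[abs_def]
    by (rule tendsto_eq_rhs, rule tendsto_add[OF tendsto_add], (rule tendsto_mult e)+) (simp add: field_simps eval_nat_numeral)
  have qq: "(qcoef \<longlongrightarrow> - (2 * of_real pi ^ 6) / 27) cusp" unfolding qcoef_def[abs_def]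
    by (rule tendsto_eq_rhs, rule tendsto_minus, (rule tendsto_mult e)+) (simp add: field_simps eval_nat_numeral)
  have d: "((\<lambda>\<tau>. 4 * pcoef \<tau> ^ 3 + 27 * qcoef \<tau> ^ 2) \<longlongrightarrow> 0) cusp"
    by (rule tendsto_eq_rhs, (rule tendsto_add tendsto_mult tendsto_power tendsto_const pp qq)+) (simp add: field_simps eval_nat_numeral)
  have "\<forall>\<^sub>F \<tau> in cusp. 4 * pcoef \<tau> ^ 3 + 27 * qcoef \<tau> ^ 2 \<noteq> 0"
    unfolding eventually_cusp using disc_nz by (intro exI[of _ 1]) auto
  with d have "filterlim (\<lambda>\<tau>. 4 * pcoef \<tau> ^ 3 + 27 * qcoef \<tau> ^ 2) (at 0) cusp" unfolding filterlim_at by auto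
  moreover have "((\<lambda>\<tau>. pcoef \<tau> ^ 3) \<longlongrightarrow> (- (of_real pi ^ 4) / 3) ^ 3) cusp" by (intro tendsto_power pp)
  ultimately show ?thesis unfolding jfun_def[abs_def]
    by (intro filterlim_divide_at_infinity) auto
qed

text \<open>Choose \<gamma> with the smallest automorphy factor, which exists because only finitely
  many values are at most 1. A translation centres the real part, and minimality against the
  inversion gives modulus at least 1. The height 1/2 is not the best possible; compactness only asks
  for a positive bound.\<close>

lemma reduction:
  assumes \<tau>: "0 < Im \<tau>"
  obtains \<gamma> where "\<gamma> \<in> SL2" "\<bar>Re (mact \<gamma> \<tau>)\<bar> \<le> 1 / 2" "1 / 2 \<le> Im (mact \<gamma> \<tau>)"
proof -
  define A where "A = {norm (autf \<gamma> \<tau>) | \<gamma>. \<gamma> \<in> SL2 \<and> norm (autf \<gamma> \<tau>) \<le> 1}"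
  have one: "(1, 0, 0, 1) \<in> SL2" by (simp add: SL2_def)
  have "finite A"
  proof -
    define B where "B = {c::int. \<bar>real_of_int c\<bar> * Im \<tau> < 2} \<times> {d::int. \<bar>real_of_int d\<bar> * 1 < 2 + 2 / Im \<tau> * norm \<tau>}"
    have "finite B" unfolding B_def using \<tau> by (intro finite_cartesian_product finite_int_bound) auto
    moreover have "A \<subseteq> (\<lambda>(c, d). norm (of_int c * \<tau> + of_int d)) ` B"
    proof
      fix x assume "x \<in> A"
      then obtain a b c d where x: "x = norm (of_int c * \<tau> + of_int d)" "norm (of_int c * \<tau> + of_int d) \<le> 1"
        by (auto simp: A_def autf_def)
      have "\<bar>Im (of_int c * \<tau> + of_int d)\<bar> \<le> 1" using abs_Im_le_cmod x(2) order_trans by blast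
      then have c: "\<bar>real_of_int c\<bar> * Im \<tau> \<le> 1" using \<tau> by (simp add: abs_mult)
      then have c': "\<bar>real_of_int c\<bar> \<le> 2 / Im \<tau>" using \<tau> by (simp add: field_simps)
      have "norm (of_int d :: complex) \<le> norm (of_int c * \<tau> + of_int d) + norm (of_int c * \<tau>)"
        by (metis add_diff_cancel_left' norm_triangle_ineq4 add.commute)
      then have "\<bar>real_of_int d\<bar> \<le> 1 + \<bar>real_of_int c\<bar> * norm \<tau>" using x(2) by (simp add: norm_mult)
      also have "\<dots> \<le> 1 + 2 / Im \<tau> * norm \<tau>" using c' by (intro add_left_mono mult_right_mono) auto
      finally have "(c, d) \<in> B" using c unfolding B_def by simp
      then show "x \<in> (\<lambda>(c, d). norm (of_int c * \<tau> + of_int d)) ` B" using x(1) by (intro image_eqI[of _ _ "(c, d)"]) simp_all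
    qed
    ultimately show ?thesis using finite_surj by blast
  qed
  moreover have "A \<noteq> {}" unfolding A_def using one autf_one[of \<tau>] by (metis (mono_tags, lifting) empty_iff mem_Collect_eq norm_one order_refl)
  ultimately have M: "Min A \<in> A" "\<And>x. x \<in> A \<Longrightarrow> Min A \<le> x" by auto
  from M(1) obtain \<gamma> where g: "\<gamma> \<in> SL2" "norm (autf \<gamma> \<tau>) \<le> 1" and gm: "Min A = norm (autf \<gamma> \<tau>)"
    unfolding A_def by blast
  have min: "norm (autf \<gamma> \<tau>) \<le> norm (autf \<delta> \<tau>)" if "\<delta> \<in> SL2" for \<delta>
  proof (cases "norm (autf \<delta> \<tau>) \<le> 1")
    case True
    then have "norm (autf \<delta> \<tau>) \<in> A" using that unfolding A_def by blast
    then show ?thesis using M(2) gm by simp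
  qed (use g in auto)
  define n where "n = - round (Re (mact \<gamma> \<tau>))"
  have T: "(1, n, 0, 1) \<in> SL2" by (simp add: SL2_def)
  define \<delta> where "\<delta> = mmul (1, n, 0, 1) \<gamma>"
  have d: "\<delta> \<in> SL2" unfolding \<delta>_def by (rule mmul_SL2[OF T g(1)])
  have md: "mact \<delta> \<tau> = mact \<gamma> \<tau> + of_int n" unfolding \<delta>_def mact_mmul[OF T g(1) \<tau>] by (simp add: mact_def)
  have ad: "autf \<delta> \<tau> = autf \<gamma> \<tau>" unfolding \<delta>_def using autf_mmul[OF g(1), of \<tau> "(1, n, 0, 1)"] \<tau> by (simp add: autf_def)
  have re: "\<bar>Re (mact \<delta> \<tau>)\<bar> \<le> 1 / 2"
    unfolding md n_def using of_int_round_abs_le[of "Re (mact \<gamma> \<tau>)"] by (simp add: abs_minus_commute)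
  have S: "(0, -1, 1, 0) \<in> SL2" by (simp add: SL2_def)
  have "autf (mmul (0, -1, 1, 0) \<delta>) \<tau> = mact \<delta> \<tau> * autf \<gamma> \<tau>"
    using autf_mmul[OF d, of \<tau> "(0, -1, 1, 0)"] \<tau> ad by (simp add: autf_def)
  then have "norm (autf \<gamma> \<tau>) \<le> norm (mact \<delta> \<tau>) * norm (autf \<gamma> \<tau>)"
    using min[OF mmul_SL2[OF S d]] by (simp add: norm_mult)
  then have "1 \<le> norm (mact \<delta> \<tau>)" using autf_nz[OF g(1), of \<tau>] \<tau> by simp
  then have "1 \<le> norm (mact \<delta> \<tau>) ^ 2" by simp
  then have "1 \<le> Re (mact \<delta> \<tau>) ^ 2 + Im (mact \<delta> \<tau>) ^ 2" by (simp add: cmod_power2)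
  moreover have "Re (mact \<delta> \<tau>) ^ 2 \<le> (1 / 2) ^ 2" using re by (metis abs_le_square_iff abs_of_nonneg zero_le_divide_1_iff zero_le_numeral)
  ultimately have "(1 / 2) ^ 2 \<le> Im (mact \<delta> \<tau>) ^ 2" by (simp add: power2_eq_square)
  then have "1 / 2 \<le> Im (mact \<delta> \<tau>)" using Im_mact_pos[OF d \<tau>] power2_le_imp_le less_imp_le by blast
  then show ?thesis using that d re by blast
qed

text \<open>The image is open by the open mapping theorem. It is closed because a point with bounded
  value can be reduced into a fixed compact box, \<open>jfun\<close> being large above it.\<close>

lemma jfun_surj: "\<exists>\<tau>. 0 < Im \<tau> \<and> jfun \<tau> = w"
proof -
  let ?H = "{\<tau>. 0 < Im \<tau>}"
  have oH: "open ?H" by (intro open_Collect_less continuous_intros)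
  have cH: "connected ?H" by (rule convex_connected) (rule convex_halfspace_Im_gt)
  have big: "\<exists>Y>0. \<forall>\<tau>. Y \<le> Im \<tau> \<longrightarrow> M < norm (jfun \<tau>)" for M
  proof -
    have "\<forall>\<^sub>F \<tau> in cusp. M + 1 \<le> norm (jfun \<tau>)" using jfun_cusp
      by (metis (mono_tags, lifting) eventually_mono filterlim_at_infinity[of 0] order_refl filterlim_at_infinity_imp_norm_at_top filterlim_at_top)
    then obtain Y where "\<And>\<tau>. Y \<le> Im \<tau> \<Longrightarrow> M + 1 \<le> norm (jfun \<tau>)" unfolding eventually_cusp by blast
    then show ?thesis by (intro exI[of _ "max 1 Y"]) (force simp: less_le_trans)
  qed
  have nc: "\<not> jfun constant_on ?H"
  proof
    assume "jfun constant_on ?H"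
    then obtain c where c: "\<And>\<tau>. 0 < Im \<tau> \<Longrightarrow> jfun \<tau> = c" by (auto simp: constant_on_def)
    obtain Y where "Y > 0" "\<And>\<tau>. Y \<le> Im \<tau> \<Longrightarrow> norm c < norm (jfun \<tau>)" using big by blast
    from this(2)[of "\<i> * of_real Y"] c[of "\<i> * of_real Y"] this(1) show False by simp
  qed
  have op: "open (jfun ` ?H)" by (rule open_mapping_thm[OF jfun_holomorphic oH cH oH order_refl nc])
  have "closed (jfun ` ?H)"
  proof -
    have "w \<in> jfun ` ?H" if w: "w \<in> closure (jfun ` ?H)" for w
    proof -
      define M where "M = norm w + 1"
      obtain Y where Y: "Y > 0" "\<And>\<tau>. Y \<le> Im \<tau> \<Longrightarrow> M < norm (jfun \<tau>)" using big by blast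
      define Q where "Q = cbox (Complex (- 1 / 2) (1 / 2)) (Complex (1 / 2) Y)"
      have QH: "Q \<subseteq> ?H" by (auto simp: Q_def in_cbox_complex_iff)
      have "compact (jfun ` Q)" unfolding Q_def
        by (rule compact_continuous_image[OF holomorphic_on_imp_continuous_on[OF holomorphic_on_subset[OF jfun_holomorphic]] compact_cbox])
           (use QH in \<open>simp add: Q_def\<close>)
      then have cl: "closed (jfun ` Q)" by (rule compact_imp_closed)
      have sub: "ball 0 M \<inter> jfun ` ?H \<subseteq> jfun ` Q"
      proof
        fix v assume "v \<in> ball 0 M \<inter> jfun ` ?H"
        then obtain \<tau> where t: "0 < Im \<tau>" "v = jfun \<tau>" "norm v < M" by auto
        obtain \<gamma> where g: "\<gamma> \<in> SL2" "\<bar>Re (mact \<gamma> \<tau>)\<bar> \<le> 1 / 2" "1 / 2 \<le> Im (mact \<gamma> \<tau>)" using reduction[OF t(1)] .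
        have v: "v = jfun (mact \<gamma> \<tau>)" using jfun_mact[OF g(1) t(1)] t(2) by simp
        have "Im (mact \<gamma> \<tau>) \<le> Y" using Y(2)[of "mact \<gamma> \<tau>"] v t(3) by force
        then have "mact \<gamma> \<tau> \<in> Q" using g by (auto simp: Q_def in_cbox_complex_iff)
        then show "v \<in> jfun ` Q" using v by blast
      qed
      have "w \<in> ball 0 M \<inter> closure (jfun ` ?H)" using w by (auto simp: M_def)
      then have "w \<in> closure (ball 0 M \<inter> jfun ` ?H)" using open_Int_closure_subset[OF open_ball] by blast
      then have "w \<in> jfun ` Q" using closure_minimal[OF sub cl] by blast
      then show ?thesis using QH by blast
    qed
    then have "closure (jfun ` ?H) \<subseteq> jfun ` ?H" by (rule subsetI)
    then show ?thesis by (simp only: closure_subset_eq)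
  qed
  with op have "jfun ` ?H = {} \<or> jfun ` ?H = UNIV" using clopen[of "jfun ` ?H"] by simp
  moreover have "jfun \<i> \<in> jfun ` ?H" by (rule imageI) simp
  ultimately have "jfun ` ?H = UNIV" by blast
  then show ?thesis by (metis (mono_tags, lifting) UNIV_I imageE mem_Collect_eq)
qed

text \<open>Since p and q have the coprime weights 2 and 3, the scale is the ratio of the q's
  divided by the ratio of the p's. If one coefficient vanishes, a cube root or a square root takes
  over.\<close>

lemma proportional_cubics:
  fixes p0 q0 p1 q1 :: complex
  assumes "4 * p0 ^ 3 + 27 * q0 ^ 2 \<noteq> 0" "4 * p1 ^ 3 + 27 * q1 ^ 2 \<noteq> 0"
    and eq: "p0 ^ 3 * q1 ^ 2 = p1 ^ 3 * q0 ^ 2"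
  obtains c where "c \<noteq> 0" "p0 = c\<^sup>2 * p1" "q0 = c ^ 3 * q1"
proof -
  consider "p0 \<noteq> 0" "q0 \<noteq> 0" | "p0 = 0" "q0 \<noteq> 0" | "p0 \<noteq> 0" "q0 = 0" using assms(1) by fastforce
  then show ?thesis
  proof cases
    case 1
    then have nz: "p1 \<noteq> 0" "q1 \<noteq> 0" using eq assms(2) by auto
    define c where "c = q0 * p1 / (q1 * p0)"
    have "c\<^sup>2 * p1 = p0" "c ^ 3 * q1 = q0"
    proof -
      have "c\<^sup>2 * p1 = (p1 ^ 3 * q0 ^ 2) / (q1 ^ 2 * p0 ^ 2)" by (simp add: c_def power_divide power_mult_distrib eval_nat_numeral mult_ac)
      then show "c\<^sup>2 * p1 = p0" unfolding eq[symmetric] using 1 nz by (simp add: eval_nat_numeral)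
      have "c ^ 3 * q1 = q0 * (p1 ^ 3 * q0 ^ 2) / (q1 ^ 2 * p0 ^ 3)" using nz by (simp add: c_def power_divide power_mult_distrib eval_nat_numeral mult_ac)
      then show "c ^ 3 * q1 = q0" unfolding eq[symmetric] using 1 nz by (simp add: eval_nat_numeral)
    qed
    moreover have "c \<noteq> 0" using 1 nz by (simp add: c_def)
    ultimately show ?thesis using that by metis
  next
    case 2
    have "p1 = 0" using eq 2 by simp
    then have "q1 \<noteq> 0" using assms(2) by simp
    define c where "c = exp (Ln (q0 / q1) / 3)"
    have "c ^ 3 = exp (3 * (Ln (q0 / q1) / 3))" unfolding c_def by (subst exp_of_nat_mult[symmetric]) simp
    then have "c ^ 3 = q0 / q1" using 2 \<open>q1 \<noteq> 0\<close> by simp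
    moreover have "c \<noteq> 0" by (simp add: c_def)
    ultimately show ?thesis using that[of c] 2(1) \<open>p1 = 0\<close> \<open>q1 \<noteq> 0\<close> by simp
  next
    case 3
    have "q1 = 0" using eq 3 by simp
    then have "p1 \<noteq> 0" using assms(2) by auto
    moreover note \<open>q1 = 0\<close>
    ultimately show ?thesis using that[of "csqrt (p0 / p1)"] 3 by simp
  qed
qed

theorem cubic_surj:
  assumes "x \<in> Conf3"
  obtains \<alpha> c \<tau> where "c \<noteq> 0" "0 < Im \<tau>" "x = cubic (\<alpha>, c, \<tau>)"
proof -
  obtain z1 z2 z3 where x: "x = vieta z1 z2 z3" "z1 \<noteq> z2" "z1 \<noteq> z3" "z2 \<noteq> z3"
    using assms by (auto simp: Conf3_def)
  define \<alpha> where "\<alpha> = (z1 + z2 + z3) / 3"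
  define u1 u2 u3 where "u1 = z1 - \<alpha>" and "u2 = z2 - \<alpha>" and "u3 = z3 - \<alpha>"
  have s: "u1 + u2 + u3 = 0" by (simp add: u1_def u2_def u3_def \<alpha>_def field_simps)
  define p0 q0 where "p0 = u1 * u2 + u1 * u3 + u2 * u3" and "q0 = - (u1 * u2 * u3)"
  have d0: "4 * p0 ^ 3 + 27 * q0 ^ 2 \<noteq> 0"
    unfolding p0_def q0_def depressed_disc[OF s] using x by (simp add: u1_def u2_def u3_def)
  obtain \<tau> where t: "0 < Im \<tau>" "jfun \<tau> = p0 ^ 3 / (4 * p0 ^ 3 + 27 * q0 ^ 2)" using jfun_surj by blast
  have d1: "4 * pcoef \<tau> ^ 3 + 27 * qcoef \<tau> ^ 2 \<noteq> 0" using disc_nz t(1) by auto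
  have "pcoef \<tau> ^ 3 * (4 * p0 ^ 3 + 27 * q0 ^ 2) = p0 ^ 3 * (4 * pcoef \<tau> ^ 3 + 27 * qcoef \<tau> ^ 2)"
    using t(2) d0 d1 unfolding jfun_def by (simp add: frac_eq_eq)
  then have "p0 ^ 3 * qcoef \<tau> ^ 2 = pcoef \<tau> ^ 3 * q0 ^ 2" by (simp add: algebra_simps)
  from proportional_cubics[OF d0 d1 this] obtain c where c: "c \<noteq> 0" "p0 = c\<^sup>2 * pcoef \<tau>" "q0 = c ^ 3 * qcoef \<tau>" by blast
  have "x = vieta (\<alpha> + u1) (\<alpha> + u2) (\<alpha> + u3)" by (simp add: x u1_def u2_def u3_def)
  also have "\<dots> = (- (3 * \<alpha>), 3 * \<alpha>\<^sup>2 + p0, - (\<alpha> ^ 3) - \<alpha> * p0 + q0)"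
    unfolding vieta_shift[OF s] by (simp add: p0_def q0_def)
  also have "\<dots> = cubic (\<alpha>, c, \<tau>)" unfolding cubic_explicit c ..
  finally show ?thesis using that c(1) t(1) by blast
qed

section \<open>The covering of the configuration space\<close>

definition Xs :: "cfg set" where "Xs = {x. fst (snd x) \<noteq> 0 \<and> 0 < Im (snd (snd x))}"

definition act :: "mat \<Rightarrow> cfg \<Rightarrow> cfg" where
  "act \<gamma> x = (fst x, fst (snd x) / autf \<gamma> (snd (snd x)) ^ 2, mact \<gamma> (snd (snd x)))"

lemma continuous_on_coefs:
  "continuous_on {\<tau>. 0 < Im \<tau>} pcoef" "continuous_on {\<tau>. 0 < Im \<tau>} qcoef"
  unfolding pcoef_def[abs_def] qcoef_def[abs_def]
  using e_holomorphic[THEN holomorphic_on_imp_continuous_on] by (intro continuous_intros; simp)+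

lemma continuous_on_cubic: "continuous_on Xs cubic"
proof -
  have p: "continuous_on Xs (\<lambda>x. pcoef (snd (snd x)))" "continuous_on Xs (\<lambda>x. qcoef (snd (snd x)))"
    by (rule continuous_on_compose2[OF continuous_on_coefs(1)] continuous_on_compose2[OF continuous_on_coefs(2)];
        auto intro!: continuous_intros simp: Xs_def)+
  have "cubic x = (- (3 * fst x), 3 * fst x ^ 2 + fst (snd x) ^ 2 * pcoef (snd (snd x)),
     - (fst x ^ 3) - fst x * (fst (snd x) ^ 2 * pcoef (snd (snd x))) + fst (snd x) ^ 3 * qcoef (snd (snd x)))" for x
    using cubic_explicit[of "fst x" "fst (snd x)" "snd (snd x)"] by simp
  then show ?thesis using p by (subst continuous_on_cong[OF refl]) (auto intro!: continuous_intros)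
qed

lemma act_Xs: "\<gamma> \<in> SL2 \<Longrightarrow> x \<in> Xs \<Longrightarrow> act \<gamma> x \<in> Xs"
  using autf_nz[of \<gamma> "snd (snd x)"] Im_mact_pos[of \<gamma> "snd (snd x)"] by (simp add: Xs_def act_def)

lemma cubic_act: "\<gamma> \<in> SL2 \<Longrightarrow> x \<in> Xs \<Longrightarrow> cubic (act \<gamma> x) = cubic x"
  using cubic_mact[of \<gamma> "snd (snd x)" "fst (snd x)" "fst x"] by (simp add: Xs_def act_def)

lemma act_mmul: "\<gamma> \<in> SL2 \<Longrightarrow> \<delta> \<in> SL2 \<Longrightarrow> x \<in> Xs \<Longrightarrow> act (mmul \<gamma> \<delta>) x = act \<gamma> (act \<delta> x)"
  using mact_mmul[of \<gamma> \<delta> "snd (snd x)"] autf_mmul[of \<delta> "snd (snd x)" \<gamma>]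
  by (simp add: Xs_def act_def power_mult_distrib mult.commute)

lemma act_one [simp]: "act (1, 0, 0, 1) x = x" by (simp add: act_def)

lemma act_inv: "\<gamma> \<in> SL2 \<Longrightarrow> x \<in> Xs \<Longrightarrow> act (minv \<gamma>) (act \<gamma> x) = x" "\<gamma> \<in> SL2 \<Longrightarrow> x \<in> Xs \<Longrightarrow> act \<gamma> (act (minv \<gamma>) x) = x"
  using act_mmul[of "minv \<gamma>" \<gamma> x] act_mmul[of \<gamma> "minv \<gamma>" x] minv_SL2[of \<gamma>] mmul_minv[of \<gamma>] by auto

lemma continuous_autf: "continuous_on A (autf \<gamma>)"
  by (cases \<gamma>) (auto simp: autf_def intro!: continuous_intros)

lemma continuous_mact: "\<gamma> \<in> SL2 \<Longrightarrow> continuous_on {\<tau>. 0 < Im \<tau>} (mact \<gamma>)"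
proof -
  assume g: "\<gamma> \<in> SL2"
  obtain a b c d where \<gamma>: "\<gamma> = (a, b, c, d)" by (metis prod_cases4)
  have "of_int c * \<tau> + of_int d \<noteq> 0" if "0 < Im \<tau>" for \<tau>
    using autf_nz[OF g, of \<tau>] that by (auto simp: \<gamma> autf_def)
  then show ?thesis by (auto simp: \<gamma> mact_def intro!: continuous_intros)
qed

lemma continuous_act: "\<gamma> \<in> SL2 \<Longrightarrow> continuous_on Xs (act \<gamma>)"
proof -
  assume g: "\<gamma> \<in> SL2"
  have 1: "continuous_on Xs (\<lambda>x. autf \<gamma> (snd (snd x)))"
    by (rule continuous_on_compose2[OF continuous_autf[of UNIV]]) (auto intro!: continuous_intros)
  have 2: "continuous_on Xs (\<lambda>x. mact \<gamma> (snd (snd x)))"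
    by (rule continuous_on_compose2[OF continuous_mact[OF g]]) (auto intro!: continuous_intros simp: Xs_def)
  have "autf \<gamma> (snd (snd x)) \<noteq> 0" if "x \<in> Xs" for x using autf_nz[OF g] that by (auto simp: Xs_def)
  then show ?thesis unfolding act_def[abs_def] using 1 2 by (intro continuous_intros) auto
qed

lemma inj_act: "\<gamma> \<in> SL2 \<Longrightarrow> inj_on (act \<gamma>) Xs"
  by (rule inj_on_inverseI[of _ "act (minv \<gamma>)"]) (rule act_inv)

lemma cubic_fibre_act:
  assumes "x \<in> Xs" "y \<in> Xs" "cubic x = cubic y"
  obtains \<gamma> where "\<gamma> \<in> SL2" "y = act \<gamma> x"
proof -
  obtain \<alpha> c \<tau> \<alpha>' c' \<tau>' where xy: "x = (\<alpha>, c, \<tau>)" "y = (\<alpha>', c', \<tau>')" by (metis prod_cases3)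
  then have "0 < Im \<tau>" "0 < Im \<tau>'" "c \<noteq> 0" "c' \<noteq> 0" "cubic (\<alpha>, c, \<tau>) = cubic (\<alpha>', c', \<tau>')" using assms by (auto simp: Xs_def)
  from cubic_fibre[OF this] obtain \<gamma> where "\<gamma> \<in> SL2" "\<alpha>' = \<alpha>" "\<tau>' = mact \<gamma> \<tau>" "c' = c / autf \<gamma> \<tau> ^ 2" .
  then show ?thesis using that xy by (simp add: act_def)
qed

lemma cubic_image: "cubic ` Xs = Conf3"
proof
  show "cubic ` Xs \<subseteq> Conf3" using cubic_in_Conf3 by (auto simp: Xs_def)
  show "Conf3 \<subseteq> cubic ` Xs"
  proof
    fix x assume "x \<in> Conf3"
    from cubic_surj[OF this] obtain \<alpha> c \<tau> where "c \<noteq> 0" "0 < Im \<tau>" "x = cubic (\<alpha>, c, \<tau>)" .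
    then show "x \<in> cubic ` Xs" by (intro image_eqI[of _ _ "(\<alpha>, c, \<tau>)"]) (auto simp: Xs_def)
  qed
qed

text \<open>A scale that moves little forces the square of the automorphy factor to be close to 1,
  hence the factor close to 1 or -1, hence the lower left entry to vanish. A displacement of \<tau>
  by less than 1 then excludes translations. Only 1 and -1 remain, and both act trivially.\<close>

lemma act_wandering:
  assumes x0: "x0 \<in> Xs"
  obtains V where "open V" "x0 \<in> V" "V \<subseteq> Xs"
    "\<And>\<gamma> x y. \<gamma> \<in> SL2 \<Longrightarrow> x \<in> V \<Longrightarrow> act \<gamma> x \<in> V \<Longrightarrow> act \<gamma> y = y"
proof -
  obtain \<alpha>0 c0 \<tau>0 where x0e: "x0 = (\<alpha>0, c0, \<tau>0)" by (metis prod_cases3)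
  have c0: "c0 \<noteq> 0" and t0: "0 < Im \<tau>0" using x0 by (auto simp: x0e Xs_def)
  \<comment> \<open>The half of Im \<tau>0 turns the estimate |c| Im \<tau> < m for the integer c
    into c = 0.\<close>
  define m where "m = min (1 / 2) (Im \<tau>0 / 2)"
  have m: "0 < m" "m \<le> 1 / 2" "m \<le> Im \<tau>0 / 2" using t0 by (auto simp: m_def)
  define \<eta> where "\<eta> = m ^ 2"
  have eta: "0 < \<eta>" "\<eta> \<le> 1 / 4"
    using m power_mono[of m "1 / 2" 2] by (auto simp: \<eta>_def power2_eq_square)
  \<comment> \<open>Two scales within r |c0| of c0 then differ by less than \<eta> times either of
    them, because 2 r <= \<eta> (1 - r).\<close>
  define r where "r = \<eta> / 4"
  define \<epsilon> where "\<epsilon> = min (1 / 4) (Im \<tau>0 / 2)"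
  define V where "V = (UNIV :: complex set) \<times> ball c0 (r * norm c0) \<times> ball \<tau>0 \<epsilon>"
  have V1: "open V" unfolding V_def by (intro open_Times) auto
  have V2: "x0 \<in> V" using c0 t0 eta by (auto simp: V_def x0e r_def \<epsilon>_def)
  have Vt: "Im \<tau>0 / 2 < Im \<tau>" if "\<tau> \<in> ball \<tau>0 \<epsilon>" for \<tau>
  proof -
    have "\<bar>Im (\<tau>0 - \<tau>)\<bar> < Im \<tau>0 / 2" using that abs_Im_le_cmod[of "\<tau>0 - \<tau>"] by (auto simp: dist_norm \<epsilon>_def)
    then show ?thesis unfolding minus_complex.sel by linarith
  qed
  have Vc: "(1 - r) * norm c0 < norm c" if "c \<in> ball c0 (r * norm c0)" for c
    using that norm_triangle_ineq2[of c0 c] by (simp add: dist_norm algebra_simps)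
  have V3: "V \<subseteq> Xs"
  proof
    fix x assume "x \<in> V"
    then have "fst (snd x) \<in> ball c0 (r * norm c0)" "snd (snd x) \<in> ball \<tau>0 \<epsilon>" by (auto simp: V_def)
    from Vc[OF this(1)] Vt[OF this(2)] show "x \<in> Xs" using eta c0 t0 by (auto simp: Xs_def r_def mult_less_0_iff)
  qed
  have "act \<gamma> y = y" if g: "\<gamma> \<in> SL2" and x: "x \<in> V" and gx: "act \<gamma> x \<in> V" for \<gamma> x y
  proof -
    obtain a b c d where \<gamma>: "\<gamma> = (a, b, c, d)" by (metis prod_cases4)
    have dt: "a * d - b * c = 1" using g by (simp add: \<gamma> SL2_def)
    obtain \<alpha> k \<tau> where xe: "x = (\<alpha>, k, \<tau>)" by (metis prod_cases3)
    define s where "s = autf \<gamma> \<tau>"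
    have t: "\<tau> \<in> ball \<tau>0 \<epsilon>" "mact \<gamma> \<tau> \<in> ball \<tau>0 \<epsilon>" and k: "k \<in> ball c0 (r * norm c0)" "k / s ^ 2 \<in> ball c0 (r * norm c0)"
      using x gx by (auto simp: xe V_def act_def s_def)
    have s0: "s \<noteq> 0" using autf_nz[OF g, of \<tau>] Vt[OF t(1)] t0 by (auto simp: s_def)
    have k0: "k \<noteq> 0" using Vc[OF k(1)] eta c0 by (auto simp: r_def mult_less_0_iff)
    define k' where "k' = k / s ^ 2"
    have "norm (k - k') \<le> norm (c0 - k') + norm (c0 - k)" using norm_triangle_ineq4[of "c0 - k'" "c0 - k"] by simp
    also have "\<dots> < 2 * (r * norm c0)" using k by (simp add: dist_norm k'_def)
    also have "\<dots> \<le> \<eta> * ((1 - r) * norm c0)"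
    proof -
      have "2 * r \<le> \<eta> * (1 - r)" using eta by (simp add: r_def field_simps)
      then show ?thesis using mult_right_mono[of "2 * r" "\<eta> * (1 - r)" "norm c0"] by simp
    qed
    also have "\<dots> \<le> \<eta> * norm k'" using Vc[OF k(2)] eta by (intro mult_left_mono) (auto simp: k'_def)
    finally have "norm (k - k') < \<eta> * norm k'" .
    moreover have "k - k' = (s ^ 2 - 1) * k'" using s0 by (simp add: k'_def field_simps)
    moreover have "k' \<noteq> 0" using k0 s0 by (simp add: k'_def)
    ultimately have "norm (s ^ 2 - 1) < \<eta>" by (simp add: norm_mult)
    then have ss: "norm (s - 1) * norm (s + 1) < m * m"
      by (simp add: \<eta>_def norm_mult[symmetric] power2_eq_square algebra_simps)
    have "norm (s - 1) < m \<or> norm (s + 1) < m"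
    proof (rule ccontr)
      assume "\<not> ?thesis"
      then have "m * m \<le> norm (s - 1) * norm (s + 1)" using m by (intro mult_mono) auto
      then show False using ss by simp
    qed
    then obtain e :: real where e: "e = 1 \<or> e = -1" "norm (s - of_real e) < m" by force
    have "\<bar>real_of_int c\<bar> * Im \<tau> < m"
      using abs_Im_le_cmod[of "s - of_real e"] e(2) Vt[OF t(1)] t0 by (simp add: s_def \<gamma> autf_def abs_mult)
    also have "\<dots> < 1 * Im \<tau>" using m Vt[OF t(1)] by simp
    finally have "\<bar>real_of_int c\<bar> < 1" using Vt[OF t(1)] t0 by (simp add: mult_less_cancel_right)
    then have c: "c = 0" by linarith
    then have "a * d = 1" using dt by simp
    then have ad: "a = 1 \<and> d = 1 \<or> a = -1 \<and> d = -1" using zmult_eq_1_iff by blast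
    have "mact \<gamma> \<tau> - \<tau> = of_int (a * b)" using ad c by (auto simp: \<gamma> mact_def)
    moreover have "norm (mact \<gamma> \<tau> - \<tau>) \<le> norm (\<tau>0 - \<tau>) + norm (\<tau>0 - mact \<gamma> \<tau>)"
      using norm_triangle_ineq4[of "\<tau>0 - \<tau>" "\<tau>0 - mact \<gamma> \<tau>"] by simp
    moreover have "\<dots> < 1" using t by (simp add: dist_norm \<epsilon>_def)
    ultimately have "\<bar>real_of_int (a * b)\<bar> < 1" by (metis norm_of_int order_le_less_trans)
    then have "b = 0" using ad by auto
    then show ?thesis using ad c by (auto simp: \<gamma> act_def autf_def mact_def)
  qed
  then show ?thesis using that V1 V2 V3 by blast
qed

text \<open>Sheets and their images are open by invariance of domain, the dimensions being equal.
  The sheets form a set of images and not a family, so that \<gamma> and -\<gamma> contribute the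
  same sheet.\<close>

theorem covering_cubic: "covering_space Xs cubic Conf3"
proof (rule covering_spaceI[OF continuous_on_cubic cubic_image])
  fix y assume "y \<in> Conf3"
  then obtain x0 where x0: "x0 \<in> Xs" "y = cubic x0" using cubic_image by blast
  obtain V where V: "open V" "x0 \<in> V" "V \<subseteq> Xs"
    and wand: "\<And>\<gamma> x y. \<gamma> \<in> SL2 \<Longrightarrow> x \<in> V \<Longrightarrow> act \<gamma> x \<in> V \<Longrightarrow> act \<gamma> y = y"
    using act_wandering[OF x0(1)] by metis
  have inj: "inj_on cubic V"
  proof (rule inj_onI)
    fix x y assume xy: "x \<in> V" "y \<in> V" "cubic x = cubic y"
    then obtain \<gamma> where "\<gamma> \<in> SL2" "y = act \<gamma> x" using cubic_fibre_act V(3) by (metis subsetD)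
    then show "x = y" using wand[of \<gamma> x x] xy by simp
  qed
  define T where "T = cubic ` V"
  have oT: "open T" unfolding T_def using invariance_of_domain[OF continuous_on_subset[OF continuous_on_cubic V(3)] V(1) inj] .
  have TC: "T \<subseteq> Conf3" using V(3) cubic_image by (auto simp: T_def)
  define v where "v = (\<lambda>\<gamma>. act \<gamma> ` V) ` SL2"
  have sub: "act \<gamma> ` V \<subseteq> Xs" if "\<gamma> \<in> SL2" for \<gamma> using act_Xs[OF that] V(3) by blast
  have opn: "open (act \<gamma> ` V)" if "\<gamma> \<in> SL2" for \<gamma>
    using invariance_of_domain[OF continuous_on_subset[OF continuous_act[OF that] V(3)] V(1) inj_on_subset[OF inj_act[OF that] V(3)]] .
  have img: "cubic ` (act \<gamma> ` V) = T" if "\<gamma> \<in> SL2" for \<gamma>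
    unfolding T_def image_image using cubic_act[OF that] V(3) by (intro image_cong) auto
  have inj': "inj_on cubic (act \<gamma> ` V)" if "\<gamma> \<in> SL2" for \<gamma>
  proof (rule inj_onI)
    fix a b assume "a \<in> act \<gamma> ` V" "b \<in> act \<gamma> ` V" "cubic a = cubic b"
    then obtain x z where "x \<in> V" "z \<in> V" "a = act \<gamma> x" "b = act \<gamma> z" by blast
    moreover from this have "x \<in> Xs" "z \<in> Xs" using V(3) by blast+
    moreover from calculation have "cubic x = cubic z" using cubic_act[OF \<open>\<gamma> \<in> SL2\<close>, of x] cubic_act[OF \<open>\<gamma> \<in> SL2\<close>, of z] V(3) \<open>cubic a = cubic b\<close> by auto
    ultimately show "a = b" using inj by (metis inj_onD)
  qed
  have U: "\<Union> v = Xs \<inter> cubic -` T"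
  proof (intro equalityI subsetI)
    fix x assume "x \<in> \<Union> v"
    then show "x \<in> Xs \<inter> cubic -` T" using sub img unfolding v_def by blast
  next
    fix x assume "x \<in> Xs \<inter> cubic -` T"
    then obtain z where z: "z \<in> V" "cubic z = cubic x" "x \<in> Xs" by (auto simp: T_def)
    then obtain \<gamma> where "\<gamma> \<in> SL2" "x = act \<gamma> z" using cubic_fibre_act V(3) by (metis subsetD)
    then show "x \<in> \<Union> v" using z(1) unfolding v_def by blast
  qed
  have dis: "pairwise disjnt v"
  proof (rule pairwiseI)
    fix A B assume AB: "A \<in> v" "B \<in> v" "A \<noteq> B"
    then obtain \<gamma> \<delta> where gd: "\<gamma> \<in> SL2" "\<delta> \<in> SL2" "A = act \<gamma> ` V" "B = act \<delta> ` V" unfolding v_def by blast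
    show "disjnt A B"
    proof (rule ccontr)
      assume "\<not> disjnt A B"
      then obtain x z where xz: "x \<in> V" "z \<in> V" "act \<gamma> x = act \<delta> z" unfolding gd disjnt_iff by blast
      then have "cubic x = cubic z" using cubic_act gd V(3) by (metis subsetD)
      then have "x = z" using inj xz by (metis inj_onD)
      define \<mu> where "\<mu> = mmul (minv \<delta>) \<gamma>"
      have mu: "\<mu> \<in> SL2" unfolding \<mu>_def using gd mmul_SL2 minv_SL2 by blast
      have e: "act \<mu> w = act (minv \<delta>) (act \<gamma> w)" if "w \<in> Xs" for w
        unfolding \<mu>_def using act_mmul[OF minv_SL2 _ that] gd by blast
      have "act \<mu> x = x" using e[of x] xz \<open>x = z\<close> act_inv(1)[OF gd(2), of z] V(3) by auto
      then have "act \<mu> w = w" for w using wand[OF mu xz(1)] xz(1) by simp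
      then have "act \<gamma> w = act \<delta> w" if "w \<in> V" for w
        using e[of w] act_inv(2)[OF gd(2), of "act \<gamma> w"] act_Xs[OF gd(1), of w] that V(3) by (metis subsetD)
      then have "A = B" unfolding gd by (intro image_cong) auto
      then show False using AB by simp
    qed
  qed
  show "\<exists>T. y \<in> T \<and> openin (top_of_set Conf3) T \<and>
      (\<exists>v. \<Union> v = Xs \<inter> cubic -` T \<and> (\<forall>u\<in>v. openin (top_of_set Xs) u) \<and> pairwise disjnt v \<and> (\<forall>u\<in>v. \<exists>q. homeomorphism u T cubic q))"
  proof (intro exI[of _ T] conjI exI[of _ v] ballI)
    show "y \<in> T" using x0 V(2) by (simp add: T_def)
    show "openin (top_of_set Conf3) T" using oT TC by (simp add: open_subset)
    show "\<Union> v = Xs \<inter> cubic -` T" by (rule U)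
    show "pairwise disjnt v" by (rule dis)
    fix u assume "u \<in> v"
    then obtain \<gamma> where g: "\<gamma> \<in> SL2" "u = act \<gamma> ` V" unfolding v_def by blast
    show "openin (top_of_set Xs) u" using opn[OF g(1)] sub[OF g(1)] g(2) by (simp add: open_subset)
    obtain h where "homeomorphism u (cubic ` u) cubic h"
      using invariance_of_domain_homeomorphism[of u cubic] opn[OF g(1)] continuous_on_subset[OF continuous_on_cubic sub[OF g(1)]] inj'[OF g(1)] g(2)
      by (metis order_refl)
    then show "\<exists>q. homeomorphism u T cubic q" using img[OF g(1)] g(2) by auto
  qed
qed


section \<open>Real configurations and the imaginary half-axis\<close>

lemma csum_cnj: "csum (cnj \<tau>) (cnj z) = cnj (csum \<tau> z)"
proof -
  have "cnj (complex_of_real pi / sin (of_real pi * (z + of_int n * \<tau>))) = of_real pi / sin (of_real pi * (cnj z + of_int n * cnj \<tau>))" for n :: int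
    by (simp add: cnj_sin)
  then show ?thesis unfolding csum_def by (simp flip: infsum_cnj)
qed

lemma csum_uminus_gen: "csum (- \<tau>) z = csum \<tau> z"
proof -
  have b: "bij_betw (\<lambda>n::int. - n) UNIV UNIV" by (rule bij_betwI[of _ _ _ "\<lambda>n. - n"]) auto
  have "csum \<tau> z = (\<Sum>\<^sub>\<infinity>n::int. of_real pi / sin (of_real pi * (z + of_int (- n) * \<tau>)))"
    unfolding csum_def by (rule infsum_reindex_bij_betw[OF b, symmetric])
  then show ?thesis by (simp add: csum_def)
qed

lemma csum_gen_add_2: "csum (\<tau> + 2) z = csum \<tau> z"
proof -
  have "sin (complex_of_real pi * (z + of_int n * (\<tau> + 2))) = sin (complex_of_real pi * (z + of_int n * \<tau>))" for n :: int
  proof -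
    have "complex_of_real pi * (z + of_int n * (\<tau> + 2)) = complex_of_real pi * (z + of_int n * \<tau>) + of_real (2 * pi * of_int n)"
      by (simp add: algebra_simps)
    moreover have "sin (complex_of_real (2 * pi * of_int n)) = 0" "cos (complex_of_real (2 * pi * of_int n)) = 1"
      unfolding sin_of_real cos_of_real using sin_integer_2pi[of "of_int n"] cos_integer_2pi[of "of_int n"] by auto
    ultimately show ?thesis by (simp add: sin_add)
  qed
  then show ?thesis unfolding csum_def by simp
qed

lemma cnj_sq_real: "cnj z = z \<Longrightarrow> z ^ 2 \<noteq> 0 \<Longrightarrow> \<exists>r>0. z ^ 2 = complex_of_real r"
proof -
  assume "cnj z = z" "z ^ 2 \<noteq> 0"
  then have "z = of_real (Re z)" by (simp add: complex_eq_iff)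
  then have z: "z ^ 2 = of_real (Re z ^ 2)" by (metis of_real_power)
  moreover have "Re z \<noteq> 0" using \<open>z ^ 2 \<noteq> 0\<close> z by auto
  ultimately show ?thesis by (intro exI[of _ "Re z ^ 2"]) auto
qed

text \<open>The lattice of a purely imaginary \<tau> is invariant under conjugation. The relevant
  series values are fixed by it, hence real, and their nonzero squares are positive: A and B come
  from \<open>csum\<close>, and A - B from \<open>csum3\<close>.\<close>

lemma roots_imaginary:
  assumes y: "0 < y"
  obtains A B where "0 < B" "B < A" "roota (\<i> * of_real y) = of_real A" "rootb (\<i> * of_real y) = of_real B"
proof -
  define \<tau> where "\<tau> = \<i> * complex_of_real y"
  have t: "Im \<tau> \<noteq> 0" using y by (simp add: \<tau>_def)
  have cn: "cnj \<tau> = - \<tau>" by (simp add: \<tau>_def)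
  note d = roots_distinct[OF t]
  have "cnj (csum \<tau> (1 / 2)) = csum \<tau> (1 / 2)"
    unfolding csum_cnj[symmetric] cn csum_uminus_gen by simp
  then obtain A where A: "roota \<tau> = of_real A" "A > 0" using cnj_sq_real d unfolding roota_def by blast
  have "cnj (csum \<tau> ((1 + \<tau>) / 2)) = csum \<tau> ((1 - \<tau>) / 2)"
    unfolding csum_cnj[symmetric] cn csum_uminus_gen by (simp add: cn)
  also have "\<dots> = csum \<tau> ((1 - \<tau>) / 2 + \<tau>)" by (rule csum_add_gen[symmetric])
  also have "(1 - \<tau>) / 2 + \<tau> = (1 + \<tau>) / 2" by (simp add: field_simps)
  finally obtain B where B: "rootb \<tau> = of_real B" "B > 0" using cnj_sq_real d unfolding rootb_def by blast
  have "cnj (csum3 \<tau> (1 / 2)) = csum (1 - \<tau>) (1 / 2)"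
    unfolding csum3_def csum_cnj[symmetric] by (simp add: cn)
  \<comment> \<open>The conjugate of 1 + \<tau> is its negative shifted by 2, and the series is
    unchanged by either operation on the second period.\<close>
  also have "1 - \<tau> = - (1 + \<tau>) + 2" by simp
  also have "csum (- (1 + \<tau>) + 2) (1 / 2) = csum3 \<tau> (1 / 2)" unfolding csum_gen_add_2 csum_uminus_gen csum3_def ..
  finally have c3: "cnj (csum3 \<tau> (1 / 2)) = csum3 \<tau> (1 / 2)" .
  have s3: "csum3 \<tau> (1 / 2) ^ 2 = roota \<tau> - rootb \<tau>"
    using csum_sq_diff(2)[OF t half_not_Lat(1)[OF t]] by (simp add: roota_def)
  then obtain r where r: "r > 0" "roota \<tau> - rootb \<tau> = of_real r" using cnj_sq_real[OF c3] d by auto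
  have "r = A - B" using r(2) A B by (metis of_real_diff of_real_eq_iff)
  then show ?thesis using that A B r(1) by (simp add: \<tau>_def)
qed

text \<open>The modular lambda function on the half-axis; geometrically, the relative position of
  the middle point between the outer two.\<close>

definition lamf :: "real \<Rightarrow> real" where "lamf y = Re (rootb (\<i> * of_real y) / roota (\<i> * of_real y))"

lemma three_sets_real:
  fixes p r A B k :: real
  assumes "{0, - p, - r} = {k, A + k, B + k}" "0 < B" "B < A" "0 < r" "r < p"
  shows "p = A" "r = A - B"
proof -
  have "Max {0, - p, - r} = 0" "Max {k, A + k, B + k} = A + k" "Min {0, - p, - r} = - p" "Min {k, A + k, B + k} = k"
    using assms(2-) by auto
  then have k: "k = - p" "A = p" using assms(1) by auto
  then show "p = A" by simp
  have "- r \<in> {k, A + k, B + k}" using assms(1) by blast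
  then show "r = A - B" using assms(2-) k by auto
qed

text \<open>The inversion has a negative squared automorphy factor on the half-axis, so it reverses
  the order of the three real roots and reflects the middle position.\<close>

lemma lamf_inverse: assumes y: "0 < y" shows "lamf (1 / y) = 1 - lamf y"
proof -
  define \<tau> where "\<tau> = \<i> * complex_of_real y"
  obtain A B where AB: "0 < B" "B < A" "roota (\<i> * of_real y) = of_real A" "rootb (\<i> * of_real y) = of_real B"
    using roots_imaginary[OF y] by blast
  obtain A' B' where AB': "0 < B'" "B' < A'" "roota (\<i> * of_real (1 / y)) = of_real A'" "rootb (\<i> * of_real (1 / y)) = of_real B'"
    using roots_imaginary[of "1 / y"] y by (metis zero_less_divide_1_iff)
  have S: "(0, -1, 1, 0) \<in> SL2" by (simp add: SL2_def)
  have m: "mact (0, -1, 1, 0) \<tau> = \<i> * of_real (1 / y)" using y by (simp add: mact_def \<tau>_def field_simps)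
  have j: "autf (0, -1, 1, 0) \<tau> ^ 2 = - of_real (y ^ 2)" by (simp add: autf_def \<tau>_def power_mult_distrib)
  have t: "0 < Im \<tau>" using y by (simp add: \<tau>_def)
  from roots_mact[OF S t] obtain \<kappa> where
    k0: "(\<lambda>v. v / autf (0, -1, 1, 0) \<tau> ^ 2) ` {0, roota (mact (0, -1, 1, 0) \<tau>), rootb (mact (0, -1, 1, 0) \<tau>)} = (\<lambda>v. v + \<kappa>) ` {0, roota \<tau>, rootb \<tau>}" by blast
  note AB\<tau> = AB(3,4)[folded \<tau>_def]
  have "(\<lambda>v. v / (- of_real (y ^ 2))) ` {0, of_real A', of_real B'} = (\<lambda>v. v + \<kappa>) ` {0, of_real A, of_real B}"
    using k0 unfolding m j AB' AB\<tau> .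
  then have k': "{0, - of_real (A' / y ^ 2), - of_real (B' / y ^ 2)} = {\<kappa>, of_real A + \<kappa>, of_real B + \<kappa>}" by simp
  have "\<kappa> \<in> {0, - of_real (A' / y ^ 2), - of_real (B' / y ^ 2)}" unfolding k' by simp
  then have kr: "\<kappa> = of_real (Re \<kappa>)" by auto
  have "Re ` {0, - of_real (A' / y ^ 2), - of_real (B' / y ^ 2)} = Re ` {\<kappa>, of_real A + \<kappa>, of_real B + \<kappa>}" unfolding k' ..
  then have "{0, - (A' / y ^ 2), - (B' / y ^ 2)} = {Re \<kappa>, A + Re \<kappa>, B + Re \<kappa>}" by simp
  from three_sets_real[OF this] AB AB' y have "A' / y ^ 2 = A" "B' / y ^ 2 = A - B" by (auto simp: divide_strict_right_mono)
  then have "A' = A * y ^ 2" "B' = (A - B) * y ^ 2" using y by (auto simp: field_simps)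
  then show ?thesis using AB AB' y by (simp add: lamf_def field_simps flip: of_real_divide)
qed

lemma lamf_one: "lamf 1 = 1 / 2" using lamf_inverse[of 1] by simp

lemma lamf_continuous: "continuous_on {0<..} lamf"
proof -
  have a: "continuous_on {0<..} (\<lambda>y. roota (\<i> * complex_of_real y))" "continuous_on {0<..} (\<lambda>y. rootb (\<i> * complex_of_real y))"
    by (rule continuous_on_compose2[OF holomorphic_on_imp_continuous_on[OF roota_holomorphic]]
          continuous_on_compose2[OF holomorphic_on_imp_continuous_on[OF rootb_holomorphic]];
        auto intro!: continuous_intros)+
  have "roota (\<i> * complex_of_real y) \<noteq> 0" if "0 < y" for y using roots_distinct[of "\<i> * of_real y"] that by auto
  then show ?thesis unfolding lamf_def[abs_def] using a by (intro continuous_intros) auto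
qed

lemma lamf_small: assumes "0 < e" obtains y where "1 \<le> y" "lamf y < e"
proof -
  have "((\<lambda>\<tau>. rootb \<tau> / roota \<tau>) \<longlongrightarrow> 0 / of_real (pi\<^sup>2)) cusp" by (intro tendsto_divide rootb_cusp_0 roota_cusp) simp
  then have "\<forall>\<^sub>F \<tau> in cusp. norm (rootb \<tau> / roota \<tau>) < e" using assms by (auto simp: tendsto_iff dist_norm)
  then obtain Y where Y: "\<And>\<tau>. Y \<le> Im \<tau> \<Longrightarrow> norm (rootb \<tau> / roota \<tau>) < e" unfolding eventually_cusp by blast
  have "lamf (max 1 Y) < e" unfolding lamf_def
    by (rule le_less_trans[OF complex_Re_le_cmod]) (rule Y, simp)
  then show ?thesis using that[of "max 1 Y"] by simp
qed

text \<open>The function is small for some large y, and near 1 at the inverse of such a y;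
  continuity supplies the values between.\<close>

lemma lamf_surj: assumes "0 < m" "m < 1" obtains y where "0 < y" "lamf y = m"
proof -
  obtain y1 where y1: "1 \<le> y1" "lamf y1 < m" using lamf_small assms by blast
  obtain y2 where y2: "1 \<le> y2" "lamf y2 < 1 - m" using lamf_small[of "1 - m"] assms by auto
  have 2: "m < lamf (1 / y2)" using lamf_inverse[of y2] y2 by simp
  have "\<exists>y\<ge>1 / y2. y \<le> y1 \<and> lamf y = m"
  proof (rule IVT2')
    show "1 / y2 \<le> y1" using y1 y2 by (simp add: divide_le_eq) (metis mult_mono' mult_1 zero_le_one order_trans)
    show "continuous_on {1 / y2..y1} lamf" by (rule continuous_on_subset[OF lamf_continuous]) (use y2 in \<open>auto simp: less_le_trans[of 0 "1 / y2"]\<close>)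
  qed (use y1 2 in auto)
  then obtain y where "1 / y2 \<le> y" "lamf y = m" by blast
  moreover have "0 < 1 / y2" using y2 by simp
  ultimately have "0 < y" by linarith
  then show ?thesis using that \<open>lamf y = m\<close> by blast
qed

text \<open>One sheet over the real configurations: positivity of the scale distinguishes it from
  its image under the inversion, which has the same half-axis but negative scale.\<close>

definition E0 :: "cfg set" where
  "E0 = {(of_real \<alpha>, of_real c, \<i> * of_real y) | \<alpha> c y. 0 < c \<and> 0 < y}"

lemma E0_Xs: "E0 \<subseteq> Xs" by (auto simp: E0_def Xs_def)

lemma cubic_E0:
  assumes "0 < c" "0 < y"
  obtains x1 x2 x3 where "x1 < x2" "x2 < x3" "cubic (of_real \<alpha>, of_real c, \<i> * of_real y) = vieta (of_real x1) (of_real x2) (of_real x3)"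
proof -
  obtain A B where AB: "0 < B" "B < A" "roota (\<i> * of_real y) = of_real A" "rootb (\<i> * of_real y) = of_real B"
    using roots_imaginary[OF assms(2)] by blast
  have "c * (- (A + B) / 3) < c * ((2 * B - A) / 3)" "c * ((2 * B - A) / 3) < c * ((2 * A - B) / 3)"
    using AB assms by (intro mult_strict_left_mono; simp)+
  then show ?thesis
    by (intro that[of "\<alpha> + c * (- (A + B) / 3)" "\<alpha> + c * ((2 * B - A) / 3)" "\<alpha> + c * ((2 * A - B) / 3)"])
       (simp_all add: cubic_eq e1_def e2_def e3_def AB)
qed

lemma cubic_E0_Etr: "x \<in> E0 \<Longrightarrow> cubic x \<in> Etr"
proof -
  assume "x \<in> E0"
  then obtain \<alpha> c y where x: "x = (of_real \<alpha>, of_real c, \<i> * of_real y)" "0 < c" "0 < y" by (auto simp: E0_def)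
  obtain x1 x2 x3 where "x1 < x2" "x2 < x3" "cubic x = vieta (of_real x1) (of_real x2) (of_real x3)"
    unfolding x(1) using cubic_E0[OF x(2,3)] by blast
  then show ?thesis unfolding Etr_def by (metis (mono_tags, lifting) less_irrefl mem_Collect_eq order.strict_trans)
qed

lemma Etr_sorted:
  assumes "p \<in> Etr"
  obtains x1 x2 x3 where "x1 < x2" "x2 < x3" "p = vieta (of_real x1) (of_real x2) (of_real x3)"
proof -
  obtain a b c where p: "p = vieta (of_real a) (of_real b) (of_real c)" "a \<noteq> b" "a \<noteq> c" "b \<noteq> c"
    using assms by (auto simp: Etr_def)
  consider "a < b" "b < c" | "a < c" "c < b" | "b < a" "a < c" | "b < c" "c < a" | "c < a" "a < b" | "c < b" "b < a"
    using p(2-4) by linarith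
  then show ?thesis
  proof cases
    case 1 then show ?thesis using that[of a b c] p by simp
  next
    case 2 then show ?thesis using that[of a c b] p by (simp add: vieta_def algebra_simps)
  next
    case 3 then show ?thesis using that[of b a c] p by (simp add: vieta_def algebra_simps)
  next
    case 4 then show ?thesis using that[of b c a] p by (simp add: vieta_def algebra_simps)
  next
    case 5 then show ?thesis using that[of c a b] p by (simp add: vieta_def algebra_simps)
  next
    case 6 then show ?thesis using that[of c b a] p by (simp add: vieta_def algebra_simps)
  qed
qed

lemma Etr_E0: "p \<in> Etr \<Longrightarrow> \<exists>x\<in>E0. cubic x = p"
proof -
  assume "p \<in> Etr"
  then obtain x1 x2 x3 where x: "x1 < x2" "x2 < x3" "p = vieta (of_real x1) (of_real x2) (of_real x3)" by (rule Etr_sorted)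
  obtain y where y: "0 < y" "lamf y = (x2 - x1) / (x3 - x1)" using lamf_surj[of "(x2 - x1) / (x3 - x1)"] x by auto
  obtain A B where AB: "0 < B" "B < A" "roota (\<i> * of_real y) = of_real A" "rootb (\<i> * of_real y) = of_real B"
    using roots_imaginary[OF y(1)] by blast
  define c where "c = (x3 - x1) / A"
  have "lamf y = B / A" by (simp add: lamf_def AB flip: of_real_divide)
  then have cB: "c * B = x2 - x1" and cA: "c * A = x3 - x1" using y(2) AB x by (simp_all add: c_def field_simps)
  define \<alpha> where "\<alpha> = (x1 + x2 + x3) / 3"
  have "\<alpha> + c * (- (A + B) / 3) = x1" "\<alpha> + c * ((2 * B - A) / 3) = x2" "\<alpha> + c * ((2 * A - B) / 3) = x3"
    using cA cB unfolding \<alpha>_def by (simp_all add: field_simps)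
  then have E: "complex_of_real (\<alpha> + c * (- (A + B) / 3)) = of_real x1" "complex_of_real (\<alpha> + c * ((2 * B - A) / 3)) = of_real x2"
    "complex_of_real (\<alpha> + c * ((2 * A - B) / 3)) = of_real x3" by simp_all
  have "cubic (of_real \<alpha>, of_real c, \<i> * of_real y) = p"
    unfolding cubic_eq e1_def e2_def e3_def AB x(3) unfolding E[symmetric] by simp
  moreover have "0 < c" using AB x by (simp add: c_def)
  then have "(of_real \<alpha>, of_real c, \<i> * of_real y) \<in> E0" using y(1) unfolding E0_def by blast
  ultimately show ?thesis by blast
qed

text \<open>Two positive scales make the square of the automorphy factor c \<i> y + d positive. Then
  c d = 0, and d = 0 would make the square negative; so c = 0, and the real part of the image
  excludes translations.\<close>

lemma cubic_inj_E0: "inj_on cubic E0"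
proof (rule inj_onI)
  fix u v assume uv: "u \<in> E0" "v \<in> E0" "cubic u = cubic v"
  then obtain \<alpha> k y \<alpha>' k' y' where e: "u = (of_real \<alpha>, of_real k, \<i> * of_real y)" "0 < k" "0 < y"
    "v = (of_real \<alpha>', of_real k', \<i> * of_real y')" "0 < k'" "0 < y'" by (auto simp: E0_def)
  obtain \<gamma> where g: "\<gamma> \<in> SL2" "v = act \<gamma> u" using cubic_fibre_act uv E0_Xs by blast
  obtain a b c d where \<gamma>: "\<gamma> = (a, b, c, d)" by (metis prod_cases4)
  have dt: "a * d - b * c = 1" using g by (simp add: \<gamma> SL2_def)
  define s where "s = of_int c * (\<i> * complex_of_real y) + of_int d"
  have s0: "s \<noteq> 0" using autf_nz[OF g(1), of "\<i> * complex_of_real y"] e by (simp add: s_def \<gamma> autf_def)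
  have "of_real k' = of_real k / s ^ 2" using g(2) by (simp add: e act_def \<gamma> autf_def s_def)
  then have "s ^ 2 = of_real (k / k')" using e s0 by (simp add: field_simps)
  then have "Re (s ^ 2) > 0" "Im (s ^ 2) = 0" using e by simp_all
  then have 1: "of_int d * of_int d - (of_int c * y) * (of_int c * y) > 0" "(of_int c * y) * of_int d = 0"
    by (auto simp: s_def power2_eq_square)
  have c: "c = 0"
  proof (rule ccontr)
    assume "c \<noteq> 0"
    then have "d = 0" using 1(2) e(3) by simp
    then show False using 1(1) zero_le_square[of "of_int c * y"] by simp
  qed
  then have "a * d = 1" using dt by simp
  then have ad: "a = 1 \<and> d = 1 \<or> a = -1 \<and> d = -1" using zmult_eq_1_iff by blast
  have "\<i> * of_real y' = mact \<gamma> (\<i> * of_real y)" using g(2) by (simp add: e act_def)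
  then have "Re (mact \<gamma> (\<i> * of_real y)) = Re (\<i> * of_real y')" by simp
  then have "Re (mact \<gamma> (\<i> * of_real y)) = 0" by simp
  then have "b = 0" using ad c by (auto simp: \<gamma> mact_def)
  then show "u = v" using g(2) ad c by (auto simp: \<gamma> act_def autf_def mact_def)
qed

text \<open>This section plays the part of the simple connectedness of \<open>Etr\<close>: paths in
  \<open>Etr\<close> are lifted by composing with it. In real coordinates the restriction of
  \<open>cubic\<close> is a continuous injection of an open subset of real 3-space into real
  3-space, so its inverse is continuous by invariance of domain.\<close>

theorem Etr_section:
  obtains s where "continuous_on Etr s" "\<And>p. p \<in> Etr \<Longrightarrow> s p \<in> E0 \<and> cubic (s p) = p" "\<And>x. x \<in> E0 \<Longrightarrow> s (cubic x) = x"
proof -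
  define S where "S = {x :: real \<times> real \<times> real. 0 < fst (snd x) \<and> 0 < snd (snd x)}"
  define i where "i = (\<lambda>x :: real \<times> real \<times> real. (complex_of_real (fst x), complex_of_real (fst (snd x)), \<i> * complex_of_real (snd (snd x))))"
  define R where "R = (\<lambda>p :: cfg. (Re (fst p), Re (fst (snd p)), Re (snd (snd p))))"
  define \<Psi> where "\<Psi> = (\<lambda>x. R (cubic (i x)))"
  have iS: "i ` S = E0" unfolding i_def S_def E0_def by (force simp: image_iff)
  have oS: "open S"
  proof -
    have "open {x :: real \<times> real \<times> real. 0 < fst (snd x)}" "open {x :: real \<times> real \<times> real. 0 < snd (snd x)}"
      by (intro open_Collect_less continuous_intros)+
    then have "open ({x :: real \<times> real \<times> real. 0 < fst (snd x)} \<inter> {x. 0 < snd (snd x)})" by (rule open_Int)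
    then show ?thesis by (simp add: S_def Collect_conj_eq)
  qed
  have cont_i: "continuous_on A i" for A unfolding i_def by (intro continuous_intros)
  have cont_R: "continuous_on A R" for A unfolding R_def by (intro continuous_intros)
  have c\<Psi>: "continuous_on S \<Psi>" unfolding \<Psi>_def
    by (intro continuous_on_compose2[OF cont_R[of UNIV]] continuous_on_compose2[OF continuous_on_cubic cont_i]) (use iS E0_Xs in auto)
  have R_inj: "p = q'" if "p \<in> Etr" "q' \<in> Etr" "R p = R q'" for p q'
  proof -
    have "Im (fst p) = 0 \<and> Im (fst (snd p)) = 0 \<and> Im (snd (snd p)) = 0" if p: "p \<in> Etr" for p
    proof -
      obtain a b c where "p = vieta (of_real a) (of_real b) (of_real c)" using p by (auto simp: Etr_def)
      then show ?thesis by (simp add: vieta_def)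
    qed
    from this[OF that(1)] this[OF that(2)] that(3) show ?thesis by (simp add: R_def prod_eq_iff complex_eq_iff)
  qed
  have inj_i: "inj i" by (auto simp: inj_def i_def)
  have inj: "inj_on \<Psi> S"
  proof (rule inj_onI)
    fix x y assume xy: "x \<in> S" "y \<in> S" "\<Psi> x = \<Psi> y"
    then have "cubic (i x) = cubic (i y)" using R_inj cubic_E0_Etr iS unfolding \<Psi>_def by blast
    then have "i x = i y" using cubic_inj_E0 xy iS by (metis imageI inj_onD)
    then show "x = y" using inj_i by (metis injD)
  qed
  obtain g where g: "homeomorphism S (\<Psi> ` S) \<Psi> g"
    using invariance_of_domain_homeomorphism[OF oS c\<Psi> _ inj] by auto
  define s where "s = (\<lambda>p. i (g (R p)))"
  have RE: "R ` Etr = \<Psi> ` S"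
  proof -
    have E: "Etr = cubic ` i ` S" unfolding iS using Etr_E0 cubic_E0_Etr by blast
    show ?thesis unfolding E \<Psi>_def image_image ..
  qed
  have s2: "s (cubic x) = x" if x: "x \<in> E0" for x
  proof -
    obtain v where v: "v \<in> S" "x = i v" using iS x by blast
    then have "g (R (cubic x)) = v" using g unfolding homeomorphism_def \<Psi>_def by auto
    then show ?thesis using v by (simp add: s_def)
  qed
  show ?thesis
  proof (rule that[of s])
    show "continuous_on Etr s" unfolding s_def
      by (rule continuous_on_compose2[OF cont_i[of UNIV]], rule continuous_on_compose2[OF _ cont_R])
         (use g RE in \<open>auto simp: homeomorphism_def\<close>)
    show "s p \<in> E0 \<and> cubic (s p) = p" if "p \<in> Etr" for p
      using Etr_E0[OF that] s2 by metis
  qed (rule s2)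
qed

section \<open>Monodromy of braid words\<close>

text \<open>Passing to the logarithm of the scale makes the covering space convex, so two lifted
  paths with common end points are always homotopic.\<close>

definition Xu :: "cfg set" where "Xu = {x. 0 < Im (snd (snd x))}"
definition expc :: "cfg \<Rightarrow> cfg" where "expc x = (fst x, exp (fst (snd x)), snd (snd x))"
definition cubu :: "cfg \<Rightarrow> cfg" where "cubu x = cubic (expc x)"

lemma convex_Xu: "convex Xu"
proof -
  have "linear (\<lambda>x :: cfg. snd (snd x))" by (intro linearI) auto
  then have "convex ((\<lambda>x :: cfg. snd (snd x)) -` {z. 0 < Im z})" by (intro convex_linear_vimage convex_halfspace_Im_gt)
  then show ?thesis by (simp add: Xu_def vimage_def)
qed

lemma expc_Xs: "x \<in> Xu \<Longrightarrow> expc x \<in> Xs" by (simp add: Xu_def Xs_def expc_def)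

lemma continuous_expc: "continuous_on A expc" unfolding expc_def[abs_def] by (intro continuous_intros)

lemma continuous_cubu: "continuous_on Xu cubu"
  unfolding cubu_def[abs_def] by (rule continuous_on_compose2[OF continuous_on_cubic continuous_expc]) (auto intro: expc_Xs)

lemma cubu_Conf3: "x \<in> Xu \<Longrightarrow> cubu x \<in> Conf3" using expc_Xs cubic_image unfolding cubu_def by blast

lemma homotopic_cubu:
  assumes "path g" "path h" "path_image g \<subseteq> Xu" "path_image h \<subseteq> Xu" "pathstart g = pathstart h" "pathfinish g = pathfinish h"
  shows "homotopic_paths Conf3 (cubu \<circ> g) (cubu \<circ> h)"
proof -
  have "simply_connected Xu" by (rule convex_imp_simply_connected[OF convex_Xu])
  then have "homotopic_paths Xu g h" using assms unfolding simply_connected_eq_homotopic_paths by metis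
  then show ?thesis by (rule homotopic_paths_continuous_image[OF _ continuous_cubu]) (auto intro: cubu_Conf3)
qed

text \<open>A lift of \<open>act \<gamma>\<close> to the logarithmic coordinates; \<kappa> selects
  the branch and has to be a multiple of 2 \<pi> \<i>.\<close>

definition tl :: "mat \<Rightarrow> complex \<Rightarrow> cfg \<Rightarrow> cfg" where
  "tl \<gamma> \<kappa> x = (fst x, fst (snd x) - 2 * Ln (autf \<gamma> (snd (snd x))) + \<kappa>, mact \<gamma> (snd (snd x)))"

text \<open>On the upper half-plane the automorphy factor is either constant or never real, so the
  principal logarithm does not jump.\<close>

lemma continuous_Ln_autf:
  assumes "\<gamma> \<in> SL2" shows "continuous_on {\<tau>. 0 < Im \<tau>} (\<lambda>\<tau>. Ln (autf \<gamma> \<tau>))"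
proof -
  obtain a b c d where \<gamma>: "\<gamma> = (a, b, c, d)" by (metis prod_cases4)
  show ?thesis
  proof (cases "c = 0")
    case True
    then show ?thesis by (simp add: \<gamma> autf_def)
  next
    case False
    have "of_int c * \<tau> + of_int d \<notin> \<real>\<^sub>\<le>\<^sub>0" if "0 < Im \<tau>" for \<tau>
      using False that by (auto simp: complex_nonpos_Reals_iff)
    then show ?thesis by (auto simp: \<gamma> autf_def intro!: continuous_intros)
  qed
qed

lemma continuous_tl: "\<gamma> \<in> SL2 \<Longrightarrow> continuous_on Xu (tl \<gamma> \<kappa>)"
  unfolding tl_def[abs_def]
  by (intro continuous_intros continuous_on_compose2[OF continuous_Ln_autf] continuous_on_compose2[OF continuous_mact])
     (auto simp: Xu_def)

lemma tl_Xu: "\<gamma> \<in> SL2 \<Longrightarrow> x \<in> Xu \<Longrightarrow> tl \<gamma> \<kappa> x \<in> Xu"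
  using Im_mact_pos[of \<gamma> "snd (snd x)"] by (simp add: Xu_def tl_def)

lemma exp_2_Ln: "z \<noteq> 0 \<Longrightarrow> exp (2 * Ln z) = z ^ 2" by (simp add: exp_double)

lemma expc_tl:
  assumes "\<gamma> \<in> SL2" "x \<in> Xu" "exp \<kappa> = 1"
  shows "expc (tl \<gamma> \<kappa> x) = act \<gamma> (expc x)"
  using autf_nz[OF assms(1), of "snd (snd x)"] assms(2,3)
  by (simp add: expc_def tl_def act_def exp_add exp_diff exp_2_Ln Xu_def)

lemma cubu_tl: "\<gamma> \<in> SL2 \<Longrightarrow> x \<in> Xu \<Longrightarrow> exp \<kappa> = 1 \<Longrightarrow> cubu (tl \<gamma> \<kappa> x) = cubu x"
  unfolding cubu_def by (simp add: expc_tl cubic_act expc_Xs)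

text \<open>The square lattice carries the base configuration: lambda is 1/2 at \<open>\<i>\<close>,
  which puts the middle point halfway, and the scale is chosen such that the outer points are at
  distance 2.\<close>

definition c0 :: real where "c0 = 2 / Re (roota \<i>)"
definition x0 :: cfg where "x0 = (2, of_real (ln c0), \<i>)"

lemma roots_i: obtains A where "0 < A" "roota \<i> = of_real A" "rootb \<i> = of_real (A / 2)" "c0 = 2 / A"
proof -
  obtain A B where AB: "0 < B" "B < A" "roota (\<i> * of_real 1) = of_real A" "rootb (\<i> * of_real 1) = of_real B"
    using roots_imaginary[of 1] by (metis zero_less_one)
  have "B / A = 1 / 2" using lamf_one AB by (simp add: lamf_def flip: of_real_divide)
  then have "B = A / 2" using AB by (simp add: field_simps)
  show ?thesis by (rule that[of A]) (use AB \<open>B = A / 2\<close> in \<open>auto simp: c0_def\<close>)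
qed

lemma c0_pos: "0 < c0" using roots_i by (metis divide_pos_pos zero_less_numeral)

lemma c0_e: "2 + of_real c0 * e1 \<i> = 1" "2 + of_real c0 * e2 \<i> = 2" "2 + of_real c0 * e3 \<i> = 3"
proof -
  obtain A where A: "0 < A" "roota \<i> = of_real A" "rootb \<i> = of_real (A / 2)" "c0 = 2 / A" by (rule roots_i)
  then have "c0 * A = 2" by (simp add: field_simps)
  then have k: "complex_of_real c0 * of_real A = 2" by (metis of_real_mult of_real_numeral)
  have E: "e1 \<i> = - of_real A / 2" "e2 \<i> = 0" "e3 \<i> = of_real A / 2"
    unfolding e1_def e2_def e3_def A(2,3) by (simp_all add: field_simps)
  show "2 + of_real c0 * e1 \<i> = 1" "2 + of_real c0 * e2 \<i> = 2" "2 + of_real c0 * e3 \<i> = 3"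
    unfolding E using k by simp_all
qed

lemma exp_ln_c0: "exp (complex_of_real (ln c0)) = of_real c0" using c0_pos by (simp add: exp_of_real)

lemma cubu_x0: "cubu x0 = base_cfg"
  by (simp add: cubu_def expc_def x0_def exp_ln_c0 cubic_eq c0_e base_cfg_def)

lemma x0_Xu: "x0 \<in> Xu" by (simp add: x0_def Xu_def)

text \<open>\<open>Mon \<rho> \<gamma>\<close>: the loop \<open>\<rho>\<close> lifts to the contractible space \<open>Xu\<close>, along which the period ratio
  moves from \<open>\<i>\<close> to its image under \<open>\<gamma>\<close>.\<close>

definition Mon :: "(real \<Rightarrow> cfg) \<Rightarrow> mat \<Rightarrow> bool" where
  "Mon \<rho> \<gamma> \<longleftrightarrow> \<gamma> \<in> SL2 \<and> pathstart \<rho> = base_cfg \<and> pathfinish \<rho> = base_cfg \<and>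
    (\<exists>h u. path h \<and> path_image h \<subseteq> Xu \<and> pathstart h = x0 \<and> pathfinish h = (2, u, mact \<gamma> \<i>) \<and>
       exp u = of_real c0 / autf \<gamma> \<i> ^ 2 \<and> homotopic_paths Conf3 (cubu \<circ> h) \<rho>)"

lemma Mon_const: "Mon const_path (1, 0, 0, 1)"
proof -
  have "homotopic_paths Conf3 (cubu \<circ> (\<lambda>t. x0)) const_path"
    by (rule homotopic_paths_eq)
       (use cubu_x0 cubu_Conf3[OF x0_Xu] in \<open>auto simp: path_def const_path_def path_image_def intro!: continuous_intros\<close>)
  then show ?thesis unfolding Mon_def
    by (intro conjI exI[of _ "\<lambda>t. x0"] exI[of _ "of_real (ln c0)"])
       (use x0_Xu exp_ln_c0 in \<open>auto simp: SL2_def const_path_def pathstart_def pathfinish_def path_def path_image_def x0_def\<close>)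
qed

text \<open>The lift of the second loop is moved by the deck transformation of \<gamma>, with
  \<kappa> chosen so that it starts where the first lift ends. The matrices therefore multiply in
  the order of concatenation.\<close>

lemma Mon_join:
  assumes "Mon \<rho> \<gamma>" "Mon \<sigma> \<delta>" shows "Mon (\<rho> +++ \<sigma>) (mmul \<gamma> \<delta>)"
proof -
  obtain h u where h: "\<gamma> \<in> SL2" "pathstart \<rho> = base_cfg" "pathfinish \<rho> = base_cfg" "path h" "path_image h \<subseteq> Xu"
    "pathstart h = x0" "pathfinish h = (2, u, mact \<gamma> \<i>)" "exp u = of_real c0 / autf \<gamma> \<i> ^ 2" "homotopic_paths Conf3 (cubu \<circ> h) \<rho>"
    using assms(1) unfolding Mon_def by blast
  obtain k v where k: "\<delta> \<in> SL2" "pathstart \<sigma> = base_cfg" "pathfinish \<sigma> = base_cfg" "path k" "path_image k \<subseteq> Xu"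
    "pathstart k = x0" "pathfinish k = (2, v, mact \<delta> \<i>)" "exp v = of_real c0 / autf \<delta> \<i> ^ 2" "homotopic_paths Conf3 (cubu \<circ> k) \<sigma>"
    using assms(2) unfolding Mon_def by blast
  define \<kappa> where "\<kappa> = u - of_real (ln c0) + 2 * Ln (autf \<gamma> \<i>)"
  have j: "autf \<gamma> \<i> \<noteq> 0" "autf \<delta> \<i> \<noteq> 0" "autf \<gamma> (mact \<delta> \<i>) \<noteq> 0"
    using autf_nz[OF h(1)] autf_nz[OF k(1)] Im_mact_pos[OF k(1), of \<i>] by auto
  have ek: "exp \<kappa> = 1" using h(8) j c0_pos by (simp add: \<kappa>_def exp_add exp_diff exp_2_Ln exp_ln_c0)
  define k' where "k' = tl \<gamma> \<kappa> \<circ> k"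
  have k': "path k'" "path_image k' \<subseteq> Xu"
    unfolding k'_def using k(4,5) continuous_on_subset[OF continuous_tl[OF h(1)] k(5)] tl_Xu[OF h(1)]
    by (auto intro!: path_continuous_image simp: path_image_compose)
  have s: "pathstart k' = pathfinish h"
    unfolding k'_def pathstart_compose k(6) h(7) by (simp add: tl_def x0_def \<kappa>_def)
  have f: "pathfinish k' = (2, v - 2 * Ln (autf \<gamma> (mact \<delta> \<i>)) + \<kappa>, mact (mmul \<gamma> \<delta>) \<i>)"
    unfolding k'_def pathfinish_compose k(7) using mact_mmul[OF h(1) k(1), of \<i>] by (simp add: tl_def)
  have e: "exp (v - 2 * Ln (autf \<gamma> (mact \<delta> \<i>)) + \<kappa>) = of_real c0 / autf (mmul \<gamma> \<delta>) \<i> ^ 2"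
    using j autf_mmul[OF k(1), of \<i> \<gamma>] by (simp add: exp_add exp_diff exp_2_Ln k(8) ek power_mult_distrib field_simps)
  have "homotopic_paths Conf3 (cubu \<circ> k) (cubu \<circ> k')"
  proof (rule homotopic_paths_eq)
    show "path (cubu \<circ> k)" using k continuous_on_subset[OF continuous_cubu k(5)] by (intro path_continuous_image)
    show "path_image (cubu \<circ> k) \<subseteq> Conf3" using k(5) cubu_Conf3 by (auto simp: path_image_compose)
    show "(cubu \<circ> k) t = (cubu \<circ> k') t" if "t \<in> {0..1}" for t
    proof -
      have "k t \<in> Xu" using k(5) that unfolding path_image_def by blast
      then show ?thesis using cubu_tl[OF h(1) _ ek, of "k t"] by (simp add: k'_def)
    qed
  qed
  then have hk': "homotopic_paths Conf3 (cubu \<circ> k') \<sigma>" using k(9) homotopic_paths_sym homotopic_paths_trans by blast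
  have "homotopic_paths Conf3 (cubu \<circ> (h +++ k')) (\<rho> +++ \<sigma>)"
    unfolding path_compose_join by (rule homotopic_paths_join[OF h(9) hk']) (simp add: pathfinish_compose pathstart_compose s)
  then show ?thesis unfolding Mon_def
    using h k k' s f e mmul_SL2[OF h(1) k(1)]
    by (intro conjI exI[of _ "h +++ k'"] exI[of _ "v - 2 * Ln (autf \<gamma> (mact \<delta> \<i>)) + \<kappa>"])
       (auto simp: path_image_join)
qed

text \<open>The reversed lift starts over \<open>mact \<gamma> \<i>\<close>; the deck transformation
  of the inverse matrix brings this start to \<open>x0\<close>.\<close>

lemma Mon_reverse:
  assumes "Mon \<rho> \<gamma>" shows "Mon (reversepath \<rho>) (minv \<gamma>)"
proof -
  obtain h u where h: "\<gamma> \<in> SL2" "pathstart \<rho> = base_cfg" "pathfinish \<rho> = base_cfg" "path h" "path_image h \<subseteq> Xu"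
    "pathstart h = x0" "pathfinish h = (2, u, mact \<gamma> \<i>)" "exp u = of_real c0 / autf \<gamma> \<i> ^ 2" "homotopic_paths Conf3 (cubu \<circ> h) \<rho>"
    using assms(1) unfolding Mon_def by blast
  define \<delta> where "\<delta> = minv \<gamma>"
  have d: "\<delta> \<in> SL2" unfolding \<delta>_def using minv_SL2 h(1) by blast
  define \<kappa> where "\<kappa> = of_real (ln c0) - u + 2 * Ln (autf \<delta> (mact \<gamma> \<i>))"
  have j: "autf \<gamma> \<i> \<noteq> 0" "autf \<delta> \<i> \<noteq> 0" "autf \<delta> (mact \<gamma> \<i>) \<noteq> 0"
    using autf_nz[OF h(1)] autf_nz[OF d] Im_mact_pos[OF h(1), of \<i>] by auto
  have one: "autf \<delta> (mact \<gamma> \<i>) * autf \<gamma> \<i> = 1"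
    using autf_mmul[OF h(1), of \<i> \<delta>] mmul_minv(2)[OF h(1)] by (simp add: \<delta>_def)
  have ek: "exp \<kappa> = 1"
  proof -
    have "exp \<kappa> = (autf \<delta> (mact \<gamma> \<i>) * autf \<gamma> \<i>) ^ 2" using h(8) j c0_pos
      by (simp add: \<kappa>_def exp_add exp_diff exp_2_Ln exp_ln_c0 power_mult_distrib)
    then show ?thesis by (simp add: one)
  qed
  define k where "k = tl \<delta> \<kappa> \<circ> reversepath h"
  have k: "path k" "path_image k \<subseteq> Xu"
    unfolding k_def using h(4,5) continuous_on_subset[OF continuous_tl[OF d] h(5)] tl_Xu[OF d]
    by (auto intro!: path_continuous_image simp: path_image_compose)
  have "mact \<delta> (mact \<gamma> \<i>) = \<i>" using mact_mmul[OF d h(1), of \<i>] mmul_minv(2)[OF h(1)] by (simp add: \<delta>_def)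
  then have s: "pathstart k = x0"
    unfolding k_def pathstart_compose pathstart_reversepath h(7) by (simp add: tl_def x0_def \<kappa>_def)
  have f: "pathfinish k = (2, of_real (ln c0) - 2 * Ln (autf \<delta> \<i>) + \<kappa>, mact \<delta> \<i>)"
    unfolding k_def pathfinish_compose pathfinish_reversepath h(6) by (simp add: tl_def x0_def)
  have e: "exp (of_real (ln c0) - 2 * Ln (autf \<delta> \<i>) + \<kappa>) = of_real c0 / autf \<delta> \<i> ^ 2"
    using j by (simp add: exp_add exp_diff exp_2_Ln exp_ln_c0 ek)
  have rev: "reversepath (cubu \<circ> h) = cubu \<circ> reversepath h" by (simp add: reversepath_def fun_eq_iff)
  have "homotopic_paths Conf3 (cubu \<circ> reversepath h) (cubu \<circ> k)"
  proof (rule homotopic_paths_eq)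
    show "path (cubu \<circ> reversepath h)" using h continuous_on_subset[OF continuous_cubu h(5)] by (intro path_continuous_image) auto
    show "path_image (cubu \<circ> reversepath h) \<subseteq> Conf3" using h(5) cubu_Conf3 by (auto simp: path_image_compose)
    show "(cubu \<circ> reversepath h) t = (cubu \<circ> k) t" if "t \<in> {0..1}" for t
    proof -
      have "1 - t \<in> {0..1}" using that by auto
      then have "h (1 - t) \<in> Xu" using h(5) unfolding path_image_def by blast
      then show ?thesis using cubu_tl[OF d _ ek, of "h (1 - t)"] by (simp add: k_def reversepath_def)
    qed
  qed
  moreover have "homotopic_paths Conf3 (cubu \<circ> reversepath h) (reversepath \<rho>)"
    unfolding rev[symmetric] homotopic_paths_reversepath by (rule h(9))
  ultimately have "homotopic_paths Conf3 (cubu \<circ> k) (reversepath \<rho>)" using homotopic_paths_sym homotopic_paths_trans by blast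
  then show ?thesis unfolding Mon_def \<delta>_def[symmetric] using h k s f e d
    by (intro conjI exI[of _ k] exI[of _ "of_real (ln c0) - 2 * Ln (autf \<delta> \<i>) + \<kappa>"]) auto
qed

section \<open>Lifting the two generators\<close>

text \<open>The shift \<tau> to \<tau> + 1 exchanges the half periods \<tau>/2 and (1 + \<tau>)/2.
  So \<open>e1\<close> and \<open>e2\<close> change places while \<open>e3\<close> stays: the
  permutation of the first generator.\<close>

lemma roots_shift:
  assumes "0 < Im \<tau>"
  shows "roota (1 + \<tau>) = roota \<tau> - rootb \<tau>" "rootb (1 + \<tau>) = - rootb \<tau>"
proof -
  have t: "Im \<tau> \<noteq> 0" using assms by auto
  show "roota (1 + \<tau>) = roota \<tau> - rootb \<tau>"
    using csum_sq_diff(2)[OF t half_not_Lat(1)[OF t]] by (simp add: roota_def csum3_def)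
  have "rootb (1 + \<tau>) = csum3 \<tau> (\<tau> / 2 + 1) ^ 2" by (simp add: rootb_def csum3_def add_divide_distrib add.commute)
  also have "\<dots> = csum3 \<tau> (\<tau> / 2) ^ 2" unfolding csum3_facts(3)[OF t] by simp
  also have "\<dots> = - rootb \<tau>" using csum_sq_diff(2)[OF t half_not_Lat(2)[OF t]] csum_half_zero(1)[OF t] by simp
  finally show "rootb (1 + \<tau>) = - rootb \<tau>" .
qed

text \<open>Above this height lambda is small and its argument differs from that of exp(\<i> \<pi>
  \<tau>) by less than a right angle. Hence it makes a half turn when Re \<tau> increases by
  1.\<close>

lemma cusp_height:
  obtains Y where "1 \<le> Y" "\<And>\<tau>. Y \<le> Im \<tau> \<Longrightarrow> 0 < Re (roota \<tau>)"
    "\<And>\<tau>. Y \<le> Im \<tau> \<Longrightarrow> 0 < Re (rootb \<tau> / exp (\<i> * pi * \<tau>) / roota \<tau>)" "\<And>\<tau>. Y \<le> Im \<tau> \<Longrightarrow> norm (rootb \<tau> / roota \<tau>) < 1"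
proof -
  have "((\<lambda>\<tau>. Re (roota \<tau>)) \<longlongrightarrow> Re (of_real (pi\<^sup>2))) cusp" by (intro tendsto_Re roota_cusp)
  then have 1: "\<forall>\<^sub>F \<tau> in cusp. 0 < Re (roota \<tau>)" by (rule order_tendstoD) simp
  have "((\<lambda>\<tau>. Re (rootb \<tau> / exp (\<i> * pi * \<tau>) / roota \<tau>)) \<longlongrightarrow> Re (of_real (16 * pi\<^sup>2) / of_real (pi\<^sup>2))) cusp"
    by (intro tendsto_Re tendsto_divide rootb_cusp roota_cusp) simp
  then have 2: "\<forall>\<^sub>F \<tau> in cusp. 0 < Re (rootb \<tau> / exp (\<i> * pi * \<tau>) / roota \<tau>)" by (rule order_tendstoD) simp
  have "((\<lambda>\<tau>. norm (rootb \<tau> / roota \<tau>)) \<longlongrightarrow> norm (0 / complex_of_real (pi\<^sup>2))) cusp"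
    by (intro tendsto_norm tendsto_divide rootb_cusp_0 roota_cusp) simp
  then have 3: "\<forall>\<^sub>F \<tau> in cusp. norm (rootb \<tau> / roota \<tau>) < 1" by (rule order_tendstoD) simp
  from 1 2 3 have "\<forall>\<^sub>F \<tau> in cusp. 0 < Re (roota \<tau>) \<and> 0 < Re (rootb \<tau> / exp (\<i> * pi * \<tau>) / roota \<tau>) \<and> norm (rootb \<tau> / roota \<tau>) < 1"
    by eventually_elim auto
  then obtain Y where "\<And>\<tau>. Y \<le> Im \<tau> \<Longrightarrow> 0 < Re (roota \<tau>) \<and> 0 < Re (rootb \<tau> / exp (\<i> * pi * \<tau>) / roota \<tau>) \<and> norm (rootb \<tau> / roota \<tau>) < 1"
    unfolding eventually_cusp by blast
  then show ?thesis by (intro that[of "max 1 Y"]) auto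
qed

lemma vieta_Conf3: "S \<noteq> 0 \<Longrightarrow> m \<noteq> 0 \<Longrightarrow> m \<noteq> 1 \<Longrightarrow> vieta z (z + m * S) (z + S) \<in> Conf3"
  unfolding Conf3_def by force

text \<open>An ordered triple \<open>(z, z + m S, z + S)\<close> is recorded by \<open>z\<close>, the scale \<open>S\<close> and the ratio \<open>m\<close>; the two
  paths compared below are joined by interpolating all three linearly.  The ratio turns by the phase
  \<open>exp (\<i> \<pi> \<phi>)\<close> in both, so that it never vanishes on the way.\<close>

lemma gen1_lift:
  obtains w where "path w" "path_image w \<subseteq> {\<tau>. 0 < Im \<tau>}" "pathstart w = \<i>" "pathfinish w = 1 + \<i>"
    "homotopic_paths Conf3 (\<lambda>t. cubu (2, of_real (ln c0), w t)) (gen_path 1)"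
proof -
  obtain Y where Y: "1 \<le> Y" "\<And>\<tau>. Y \<le> Im \<tau> \<Longrightarrow> 0 < Re (roota \<tau>)"
    "\<And>\<tau>. Y \<le> Im \<tau> \<Longrightarrow> 0 < Re (rootb \<tau> / exp (\<i> * pi * \<tau>) / roota \<tau>)" "\<And>\<tau>. Y \<le> Im \<tau> \<Longrightarrow> norm (rootb \<tau> / roota \<tau>) < 1"
    using cusp_height by blast
  \<comment> \<open>The lift climbs to height Y, crosses from Re = 0 to Re = 1 during the middle
    third of the time, and descends again. The same \<phi> reparametrises the generator.\<close>
  define \<phi> where "\<phi> = (\<lambda>t::real. max 0 (min 1 (3 * t - 1)))"
  define \<eta> where "\<eta> = (\<lambda>t::real. 1 + (Y - 1) * min 1 (min (3 * t) (3 - 3 * t)))"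
  define w where "w = (\<lambda>t. Complex (\<phi> t) (\<eta> t))"
  have \<eta>1: "1 \<le> \<eta> t" if "t \<in> {0..1}" for t using that Y(1) by (auto simp: \<eta>_def)
  have w: "w t = of_real (\<phi> t) + \<i> * of_real (\<eta> t)" for t by (simp add: w_def complex_eq_iff)
  have cw: "continuous_on A w" for A unfolding w \<phi>_def \<eta>_def by (intro continuous_intros)
  have wH: "0 < Im (w t)" if "t \<in> {0..1}" for t using \<eta>1[OF that] by (simp add: w_def)
  define e where "e = (\<lambda>t. exp (\<i> * pi * \<phi> t))"
  define z1 where "z1 = (\<lambda>t. 3 / 2 - e t / 2)"
  define S1 where "S1 = (\<lambda>t. (3 + e t) / 2)"
  \<comment> \<open>The ratio is split as m = e g. Both \<open>g1\<close> and \<open>g2\<close> have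
    positive real part, so no convex combination of them vanishes.\<close>
  define g1 where "g1 = (\<lambda>t. 2 / (3 + e t))"
  define z2 where "z2 = (\<lambda>t. 2 + of_real c0 * e1 (w t))"
  define S2 where "S2 = (\<lambda>t. of_real c0 * roota (w t))"
  define g2 where "g2 = (\<lambda>t. rootb (w t) / roota (w t) / e t)"
  have ne: "norm (e t) = 1" for t by (simp add: e_def)
  have e0: "e t \<noteq> 0" for t by (simp add: e_def)
  have e3: "0 < Re (3 + e t)" for t using abs_Re_le_cmod[of "e t"] ne[of t] by simp
  have e3': "3 + e t \<noteq> 0" for t using e3[of t] by (metis less_irrefl zero_complex.sel(1))
  have ra: "roota (w t) \<noteq> 0" if "t \<in> {0..1}" for t using roots_distinct(1)[of "w t"] wH[OF that] by auto
  have gen: "gen_path 1 (\<phi> t) = vieta (z1 t) (z1 t + (e t * g1 t) * S1 t) (z1 t + S1 t)" for t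
  proof -
    have m: "(e t * g1 t) * S1 t = e t" using e3'[of t] by (simp add: S1_def g1_def)
    have E: "exp (\<i> * pi * \<phi> t) = e t" by (simp add: e_def)
    have "gen_path 1 (\<phi> t) = vieta (3 / 2 - e t / 2) (3 / 2 + e t / 2) 3" unfolding gen_path_def E by simp
    also have "\<dots> = vieta (z1 t) (z1 t + e t) (z1 t + S1 t)" by (simp add: z1_def S1_def add_divide_distrib add.commute)
    finally show ?thesis unfolding m .
  qed
  have our: "cubu (2, of_real (ln c0), w t) = vieta (z2 t) (z2 t + (e t * g2 t) * S2 t) (z2 t + S2 t)" if t: "t \<in> {0..1}" for t
  proof -
    have "(e t * g2 t) * S2 t = of_real c0 * rootb (w t)" using ra[OF t] e0[of t] by (simp add: g2_def S2_def)
    moreover have "cubu (2, of_real (ln c0), w t) = vieta (z2 t) (z2 t + of_real c0 * rootb (w t)) (z2 t + S2 t)"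
      unfolding cubu_def expc_def by (simp add: exp_ln_c0 cubic_eq z2_def S2_def e1_def e2_def e3_def field_simps)
    ultimately show ?thesis by (simp only:)
  qed
  have phase: "(\<phi> t = 0) \<or> (\<phi> t = 1) \<or> Y \<le> Im (w t)" if "t \<in> {0..1}" for t
  proof -
    consider "3 * t \<le> 1" | "2 \<le> 3 * t" | "1 \<le> 3 * t" "3 * t \<le> 2" by linarith
    then show ?thesis
    proof cases
      case 3
      then have "min 1 (min (3 * t) (3 - 3 * t)) = 1" by (simp add: min_def)
      then show ?thesis by (simp add: \<eta>_def w_def)
    qed (simp_all add: \<phi>_def)
  qed
  have p0: "w t = \<i> * of_real (\<eta> t)" "e t = 1" if "\<phi> t = 0" for t using that by (auto simp: w e_def)
  have p1: "w t = 1 + \<i> * of_real (\<eta> t)" "e t = -1" if "\<phi> t = 1" for t using that by (auto simp: w e_def)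
  have P0: "\<exists>A B. 0 < B \<and> B < A \<and> roota (w t) = of_real A \<and> rootb (w t) = of_real B" if "\<phi> t = 0" "t \<in> {0..1}" for t
  proof -
    have "0 < \<eta> t" using \<eta>1[OF that(2)] by simp
    from roots_imaginary[OF this] show ?thesis unfolding p0(1)[OF that(1)] by metis
  qed
  have P1: "\<exists>A B. 0 < B \<and> B < A \<and> roota (w t) = of_real (A - B) \<and> rootb (w t) = of_real (- B)" if "\<phi> t = 1" "t \<in> {0..1}" for t
  proof -
    have y: "0 < \<eta> t" using \<eta>1[OF that(2)] by simp
    from roots_imaginary[OF y] obtain A B where "0 < B" "B < A" "roota (\<i> * of_real (\<eta> t)) = of_real A" "rootb (\<i> * of_real (\<eta> t)) = of_real B" .
    then show ?thesis unfolding p1(1)[OF that(1)] using roots_shift[of "\<i> * of_real (\<eta> t)"] y by (intro exI[of _ A] exI[of _ B]) auto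
  qed
  have S1p: "0 < Re (S1 t)" for t using e3[of t] by (simp add: S1_def)
  have S2p: "0 < Re (S2 t)" if t: "t \<in> {0..1}" for t
    using phase[OF t] P0[OF _ t] P1[OF _ t] Y(2)[of "w t"] c0_pos by (auto simp: S2_def)
  have g1p: "0 < Re (g1 t)" for t
  proof -
    have "Re (g1 t) = 2 * Re (3 + e t) / norm (3 + e t) ^ 2" by (simp add: g1_def Re_divide cmod_power2)
    then show ?thesis using e3[of t] e3'[of t] by (simp add: zero_less_divide_iff)
  qed
  have g2p: "0 < Re (g2 t)" if t: "t \<in> {0..1}" for t
  proof -
    consider "\<phi> t = 0" | "\<phi> t = 1" | "Y \<le> Im (w t)" using phase[OF t] by blast
    then show ?thesis
    proof cases
      case 1
      then show ?thesis using P0[OF 1 t] p0(2)[OF 1] by (auto simp: g2_def simp flip: of_real_divide)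
    next
      case 2
      then show ?thesis using P1[OF 2 t] p1(2)[OF 2] by (auto simp: g2_def simp flip: of_real_divide)
    next
      case 3
      have "exp (\<i> * pi * w t) = e t * of_real (exp (- pi * \<eta> t))"
        unfolding w e_def by (simp add: exp_of_real[symmetric] algebra_simps flip: exp_add)
      then have E: "g2 t = of_real (exp (- pi * \<eta> t)) * (rootb (w t) / exp (\<i> * pi * w t) / roota (w t))"
        using e0[of t] by (simp add: g2_def)
      have "Re (g2 t) = exp (- pi * \<eta> t) * Re (rootb (w t) / exp (\<i> * pi * w t) / roota (w t))"
        unfolding E by (simp only: times_complex.sel Re_complex_of_real Im_complex_of_real mult_zero_left diff_zero)
      then show ?thesis using mult_pos_pos[OF exp_gt_zero Y(3)[OF 3]] by presburger
    qed
  qed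
  have m1: "norm (e t * g1 t) \<le> 1" for t
  proof -
    have "3 \<le> norm (3 + e t) + norm (e t)" using norm_triangle_ineq4[of "3 + e t" "e t"] by simp
    then have "2 \<le> norm (3 + e t)" using ne[of t] by simp
    then show ?thesis by (simp add: g1_def norm_mult norm_divide ne divide_le_eq)
  qed
  have m1': "e t * g1 t \<noteq> 1" for t
  proof
    assume "e t * g1 t = 1"
    then have "e t = 3" using e3'[of t] by (simp add: g1_def field_simps)
    then show False using ne[of t] by simp
  qed
  define H where "H = (\<lambda>x :: real \<times> real. let s = complex_of_real (fst x); t = snd x;
     z = (1 - s) * z1 t + s * z2 t; S = (1 - s) * S1 t + s * S2 t; m = (1 - s) * (e t * g1 t) + s * (e t * g2 t)
     in vieta z (z + m * S) (z + S))"
  have HC: "H (s, t) \<in> Conf3" if s: "s \<in> {0..1}" and t: "t \<in> {0..1}" for s t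
  proof -
    define S where "S = (1 - of_real s) * S1 t + of_real s * S2 t"
    define g where "g = (1 - of_real s) * g1 t + of_real s * g2 t"
    have comb: "0 < (1 - s) * a + s * b" if "0 < a" "0 < b" for a b :: real
      using that s by (cases "s = 0") (auto intro!: add_nonneg_pos)
    have "0 < Re S" using comb[OF S1p S2p[OF t]] by (simp add: S_def)
    then have S: "S \<noteq> 0" by auto
    have "0 < Re g" using comb[OF g1p g2p[OF t]] by (simp add: g_def)
    then have "g \<noteq> 0" by auto
    then have m: "e t * g \<noteq> 0" using e0 by simp
    \<comment> \<open>The interpolated ratio must also avoid 1. On the climb it is real and below 1,
      on the descent its real part is negative, and on the crossing its modulus is below 1 for s >
      0.\<close>
    have ne1: "e t * g \<noteq> 1"
    proof -
      consider "\<phi> t = 0" | "\<phi> t = 1" | "Y \<le> Im (w t)" using phase[OF t] by blast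
      then show ?thesis
      proof cases
        case 1
        obtain A B where "0 < B" "B < A" "roota (w t) = of_real A" "rootb (w t) = of_real B" using P0[OF 1 t] by blast
        note AB = this
        define r where "r = (1 - s) * (1 / 2) + s * (B / A)"
        have g12: "g1 t = of_real (1 / 2)" "g2 t = of_real (B / A)"
          unfolding g1_def g2_def AB p0(2)[OF 1] by simp_all
        have E: "e t * g = of_real r" unfolding g_def g12 p0(2)[OF 1] r_def by simp
        have "0 < (1 - s) * (1 / 2) + s * (1 - B / A)" using AB by (intro comb) simp_all
        also have "\<dots> = 1 - r" by (simp add: r_def algebra_simps)
        finally have "r \<noteq> 1" by simp
        then show ?thesis unfolding E by simp
      next
        case 2
        have "Re (e t * g) < 0" unfolding p1(2)[OF 2] using \<open>0 < Re g\<close> by simp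
        then show ?thesis by (metis less_asym one_complex.sel(1) zero_less_one)
      next
        case 3
        have n2: "norm (e t * g2 t) < 1" using Y(4)[OF 3] e0[of t] by (simp add: g2_def)
        show ?thesis
        proof (cases "s = 0")
          case True
          then show ?thesis using m1' by (simp add: g_def)
        next
          case False
          then have s': "0 < s" using s by simp
          have "e t * g = of_real (1 - s) * (e t * g1 t) + of_real s * (e t * g2 t)" by (simp add: g_def algebra_simps)
          also have "norm \<dots> \<le> norm (complex_of_real (1 - s)) * norm (e t * g1 t) + norm (complex_of_real s) * norm (e t * g2 t)"
            by (metis norm_mult norm_triangle_ineq)
          also have "\<dots> = (1 - s) * norm (e t * g1 t) + s * norm (e t * g2 t)" using s by (simp only: norm_of_real) auto
          also have "\<dots> < (1 - s) * 1 + s * 1"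
            using s s' m1[of t] n2 by (intro add_le_less_mono mult_left_mono mult_strict_left_mono) auto
          finally show ?thesis by auto
        qed
      qed
    qed
    have mE: "(1 - of_real s) * (e t * g1 t) + of_real s * (e t * g2 t) = e t * g" by (simp add: g_def algebra_simps)
    show ?thesis unfolding H_def Let_def fst_conv snd_conv mE S_def[symmetric] by (rule vieta_Conf3[OF S m ne1])
  qed
  have cont: "continuous_on ({0..1} \<times> {0..1}) H"
  proof -
    have cwt: "continuous_on ({0..1} \<times> {0..1}) (\<lambda>x :: real \<times> real. w (snd x))"
      by (rule continuous_on_compose2[OF cw[of UNIV]]) (auto intro!: continuous_intros)
    have c\<phi>: "continuous_on ({0..1} \<times> {0..1}) (\<lambda>x :: real \<times> real. \<phi> (snd x))"
      unfolding \<phi>_def by (intro continuous_intros)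
    have ce: "continuous_on ({0..1} \<times> {0..1}) (\<lambda>x :: real \<times> real. e (snd x))"
      unfolding e_def using c\<phi> by (intro continuous_intros)
    have ca: "continuous_on ({0..1} \<times> {0..1}) (\<lambda>x :: real \<times> real. roota (w (snd x)))"
      by (rule continuous_on_compose2[OF holomorphic_on_imp_continuous_on[OF roota_holomorphic] cwt]) (use wH in auto)
    have cb: "continuous_on ({0..1} \<times> {0..1}) (\<lambda>x :: real \<times> real. rootb (w (snd x)))"
      by (rule continuous_on_compose2[OF holomorphic_on_imp_continuous_on[OF rootb_holomorphic] cwt]) (use wH in auto)
    have cc: "continuous_on ({0..1} \<times> {0..1}) (\<lambda>x :: real \<times> real. z1 (snd x))" "continuous_on ({0..1} \<times> {0..1}) (\<lambda>x :: real \<times> real. S1 (snd x))"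
      "continuous_on ({0..1} \<times> {0..1}) (\<lambda>x :: real \<times> real. z2 (snd x))" "continuous_on ({0..1} \<times> {0..1}) (\<lambda>x :: real \<times> real. S2 (snd x))"
      unfolding z1_def S1_def z2_def S2_def e1_def by (intro continuous_intros ce ca cb; simp)+
    have cg1: "continuous_on ({0..1} \<times> {0..1}) (\<lambda>x :: real \<times> real. g1 (snd x))"
      unfolding g1_def by (intro continuous_intros ce ballI e3')
    have cg2: "continuous_on ({0..1} \<times> {0..1}) (\<lambda>x :: real \<times> real. g2 (snd x))"
      unfolding g2_def by (intro continuous_intros ce ca cb ballI e0) (use ra in auto)
    show ?thesis unfolding H_def Let_def vieta_def
      by (intro continuous_intros cc cg1 cg2 ce)
  qed
  have ends: "H (s, 0) = base_cfg" "H (s, 1) = vieta 2 1 3" for s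
  proof -
    have w0: "w 0 = \<i>" "w 1 = 1 + \<i>" "\<phi> 0 = 0" "\<phi> 1 = 1" by (simp_all add: w_def \<phi>_def \<eta>_def complex_eq_iff)
    obtain A where A: "0 < A" "roota \<i> = of_real A" "rootb \<i> = of_real (A / 2)" "c0 = 2 / A" by (rule roots_i)
    have "c0 * A = 2" using A(1,4) by (simp add: field_simps)
    then have k: "complex_of_real c0 * of_real A = 2" by (metis of_real_mult of_real_numeral)
    have A0: "complex_of_real A \<noteq> 0" using A(1) by simp
    have A3: "rootb \<i> = of_real A / 2" using A(3) by simp
    have sh: "roota (1 + \<i>) = of_real A / 2" "rootb (1 + \<i>) = - (of_real A / 2)" using roots_shift[of \<i>] unfolding A(2) A3 by simp_all
    have cv: "(1 - complex_of_real s) * x + of_real s * x = x" for x by (simp add: algebra_simps)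
    have v1: "z1 0 = 1" "S1 0 = 2" "e 0 * g1 0 = 1 / 2" by (simp_all add: z1_def S1_def g1_def p0(2)[OF w0(3)])
    have v2: "z2 0 = 1" unfolding z2_def w0 by (rule c0_e(1))
    have v3: "S2 0 = 2" unfolding S2_def w0 A(2) by (rule k)
    have v4: "e 0 * g2 0 = 1 / 2" unfolding g2_def w0 A(2) A3 p0(2)[OF w0(3)] using A0 by simp
    have "H (s, 0) = vieta 1 (1 + 1 / 2 * 2) (1 + 2)" unfolding H_def Let_def fst_conv snd_conv v1 v2 v3 v4 cv ..
    then show "H (s, 0) = base_cfg" by (simp add: base_cfg_def)
    have v1: "z1 1 = 2" "S1 1 = 1" "e 1 * g1 1 = -1" by (simp_all add: z1_def S1_def g1_def p1(2)[OF w0(4)])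
    have v2: "z2 1 = 2" unfolding z2_def w0 e1_def sh by simp
    have v3: "S2 1 = 1" unfolding S2_def w0 sh using k by simp
    have v4: "e 1 * g2 1 = -1" unfolding g2_def w0 sh p1(2)[OF w0(4)] using A0 by simp
    have "H (s, 1) = vieta 2 (2 + (- 1) * 1) (2 + 1)" unfolding H_def Let_def fst_conv snd_conv v1 v2 v3 v4 cv ..
    then show "H (s, 1) = vieta 2 1 3" by simp
  qed
  have H0: "H (0, t) = gen_path 1 (\<phi> t)" for t unfolding gen by (simp add: H_def Let_def)
  have H1: "H (1, t) = cubu (2, of_real (ln c0), w t)" if "t \<in> {0..1}" for t unfolding our[OF that] by (simp add: H_def Let_def)
  have hom: "homotopic_paths Conf3 (\<lambda>t. gen_path 1 (\<phi> t)) (\<lambda>t. cubu (2, of_real (ln c0), w t))"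
    unfolding homotopic_paths
  proof (intro exI[of _ H] conjI ballI)
    fix s :: real assume "s \<in> {0..1}"
    show "pathstart (H \<circ> Pair s) = pathstart (\<lambda>t. gen_path 1 (\<phi> t))" using ends(1)[of s] ends(1)[of 0] H0[of 0] by (simp add: pathstart_def)
    show "pathfinish (H \<circ> Pair s) = pathfinish (\<lambda>t. gen_path 1 (\<phi> t))" using ends(2)[of s] ends(2)[of 0] H0[of 1] by (simp add: pathfinish_def)
  qed (use cont HC H0 H1 in auto)
  have pg: "path (gen_path 1)"
    unfolding path_def gen_path_def vieta_def by (auto intro!: continuous_intros)
  have rp: "homotopic_paths Conf3 (gen_path 1) (\<lambda>t. gen_path 1 (\<phi> t))"
  proof (rule homotopic_paths_reparametrize[OF pg, where f = \<phi>])
    show "path_image (gen_path 1) \<subseteq> Conf3"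
    proof
      fix p assume "p \<in> path_image (gen_path 1)"
      then obtain s :: real where s: "s \<in> {0..1}" "p = gen_path 1 s" by (auto simp: path_image_def)
      have "3 * ((s + 1) / 3) - 1 = s" by (simp add: add_divide_distrib)
      then have "\<phi> ((s + 1) / 3) = s" unfolding \<phi>_def using s(1) by (simp only:) (simp add: min_def max_def)
      moreover have "(s + 1) / 3 \<in> {0..1}" using s(1) by auto
      then have "H (0, (s + 1) / 3) \<in> Conf3" by (intro HC) auto
      ultimately have "p \<in> Conf3" unfolding s(2) H0 by simp
      then show "p \<in> Conf3" by simp
    qed
    show "continuous_on {0..1} \<phi>" unfolding \<phi>_def by (intro continuous_intros)
    show "\<phi> \<in> {0..1} \<rightarrow> {0..1}" unfolding \<phi>_def by (rule funcsetI) simp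
    show "\<phi> 0 = 0" "\<phi> 1 = 1" by (simp_all add: \<phi>_def)
  qed (rule refl)
  show ?thesis
  proof (rule that[of w])
    show "path w" unfolding path_def by (rule cw)
    show "path_image w \<subseteq> {\<tau>. 0 < Im \<tau>}" using wH by (auto simp: path_image_def)
    show "pathstart w = \<i>" "pathfinish w = 1 + \<i>" by (simp_all add: pathstart_def pathfinish_def w_def \<phi>_def \<eta>_def complex_eq_iff)
    show "homotopic_paths Conf3 (\<lambda>t. cubu (2, of_real (ln c0), w t)) (gen_path 1)"
      by (rule homotopic_paths_sym[OF homotopic_paths_trans[OF rp hom]])
  qed
qed


lemma Mon_gen1: "Mon (gen_path 1) (1, 1, 0, 1)"
proof -
  obtain w where w: "path w" "path_image w \<subseteq> {\<tau>. 0 < Im \<tau>}" "pathstart w = \<i>" "pathfinish w = 1 + \<i>"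
    "homotopic_paths Conf3 (\<lambda>t. cubu (2, of_real (ln c0), w t)) (gen_path 1)" by (rule gen1_lift)
  define h where "h = (\<lambda>t. (2 :: complex, complex_of_real (ln c0), w t))"
  have "path h" unfolding h_def path_def using w(1) by (intro continuous_intros) (simp add: path_def)
  moreover have "path_image h \<subseteq> Xu" using w(2) by (auto simp: path_image_def h_def Xu_def)
  moreover have "pathstart h = x0" "pathfinish h = (2, of_real (ln c0), mact (1, 1, 0, 1) \<i>)"
    using w(3,4) by (simp_all add: pathstart_def pathfinish_def h_def x0_def mact_def add.commute)
  moreover have "homotopic_paths Conf3 (cubu \<circ> h) (gen_path 1)" using w(5) by (simp add: h_def o_def)
  moreover have "gen_path 1 0 = base_cfg" by (simp add: gen_path_def base_cfg_def)
  moreover have "gen_path 1 1 = base_cfg"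
    by (simp add: gen_path_def base_cfg_def vieta_def)
  moreover have "exp (complex_of_real (ln c0)) = of_real c0 / autf (1, 1, 0, 1) \<i> ^ 2" by (simp add: exp_ln_c0 autf_def)
  ultimately show ?thesis unfolding Mon_def SL2_def pathstart_def pathfinish_def
    by (intro conjI exI[of _ h] exI[of _ "of_real (ln c0)"]) auto
qed

text \<open>The symmetry \<open>z \<mapsto> 4 - z\<close> of the base configuration exchanges the two generators.\<close>

definition refl_cfg :: "cfg \<Rightarrow> cfg" where
  "refl_cfg p = (- 12 - fst p, 48 + 8 * fst p + fst (snd p), - 64 - 16 * fst p - 4 * fst (snd p) - snd (snd p))"

lemma refl_vieta: "refl_cfg (vieta z1 z2 z3) = vieta (4 - z1) (4 - z2) (4 - z3)"
  by (simp add: refl_cfg_def vieta_def algebra_simps)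

lemma refl_Conf3: "p \<in> Conf3 \<Longrightarrow> refl_cfg p \<in> Conf3"
proof -
  assume "p \<in> Conf3"
  then obtain z1 z2 z3 where "p = vieta z1 z2 z3" "z1 \<noteq> z2" "z1 \<noteq> z3" "z2 \<noteq> z3" by (auto simp: Conf3_def)
  then have "refl_cfg p = vieta (4 - z1) (4 - z2) (4 - z3)" "4 - z1 \<noteq> 4 - z2" "4 - z1 \<noteq> 4 - z3" "4 - z2 \<noteq> 4 - z3"
    by (simp_all add: refl_vieta)
  then show ?thesis unfolding Conf3_def by blast
qed

text \<open>The reflection keeps the centre 2 and negates the scale, which adds \<i> \<pi> to its
  logarithm.\<close>

lemma refl_cubu: "refl_cfg (cubu (2, u, \<tau>)) = cubu (2, u + \<i> * pi, \<tau>)"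
  by (simp add: cubu_def expc_def cubic_eq refl_vieta exp_add)

lemma refl_gen: "refl_cfg (gen_path 1 t) = gen_path 2 t"
proof -
  define e where "e = exp (\<i> * pi * t)"
  have "gen_path 1 t = vieta (3 / 2 - e / 2) (3 / 2 + e / 2) 3" "gen_path 2 t = vieta 1 (5 / 2 - e / 2) (5 / 2 + e / 2)"
    by (simp_all add: gen_path_def e_def)
  moreover have "vieta (4 - (3 / 2 - e / 2)) (4 - (3 / 2 + e / 2)) (4 - 3) = vieta 1 (5 / 2 - e / 2) (5 / 2 + e / 2)"
    by (simp add: vieta_def field_simps)
  ultimately show ?thesis by (simp only: refl_vieta)
qed

text \<open>The reflected lift starts at the scale -c0. The matrix (0, 1, -1, 0) fixes
  \<open>\<i>\<close> and has squared automorphy factor -1 there, so its deck transformation brings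
  the start back to \<open>x0\<close>; it sends the end point 1 + \<i> to the point recorded by the
  matrix of the second generator.\<close>

lemma Mon_gen2: "Mon (gen_path 2) (1, 0, -1, 1)"
proof -
  obtain w where w: "path w" "path_image w \<subseteq> {\<tau>. 0 < Im \<tau>}" "pathstart w = \<i>" "pathfinish w = 1 + \<i>"
    "homotopic_paths Conf3 (\<lambda>t. cubu (2, of_real (ln c0), w t)) (gen_path 1)" by (rule gen1_lift)
  define k where "k = (\<lambda>t. (2 :: complex, complex_of_real (ln c0) + \<i> * pi, w t))"
  have k: "path k" "path_image k \<subseteq> Xu"
    unfolding k_def path_def using w(1,2) by (auto simp: path_def path_image_def Xu_def intro!: continuous_intros)
  have c: "continuous_on Conf3 refl_cfg" unfolding refl_cfg_def[abs_def] by (intro continuous_intros)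
  have "homotopic_paths Conf3 (refl_cfg \<circ> (\<lambda>t. cubu (2, of_real (ln c0), w t))) (refl_cfg \<circ> gen_path 1)"
    by (rule homotopic_paths_continuous_image[OF w(5) c]) (auto intro: refl_Conf3)
  then have hk: "homotopic_paths Conf3 (cubu \<circ> k) (gen_path 2)"
    by (simp only: o_def refl_cubu refl_gen k_def)
  define \<gamma> :: mat where "\<gamma> = (0, 1, -1, 0)"
  have g: "\<gamma> \<in> SL2" by (simp add: \<gamma>_def SL2_def)
  \<comment> \<open>Reflection contributes \<i> \<pi>, and so does -2 Ln(-\<i>); together they are
    cancelled by -2 \<pi> \<i>.\<close>
  define \<kappa> where "\<kappa> = - 2 * of_real pi * \<i>"
  have ek: "exp \<kappa> = 1"
  proof -
    have "exp (2 * of_real pi * \<i>) = 1" by (rule exp_two_pi_i)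
    then show ?thesis by (simp add: \<kappa>_def exp_minus)
  qed
  define h where "h = tl \<gamma> \<kappa> \<circ> k"
  have h: "path h" "path_image h \<subseteq> Xu"
    unfolding h_def using k continuous_on_subset[OF continuous_tl[OF g] k(2)] tl_Xu[OF g]
    by (auto intro!: path_continuous_image simp: path_image_compose)
  have s: "pathstart h = x0"
    using w(3) by (simp add: h_def k_def pathstart_def tl_def x0_def \<gamma>_def autf_def mact_def \<kappa>_def)
  define u where "u = complex_of_real (ln c0) + \<i> * pi - 2 * Ln (autf \<gamma> (1 + \<i>)) + \<kappa>"
  have m: "mact \<gamma> (1 + \<i>) = mact (1, 0, -1, 1) \<i>"
    by (simp add: \<gamma>_def mact_def complex_eq_iff Re_divide Im_divide)
  have f: "pathfinish h = (2, u, mact (1, 0, -1, 1) \<i>)"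
    using w(4) unfolding m[symmetric] by (simp add: h_def k_def pathfinish_def tl_def u_def)
  have nz: "autf \<gamma> (1 + \<i>) \<noteq> 0" using autf_nz[OF g, of "1 + \<i>"] by simp
  have "autf \<gamma> (1 + \<i>) ^ 2 = 2 * \<i>" "autf (1, 0, -1, 1) \<i> ^ 2 = - (2 * \<i>)"
    by (simp_all add: \<gamma>_def autf_def power2_eq_square algebra_simps)
  then have eu: "exp u = of_real c0 / autf (1, 0, -1, 1) \<i> ^ 2"
    using nz by (simp add: u_def exp_add exp_diff exp_2_Ln exp_ln_c0 ek)
  have "homotopic_paths Conf3 (cubu \<circ> k) (cubu \<circ> h)"
  proof (rule homotopic_paths_eq)
    show "path (cubu \<circ> k)" using k continuous_on_subset[OF continuous_cubu k(2)] by (intro path_continuous_image)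
    show "path_image (cubu \<circ> k) \<subseteq> Conf3" using k(2) cubu_Conf3 by (auto simp: path_image_compose)
    show "(cubu \<circ> k) t = (cubu \<circ> h) t" if "t \<in> {0..1}" for t
    proof -
      have "k t \<in> Xu" using k(2) that unfolding path_image_def by blast
      then show ?thesis using cubu_tl[OF g _ ek, of "k t"] by (simp add: h_def)
    qed
  qed
  then have hh: "homotopic_paths Conf3 (cubu \<circ> h) (gen_path 2)" using hk homotopic_paths_sym homotopic_paths_trans by blast
  have "gen_path 2 0 = base_cfg" by (simp add: gen_path_def base_cfg_def)
  moreover have "gen_path 2 1 = base_cfg" by (simp add: gen_path_def base_cfg_def vieta_def)
  ultimately show ?thesis unfolding Mon_def using h s f eu hh
    by (intro conjI exI[of _ h] exI[of _ u]) (auto simp: SL2_def pathstart_def pathfinish_def)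
qed

definition gmat :: "nat \<Rightarrow> int \<Rightarrow> mat" where "gmat i k = (if i = 1 then (1, k, 0, 1) else (1, 0, - k, 1))"

fun wmat :: "(nat \<times> int) list \<Rightarrow> mat" where
  "wmat [] = (1, 0, 0, 1)"
| "wmat ((i, k) # ws) = mmul (gmat i k) (wmat ws)"

lemma gmat_add: "mmul (gmat i k) (gmat i l) = gmat i (k + l)" by (simp add: gmat_def mmul_def)

lemma Mon_iter: assumes "Mon g (gmat i k)" shows "Mon (iter_path g n) (gmat i (int n * k))"
proof (induction n)
  case 0
  then show ?case using Mon_const by (simp add: gmat_def)
next
  case (Suc n)
  then show ?case using Mon_join[OF assms Suc] gmat_add[of i k "int n * k"] by (simp add: algebra_simps)
qed

lemma Mon_gen: "i \<in> {1, 2} \<Longrightarrow> Mon (gen_path i) (gmat i 1)"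
  using Mon_gen1 Mon_gen2 by (auto simp: gmat_def)

lemma Mon_gen_pow: assumes "i \<in> {1, 2}" shows "Mon (gen_pow_path i k) (gmat i k)"
proof (cases "0 \<le> k")
  case True
  then show ?thesis using Mon_iter[OF Mon_gen[OF assms], of "nat k"] by (simp add: gen_pow_path_def)
next
  case False
  have "Mon (reversepath (gen_path i)) (gmat i (-1))"
    using Mon_reverse[OF Mon_gen[OF assms]] by (auto simp: gmat_def minv_def split: if_splits)
  from Mon_iter[OF this, of "nat (-k)"] show ?thesis using False by (simp add: gen_pow_path_def)
qed

theorem Mon_word: "(\<And>i k. (i, k) \<in> set ws \<Longrightarrow> i \<in> {1, 2}) \<Longrightarrow> Mon (word_path ws) (wmat ws)"
proof (induction ws)
  case (Cons a ws)
  obtain i k where a: "a = (i, k)" by (metis surj_pair)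
  have "Mon (gen_pow_path i k) (gmat i k)" by (rule Mon_gen_pow) (use Cons.prems a in auto)
  moreover have "Mon (word_path ws) (wmat ws)" by (rule Cons.IH) (use Cons.prems in auto)
  ultimately show ?case using Mon_join a by simp
qed (use Mon_const in simp)

section \<open>Distance of two geodesics\<close>

text \<open>The real part of the Cauchy integral over the boundary equates \<delta> times the width
  with the height times the difference of the mean imaginary parts on the two vertical sides; this
  difference is at most \<pi>.\<close>

lemma rectangle_flux:
  fixes G :: "complex \<Rightarrow> complex"
  assumes z: "Re z0 < Re z1" "Im z0 < Im z1"
    and cont: "continuous_on (cbox z0 z1) G" and hol: "G holomorphic_on box z0 z1"
    and bot: "\<And>x. Re z0 < x \<Longrightarrow> x < Re z1 \<Longrightarrow> Re (G (Complex x (Im z0))) = 0"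
    and top: "\<And>x. Re z0 < x \<Longrightarrow> x < Re z1 \<Longrightarrow> Re (G (Complex x (Im z1))) = - \<delta>"
    and im: "\<And>w. w \<in> cbox z0 z1 \<Longrightarrow> 0 \<le> Im (G w) \<and> Im (G w) \<le> pi"
  shows "\<delta> * (Re z1 - Re z0) \<le> pi * (Im z1 - Im z0)"
proof -
  define W h where "W = Re z1 - Re z0" and "h = Im z1 - Im z0"
  define a2 a4 where "a2 = Complex (Re z1) (Im z0)" and "a4 = Complex (Re z0) (Im z1)"
  have c: "z0 \<in> cbox z0 z1" "a2 \<in> cbox z0 z1" "z1 \<in> cbox z0 z1" "a4 \<in> cbox z0 z1"
    using z by (auto simp: a2_def a4_def in_cbox_complex_iff)
  have seg: "closed_segment a b \<subseteq> cbox z0 z1" if "a \<in> cbox z0 z1" "b \<in> cbox z0 z1" for a b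
    using that convex_box(1)[of z0 z1] by (simp add: convex_contains_segment)
  have lp: "linepath a b t \<in> cbox z0 z1" if "a \<in> cbox z0 z1" "b \<in> cbox z0 z1" "t \<in> {0..1}" for a b t
    using seg[OF that(1,2)] linepath_in_path[OF that(3)] by blast
  have cl: "continuous_on {0..1} (\<lambda>t. G (linepath a b t))" if "a \<in> cbox z0 z1" "b \<in> cbox z0 z1" for a b
    by (rule continuous_on_compose2[OF cont]) (use lp[OF that] in \<open>auto intro!: continuous_intros\<close>)
  define J where "J = (\<lambda>a b. integral {0..1} (\<lambda>t. G (linepath a b t)))"
  have J: "((\<lambda>t. G (linepath a b t)) has_integral J a b) {0..1}" if "a \<in> cbox z0 z1" "b \<in> cbox z0 z1" for a b
    unfolding J_def by (rule integrable_integral, rule integrable_continuous_interval, rule cl[OF that])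
  have CJ: "(G has_contour_integral J a b * (b - a)) (linepath a b)" if "a \<in> cbox z0 z1" "b \<in> cbox z0 z1" for a b
    unfolding has_contour_integral_linepath by (rule has_integral_mult_left[OF J[OF that]])
  let ?g = "linepath z0 a2 +++ linepath a2 z1 +++ linepath z1 a4 +++ linepath a4 z0"
  have "(G has_contour_integral (J z0 a2 * (a2 - z0) + (J a2 z1 * (z1 - a2) + (J z1 a4 * (a4 - z1) + J a4 z0 * (z0 - a4))))) ?g"
    by (intro has_contour_integral_join CJ c valid_path_linepath valid_path_join) auto
  moreover have "(G has_contour_integral 0) ?g"
  proof (rule Cauchy_theorem_convex[OF cont convex_box(1), of "{}"])
    show "G field_differentiable at w" if "w \<in> interior (cbox z0 z1) - {}" for w
      using hol that open_box[of z0 z1] by (auto simp: interior_cbox holomorphic_on_imp_differentiable_at)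
    show "path_image ?g \<subseteq> cbox z0 z1"
      using seg c by (auto simp: path_image_join)
  qed (auto intro!: valid_path_join)
  ultimately have "J z0 a2 * (a2 - z0) + (J a2 z1 * (z1 - a2) + (J z1 a4 * (a4 - z1) + J a4 z0 * (z0 - a4))) = 0"
    by (rule has_contour_integral_unique)
  moreover have "a2 - z0 = of_real W" "z1 - a2 = \<i> * of_real h" "a4 - z1 = - of_real W" "z0 - a4 = - (\<i> * of_real h)"
    by (simp_all add: complex_eq_iff W_def h_def a2_def a4_def)
  ultimately have "J z0 a2 * of_real W + (J a2 z1 * (\<i> * of_real h) + (J z1 a4 * (- of_real W) + J a4 z0 * (- (\<i> * of_real h)))) = 0" by simp
  then have "Re (J z0 a2 * of_real W + (J a2 z1 * (\<i> * of_real h) + (J z1 a4 * (- of_real W) + J a4 z0 * (- (\<i> * of_real h))))) = 0" by simp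
  then have flux: "Re (J z0 a2) * W - Im (J a2 z1) * h - Re (J z1 a4) * W + Im (J a4 z0) * h = 0" by simp
  \<comment> \<open>The values are prescribed on the open sides only; continuity extends them to the
    corners.\<close>
  have const: "Re (J a b) = r" if ab: "a \<in> cbox z0 z1" "b \<in> cbox z0 z1" and r: "\<And>t. t \<in> {0<..<1} \<Longrightarrow> Re (G (linepath a b t)) = r" for a b r
  proof -
    have cr: "continuous_on (closure {0<..<1}) (\<lambda>t. Re (G (linepath a b t)))"
      using cl[OF ab] by (auto intro!: continuous_intros)
    have r01: "Re (G (linepath a b t)) = r" if "t \<in> {0..1}" for t
      by (rule continuous_constant_on_closure[OF cr]) (use r that in auto)
    have "((\<lambda>t. r) has_integral Re (J a b)) {0..1::real}"
      by (rule has_integral_eq[OF r01 has_integral_Re[OF J[OF ab]]])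
    moreover have "((\<lambda>t. r) has_integral r) {0..1::real}" using has_integral_const_real[of r 0 1] by simp
    ultimately show ?thesis by (rule has_integral_unique)
  qed
  have 1: "Re (J z0 a2) = 0"
  proof (rule const[OF c(1,2)])
    fix t :: real assume t: "t \<in> {0<..<1}"
    have "linepath z0 a2 t = Complex (Re z0 + t * W) (Im z0)"
      by (simp add: linepath_def a2_def W_def complex_eq_iff algebra_simps)
    moreover have "0 < t * W" "t * W < 1 * W" using t z by (auto simp: W_def intro!: mult_strict_right_mono)
    ultimately show "Re (G (linepath z0 a2 t)) = 0" using bot[of "Re z0 + t * W"] by (simp add: W_def)
  qed
  have 2: "Re (J z1 a4) = - \<delta>"
  proof (rule const[OF c(3,4)])
    fix t :: real assume t: "t \<in> {0<..<1}"
    have "linepath z1 a4 t = Complex (Re z1 - t * W) (Im z1)"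
      by (simp add: linepath_def a4_def W_def complex_eq_iff algebra_simps)
    moreover have "0 < t * W" "t * W < 1 * W" using t z by (auto simp: W_def intro!: mult_strict_right_mono)
    ultimately show "Re (G (linepath z1 a4 t)) = - \<delta>" using top[of "Re z1 - t * W"] by (simp add: W_def)
  qed
  have 3: "Im (J a2 z1) \<le> pi"
  proof (rule has_integral_le[OF has_integral_Im[OF J[OF c(2,3)]]])
    show "((\<lambda>t. pi) has_integral pi) {0..1::real}" using has_integral_const_real[of pi 0 1] by simp
  qed (use im lp[OF c(2,3)] in auto)
  have 4: "0 \<le> Im (J a4 z0)"
    by (rule has_integral_nonneg[OF has_integral_Im[OF J[OF c(4,1)]]]) (use im lp[OF c(4,1)] in auto)
  have "0 < h" using z by (simp add: h_def)
  have "\<delta> * W = Im (J a2 z1) * h - Im (J a4 z0) * h" using flux 1 2 by simp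
  also have "\<dots> \<le> pi * h" using mult_right_mono[OF 3 less_imp_le[OF \<open>0 < h\<close>]] mult_nonneg_nonneg[OF 4 less_imp_le[OF \<open>0 < h\<close>]] by linarith
  finally show ?thesis by (simp add: W_def h_def)
qed

text \<open>For a matrix without zero entries the geodesics \<open>\<i>\<real>\<^sub>+\<close> and its image have a common perpendicular, with
  end points \<open>\<plusminus>\<rho>\<close>; the map below sends it to the imaginary axis and the two geodesics to
  concentric half circles.\<close>

definition perp :: "mat \<Rightarrow> real" where
  "perp = (\<lambda>(a, b, c, d). sgn (of_int (a * c)) * sqrt (of_int a * of_int b / (of_int c * of_int d)))"
definition halfcirc :: "mat \<Rightarrow> complex \<Rightarrow> complex" where
  "halfcirc \<gamma> \<tau> = of_real (sgn (perp \<gamma>)) * (\<tau> - of_real (perp \<gamma>)) / (\<tau> + of_real (perp \<gamma>))"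
definition Kof :: "mat \<Rightarrow> int" where "Kof = (\<lambda>(a, b, c, d). \<bar>a * d + b * c\<bar>)"
definition kappa :: "mat \<Rightarrow> real" where
  "kappa = (\<lambda>(a, b, c, d). 1 / \<bar>of_int a * of_int d + of_int b * of_int c + 2 * perp (a, b, c, d) * of_int c * of_int d\<bar>)"

definition generic :: "mat \<Rightarrow> bool" where
  "generic = (\<lambda>(a, b, c, d). a \<noteq> 0 \<and> b \<noteq> 0 \<and> c \<noteq> 0 \<and> d \<noteq> 0)"

lemma Im_complex_of_real_mult: "Im (of_real x * z) = x * Im z"
  by simp

text \<open>The products a d and b c are consecutive integers and neither is 0.\<close>

lemma generic_signs:
  fixes a b c d :: int
  assumes "a * d - b * c = 1" "a \<noteq> 0" "b \<noteq> 0" "c \<noteq> 0" "d \<noteq> 0"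
  shows "0 < (a * d) * (b * c)" "sgn (a * d) = sgn (b * c)"
proof -
  have n: "b * c \<noteq> 0" "a * d \<noteq> 0" using assms by auto
  have e: "a * d = b * c + 1" using assms(1) by simp
  then have "0 < b * c \<or> b * c < -1" using n by linarith
  then show "0 < (a * d) * (b * c)" proof
    assume "0 < b * c" then show ?thesis using e by (intro mult_pos_pos[of "a * d"]) linarith+
  next
    assume "b * c < -1" then show ?thesis using e by (intro mult_neg_neg[of "a * d"]) linarith+
  qed
  then show "sgn (a * d) = sgn (b * c)" by (auto simp: zero_less_mult_iff[of "a * d" "b * c"])
qed

text \<open>The image geodesic ends at a/c and b/d. The square of the radius is the product of these
  end points, which makes the circle about 0 orthogonal to both geodesics. Its sign follows a/c, so
  that a d, b c and \<rho> c d all have the same sign and \<open>kappa\<close> is less than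
  1.\<close>

lemma perp_facts:
  assumes g: "\<gamma> \<in> SL2" "generic \<gamma>" and \<gamma>: "\<gamma> = (a, b, c, d)"
  defines "r \<equiv> perp \<gamma>"
  shows "r \<noteq> 0" "r\<^sup>2 * of_int c * of_int d = of_int a * of_int b"
    "0 < of_int a * of_int d * (r * of_int c * of_int d)"
    "r * of_int c * of_int d * (r * of_int c * of_int d) = of_int a * of_int b * of_int c * of_int d"
proof -
  have nz: "a \<noteq> 0" "b \<noteq> 0" "c \<noteq> 0" "d \<noteq> 0" and dt: "a * d - b * c = 1" using g by (auto simp: \<gamma> generic_def SL2_def)
  have "0 < (a * d) * (b * c)" by (rule generic_signs[OF dt nz])
  then have "0 < (a * b) * (c * d)" by (simp add: mult_ac)
  then have "0 < real_of_int ((a * b) * (c * d))" by (simp only: of_int_0_less_iff)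
  then have p: "0 < (real_of_int a * of_int b) * (of_int c * of_int d)" by simp
  then have q: "0 < real_of_int a * of_int b / (of_int c * of_int d)" by (auto simp: zero_less_mult_iff zero_less_divide_iff)
  have s: "sgn (real_of_int (a * c)) ^ 2 = 1" "sgn (real_of_int (a * c)) \<noteq> 0" using nz by (auto simp: sgn_if)
  have r: "r = sgn (real_of_int (a * c)) * sqrt (of_int a * of_int b / (of_int c * of_int d))" by (simp add: r_def perp_def \<gamma>)
  show "r \<noteq> 0" unfolding r using s(2) real_sqrt_gt_zero[OF q] by (metis less_irrefl mult_eq_0_iff)
  have "r\<^sup>2 = of_int a * of_int b / (of_int c * of_int d)" unfolding r power_mult_distrib s(1) using q by simp
  then show r2: "r\<^sup>2 * of_int c * of_int d = of_int a * of_int b" using nz by simp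
  have "of_int a * of_int d * (r * of_int c * of_int d) = (of_int a * of_int c * sgn (real_of_int (a * c))) * (of_int d * of_int d) * sqrt (of_int a * of_int b / (of_int c * of_int d))"
    unfolding r by (simp add: mult_ac)
  also have "of_int a * of_int c * sgn (real_of_int (a * c)) = \<bar>real_of_int (a * c)\<bar>" by (simp add: sgn_if)
  also have "0 < \<bar>real_of_int (a * c)\<bar> * (of_int d * of_int d) * sqrt (of_int a * of_int b / (of_int c * of_int d))"
    by (intro mult_pos_pos[OF mult_pos_pos real_sqrt_gt_zero[OF q]]) (use nz in \<open>auto simp: zero_less_mult_iff[of "real_of_int d"]\<close>)
  finally show "0 < of_int a * of_int d * (r * of_int c * of_int d)" .
  have "r * of_int c * of_int d * (r * of_int c * of_int d) = (r\<^sup>2 * of_int c * of_int d) * (of_int c * of_int d)"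
    by (simp add: power2_eq_square)
  then show "r * of_int c * of_int d * (r * of_int c * of_int d) = of_int a * of_int b * of_int c * of_int d"
    unfolding r2 by simp
qed

text \<open>\<open>Kof\<close> is the hyperbolic cosine of the distance of the two geodesics and 1 /
  \<open>kappa\<close> is its exponential, because (a d + b c)^2 - 1 = 4 a d b c. The estimates are
  cosh <= exp <= 2 cosh.\<close>

lemma kappa_bounds:
  assumes g: "\<gamma> \<in> SL2" "generic \<gamma>"
  shows "0 < kappa \<gamma>" "real_of_int (Kof \<gamma>) \<le> 1 / kappa \<gamma>" "1 / kappa \<gamma> \<le> 2 * real_of_int (Kof \<gamma>)" "3 \<le> Kof \<gamma>"
proof -
  obtain a b c d where \<gamma>: "\<gamma> = (a, b, c, d)" by (metis prod_cases4)
  have nz: "a \<noteq> 0" "b \<noteq> 0" "c \<noteq> 0" "d \<noteq> 0" and dt: "a * d - b * c = 1" using g by (auto simp: \<gamma> generic_def SL2_def)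
  note P = perp_facts[OF g \<gamma>]
  define t where "t = perp \<gamma> * of_int c * of_int d"
  define u v where "u = real_of_int (a * d)" and "v = real_of_int (b * c)"
  have uv: "0 < u * v" using generic_signs(1)[OF dt nz] unfolding u_def v_def by (metis of_int_0_less_iff of_int_mult)
  have tu: "0 < u * t" using P(3) by (simp add: u_def t_def)
  have tt: "t * t = u * v" using P(4) by (simp add: u_def v_def t_def mult_ac)
  have k: "1 / kappa \<gamma> = \<bar>u + v + 2 * t\<bar>" by (simp add: kappa_def \<gamma> t_def u_def v_def mult.assoc)
  have K: "real_of_int (Kof \<gamma>) = \<bar>u + v\<bar>" by (simp add: Kof_def \<gamma> u_def v_def)
  have abs: "\<bar>u + v\<bar> = \<bar>u\<bar> + \<bar>v\<bar>" "\<bar>u + v + 2 * t\<bar> = \<bar>u\<bar> + \<bar>v\<bar> + 2 * \<bar>t\<bar>"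
    using uv tu by (auto simp: zero_less_mult_iff)
  have "(\<bar>u\<bar> - \<bar>v\<bar>)\<^sup>2 \<ge> 0" by simp
  then have "4 * (u * v) \<le> (\<bar>u\<bar> + \<bar>v\<bar>)\<^sup>2" using uv by (auto simp: power2_eq_square algebra_simps abs_if zero_less_mult_iff split: if_splits)
  then have "(2 * \<bar>t\<bar>)\<^sup>2 \<le> (\<bar>u\<bar> + \<bar>v\<bar>)\<^sup>2" using tt by (simp add: power2_eq_square)
  then have t2: "2 * \<bar>t\<bar> \<le> \<bar>u\<bar> + \<bar>v\<bar>" by (rule power2_le_imp_le) simp
  show "real_of_int (Kof \<gamma>) \<le> 1 / kappa \<gamma>" "1 / kappa \<gamma> \<le> 2 * real_of_int (Kof \<gamma>)" unfolding k K abs using t2 by auto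
  have "a * d = b * c + 1" "b * c \<noteq> 0" "a * d \<noteq> 0" using dt nz by auto
  then have "b * c \<ge> 1 \<or> b * c \<le> -2" by linarith
  then show "3 \<le> Kof \<gamma>" using \<open>a * d = b * c + 1\<close> by (auto simp: Kof_def \<gamma>)
  then have "0 < 1 / kappa \<gamma>" using \<open>real_of_int (Kof \<gamma>) \<le> 1 / kappa \<gamma>\<close> by linarith
  then show "0 < kappa \<gamma>" by simp
qed

lemma halfcirc_upper:
  assumes "\<gamma> \<in> SL2" "generic \<gamma>" "0 < Im \<tau>"
  shows "0 < Im (halfcirc \<gamma> \<tau>)" "\<tau> + of_real (perp \<gamma>) \<noteq> 0"
proof -
  obtain a b c d where \<gamma>: "\<gamma> = (a, b, c, d)" by (metis prod_cases4)
  define r where "r = perp \<gamma>"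
  have r: "r \<noteq> 0" unfolding r_def by (rule perp_facts[OF assms(1,2) \<gamma>])
  show n: "\<tau> + of_real (perp \<gamma>) \<noteq> 0" using assms(3) by (auto simp: complex_eq_iff)
  have "Im ((\<tau> - of_real r) / (\<tau> + of_real r)) = 2 * r * Im \<tau> / norm (\<tau> + of_real r) ^ 2"
    by (simp add: Im_divide cmod_power2 algebra_simps)
  then have "Im (halfcirc \<gamma> \<tau>) = sgn r * (2 * r * Im \<tau> / norm (\<tau> + of_real r) ^ 2)"
    by (simp only: halfcirc_def r_def[symmetric] times_divide_eq_right[symmetric] Im_complex_of_real_mult)
  also have "\<dots> = 2 * \<bar>r\<bar> * Im \<tau> / norm (\<tau> + of_real r) ^ 2" by (simp add: sgn_if)
  finally show "0 < Im (halfcirc \<gamma> \<tau>)" using r assms(3) n by (simp add: r_def)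
qed

lemma norm_halfcirc_imaginary:
  assumes "\<gamma> \<in> SL2" "generic \<gamma>" "0 < Im \<tau>"
  shows "norm (halfcirc \<gamma> \<tau>) = 1 \<longleftrightarrow> Re \<tau> = 0"
proof -
  obtain a b c d where \<gamma>: "\<gamma> = (a, b, c, d)" by (metis prod_cases4)
  define r where "r = perp \<gamma>"
  have r: "r \<noteq> 0" unfolding r_def by (rule perp_facts[OF assms(1,2) \<gamma>])
  have n: "norm (\<tau> + of_real r) \<noteq> 0" using halfcirc_upper(2)[OF assms] by (simp add: r_def)
  have "norm (halfcirc \<gamma> \<tau>) = norm (\<tau> - of_real r) / norm (\<tau> + of_real r)"
    unfolding halfcirc_def r_def[symmetric] using r by (simp add: norm_divide norm_mult sgn_if)
  then have "norm (halfcirc \<gamma> \<tau>) = 1 \<longleftrightarrow> norm (\<tau> - of_real r) = norm (\<tau> + of_real r)" using n by (simp only: divide_eq_1_iff) simp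
  also have "\<dots> \<longleftrightarrow> norm (\<tau> - of_real r) ^ 2 = norm (\<tau> + of_real r) ^ 2" by (simp add: power2_eq_iff_nonneg)
  also have "\<dots> \<longleftrightarrow> Re \<tau> = 0" unfolding cmod_power2 using r by (simp add: power2_eq_square algebra_simps)
  finally show ?thesis .
qed

text \<open>By X' Y = -Y' X, the composition of \<open>halfcirc\<close> with \<gamma> is a Moebius
  map whose zero Y/X and pole -Y/X are opposite reals. So it has modulus |X'/X| exactly on the
  imaginary axis.\<close>

lemma norm_halfcirc_mact:
  assumes g: "\<gamma> \<in> SL2" "generic \<gamma>" and \<tau>: "0 < Im \<tau>"
  shows "norm (halfcirc \<gamma> (mact \<gamma> \<tau>)) = kappa \<gamma> \<longleftrightarrow> Re \<tau> = 0"
proof -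
  obtain a b c d where \<gamma>: "\<gamma> = (a, b, c, d)" by (metis prod_cases4)
  have nz: "a \<noteq> 0" "b \<noteq> 0" "c \<noteq> 0" "d \<noteq> 0" and dt: "a * d - b * c = 1" using g by (auto simp: \<gamma> generic_def SL2_def)
  have dt': "real_of_int a * of_int d - of_int b * of_int c = 1" using dt by (metis of_int_1 of_int_diff of_int_mult)
  define r where "r = perp \<gamma>"
  note P = perp_facts[OF g \<gamma>, folded r_def]
  define X Y X' Y' where "X = of_int a + r * of_int c" and "Y = of_int b + r * of_int d"
    and "X' = of_int a - r * of_int c" and "Y' = of_int b - r * of_int d"
  have XY: "X' * Y = - (Y' * X)" using P(2) by (simp add: X_def Y_def X'_def Y'_def power2_eq_square algebra_simps)
  have dX: "of_int d * (X * X') = of_int a"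
  proof -
    have "of_int d * (X * X') = of_int a * (of_int a * of_int d) - (r\<^sup>2 * of_int c * of_int d) * of_int c"
      by (simp add: X_def X'_def power2_eq_square algebra_simps)
    also have "\<dots> = of_int a * (of_int a * of_int d - of_int b * of_int c)" unfolding P(2) by (simp add: algebra_simps)
    finally show ?thesis using dt' by simp
  qed
  have X: "X \<noteq> 0" "X' \<noteq> 0" using dX nz by auto
  have bY: "of_int c * (Y * Y') = - of_int b"
  proof -
    have "of_int c * (Y * Y') = of_int b * (of_int b * of_int c) - (r\<^sup>2 * of_int c * of_int d) * of_int d"
      by (simp add: Y_def Y'_def power2_eq_square algebra_simps)
    also have "\<dots> = - (of_int b * (of_int a * of_int d - of_int b * of_int c))" unfolding P(2) by (simp add: algebra_simps)
    finally show ?thesis using dt' by simp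
  qed
  have Y: "Y \<noteq> 0" using bY nz by auto
  have kap: "\<bar>X' / X\<bar> = kappa \<gamma>"
  proof -
    have "of_int a * X = X' * (of_int d * X\<^sup>2)" using dX by (simp add: power2_eq_square mult_ac)
    also have "of_int d * X\<^sup>2 = of_int a * (of_int a * of_int d + of_int b * of_int c + 2 * r * of_int c * of_int d)"
    proof -
      have "of_int d * X\<^sup>2 = of_int a * (of_int a * of_int d) + 2 * (of_int a * (r * of_int c * of_int d)) + (r\<^sup>2 * of_int c * of_int d) * of_int c"
        by (simp add: X_def power2_eq_square algebra_simps)
      then show ?thesis unfolding P(2) by (simp add: algebra_simps)
    qed
    finally have "X = X' * (of_int a * of_int d + of_int b * of_int c + 2 * r * of_int c * of_int d)" using nz by simp
    then have "X' / X = 1 / (of_int a * of_int d + of_int b * of_int c + 2 * r * of_int c * of_int d)" using X by (metis divide_divide_eq_left divide_self mult.commute)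
    then show ?thesis by (simp add: kappa_def \<gamma> r_def)
  qed
  define j where "j = of_int c * \<tau> + of_int d"
  have j: "j \<noteq> 0" using autf_nz[OF g(1), of \<tau>] \<tau> by (simp add: j_def \<gamma> autf_def)
  have m: "mact \<gamma> \<tau> = (of_int a * \<tau> + of_int b) / j" by (simp add: mact_def \<gamma> j_def)
  have "mact \<gamma> \<tau> - of_real r = (of_real X' * \<tau> + of_real Y') / j" "mact \<gamma> \<tau> + of_real r = (of_real X * \<tau> + of_real Y) / j"
    unfolding m using j by (simp_all add: j_def X_def Y_def X'_def Y'_def field_simps)
  then have "halfcirc \<gamma> (mact \<gamma> \<tau>) = of_real (sgn r) * (of_real X' * \<tau> + of_real Y') / (of_real X * \<tau> + of_real Y)"
    unfolding halfcirc_def r_def[symmetric] using j by simp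
  moreover have "of_real X' * \<tau> + of_real Y' = of_real (X' / X) * (of_real X * \<tau> - of_real Y)"
  proof -
    have "Y' = - (X' / X) * Y" using XY X by (simp add: field_simps)
    then show ?thesis using X by (simp add: algebra_simps)
  qed
  ultimately have "norm (halfcirc \<gamma> (mact \<gamma> \<tau>)) = \<bar>X' / X\<bar> * (norm (of_real X * \<tau> - of_real Y) / norm (of_real X * \<tau> + of_real Y))"
    using P(1) by (simp add: norm_mult norm_divide sgn_if)
  then have eq: "norm (halfcirc \<gamma> (mact \<gamma> \<tau>)) = kappa \<gamma> * (norm (of_real X * \<tau> - of_real Y) / norm (of_real X * \<tau> + of_real Y))"
    unfolding kap .
  have "of_real X * \<tau> + of_real Y \<noteq> 0" using X \<tau> by (auto simp: complex_eq_iff)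
  then have "norm (halfcirc \<gamma> (mact \<gamma> \<tau>)) = kappa \<gamma> \<longleftrightarrow> norm (of_real X * \<tau> - of_real Y) = norm (of_real X * \<tau> + of_real Y)"
    unfolding eq using kappa_bounds(1)[OF g] by (simp add: field_simps)
  also have "\<dots> \<longleftrightarrow> norm (of_real X * \<tau> - of_real Y) ^ 2 = norm (of_real X * \<tau> + of_real Y) ^ 2" by (simp add: power2_eq_iff_nonneg)
  also have "\<dots> \<longleftrightarrow> Re \<tau> = 0" unfolding cmod_power2 using X Y by (simp add: power2_eq_square algebra_simps)
  finally show ?thesis .
qed

lemma geodesic_distance_bound:
  assumes g: "\<gamma> \<in> SL2" "generic \<gamma>" and z: "Re z0 < Re z1" "Im z0 < Im z1"
    and cont: "continuous_on (cbox z0 z1) \<tau>" and hol: "\<tau> holomorphic_on box z0 z1"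
    and up: "\<And>w. w \<in> cbox z0 z1 \<Longrightarrow> 0 < Im (\<tau> w)"
    and bot: "\<And>x. Re z0 < x \<Longrightarrow> x < Re z1 \<Longrightarrow> Re (\<tau> (Complex x (Im z0))) = 0"
    and top: "\<And>x. Re z0 < x \<Longrightarrow> x < Re z1 \<Longrightarrow> \<exists>v. 0 < Im v \<and> Re v = 0 \<and> \<tau> (Complex x (Im z1)) = mact \<gamma> v"
  shows "ln (of_int (Kof \<gamma>)) * (Re z1 - Re z0) \<le> pi * (Im z1 - Im z0)"
proof -
  define G where "G = (\<lambda>w. Ln (halfcirc \<gamma> (\<tau> w)))"
  have hc: "0 < Im (halfcirc \<gamma> (\<tau> w))" "\<tau> w + of_real (perp \<gamma>) \<noteq> 0" if "w \<in> cbox z0 z1" for w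
    using halfcirc_upper[OF g up[OF that]] by auto
  have np: "halfcirc \<gamma> (\<tau> w) \<notin> \<real>\<^sub>\<le>\<^sub>0" "halfcirc \<gamma> (\<tau> w) \<noteq> 0" if "w \<in> cbox z0 z1" for w
    using hc(1)[OF that] by (auto simp: complex_nonpos_Reals_iff)
  have "continuous_on (cbox z0 z1) (\<lambda>w. halfcirc \<gamma> (\<tau> w))"
    unfolding halfcirc_def using hc(2) by (intro continuous_intros cont) auto
  then have cG: "continuous_on (cbox z0 z1) G" unfolding G_def using np by (intro continuous_on_Ln') auto
  have sub: "box z0 z1 \<subseteq> cbox z0 z1" by (rule box_subset_cbox)
  have "(\<lambda>w. halfcirc \<gamma> (\<tau> w)) holomorphic_on box z0 z1"
    unfolding halfcirc_def using hc(2) sub by (intro holomorphic_intros hol) auto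
  then have hG: "G holomorphic_on box z0 z1" unfolding G_def using np sub by (intro holomorphic_on_Ln') auto
  have "- ln (kappa \<gamma>) * (Re z1 - Re z0) \<le> pi * (Im z1 - Im z0)"
  proof (rule rectangle_flux[OF z cG hG])
    fix x assume x: "Re z0 < x" "x < Re z1"
    have b: "Complex x (Im z0) \<in> cbox z0 z1" "Complex x (Im z1) \<in> cbox z0 z1" using x z by (auto simp: in_cbox_complex_iff)
    have "norm (halfcirc \<gamma> (\<tau> (Complex x (Im z0)))) = 1"
      using norm_halfcirc_imaginary[OF g up[OF b(1)]] bot[OF x] by simp
    then show "Re (G (Complex x (Im z0))) = 0" using np(2)[OF b(1)] by (simp add: G_def Re_Ln)
    obtain v where v: "0 < Im v" "Re v = 0" "\<tau> (Complex x (Im z1)) = mact \<gamma> v" using top[OF x] by blast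
    have "norm (halfcirc \<gamma> (\<tau> (Complex x (Im z1)))) = kappa \<gamma>"
      unfolding v(3) using norm_halfcirc_mact[OF g v(1)] v(2) by simp
    then show "Re (G (Complex x (Im z1))) = - (- ln (kappa \<gamma>))" using np(2)[OF b(2)] by (simp add: G_def Re_Ln)
  next
    fix w assume w: "w \<in> cbox z0 z1"
    show "0 \<le> Im (G w) \<and> Im (G w) \<le> pi" using Im_Ln_pos_lt_imp[OF hc(1)[OF w]] by (simp add: G_def)
  qed
  moreover have "ln (of_int (Kof \<gamma>)) \<le> - ln (kappa \<gamma>)"
  proof -
    have "ln (of_int (Kof \<gamma>)) \<le> ln (1 / kappa \<gamma>)" using kappa_bounds[OF g] by (intro ln_mono) auto
    then show ?thesis using kappa_bounds(1)[OF g] by (simp add: ln_div)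
  qed
  ultimately show ?thesis using mult_right_mono[of "ln (of_int (Kof \<gamma>))" "- ln (kappa \<gamma>)" "Re z1 - Re z0"] z by linarith
qed

section \<open>The lower bound\<close>

text \<open>Subtracting the equations at z and w and dividing by z - w expresses the difference
  quotient of the root through those of the coefficients. The denominator \<open>K\<close> tends to
  the derivative of the cubic at the root, nonzero by simplicity.\<close>

lemma holomorphic_simple_root:
  fixes A B C x :: "complex \<Rightarrow> complex"
  assumes S: "open S" and hol: "A holomorphic_on S" "B holomorphic_on S" "C holomorphic_on S"
    and x: "continuous_on S x"
    and root: "\<And>z. z \<in> S \<Longrightarrow> x z ^ 3 + A z * x z ^ 2 + B z * x z + C z = 0"
    and simple: "\<And>z. z \<in> S \<Longrightarrow> 3 * x z ^ 2 + 2 * A z * x z + B z \<noteq> 0"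
  shows "x holomorphic_on S"
proof -
  have "x field_differentiable (at w)" if w: "w \<in> S" for w
  proof -
    define K where "K = (\<lambda>z. x z ^ 2 + x z * x w + x w ^ 2 + A z * (x z + x w) + B z)"
    have cont: "isCont g w" if "continuous_on S g" for g :: "complex \<Rightarrow> complex"
      using that S w by (simp add: continuous_on_eq_continuous_at)
    have "isCont K w" unfolding K_def
      by (intro continuous_intros cont x holomorphic_on_imp_continuous_on hol)
    then have K: "(K \<longlongrightarrow> K w) (at w)" by (simp add: isCont_def)
    have Kw: "K w \<noteq> 0" using simple[OF w] by (simp add: K_def power2_eq_square algebra_simps)
    have d: "(g has_field_derivative deriv g w) (at w)" if "g holomorphic_on S" for g
      using that S w by (rule holomorphic_derivI)
    define N where "N = (\<lambda>z. (A z - A w) / (z - w) * x w ^ 2 + (B z - B w) / (z - w) * x w + (C z - C w) / (z - w))"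
    have N: "(N \<longlongrightarrow> deriv A w * x w ^ 2 + deriv B w * x w + deriv C w) (at w)"
      unfolding N_def using d[OF hol(1)] d[OF hol(2)] d[OF hol(3)]
      by (intro tendsto_intros) (simp_all add: has_field_derivative_iff)
    have lim: "((\<lambda>z. - N z / K z) \<longlongrightarrow> - (deriv A w * x w ^ 2 + deriv B w * x w + deriv C w) / K w) (at w)"
      by (intro tendsto_intros N K Kw)
    have ev1: "\<forall>\<^sub>F z in at w. K z \<noteq> 0" using K Kw by (rule tendsto_imp_eventually_ne)
    have ev2: "\<forall>\<^sub>F z in at w. z \<in> S - {w}" using S w by (rule eventually_at_in_open)
    have "\<forall>\<^sub>F z in at w. - N z / K z = (x z - x w) / (z - w)"
      using ev1 ev2
    proof eventually_elim
      case (elim z)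
      then have zw: "z - w \<noteq> 0" "z \<in> S" by auto
      have "(x z - x w) * K z + ((A z - A w) * x w ^ 2 + (B z - B w) * x w + (C z - C w))
          = (x z ^ 3 + A z * x z ^ 2 + B z * x z + C z) - (x w ^ 3 + A w * x w ^ 2 + B w * x w + C w)"
        by (simp add: K_def power2_eq_square power3_eq_cube algebra_simps)
      also have "\<dots> = 0" using root[OF w] root[OF zw(2)] by simp
      finally have 1: "(x z - x w) * K z = - ((A z - A w) * x w ^ 2 + (B z - B w) * x w + (C z - C w))"
        by (rule eq_neg_iff_add_eq_0[THEN iffD2])
      have 2: "N z * (z - w) = (A z - A w) * x w ^ 2 + (B z - B w) * x w + (C z - C w)"
      proof -
        have "p / (z - w) * m * (z - w) = p * m" "p / (z - w) * (z - w) = p" for p m using zw(1) by simp_all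
        then show ?thesis unfolding N_def distrib_right by simp
      qed
      have "(x z - x w) * K z = - N z * (z - w)" using 1 2 by simp
      then show ?case using zw elim by (simp add: field_simps)
    qed
    then have "((\<lambda>z. (x z - x w) / (z - w)) \<longlongrightarrow> - (deriv A w * x w ^ 2 + deriv B w * x w + deriv C w) / K w) (at w)"
      by (rule Lim_transform_eventually[OF lim])
    then show ?thesis by (auto simp: field_differentiable_def has_field_derivative_iff)
  qed
  then show ?thesis by (auto simp: holomorphic_on_def intro: field_differentiable_at_within)
qed

text \<open>Equal ratios mean proportional root triples, with a factor k close to 1 near \<tau>0.
  The points (0, 1, \<tau>) and (0, k, \<tau>') then lie over one configuration and in one wandering
  neighbourhood, so they coincide.\<close>

lemma root_ratio_locally_injective:
  assumes t: "0 < Im \<tau>0"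
  obtains U where "open U" "\<tau>0 \<in> U" "U \<subseteq> {\<tau>. 0 < Im \<tau>}" "inj_on (\<lambda>\<tau>. rootb \<tau> / roota \<tau>) U"
proof -
  have "(0, 1, \<tau>0) \<in> Xs" using t by (simp add: Xs_def)
  then obtain V where V: "open V" "(0, 1, \<tau>0) \<in> V" "V \<subseteq> Xs"
    and act: "\<And>\<gamma> x y. \<gamma> \<in> SL2 \<Longrightarrow> x \<in> V \<Longrightarrow> act \<gamma> x \<in> V \<Longrightarrow> act \<gamma> y = y" by (rule act_wandering) (rule that; assumption)
  let ?H = "{\<tau>. 0 < Im \<tau>}"
  have oH: "open ?H" by (intro open_Collect_less continuous_intros)
  have nz: "roota \<tau> \<noteq> 0" if "\<tau> \<in> ?H" for \<tau> using roots_distinct[of \<tau>] that by auto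
  have ca: "continuous_on ?H roota" by (intro holomorphic_on_imp_continuous_on roota_holomorphic)
  let ?g = "\<lambda>p. (0 :: complex, roota (fst p) / roota (snd p), snd p)"
  have "continuous_on (?H \<times> ?H) ?g"
    by (intro continuous_intros continuous_on_compose2[OF ca]) (use nz in auto)
  then have "open ((?H \<times> ?H) \<inter> ?g -` V)" using open_Times[OF oH oH] V(1) by (rule continuous_open_preimage)
  moreover have "(\<tau>0, \<tau>0) \<in> (?H \<times> ?H) \<inter> ?g -` V" using t V(2) nz by simp
  ultimately obtain A B where "open A" "open B" "(\<tau>0, \<tau>0) \<in> A \<times> B" and "A \<times> B \<subseteq> (?H \<times> ?H) \<inter> ?g -` V"
    by (rule open_prod_elim)
  then have AB: "open A" "open B" "\<tau>0 \<in> A" "\<tau>0 \<in> B" "A \<times> B \<subseteq> (?H \<times> ?H) \<inter> ?g -` V" by simp_all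
  have sub: "A \<inter> B \<subseteq> ?H" using AB by blast
  have "inj_on (\<lambda>\<tau>. rootb \<tau> / roota \<tau>) (A \<inter> B)"
  proof (rule inj_onI)
    fix \<tau> \<tau>' assume in1: "\<tau> \<in> A \<inter> B" and in2: "\<tau>' \<in> A \<inter> B" and eq: "rootb \<tau> / roota \<tau> = rootb \<tau>' / roota \<tau>'"
    have n: "roota \<tau> \<noteq> 0" "roota \<tau>' \<noteq> 0" using nz in1 in2 sub by auto
    have v: "?g (\<tau>, \<tau>) \<in> V" "?g (\<tau>, \<tau>') \<in> V" using AB(5) in1 in2 by blast+
    define k where "k = roota \<tau> / roota \<tau>'"
    have "roota \<tau> = k * roota \<tau>'" "rootb \<tau> = k * rootb \<tau>'" using n eq by (simp_all add: k_def field_simps)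
    then have "e1 \<tau> = k * e1 \<tau>'" "e2 \<tau> = k * e2 \<tau>'" "e3 \<tau> = k * e3 \<tau>'"
      by (simp_all add: e1_def e2_def e3_def field_simps)
    then have "cubic (0, 1, \<tau>) = cubic (0, k, \<tau>')" by (simp add: cubic_eq)
    moreover have "(0, 1, \<tau>) \<in> V" "(0, k, \<tau>') \<in> V" using v n by (auto simp: k_def)
    ultimately obtain \<gamma> where g: "\<gamma> \<in> SL2" "(0, k, \<tau>') = act \<gamma> (0, 1, \<tau>)" using cubic_fibre_act V(3) by (metis subsetD)
    have "act \<gamma> (0, 1, \<tau>) = (0, 1, \<tau>)"
      by (rule act[OF g(1) \<open>(0, 1, \<tau>) \<in> V\<close>]) (use g(2) \<open>(0, k, \<tau>') \<in> V\<close> in simp)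
    then have "(0, k, \<tau>') = (0, 1, \<tau>)" using g(2) by simp
    then show "\<tau> = \<tau>'" by simp
  qed
  then show ?thesis using that[of "A \<inter> B"] AB sub by blast
qed

text \<open>No derivative of the covering map is computed: the three roots are holomorphic because
  they are continuous and simple, their ratio is lambda of the period ratio, and lambda has local
  holomorphic inverses.\<close>

lemma lift_holomorphic:
  assumes S: "open S" and hol: "(\<lambda>z. fst (f z)) holomorphic_on S" "(\<lambda>z. fst (snd (f z))) holomorphic_on S" "(\<lambda>z. snd (snd (f z))) holomorphic_on S"
    and F: "continuous_on S F" "F \<in> S \<rightarrow> Xs" and cF: "\<And>z. z \<in> S \<Longrightarrow> cubic (F z) = f z"
  shows "(\<lambda>z. snd (snd (F z))) holomorphic_on S"
proof -
  define \<tau> c \<alpha> where "\<tau> = (\<lambda>z. snd (snd (F z)))" and "c = (\<lambda>z. fst (snd (F z)))" and "\<alpha> = (\<lambda>z. fst (F z))"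
  have X: "c z \<noteq> 0" "0 < Im (\<tau> z)" if "z \<in> S" for z using F(2) that by (auto simp: Xs_def \<tau>_def c_def)
  have Fe: "F z = (\<alpha> z, c z, \<tau> z)" for z by (simp add: \<tau>_def c_def \<alpha>_def)
  have cont: "continuous_on S \<tau>" "continuous_on S c" "continuous_on S \<alpha>"
    unfolding \<tau>_def c_def \<alpha>_def by (intro continuous_intros F)+
  define X where "X = (\<lambda>e z. \<alpha> z + c z * e (\<tau> z))"
  have ce: "continuous_on S (\<lambda>z. e (\<tau> z))" if "e holomorphic_on {\<tau>. 0 < Im \<tau>}" for e
    by (rule continuous_on_compose2[OF holomorphic_on_imp_continuous_on[OF that] cont(1)]) (use X in auto)
  have poly: "(t - X e1 z) * (t - X e2 z) * (t - X e3 z) = t ^ 3 + fst (f z) * t ^ 2 + fst (snd (f z)) * t + snd (snd (f z))" if "z \<in> S" for z t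
    by (rule vieta_poly) (use cF[OF that] in \<open>simp add: Fe cubic_eq X_def\<close>)
  have der: "(X e1 z - X e2 z) * (X e1 z - X e3 z) \<noteq> 0" "(X e2 z - X e1 z) * (X e2 z - X e3 z) \<noteq> 0"
    "(X e3 z - X e1 z) * (X e3 z - X e2 z) \<noteq> 0" if "z \<in> S" for z
    using e_distinct[of "\<tau> z"] X[OF that] by (auto simp: X_def)
  have co: "vieta (X e1 z) (X e2 z) (X e3 z) = f z" if "z \<in> S" for z using cF[OF that] by (simp add: Fe cubic_eq X_def)
  have co: "fst (f z) = - (X e1 z + X e2 z + X e3 z)" "fst (snd (f z)) = X e1 z * X e2 z + X e1 z * X e3 z + X e2 z * X e3 z" if "z \<in> S" for z
    by (simp_all flip: co[OF that] add: vieta_def)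
  have hX: "X e holomorphic_on S" if e: "e = e1 \<or> e = e2 \<or> e = e3" for e
  proof (rule holomorphic_simple_root[OF S hol])
    have "e holomorphic_on {\<tau>. 0 < Im \<tau>}" using e e_holomorphic by auto
    then show "continuous_on S (X e)" unfolding X_def by (intro continuous_intros cont ce)
  next
    fix z assume z: "z \<in> S"
    show "X e z ^ 3 + fst (f z) * X e z ^ 2 + fst (snd (f z)) * X e z + snd (snd (f z)) = 0"
      using poly[OF z, of "X e z"] e by auto
    have "3 * X e z ^ 2 + 2 * fst (f z) * X e z + fst (snd (f z)) =
      (if e = e1 then (X e1 z - X e2 z) * (X e1 z - X e3 z) else if e = e2 then (X e2 z - X e1 z) * (X e2 z - X e3 z) else (X e3 z - X e1 z) * (X e3 z - X e2 z))"
      unfolding co[OF z] using e by (auto simp: power2_eq_square algebra_simps)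
    then show "3 * X e z ^ 2 + 2 * fst (f z) * X e z + fst (snd (f z)) \<noteq> 0" using der[OF z] by auto
  qed
  define L where "L = (\<lambda>\<tau>. rootb \<tau> / roota \<tau>)"
  have "(\<lambda>z. (X e2 z - X e1 z) / (X e3 z - X e1 z)) holomorphic_on S"
    by (intro holomorphic_intros hX) (use der in auto)
  moreover have "(X e2 z - X e1 z) / (X e3 z - X e1 z) = L (\<tau> z)" if "z \<in> S" for z
  proof -
    have "X e2 z - X e1 z = c z * rootb (\<tau> z)" "X e3 z - X e1 z = c z * roota (\<tau> z)"
      by (simp_all add: X_def e1_def e2_def e3_def field_simps)
    then show ?thesis using X[OF that] by (simp add: L_def)
  qed
  ultimately have hL: "(\<lambda>z. L (\<tau> z)) holomorphic_on S" by (rule holomorphic_transform)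
  have "\<tau> field_differentiable (at w)" if w: "w \<in> S" for w
  proof -
    obtain U where U: "open U" "\<tau> w \<in> U" "U \<subseteq> {\<tau>. 0 < Im \<tau>}" "inj_on L U"
      using root_ratio_locally_injective[OF X(2)[OF w]] unfolding L_def by blast
    have "L holomorphic_on U" unfolding L_def
      by (intro holomorphic_intros holomorphic_on_subset[OF roota_holomorphic U(3)] holomorphic_on_subset[OF rootb_holomorphic U(3)])
        (use roots_distinct U(3) in force)
    then obtain g where g: "g holomorphic_on L ` U" "\<And>z. z \<in> U \<Longrightarrow> g (L z) = z"
      using holomorphic_has_inverse[OF _ U(1,4)] by metis
    define T where "T = S \<inter> \<tau> -` U"
    have T: "open T" "w \<in> T" using continuous_open_preimage[OF cont(1) S U(1)] w U(2) by (auto simp: T_def)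
    have "(g \<circ> (\<lambda>z. L (\<tau> z))) holomorphic_on T"
      by (rule holomorphic_on_compose_gen[OF holomorphic_on_subset[OF hL] g(1)]) (auto simp: T_def)
    then have "\<tau> holomorphic_on T" by (rule holomorphic_transform) (use g(2) in \<open>auto simp: T_def\<close>)
    then show ?thesis using T by (simp add: holomorphic_on_imp_differentiable_at)
  qed
  then have "\<tau> holomorphic_on S" by (auto simp: holomorphic_on_def intro: field_differentiable_at_within)
  then show ?thesis by (simp add: \<tau>_def)
qed

text \<open>Along the bottom side the lift coincides with the real section by uniqueness of lifts.
  On one vertical segment the homotopy to the braid lifts and shows that the upper end lies on the
  \<gamma>-translate of the section; uniqueness along the top side spreads this to the whole
  side.\<close>

lemma lower_bound:
  assumes rep: "holo_rect_represents z0 z1 f \<rho>" and mon: "Mon \<rho> \<gamma>" and gen: "generic \<gamma>"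
  shows "ln (of_int (Kof \<gamma>)) / pi \<le> (Im z1 - Im z0) / (Re z1 - Re z0)"
proof -
  have z: "Re z0 < Re z1" "Im z0 < Im z1" and hol: "(\<lambda>z. fst (f z)) holomorphic_on box z0 z1"
     "(\<lambda>z. fst (snd (f z))) holomorphic_on box z0 z1" "(\<lambda>z. snd (snd (f z))) holomorphic_on box z0 z1"
    and fE: "\<And>x. Re z0 < x \<Longrightarrow> x < Re z1 \<Longrightarrow> f (Complex x (Im z0)) \<in> Etr \<and> f (Complex x (Im z1)) \<in> Etr"
    and fv: "\<And>x. Re z0 < x \<Longrightarrow> x < Re z1 \<Longrightarrow> represents_path (\<lambda>t. f (Complex x (Im z0 + t * (Im z1 - Im z0)))) \<rho>"
    using rep by (auto simp: holo_rect_represents_def rect_represents_def)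
  have "box z0 z1 \<noteq> {}" using z by (auto simp: box_ne_empty Basis_complex_def)
  then have cb: "closure (box z0 z1) = cbox z0 z1" by (rule closure_box)
  have cf: "continuous_on (cbox z0 z1) f" and fC: "f \<in> cbox z0 z1 \<rightarrow> Conf3"
    using rep by (auto simp: holo_rect_represents_def rect_represents_def cb)
  obtain s where s: "continuous_on Etr s" and sE: "\<And>p. p \<in> Etr \<Longrightarrow> s p \<in> E0" "\<And>p. p \<in> Etr \<Longrightarrow> cubic (s p) = p"
    and sc: "\<And>x. x \<in> E0 \<Longrightarrow> s (cubic x) = x" using Etr_section by metis
  have sX: "s p \<in> Xs" if "p \<in> Etr" for p using sE(1)[OF that] E0_Xs by blast
  define xm where "xm = (Re z0 + Re z1) / 2"
  have xm: "Re z0 < xm" "xm < Re z1" using z by (auto simp: xm_def)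
  define P where "P = Complex xm (Im z0)"
  have bR: "Complex x (Im z0) \<in> cbox z0 z1" "Complex x (Im z1) \<in> cbox z0 z1" if "Re z0 < x" "x < Re z1" for x
    using that z by (auto simp: in_cbox_complex_iff)
  have sPX: "s (f P) \<in> Xs" using sX fE[OF xm] by (simp add: P_def)
  obtain F where F: "continuous_on (cbox z0 z1) F" "F \<in> cbox z0 z1 \<rightarrow> Xs" "F P = s (f P)" "\<And>y. y \<in> cbox z0 z1 \<Longrightarrow> cubic (F y) = f y"
  proof (rule covering_space_lift_strong[OF covering_cubic sPX _ _ _ cf fC])
    fix g assume "continuous_on (cbox z0 z1) g" "g \<in> cbox z0 z1 \<rightarrow> Xs" "g P = s (f P)" "\<And>y. y \<in> cbox z0 z1 \<Longrightarrow> cubic (g y) = f y"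
    then show thesis by (rule that)
  next
    show "P \<in> cbox z0 z1" using bR[OF xm] by (simp add: P_def)
    show "simply_connected (cbox z0 z1)" by (rule convex_imp_simply_connected) (rule convex_box)
    show "locally path_connected (cbox z0 z1)" by (rule convex_imp_locally_path_connected) (rule convex_box)
    show "f P = cubic (s (f P))" using sE(2) fE[OF xm] by (simp add: P_def)
  qed
  let ?I = "{Re z0<..<Re z1}"
  have cT: "continuous_on ?I (\<lambda>x. Complex x y)" for y by (auto intro!: continuous_intros simp: Complex_eq)
  have uniq: "F (Complex x y) = G x" if y: "y = Im z0 \<or> y = Im z1" and x: "x \<in> ?I" and m: "F (Complex xm y) = G xm"
    and G: "continuous_on ?I G" "G \<in> ?I \<rightarrow> Xs" "\<And>x. x \<in> ?I \<Longrightarrow> cubic (G x) = f (Complex x y)" for x y G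
  proof (rule covering_space_lift_unique[OF covering_cubic, of "\<lambda>x. F (Complex x y)" xm G ?I "\<lambda>x. f (Complex x y)" x])
    have b: "Complex x y \<in> cbox z0 z1" if "x \<in> ?I" for x using y bR that by auto
    show "continuous_on ?I (\<lambda>x. f (Complex x y))" by (rule continuous_on_compose2[OF cf cT]) (use b in auto)
    show "(\<lambda>x. f (Complex x y)) \<in> ?I \<rightarrow> Conf3" using fC b by blast
    show "continuous_on ?I (\<lambda>x. F (Complex x y))" by (rule continuous_on_compose2[OF F(1) cT]) (use b in auto)
    show "(\<lambda>x. F (Complex x y)) \<in> ?I \<rightarrow> Xs" using F(2) b by blast
    show "f (Complex x y) = cubic (F (Complex x y))" if "x \<in> ?I" for x using F(4) b[OF that] by simp
  qed (use m G x xm in auto)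
  have cs: "continuous_on ?I (\<lambda>x. s (f (Complex x y)))" if y: "y = Im z0 \<or> y = Im z1" for y
  proof (rule continuous_on_compose2[OF s])
    show "continuous_on ?I (\<lambda>x. f (Complex x y))" by (rule continuous_on_compose2[OF cf cT]) (use bR y in auto)
  qed (use fE y in auto)
  have bottom: "F (Complex x (Im z0)) = s (f (Complex x (Im z0)))" if "x \<in> ?I" for x
    by (rule uniq[of "Im z0" x "\<lambda>x. s (f (Complex x (Im z0)))", OF _ that]) (use F(3) cs fE sE sX in \<open>auto simp: P_def\<close>)
  have g: "\<gamma> \<in> SL2" using mon by (simp add: Mon_def)
  define v where "v = (\<lambda>t. f (Complex xm (Im z0 + t * (Im z1 - Im z0))))"
  have rp: "represents_path v \<rho>" unfolding v_def by (rule fv[OF xm])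
  then obtain \<alpha> \<beta> where ab: "path \<alpha>" "path_image \<alpha> \<subseteq> Etr" "path \<beta>" "path_image \<beta> \<subseteq> Etr" "pathstart \<alpha> = pathstart v"
    "pathfinish \<alpha> = pathstart \<rho>" "pathstart \<beta> = pathfinish \<rho>" "pathfinish \<beta> = pathfinish v" "homotopic_paths Conf3 v (\<alpha> +++ \<rho> +++ \<beta>)"
    unfolding represents_path_def by blast
  obtain h u where h: "path h" "path_image h \<subseteq> Xu" "pathstart h = x0" "pathfinish h = (2, u, mact \<gamma> \<i>)"
       "exp u = of_real c0 / autf \<gamma> \<i> ^ 2" "homotopic_paths Conf3 (cubu \<circ> h) \<rho>" and \<rho>: "pathstart \<rho> = base_cfg" "pathfinish \<rho> = base_cfg"
    using mon by (auto simp: Mon_def)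
  have b0: "(2, of_real c0, \<i>) \<in> E0" 
  proof -
    have "(2, of_real c0, \<i>) = (of_real 2, of_real c0, \<i> * of_real 1)" by simp
    then show ?thesis unfolding E0_def using c0_pos zero_less_one by blast
  qed
  have ex0: "expc x0 = (2, of_real c0, \<i>)" by (simp add: expc_def x0_def exp_ln_c0)
  have sb: "s base_cfg = (2, of_real c0, \<i>)" using sc[OF b0] cubu_x0 by (simp add: cubu_def ex0)
  have EC: "Etr \<subseteq> Conf3" unfolding Etr_def Conf3_def by fastforce
  let ?V = "\<lambda>t. F (Complex xm (Im z0 + t * (Im z1 - Im z0)))"
  \<comment> \<open>The lift of the detour through the base point: the section over \<alpha>, the
    monodromy lift of the braid, and the \<gamma>-translate of the section over \<beta>.\<close>
  define h2 where "h2 = (s \<circ> \<alpha>) +++ (expc \<circ> h) +++ (act \<gamma> \<circ> s \<circ> \<beta>)"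
  let ?g2 = "\<alpha> +++ (cubu \<circ> h) +++ \<beta>"
  have p\<alpha>: "path (s \<circ> \<alpha>)" by (rule path_continuous_image[OF ab(1) continuous_on_subset[OF s ab(2)]])
  have ph: "path (expc \<circ> h)" by (rule path_continuous_image[OF h(1) continuous_expc])
  have p\<beta>: "path (act \<gamma> \<circ> s \<circ> \<beta>)"
  proof -
    have "continuous_on Etr (\<lambda>p. act \<gamma> (s p))" by (rule continuous_on_compose2[OF continuous_act[OF g] s]) (use sX in auto)
    then have "path ((\<lambda>p. act \<gamma> (s p)) \<circ> \<beta>)" by (rule path_continuous_image[OF ab(3) continuous_on_subset[OF _ ab(4)]])
    then show ?thesis by (simp add: o_def)
  qed
  have j1: "pathfinish (s \<circ> \<alpha>) = pathstart (expc \<circ> h)" using ab(6) \<rho> h(3) sb ex0 by (simp add: pathfinish_compose pathstart_compose)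
  have j2: "pathfinish (expc \<circ> h) = pathstart (act \<gamma> \<circ> s \<circ> \<beta>)" using ab(7) \<rho> h(4,5) sb
    by (simp add: pathfinish_compose pathstart_compose o_assoc[symmetric] expc_def act_def)
  have hc: "homotopic_paths Conf3 v ?g2"
  proof (rule homotopic_paths_trans[OF ab(9)])
    have "homotopic_paths Conf3 \<rho> (cubu \<circ> h)" using h(6) by (rule homotopic_paths_sym)
    moreover have "homotopic_paths Conf3 \<alpha> \<alpha>" "homotopic_paths Conf3 \<beta> \<beta>" using ab EC by auto
    ultimately show "homotopic_paths Conf3 (\<alpha> +++ \<rho> +++ \<beta>) ?g2" using ab \<rho> by (intro homotopic_paths_join) auto
  qed
  have inR: "Complex xm (Im z0 + t * (Im z1 - Im z0)) \<in> cbox z0 z1" if "t \<in> {0..1}" for t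
  proof -
    have "0 \<le> t * (Im z1 - Im z0)" "t * (Im z1 - Im z0) \<le> 1 * (Im z1 - Im z0)" using that z by (auto intro!: mult_right_mono)
    then show ?thesis using xm by (simp add: in_cbox_complex_iff)
  qed
  have pV: "path ?V" unfolding path_def
    by (rule continuous_on_compose2[OF F(1)]) (use inR in \<open>auto intro!: continuous_intros simp: Complex_eq\<close>)
  have "homotopic_paths Xs ?V h2"
  proof (rule covering_space_lift_homotopic_paths[OF covering_cubic _ _ _ _ hc])
    show "path v" "path_image v \<subseteq> Conf3" "path ?g2" "path_image ?g2 \<subseteq> Conf3"
      using homotopic_paths_imp_path[OF hc] homotopic_paths_imp_subset[OF hc] by auto
    show "path ?V" by (rule pV)
    show "path_image ?V \<subseteq> Xs" using F(2) inR by (auto simp: path_image_def)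
    show "cubic (?V t) = v t" if "t \<in> {0..1}" for t using F(4)[OF inR[OF that]] by (simp add: v_def)
    show "path h2" unfolding h2_def using p\<alpha> ph p\<beta> j1 j2 by auto
    have sub: "path_image (s \<circ> \<alpha>) \<subseteq> Xs" "path_image (expc \<circ> h) \<subseteq> Xs" "path_image (act \<gamma> \<circ> s \<circ> \<beta>) \<subseteq> Xs"
      using ab(2,4) h(2) sX act_Xs[OF g] expc_Xs unfolding path_image_def image_subset_iff o_def by blast+
    show "path_image h2 \<subseteq> Xs" unfolding h2_def by (intro subset_path_image_join sub)
    have \<alpha>E: "\<alpha> r \<in> Etr" "\<beta> r \<in> Etr" if "r \<in> {0..1}" for r using ab(2,4) that by (auto simp: path_image_def)
    show "cubic (h2 t) = ?g2 t" if t: "t \<in> {0..1}" for t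
      using t sE(2)[OF \<alpha>E(1)] sE(2)[OF \<alpha>E(2)] cubic_act[OF g sX[OF \<alpha>E(2)]]
      by (auto simp: h2_def joinpaths_def cubu_def)
    show "pathstart ?V = pathstart h2" using F(3) ab(5) by (simp add: h2_def pathstart_compose) (simp add: pathstart_def v_def P_def)
  qed
  then have "pathfinish ?V = pathfinish h2" by (rule homotopic_paths_imp_pathfinish)
  also have "\<dots> = act \<gamma> (s (pathfinish v))" using ab(8) by (simp add: h2_def pathfinish_compose o_assoc[symmetric])
  finally have mid: "F (Complex xm (Im z1)) = act \<gamma> (s (f (Complex xm (Im z1))))" by (simp add: pathfinish_def v_def)
  have top: "F (Complex x (Im z1)) = act \<gamma> (s (f (Complex x (Im z1))))" if "x \<in> ?I" for x
  proof (rule uniq[of "Im z1" x "\<lambda>x. act \<gamma> (s (f (Complex x (Im z1))))", OF _ that mid])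
    show "continuous_on ?I (\<lambda>x. act \<gamma> (s (f (Complex x (Im z1)))))"
      by (rule continuous_on_compose2[OF continuous_act[OF g] cs]; (intro image_subsetI sX)?) (use fE in auto)
    have E: "f (Complex x (Im z1)) \<in> Etr" if "x \<in> ?I" for x using fE that by auto
    show "(\<lambda>x. act \<gamma> (s (f (Complex x (Im z1))))) \<in> ?I \<rightarrow> Xs" by (intro Pi_I act_Xs[OF g] sX E)
    show "cubic (act \<gamma> (s (f (Complex x (Im z1))))) = f (Complex x (Im z1))" if "x \<in> ?I" for x
      unfolding cubic_act[OF g sX[OF E[OF that]]] by (rule sE(2)[OF E[OF that]])
  qed simp
  define \<tau> where "\<tau> = (\<lambda>z. snd (snd (F z)))"
  have sub: "box z0 z1 \<subseteq> cbox z0 z1" by (rule box_subset_cbox)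
  have "\<tau> holomorphic_on box z0 z1" unfolding \<tau>_def
    by (rule lift_holomorphic[OF open_box hol continuous_on_subset[OF F(1) sub]]) (use F sub in auto)
  moreover have "continuous_on (cbox z0 z1) \<tau>" unfolding \<tau>_def by (intro continuous_intros F)
  moreover have "0 < Im (\<tau> w)" if "w \<in> cbox z0 z1" for w using F(2) that by (auto simp: \<tau>_def Xs_def)
  moreover have "Re (\<tau> (Complex x (Im z0))) = 0" if "Re z0 < x" "x < Re z1" for x
    using bottom[of x] sE(1)[of "f (Complex x (Im z0))"] fE[OF that] that by (auto simp: \<tau>_def E0_def)
  moreover have "\<exists>v. 0 < Im v \<and> Re v = 0 \<and> \<tau> (Complex x (Im z1)) = mact \<gamma> v" if "Re z0 < x" "x < Re z1" for x
  proof -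
    have "s (f (Complex x (Im z1))) \<in> E0" using sE(1) fE[OF that] by auto
    then show ?thesis using top[of x] that
      by (intro exI[of _ "snd (snd (s (f (Complex x (Im z1)))))"]) (auto simp: \<tau>_def act_def E0_def)
  qed
  ultimately have "ln (of_int (Kof \<gamma>)) * (Re z1 - Re z0) \<le> pi * (Im z1 - Im z0)"
    by (intro geodesic_distance_bound[OF g gen z]) auto
  then show ?thesis using z by (simp add: field_simps)
qed

section \<open>Rectangles realising a matrix\<close>

text \<open>The values are integer multiples of \<pi>, a discrete set.\<close>

lemma constant_modulo_pi:
  fixes g :: "real \<Rightarrow> real"
  assumes cont: "continuous_on S g" and S: "connected S" and s: "\<And>x. x \<in> S \<Longrightarrow> sin (g x) = 0"
  obtains \<theta> where "\<And>x. x \<in> S \<Longrightarrow> g x = \<theta>"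
proof -
  have "g constant_on S"
  proof (rule continuous_discrete_range_constant[OF S cont])
    fix x assume x: "x \<in> S"
    obtain m :: int where m: "g x = of_int m * pi" using s[OF x] by (auto simp: sin_zero_iff_int2)
    have "pi \<le> norm (g y - g x)" if y: "y \<in> S" "g y \<noteq> g x" for y
    proof -
      obtain n :: int where n: "g y = of_int n * pi" using s[OF y(1)] by (auto simp: sin_zero_iff_int2)
      have "1 \<le> \<bar>n - m\<bar>" using y(2) m n by auto
      then have "1 \<le> \<bar>real_of_int (n - m)\<bar>" by linarith
      then have "1 * pi \<le> \<bar>real_of_int (n - m)\<bar> * pi" by (intro mult_right_mono) auto
      also have "\<dots> = norm (g y - g x)" unfolding m n by (simp add: abs_mult left_diff_distrib[symmetric])
      finally show ?thesis by simp
    qed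
    then show "\<exists>e>0. \<forall>y. y \<in> S \<and> g y \<noteq> g x \<longrightarrow> e \<le> norm (g y - g x)" using pi_gt_zero by blast
  qed
  then show ?thesis using that by (auto simp: constant_on_def)
qed

lemma real_segment_Etr:
  assumes p: "p = (2, of_real r, \<i> * of_real y)" "q' = (2, of_real r', \<i> * of_real y')" and y: "0 < y" "0 < y'"
  shows "path_image (linepath p q') \<subseteq> Xu" "path_image (cubu \<circ> linepath p q') \<subseteq> Etr"
proof -
  have *: "linepath p q' t \<in> Xu \<and> cubu (linepath p q' t) \<in> Etr" if t: "t \<in> {0..1}" for t
  proof -
    have e: "linepath p q' t = (2, of_real ((1 - t) * r + t * r'), \<i> * of_real ((1 - t) * y + t * y'))"
      unfolding p by (simp add: linepath_def algebra_simps scaleR_conv_of_real)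
    have pos: "0 < (1 - t) * y + t * y'"
    proof (cases "t = 0")
      case False
      then have "0 < t * y'" "0 \<le> (1 - t) * y" using t y by auto
      then show ?thesis by linarith
    qed (use y in auto)
    have "expc (linepath p q' t) = (of_real 2, of_real (exp ((1 - t) * r + t * r')), \<i> * of_real ((1 - t) * y + t * y'))"
      unfolding e expc_def by (simp flip: exp_of_real)
    then have "expc (linepath p q' t) \<in> E0" unfolding E0_def using pos exp_gt_zero by blast
    moreover have "linepath p q' t \<in> Xu" unfolding e Xu_def using pos by simp
    ultimately show ?thesis using cubic_E0_Etr unfolding cubu_def by blast
  qed
  show "path_image (linepath p q') \<subseteq> Xu" "path_image (cubu \<circ> linepath p q') \<subseteq> Etr"
    unfolding path_image_def o_def image_subset_iff using * by blast+
qed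

text \<open>A period ratio with the right boundary values leaves the twist open; the logarithm of
  the scale decides it. Reality on the top side determines its argument there modulo \<pi>, hence as
  a constant \<theta> along the side, and a linear correction moves this constant to the value that
  the braid demands.\<close>

lemma realize:
  assumes mon: "Mon \<rho> \<gamma>" and z: "Re z0 < Re z1" "Im z0 < Im z1"
    and \<tau>: "continuous_on (cbox z0 z1) \<tau>" "\<tau> holomorphic_on box z0 z1" "\<And>w. w \<in> cbox z0 z1 \<Longrightarrow> 0 < Im (\<tau> w)"
    and u: "continuous_on (cbox z0 z1) u" "u holomorphic_on box z0 z1"
    and bot: "\<And>x. Re z0 < x \<Longrightarrow> x < Re z1 \<Longrightarrow> Re (\<tau> (Complex x (Im z0))) = 0 \<and> Im (u (Complex x (Im z0))) = 0"
    and top: "\<And>x. Re z0 < x \<Longrightarrow> x < Re z1 \<Longrightarrow> \<exists>y>0. \<tau> (Complex x (Im z1)) = mact \<gamma> (\<i> * of_real y) \<and>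
       Im (exp (u (Complex x (Im z1))) * autf \<gamma> (\<i> * of_real y) ^ 2) = 0"
  shows "\<exists>f. holo_rect_represents z0 z1 f \<rho>"
proof -
  have g: "\<gamma> \<in> SL2" and \<rho>: "pathstart \<rho> = base_cfg" "pathfinish \<rho> = base_cfg" using mon by (auto simp: Mon_def)
  obtain hh uw where hh: "path hh" "path_image hh \<subseteq> Xu" "pathstart hh = x0" "pathfinish hh = (2, uw, mact \<gamma> \<i>)"
       "exp uw = of_real c0 / autf \<gamma> \<i> ^ 2" "homotopic_paths Conf3 (cubu \<circ> hh) \<rho>"
    using mon by (auto simp: Mon_def)
  define h where "h = Im z1 - Im z0"
  have h: "0 < h" using z by (simp add: h_def)
  let ?I = "{Re z0<..<Re z1}"
  define T where "T = (\<lambda>x. Complex x (Im z1))"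
  have cb: "closure (box z0 z1) = cbox z0 z1" using z by (intro closure_box) (auto simp: box_ne_empty Basis_complex_def)
  have sub: "box z0 z1 \<subseteq> cbox z0 z1" by (rule box_subset_cbox)
  have bR: "Complex x (Im z0) \<in> cbox z0 z1" "T x \<in> cbox z0 z1" if "x \<in> ?I" for x
    using that z by (auto simp: in_cbox_complex_iff T_def)
  have cT: "continuous_on ?I T" unfolding T_def by (auto intro!: continuous_intros simp: Complex_eq)
  define v where "v = (\<lambda>x. mact (minv \<gamma>) (\<tau> (T x)))"
  have v: "\<exists>y>0. v x = \<i> * of_real y \<and> Im (exp (u (T x)) * autf \<gamma> (v x) ^ 2) = 0" "\<tau> (T x) = mact \<gamma> (v x)" if x: "x \<in> ?I" for x
  proof -
    obtain y where y: "0 < y" "\<tau> (T x) = mact \<gamma> (\<i> * of_real y)" "Im (exp (u (T x)) * autf \<gamma> (\<i> * of_real y) ^ 2) = 0"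
      using top[of x] x by (auto simp: T_def)
    have "v x = mact (mmul (minv \<gamma>) \<gamma>) (\<i> * of_real y)" unfolding v_def y(2) using y(1) g by (simp add: mact_mmul minv_SL2)
    then have "v x = \<i> * of_real y" using g by (simp add: mmul_minv)
    then show "\<exists>y>0. v x = \<i> * of_real y \<and> Im (exp (u (T x)) * autf \<gamma> (v x) ^ 2) = 0" "\<tau> (T x) = mact \<gamma> (v x)" using y by auto
  qed
  have vpos: "0 < Im (v x)" if "x \<in> ?I" for x using v(1)[OF that] by auto
  have c\<tau>T: "continuous_on ?I (\<lambda>x. \<tau> (T x))" by (rule continuous_on_compose2[OF \<tau>(1) cT]) (use bR in auto)
  have cv: "continuous_on ?I v" unfolding v_def
    by (rule continuous_on_compose2[OF continuous_mact[OF minv_SL2[OF g]] c\<tau>T]) (use bR \<tau>(3) in auto)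
  have an: "autf \<gamma> (v x) \<noteq> 0" if "x \<in> ?I" for x using autf_nz[OF g, of "v x"] vpos[OF that] by auto
  define G where "G = (\<lambda>x. u (T x) + 2 * Ln (autf \<gamma> (v x)))"
  have "continuous_on ?I (\<lambda>x. Im (G x))" unfolding G_def
    by (intro continuous_intros continuous_on_compose2[OF u(1) cT] continuous_on_compose2[OF continuous_Ln_autf[OF g] cv]) (use bR vpos in auto)
  moreover have "sin (Im (G x)) = 0" if x: "x \<in> ?I" for x
  proof -
    have "exp (G x) = exp (u (T x)) * autf \<gamma> (v x) ^ 2" unfolding G_def using an[OF x] by (simp add: exp_add exp_2_Ln)
    then have "Im (exp (G x)) = 0" using v(1)[OF x] by auto
    then show ?thesis by (simp add: Im_exp)
  qed
  ultimately obtain \<theta> where \<theta>: "\<And>x. x \<in> ?I \<Longrightarrow> Im (G x) = \<theta>"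
    using constant_modulo_pi[of ?I "\<lambda>x. Im (G x)"] by auto
  define K where "K = uw + 2 * Ln (autf \<gamma> \<i>) - of_real (ln c0)"
  have ai: "autf \<gamma> \<i> \<noteq> 0" using autf_nz[OF g, of \<i>] by simp
  have K1: "exp K = 1" unfolding K_def using ai hh(5) c0_pos by (simp add: exp_add exp_diff exp_2_Ln exp_ln_c0)
  \<comment> \<open>A real multiple of w - \<i> Im z0 leaves the imaginary part of u unchanged on
    the bottom and adds \<kappa> h on the top, so the top side reaches the \<gamma>-translate
    belonging to this very braid.\<close>
  define \<kappa> where "\<kappa> = (Im K - \<theta>) / h"
  define u' where "u' = (\<lambda>w. u w + of_real \<kappa> * (w - \<i> * of_real (Im z0)))"
  have u'b: "Im (u' (Complex x (Im z0))) = 0" if "x \<in> ?I" for x using bot[of x] that by (simp add: u'_def)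
  have Imu't: "Im (u' (T x)) = Im (u (T x)) + (Im K - \<theta>)" for x
  proof -
    have "Im (u' (T x)) = Im (u (T x)) + \<kappa> * h" by (simp add: u'_def T_def h_def)
    then show ?thesis using h by (simp add: \<kappa>_def)
  qed
  have u't: "u' (T x) + 2 * Ln (autf \<gamma> (v x)) - K = of_real (Re (u' (T x) + 2 * Ln (autf \<gamma> (v x)) - K))" if "x \<in> ?I" for x
    using \<theta>[OF that] Imu't[of x] by (simp add: complex_eq_iff G_def)
  have u'h: "u' holomorphic_on box z0 z1" "continuous_on (cbox z0 z1) u'" unfolding u'_def
    by (intro holomorphic_intros continuous_intros u)+
  define L where "L = (\<lambda>w. (2 :: complex, u' w, \<tau> w))"
  have LX: "L w \<in> Xu" if "w \<in> cbox z0 z1" for w using \<tau>(3)[OF that] by (simp add: L_def Xu_def)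
  have cL: "continuous_on (cbox z0 z1) L" unfolding L_def by (intro continuous_intros u'h \<tau>)
  define f where "f = (\<lambda>w. cubu (L w))"
  have cf: "continuous_on (cbox z0 z1) f" unfolding f_def
    by (rule continuous_on_compose2[OF continuous_cubu cL]) (use LX in blast)
  have fC: "f ` cbox z0 z1 \<subseteq> Conf3" unfolding f_def using LX cubu_Conf3 by blast
  have fe: "f w = cubic (2, exp (u' w), \<tau> w)" for w by (simp add: f_def cubu_def expc_def L_def)
  have pq: "(\<lambda>w. pcoef (\<tau> w)) holomorphic_on box z0 z1" "(\<lambda>w. qcoef (\<tau> w)) holomorphic_on box z0 z1"
  proof -
    have im: "\<tau> ` box z0 z1 \<subseteq> {\<tau>. 0 < Im \<tau>}" using \<tau>(3) sub by auto
    have "(\<lambda>w. e1 (\<tau> w)) holomorphic_on box z0 z1" "(\<lambda>w. e2 (\<tau> w)) holomorphic_on box z0 z1" "(\<lambda>w. e3 (\<tau> w)) holomorphic_on box z0 z1"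
      using e_holomorphic[THEN holomorphic_on_compose_gen[OF \<tau>(2) _ im]] by (simp_all add: o_def)
    then show "(\<lambda>w. pcoef (\<tau> w)) holomorphic_on box z0 z1" "(\<lambda>w. qcoef (\<tau> w)) holomorphic_on box z0 z1"
      unfolding pcoef_def qcoef_def by (auto intro!: holomorphic_intros)
  qed
  have hol: "(\<lambda>w. fst (f w)) holomorphic_on box z0 z1" "(\<lambda>w. fst (snd (f w))) holomorphic_on box z0 z1" "(\<lambda>w. snd (snd (f w))) holomorphic_on box z0 z1"
    unfolding fe cubic_explicit fst_conv snd_conv by (intro holomorphic_intros u'h pq)+
  have Lb: "\<exists>r y. 0 < y \<and> L (Complex x (Im z0)) = (2, of_real r, \<i> * of_real y)" if x: "x \<in> ?I" for x
    using bot[of x] \<tau>(3)[OF bR(1)[OF x]] u'b[OF x] x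
    by (intro exI[of _ "Re (u' (Complex x (Im z0)))"] exI[of _ "Im (\<tau> (Complex x (Im z0)))"]) (auto simp: L_def complex_eq_iff)
  have Lt: "\<exists>r y. 0 < y \<and> L (T x) = tl \<gamma> K (2, of_real r, \<i> * of_real y)" if x: "x \<in> ?I" for x
  proof -
    obtain y where y: "0 < y" "v x = \<i> * of_real y" using v(1)[OF x] by blast
    obtain r where r: "u' (T x) + 2 * Ln (autf \<gamma> (v x)) - K = of_real r" using u't[OF x] by blast
    have "u' (T x) = of_real r - 2 * Ln (autf \<gamma> (v x)) + K" using r by (simp add: algebra_simps)
    then have "L (T x) = tl \<gamma> K (2, of_real r, \<i> * of_real y)" using v(2)[OF x] y(2) by (simp add: L_def tl_def)
    then show ?thesis using y by blast
  qed
  have x0e: "x0 = (2, of_real (ln c0), \<i> * of_real 1)" by (simp add: x0_def)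
  have end_h: "pathfinish hh = tl \<gamma> K x0" unfolding hh(4) by (simp add: tl_def x0_def K_def)
  have rep: "represents_path (\<lambda>t. f (Complex x (Im z0 + t * (Im z1 - Im z0)))) \<rho>" if x: "x \<in> ?I" for x
  proof -
    define l where "l = (\<lambda>t. L (Complex x (Im z0 + t * (Im z1 - Im z0))))"
    have inR: "Complex x (Im z0 + t * (Im z1 - Im z0)) \<in> cbox z0 z1" if "t \<in> {0..1}" for t
    proof -
      have "0 \<le> t * (Im z1 - Im z0)" "t * (Im z1 - Im z0) \<le> 1 * (Im z1 - Im z0)" using that z by (auto intro!: mult_right_mono)
      then show ?thesis using x by (simp add: in_cbox_complex_iff)
    qed
    have pl: "path l" unfolding path_def l_def
      by (rule continuous_on_compose2[OF cL]) (use inR in \<open>auto intro!: continuous_intros simp: Complex_eq\<close>)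
    have il: "path_image l \<subseteq> Xu" using LX inR unfolding path_image_def l_def by blast
    have sl: "pathstart l = L (Complex x (Im z0))" "pathfinish l = L (T x)" by (simp_all add: pathstart_def pathfinish_def l_def T_def)
    obtain r0 y0 where r0: "0 < y0" "pathstart l = (2, of_real r0, \<i> * of_real y0)" using Lb[OF x] sl by auto
    obtain r1 y1 where r1: "0 < y1" "pathfinish l = tl \<gamma> K (2, of_real r1, \<i> * of_real y1)" using Lt[OF x] sl by auto
    define A where "A = linepath (pathstart l) x0"
    define B' where "B' = linepath x0 (2, of_real r1, \<i> * of_real y1)"
    define B where "B = tl \<gamma> K \<circ> B'"
    have A: "path A" "path_image A \<subseteq> Xu" "path_image (cubu \<circ> A) \<subseteq> Etr" "pathstart A = pathstart l" "pathfinish A = x0"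
      using real_segment_Etr[OF r0(2) x0e r0(1)] by (auto simp: A_def)
    have B': "path B'" "path_image B' \<subseteq> Xu" "path_image (cubu \<circ> B') \<subseteq> Etr"
      using real_segment_Etr[OF x0e refl _ r1(1)] by (auto simp: B'_def)
    have B: "path B" "path_image B \<subseteq> Xu" "pathstart B = pathfinish hh" "pathfinish B = pathfinish l"
      unfolding B_def using path_continuous_image[OF B'(1) continuous_on_subset[OF continuous_tl[OF g] B'(2)]] B'(2) tl_Xu[OF g]
      by (auto simp: path_image_compose pathstart_compose pathfinish_compose end_h r1(2)) (auto simp: B'_def)
    have B3: "path_image (cubu \<circ> B) \<subseteq> Etr"
    proof -
      have "cubu (B t) = cubu (B' t)" if "t \<in> {0..1}" for t
        unfolding B_def o_def using B'(2) that by (intro cubu_tl[OF g _ K1]) (auto simp: path_image_def)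
      then show ?thesis using B'(3) by (auto simp: path_image_def)
    qed
    have cp: "path (cubu \<circ> p)" if "path p" "path_image p \<subseteq> Xu" for p
      by (rule path_continuous_image[OF that(1) continuous_on_subset[OF continuous_cubu that(2)]])
    have EC: "Etr \<subseteq> Conf3" unfolding Etr_def Conf3_def by fastforce
    have "homotopic_paths Conf3 (cubu \<circ> l) (cubu \<circ> (A +++ hh +++ B))"
    proof (rule homotopic_cubu)
      show "path_image (A +++ hh +++ B) \<subseteq> Xu" by (intro subset_path_image_join A hh B)
    qed (use pl il A B hh in auto)
    also have "cubu \<circ> (A +++ hh +++ B) = (cubu \<circ> A) +++ (cubu \<circ> hh) +++ (cubu \<circ> B)" by (simp add: path_compose_join)
    finally have 1: "homotopic_paths Conf3 (cubu \<circ> l) ((cubu \<circ> A) +++ (cubu \<circ> hh) +++ (cubu \<circ> B))" .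
    have ends: "pathfinish (cubu \<circ> A) = base_cfg" "pathstart (cubu \<circ> B) = base_cfg"
      "pathstart (cubu \<circ> A) = pathstart (cubu \<circ> l)" "pathfinish (cubu \<circ> B) = pathfinish (cubu \<circ> l)"
      "pathstart (cubu \<circ> hh) = base_cfg" "pathfinish (cubu \<circ> hh) = base_cfg"
      using A B hh(3) end_h cubu_x0 cubu_tl[OF g x0_Xu K1] by (simp_all add: pathstart_compose pathfinish_compose)
    have 2: "homotopic_paths Conf3 ((cubu \<circ> A) +++ (cubu \<circ> hh) +++ (cubu \<circ> B)) ((cubu \<circ> A) +++ \<rho> +++ (cubu \<circ> B))"
    proof -
      have "homotopic_paths Conf3 (cubu \<circ> A) (cubu \<circ> A)" "homotopic_paths Conf3 (cubu \<circ> B) (cubu \<circ> B)"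
        using cp A B A(3) B3 EC by auto
      then show ?thesis using hh(6) ends by (intro homotopic_paths_join) auto
    qed
    have V: "(\<lambda>t. f (Complex x (Im z0 + t * (Im z1 - Im z0)))) = cubu \<circ> l" by (simp add: f_def l_def o_def)
    have "cubu (pathstart l) \<in> Etr" "cubu (pathfinish l) \<in> Etr"
      using A(3) B3 ends pathstart_in_path_image[of "cubu \<circ> A"] pathfinish_in_path_image[of "cubu \<circ> B"]
      by (auto simp: pathstart_compose pathfinish_compose)
    moreover have "path_image (cubu \<circ> l) \<subseteq> Conf3" using il cubu_Conf3 unfolding path_image_compose by blast
    ultimately show ?thesis unfolding V represents_path_def
      using cp[OF pl il] A B A(3) B3 cp[OF A(1,2)] cp[OF B(1,2)] ends \<rho> homotopic_paths_trans[OF 1 2]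
      by (intro conjI exI[of _ "cubu \<circ> A"] exI[of _ "cubu \<circ> B"]) (auto simp: pathstart_compose pathfinish_compose)
  qed
  have edges: "f (Complex x (Im z0)) \<in> Etr \<and> f (Complex x (Im z1)) \<in> Etr" if x: "x \<in> ?I" for x
    using rep[OF x] by (simp add: represents_path_def pathstart_def pathfinish_def)
  have "holo_rect_represents z0 z1 f \<rho>"
    unfolding holo_rect_represents_def rect_represents_def cb using z cf fC edges rep hol by auto
  then show ?thesis by blast
qed

definition ratios :: "(real \<Rightarrow> cfg) \<Rightarrow> real set" where
  "ratios \<rho> = {(Im z1 - Im z0) / (Re z1 - Re z0) | z0 z1. \<exists>f. holo_rect_represents z0 z1 f \<rho>}"

text \<open>The map w to exp(\<i> w) takes the rectangle to a sector between the two concentric half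
  circles, and undoing \<open>halfcirc\<close> turns it into a period ratio. The remaining task is a
  scale that is real on both horizontal sides.\<close>

lemma upper_generic:
  assumes mon: "Mon \<rho> \<gamma>" and gen: "generic \<gamma>"
  shows "2 * - ln (kappa \<gamma>) / pi \<in> ratios \<rho>"
proof -
  have g: "\<gamma> \<in> SL2" using mon by (simp add: Mon_def)
  obtain a b c d where \<gamma>: "\<gamma> = (a, b, c, d)" by (metis prod_cases4)
  note P = perp_facts[OF g gen \<gamma>]
  define r where "r = perp \<gamma>"
  define \<sigma> where "\<sigma> = complex_of_real (sgn r)"
  define \<delta> where "\<delta> = - ln (kappa \<gamma>)"
  have r: "r \<noteq> 0" using P(1) by (simp add: r_def)
  have \<sigma>: "\<sigma> * \<sigma> = 1" "\<sigma> * of_real r = of_real \<bar>r\<bar>" using r by (auto simp: \<sigma>_def sgn_if)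
  have kb: "0 < kappa \<gamma>" "3 \<le> 1 / kappa \<gamma>" using kappa_bounds[OF g gen] by linarith+
  have k1: "kappa \<gamma> < 1" using kb by (simp add: field_simps)
  have \<delta>: "0 < \<delta>" using kb k1 by (simp add: \<delta>_def)
  \<comment> \<open>The angles from \<pi>/4 to 3 \<pi>/4 keep the closed rectangle inside the upper
    half-plane; the width \<pi>/2 is the source of the ratio 2 \<delta> / \<pi>.\<close>
  define z0 z1 where "z0 = Complex (pi / 4) 0" and "z1 = Complex (3 * pi / 4) \<delta>"
  have z: "Re z0 < Re z1" "Im z0 < Im z1" using \<delta> by (simp_all add: z0_def z1_def)
  define s where "s = (\<lambda>w. exp (\<i> * w))"
  have ss: "0 < Im (s w)" if "w \<in> cbox z0 z1" for w
  proof -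
    have "pi / 4 \<le> Re w" "Re w \<le> 3 * pi / 4" using that by (auto simp: in_cbox_complex_iff z0_def z1_def)
    then have "0 < sin (Re w)" using pi_gt_zero by (intro sin_gt_zero) linarith+
    then show ?thesis by (simp add: s_def Im_exp)
  qed
  have den: "1 - \<sigma> * s w \<noteq> 0" if "w \<in> cbox z0 z1" for w
    using ss[OF that] r by (auto simp: complex_eq_iff \<sigma>_def)
  define \<tau> where "\<tau> = (\<lambda>w. of_real r * (1 + \<sigma> * s w) / (1 - \<sigma> * s w))"
  have Im\<tau>: "0 < Im (\<tau> w)" if w: "w \<in> cbox z0 z1" for w
  proof -
    define \<epsilon> where "\<epsilon> = sgn r"
    define S where "S = s w"
    have e2: "\<epsilon> * \<epsilon> = 1" "r * \<epsilon> = \<bar>r\<bar>" using r by (auto simp: \<epsilon>_def sgn_if)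
    have "Im ((1 + of_real \<epsilon> * S) / (1 - of_real \<epsilon> * S)) = 2 * \<epsilon> * Im S / norm (1 - of_real \<epsilon> * S) ^ 2"
      by (simp add: Im_divide cmod_power2 algebra_simps)
    then have "Im (\<tau> w) = r * (2 * \<epsilon> * Im S / norm (1 - of_real \<epsilon> * S) ^ 2)"
      unfolding \<tau>_def \<sigma>_def \<epsilon>_def[symmetric] S_def[symmetric] times_divide_eq_right[symmetric] Im_complex_of_real_mult by simp
    also have "\<dots> = (r * \<epsilon>) * (2 * Im S / norm (1 - of_real \<epsilon> * S) ^ 2)" by simp
    also have "\<dots> > 0" using e2 r ss[OF w] den[OF w] by (simp add: S_def \<epsilon>_def \<sigma>_def)
    finally show ?thesis .
  qed
  have hc: "halfcirc \<gamma> (\<tau> w) = s w" if w: "w \<in> cbox z0 z1" for w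
  proof -
    have n: "1 - \<sigma> * s w \<noteq> 0" by (rule den[OF w])
    have "\<tau> w - of_real r = of_real r * 2 * (\<sigma> * s w) / (1 - \<sigma> * s w)" "\<tau> w + of_real r = of_real r * 2 / (1 - \<sigma> * s w)"
      unfolding \<tau>_def using n by (simp_all add: field_simps)
    then have "halfcirc \<gamma> (\<tau> w) = \<sigma> * (\<sigma> * s w)"
      unfolding halfcirc_def r_def[symmetric] \<sigma>_def[symmetric] using n r by simp
    then show ?thesis using \<sigma>(1) by (simp flip: mult.assoc)
  qed
  have ch: "continuous_on (cbox z0 z1) s" "s holomorphic_on box z0 z1" unfolding s_def
    by (intro continuous_intros holomorphic_intros)+
  have sub: "box z0 z1 \<subseteq> cbox z0 z1" by (rule box_subset_cbox)
  have c\<tau>: "continuous_on (cbox z0 z1) \<tau>" unfolding \<tau>_def using den by (intro continuous_intros ch) auto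
  have h\<tau>: "\<tau> holomorphic_on box z0 z1" unfolding \<tau>_def using den sub by (intro holomorphic_intros ch) auto
  \<comment> \<open>The scale r^2 - \<tau>^2 is positive on the imaginary axis. Transported by
    \<gamma> it becomes r^2 (c v + d)^2 - (a v + b)^2, whose imaginary part at v = \<i> y is a
    multiple of r^2 c d - a b = 0.\<close>
  define u where "u = (\<lambda>w. Ln (of_real (r\<^sup>2) - \<tau> w ^ 2))"
  have np: "of_real (r\<^sup>2) - \<tau> w ^ 2 \<notin> \<real>\<^sub>\<le>\<^sub>0" if w: "w \<in> cbox z0 z1" for w
  proof
    assume "of_real (r\<^sup>2) - \<tau> w ^ 2 \<in> \<real>\<^sub>\<le>\<^sub>0"
    then have "Im (\<tau> w ^ 2) = 0" "r\<^sup>2 \<le> Re (\<tau> w ^ 2)" by (auto simp: complex_nonpos_Reals_iff)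
    then have "Re (\<tau> w) = 0" "r\<^sup>2 \<le> (Re (\<tau> w))\<^sup>2 - (Im (\<tau> w))\<^sup>2" using Im\<tau>[OF w] by (auto simp: power2_eq_square)
    then have "r\<^sup>2 + (Im (\<tau> w))\<^sup>2 \<le> 0" by simp
    moreover have "0 < r\<^sup>2" using r by simp
    ultimately show False using zero_le_power2[of "Im (\<tau> w)"] by linarith
  qed
  have nz: "of_real (r\<^sup>2) - \<tau> w ^ 2 \<noteq> 0" if w: "w \<in> cbox z0 z1" for w using np[OF w] by auto
  have "continuous_on (cbox z0 z1) u" unfolding u_def using np by (intro continuous_on_Ln' continuous_intros c\<tau>) auto
  moreover have "u holomorphic_on box z0 z1" unfolding u_def using np sub by (intro holomorphic_on_Ln' holomorphic_intros h\<tau>) auto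
  moreover have "Re (\<tau> (Complex x (Im z0))) = 0 \<and> Im (u (Complex x (Im z0))) = 0" if x: "Re z0 < x" "x < Re z1" for x
  proof -
    have w: "Complex x (Im z0) \<in> cbox z0 z1" using x z by (auto simp: in_cbox_complex_iff)
    have "norm (s (Complex x (Im z0))) = 1" by (simp add: s_def z0_def)
    then have R: "Re (\<tau> (Complex x (Im z0))) = 0" using norm_halfcirc_imaginary[OF g gen Im\<tau>[OF w]] hc[OF w] by simp
    define y where "y = Im (\<tau> (Complex x (Im z0)))"
    have "\<tau> (Complex x (Im z0)) = \<i> * of_real y" using R by (simp add: complex_eq_iff y_def)
    then have "of_real (r\<^sup>2) - \<tau> (Complex x (Im z0)) ^ 2 = of_real (r\<^sup>2 + y\<^sup>2)" by (simp add: power_mult_distrib)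
    moreover have "0 < r\<^sup>2 + y\<^sup>2" using r by (simp add: sum_power2_gt_zero_iff)
    ultimately have "Im (u (Complex x (Im z0))) = 0" unfolding u_def by (simp only: Im_Ln_of_real) 
    then show ?thesis using R by simp
  qed
  moreover have "\<exists>y>0. \<tau> (Complex x (Im z1)) = mact \<gamma> (\<i> * of_real y) \<and>
       Im (exp (u (Complex x (Im z1))) * autf \<gamma> (\<i> * of_real y) ^ 2) = 0" if x: "Re z0 < x" "x < Re z1" for x
  proof -
    define w where "w = Complex x (Im z1)"
    have w: "w \<in> cbox z0 z1" using x z by (auto simp: in_cbox_complex_iff w_def)
    define v where "v = mact (minv \<gamma>) (\<tau> w)"
    have vp: "0 < Im v" unfolding v_def by (rule Im_mact_pos[OF minv_SL2[OF g] Im\<tau>[OF w]])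
    have "mact \<gamma> v = mact (mmul \<gamma> (minv \<gamma>)) (\<tau> w)" unfolding v_def using g Im\<tau>[OF w] by (simp add: mact_mmul minv_SL2)
    then have mv: "\<tau> w = mact \<gamma> v" using g by (simp add: mmul_minv)
    have "norm (s w) = exp (- \<delta>)" by (simp add: s_def z1_def w_def)
    then have "norm (s w) = kappa \<gamma>" using kb by (simp add: \<delta>_def)
    then have "Re v = 0" using norm_halfcirc_mact[OF g gen vp] hc[OF w] mv by simp
    then obtain y where y: "0 < y" "v = \<i> * of_real y" using vp by (intro that[of "Im v"]) (auto simp: complex_eq_iff)
    have a0: "of_int c * v + of_int d \<noteq> 0" using autf_nz[OF g, of v] vp by (simp add: \<gamma> autf_def)
    have "exp (u w) = of_real (r\<^sup>2) - \<tau> w ^ 2" unfolding u_def using nz[OF w] by simp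
    then have "exp (u w) * autf \<gamma> v ^ 2 = of_real (r\<^sup>2) * (of_int c * v + of_int d) ^ 2 - (of_int a * v + of_int b) ^ 2"
      unfolding mv using a0 by (simp add: \<gamma> autf_def mact_def power_divide left_diff_distrib)
    also have "Im \<dots> = 2 * y * (r\<^sup>2 * of_int c * of_int d - of_int a * of_int b)"
      by (simp add: y(2) power2_eq_square algebra_simps)
    also have "\<dots> = 0" using P(2) by (simp add: r_def)
    finally show ?thesis using y mv unfolding w_def by blast
  qed
  ultimately have "\<exists>f. holo_rect_represents z0 z1 f \<rho>"
    by (intro realize[OF mon z c\<tau> h\<tau> Im\<tau>]) auto
  then have "(Im z1 - Im z0) / (Re z1 - Re z0) \<in> ratios \<rho>" unfolding ratios_def by blast
  moreover have "(Im z1 - Im z0) / (Re z1 - Re z0) = 2 * \<delta> / pi" by (simp add: z0_def z1_def field_simps)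
  ultimately show ?thesis by (simp add: \<delta>_def)
qed

section \<open>Geodesics with a common end point\<close>

text \<open>The stabiliser of the imaginary half-axis in the modular group; the powers of the
  Garside element act through it.\<close>

definition edge_stab :: "mat set" where
  "edge_stab = {(1, 0, 0, 1), (-1, 0, 0, -1), (0, -1, 1, 0), (0, 1, -1, 0)}"

text \<open>Such a matrix replaces y by y or 1/y on the half-axis, and its automorphy factor there
  is real or purely imaginary, so its square is real.\<close>

lemma edge_stab_transport:
  assumes g: "\<gamma> \<in> SL2" and D: "D \<in> edge_stab" and y: "0 < y"
    and m: "\<tau> = mact \<gamma> (\<i> * of_real y)" "Im (E * autf \<gamma> (\<i> * of_real y) ^ 2) = 0"
  shows "\<exists>y'>0. \<tau> = mact (mmul \<gamma> D) (\<i> * of_real y') \<and> Im (E * autf (mmul \<gamma> D) (\<i> * of_real y') ^ 2) = 0"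
proof -
  have "\<exists>y'>0. mact D (\<i> * of_real y') = \<i> * of_real y \<and> Im (autf D (\<i> * of_real y') ^ 2) = 0"
  proof (cases "D = (1, 0, 0, 1) \<or> D = (-1, 0, 0, -1)")
    case True
    then show ?thesis using y by (intro exI[of _ y]) (auto simp: mact_def autf_def)
  next
    case False
    then show ?thesis using D y by (intro exI[of _ "1 / y"]) (auto simp: edge_stab_def mact_def autf_def field_simps power2_eq_square)
  qed
  then obtain y' where y': "0 < y'" "mact D (\<i> * of_real y') = \<i> * of_real y" "Im (autf D (\<i> * of_real y') ^ 2) = 0" by blast
  have DS: "D \<in> SL2" using D by (auto simp: edge_stab_def SL2_def)
  have 1: "\<tau> = mact (mmul \<gamma> D) (\<i> * of_real y')" using m(1) y' mact_mmul[OF g DS, of "\<i> * of_real y'"] by simp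
  have "autf (mmul \<gamma> D) (\<i> * of_real y') = autf \<gamma> (\<i> * of_real y) * autf D (\<i> * of_real y')"
    using autf_mmul[OF DS, of "\<i> * of_real y'" \<gamma>] y' by simp
  then have "E * autf (mmul \<gamma> D) (\<i> * of_real y') ^ 2 = (E * autf \<gamma> (\<i> * of_real y) ^ 2) * autf D (\<i> * of_real y') ^ 2"
    by (simp only: power_mult_distrib mult.assoc)
  then have "Im (E * autf (mmul \<gamma> D) (\<i> * of_real y') ^ 2) = 0" using m(2) y'(3) by (simp only: times_complex.sel(2)[of "E * _"] mult_zero_left mult_zero_right add_0)
  then show ?thesis using 1 y'(1) by blast
qed

text \<open>For the first generator the geodesics are the vertical lines Re = 0 and Re = k, and the
  affine map \<open>t\<close> puts a rectangle of height 1 and any width W between them, far up. The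
  second generator is treated by the inversion -1/t.\<close>

lemma upper_parabolic:
  assumes j: "j \<in> {1, 2}" and D: "D \<in> edge_stab" and mon: "Mon \<rho> (mmul (gmat j k) D)" and W: "0 < W"
  shows "1 / W \<in> ratios \<rho>"
proof -
  define z0 z1 where "z0 = Complex 0 0" and "z1 = Complex W 1"
  have z: "Re z0 < Re z1" "Im z0 < Im z1" using W by (simp_all add: z0_def z1_def)
  \<comment> \<open>High enough for \<open>t\<close> to stay in the upper half-plane on the whole
    rectangle.\<close>
  define Y where "Y = \<bar>of_int k\<bar> * W + 1"
  define t where "t = (\<lambda>w. \<i> * (of_real Y - of_int k * w))"
  have tp: "0 < Im (t w)" if "w \<in> cbox z0 z1" for w
  proof -
    have "of_int k * Re w \<le> \<bar>of_int k\<bar> * W"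
      using that W mult_mono[of "of_int k" "\<bar>real_of_int k\<bar>" "Re w" W] by (auto simp: in_cbox_complex_iff z0_def z1_def)
    then show ?thesis by (simp add: t_def Y_def)
  qed
  have t0: "t w \<noteq> 0" if "w \<in> cbox z0 z1" for w using tp[OF that] by auto
  have tb: "Re (t (Complex x (Im z0))) = 0" for x by (simp add: t_def z0_def)
  have tt: "t (Complex x (Im z1)) = of_int k + \<i> * of_real (Im (t (Complex x (Im z1))))" for x
    by (simp add: t_def z1_def complex_eq_iff)
  have sub: "box z0 z1 \<subseteq> cbox z0 z1" by (rule box_subset_cbox)
  have ct: "continuous_on (cbox z0 z1) t" "t holomorphic_on box z0 z1" unfolding t_def by (intro continuous_intros holomorphic_intros)+
  have gS: "gmat j k \<in> SL2" by (simp add: gmat_def SL2_def)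
  have "\<exists>f. holo_rect_represents z0 z1 f \<rho>"
  proof (cases "j = 1")
    case True
    have pre: "\<exists>y>0. t w = mact (gmat j k) (\<i> * of_real y) \<and> Im (exp 0 * autf (gmat j k) (\<i> * of_real y) ^ 2) = 0"
      if "w = Complex x (Im z1)" "w \<in> cbox z0 z1" for x w
      using tt[of x] tp[OF that(2)] that(1) True by (intro exI[of _ "Im (t w)"]) (auto simp: gmat_def mact_def autf_def add.commute)
    have top: "\<exists>y>0. t (Complex x (Im z1)) = mact (mmul (gmat j k) D) (\<i> * of_real y) \<and> Im (exp 0 * autf (mmul (gmat j k) D) (\<i> * of_real y) ^ 2) = 0"
      if "Re z0 < x" "x < Re z1" for x
    proof -
      have "Complex x (Im z1) \<in> cbox z0 z1" using that z by (auto simp: in_cbox_complex_iff)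
      then show ?thesis using pre[OF refl] edge_stab_transport[OF gS D] by blast
    qed
    show ?thesis by (rule realize[OF mon z ct tp, of "\<lambda>_. 0"]) (use tb top in auto)
  next
    case False
    then have j2: "gmat j k = (1, 0, - k, 1)" using j by (simp add: gmat_def)
    define \<tau> where "\<tau> = (\<lambda>w. - 1 / t w)"
    \<comment> \<open>The scale -\<tau>^2 compensates the inversion: it is positive on the imaginary
      axis, and transported to the top side it becomes y^2.\<close>
    define u where "u = (\<lambda>w. Ln (- (\<tau> w ^ 2)))"
    have c\<tau>: "continuous_on (cbox z0 z1) \<tau>" unfolding \<tau>_def by (intro continuous_intros ct) (use t0 in auto)
    have h\<tau>: "\<tau> holomorphic_on box z0 z1" unfolding \<tau>_def by (intro holomorphic_intros ct) (use t0 sub in auto)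
    have Im\<tau>: "0 < Im (\<tau> w)" if "w \<in> cbox z0 z1" for w
      using tp[OF that] by (simp add: \<tau>_def Im_divide sum_power2_gt_zero_iff)
    have np: "- (\<tau> w ^ 2) \<notin> \<real>\<^sub>\<le>\<^sub>0" if w: "w \<in> cbox z0 z1" for w
    proof
      assume "- (\<tau> w ^ 2) \<in> \<real>\<^sub>\<le>\<^sub>0"
      then have "Re (\<tau> w) = 0" "(Im (\<tau> w))\<^sup>2 \<le> (Re (\<tau> w))\<^sup>2" using Im\<tau>[OF w] by (auto simp: complex_nonpos_Reals_iff power2_eq_square)
      then show False using Im\<tau>[OF w] by simp
    qed
    have cu: "continuous_on (cbox z0 z1) u" unfolding u_def using np by (intro continuous_on_Ln' continuous_intros c\<tau>) auto
    have hu: "u holomorphic_on box z0 z1" unfolding u_def using np sub by (intro holomorphic_on_Ln' holomorphic_intros h\<tau>) auto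
    have bot: "Re (\<tau> (Complex x (Im z0))) = 0 \<and> Im (u (Complex x (Im z0))) = 0" if x: "Re z0 < x" "x < Re z1" for x
    proof -
      have w: "Complex x (Im z0) \<in> cbox z0 z1" using x z by (auto simp: in_cbox_complex_iff)
      have R: "Re (\<tau> (Complex x (Im z0))) = 0" using tb[of x] by (simp add: \<tau>_def Re_divide)
      define y where "y = Im (\<tau> (Complex x (Im z0)))"
      have "\<tau> (Complex x (Im z0)) = \<i> * of_real y" using R by (simp add: complex_eq_iff y_def)
      then have "- (\<tau> (Complex x (Im z0)) ^ 2) = of_real (y\<^sup>2)" by (simp add: power_mult_distrib)
      moreover have "0 < y\<^sup>2" using Im\<tau>[OF w] by (simp add: y_def)
      ultimately have "Im (u (Complex x (Im z0))) = 0" unfolding u_def by (simp only: Im_Ln_of_real)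
      then show ?thesis using R by simp
    qed
    have top0: "\<exists>y>0. \<tau> w = mact (gmat j k) (\<i> * of_real y) \<and> Im (exp (u w) * autf (gmat j k) (\<i> * of_real y) ^ 2) = 0"
      if w: "w = Complex x (Im z1)" "w \<in> cbox z0 z1" for x w
    proof -
      define y where "y = 1 / Im (t w)"
      have y: "0 < y" using tp[OF w(2)] by (simp add: y_def)
      have "t w = of_int k + \<i> * of_real (1 / y)" using tt[of x] w(1) by (simp add: y_def)
      define v where "v = \<i> * of_real y"
      have v0: "v \<noteq> 0" using y by (simp add: v_def)
      have "\<i> * of_real (1 / y) = - 1 / v" using y by (simp add: v_def field_simps)
      then have tv: "t w * v = - (1 - of_int k * v)" using \<open>t w = _\<close> v0 by (simp add: field_simps)
      have n: "1 - of_int k * v \<noteq> 0" using tv t0[OF w(2)] v0 by auto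
      have \<tau>v: "\<tau> w * (1 - of_int k * v) = v" using tv t0[OF w(2)] by (simp add: \<tau>_def field_simps)
      have "exp (u w) = - (\<tau> w ^ 2)" unfolding u_def using np[OF w(2)] by (intro exp_Ln) auto
      then have "exp (u w) * (1 - of_int k * v) ^ 2 = - ((\<tau> w * (1 - of_int k * v)) ^ 2)" by (simp add: power_mult_distrib)
      also have "\<dots> = of_real (y\<^sup>2)" unfolding \<tau>v by (simp add: v_def power_mult_distrib)
      finally have "Im (exp (u w) * (1 - of_int k * v) ^ 2) = 0" by simp
      moreover have "\<tau> w = v / (1 - of_int k * v)" using \<tau>v n by (simp add: field_simps)
      ultimately show ?thesis using y by (intro exI[of _ y]) (auto simp: j2 mact_def autf_def v_def)
    qed
    have top: "\<exists>y>0. \<tau> (Complex x (Im z1)) = mact (mmul (gmat j k) D) (\<i> * of_real y) \<and> Im (exp (u (Complex x (Im z1))) * autf (mmul (gmat j k) D) (\<i> * of_real y) ^ 2) = 0"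
      if x: "Re z0 < x" "x < Re z1" for x
    proof -
      have w: "Complex x (Im z1) \<in> cbox z0 z1" using x z by (auto simp: in_cbox_complex_iff)
      show ?thesis using top0[OF refl w] edge_stab_transport[OF gS D] by blast
    qed
    show ?thesis by (rule realize[OF mon z c\<tau> h\<tau> Im\<tau> cu hu bot top])
  qed
  then have "(Im z1 - Im z0) / (Re z1 - Re z0) \<in> ratios \<rho>" unfolding ratios_def by blast
  then show ?thesis by (simp add: z0_def z1_def)
qed

lemma ratios_nonneg: "x \<in> ratios \<rho> \<Longrightarrow> 0 \<le> x"
  by (auto simp: ratios_def holo_rect_represents_def rect_represents_def)

lemma Lambda_ratios: "Lambda_tr ws = Inf (ratios (word_path ws))"
  by (simp add: Lambda_tr_def ratios_def)

section \<open>Matrices of braid words\<close>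

lemma mmul_assoc: "mmul (mmul A B) C = mmul A (mmul B C)"
proof -
  obtain a b c d a' b' c' d' e f g h where "A = (a, b, c, d)" "B = (a', b', c', d')" "C = (e, f, g, h)" by (metis prod_cases4)
  then show ?thesis by (simp add: mmul_def algebra_simps)
qed

lemma mmul_one [simp]: "mmul A (1, 0, 0, 1) = A" "mmul (1, 0, 0, 1) A = A"
  by (simp_all add: mmul_def split: prod.splits)

lemma wmat_append: "wmat (xs @ ys) = mmul (wmat xs) (wmat ys)"
proof (induction xs)
  case (Cons p xs)
  obtain i k where p: "p = (i, k)" by force
  have "wmat ((p # xs) @ ys) = mmul (gmat i k) (mmul (wmat xs) (wmat ys))" using Cons by (simp add: p)
  then show ?case by (simp only: p wmat.simps mmul_assoc)
qed simp

lemma edge_stab_mmul: "A \<in> edge_stab \<Longrightarrow> B \<in> edge_stab \<Longrightarrow> mmul A B \<in> edge_stab"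
  unfolding edge_stab_def by (elim insertE emptyE; hypsubst; simp add: mmul_def)

text \<open>The Garside element gives (0, 1, -1, 0) and its inverse (0, -1, 1, 0); these exchange
  the ends of the half-axis.\<close>

lemma wmat_delta: "wmat (delta_word l) \<in> edge_stab"
proof -
  have "wmat (concat (replicate n [(1, sgn l), (2, sgn l), (1, sgn l)])) \<in> edge_stab" for n
  proof (induction n)
    case 0
    then show ?case by (simp add: edge_stab_def)
  next
    case (Suc n)
    define t where "t = [(1 :: nat, sgn l), (2, sgn l), (1, sgn l)]"
    consider "sgn l = 1" | "sgn l = 0" | "sgn l = -1" by (cases l "0 :: int" rule: linorder_cases) simp_all
    then have "wmat t \<in> edge_stab" by cases (simp_all add: t_def gmat_def mmul_def edge_stab_def)
    then have "mmul (wmat t) (wmat (concat (replicate n t))) \<in> edge_stab" using Suc unfolding t_def by (rule edge_stab_mmul)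
    then show ?case unfolding t_def[symmetric] replicate_Suc concat.simps wmat_append .
  qed
  then show ?thesis by (simp add: delta_word_def)
qed

fun altw :: "nat \<Rightarrow> int list \<Rightarrow> (nat \<times> int) list" where
  "altw j [] = []"
| "altw j (k # ks) = (j, k) # altw (other_gen j) ks"

fun tprod :: "int list \<Rightarrow> mat" where
  "tprod [] = (1, 0, 0, 1)"
| "tprod (k # ks) = mmul (k, -1, 1, 0) (tprod ks)"

text \<open>Conjugation by \<open>S = (0, -1, 1, 0)\<close> exchanges the two unipotent generators, so an alternating word becomes a
  product of the matrices \<open>gmat 1 k S\<close>.\<close>

lemma wmat_altw:
  "\<exists>D\<in>edge_stab. wmat (altw 1 ks) = mmul (tprod ks) D"
  "\<exists>D\<in>edge_stab. wmat (altw 2 ks) = mmul (0, -1, 1, 0) (mmul (tprod ks) D)"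
proof (induction ks)
  case Nil
  {
    case 1
    then show ?case by (intro bexI[of _ "(1, 0, 0, 1)"]) (simp_all add: edge_stab_def)
  next
    case 2
    then show ?case by (intro bexI[of _ "(0, 1, -1, 0)"]) (simp_all add: edge_stab_def mmul_def)
  }
next
  case (Cons k ks)
  {
    case 1
    obtain D where D: "D \<in> edge_stab" "wmat (altw 2 ks) = mmul (0, -1, 1, 0) (mmul (tprod ks) D)" using Cons.IH(2) by blast
    have "wmat (altw 1 (k # ks)) = mmul (gmat 1 k) (mmul (0, -1, 1, 0) (mmul (tprod ks) D))"
      unfolding D(2)[symmetric] by (simp add: other_gen_def)
    also have "\<dots> = mmul (mmul (gmat 1 k) (0, -1, 1, 0)) (mmul (tprod ks) D)" by (simp only: mmul_assoc)
    also have "mmul (gmat 1 k) (0, -1, 1, 0) = (k, -1, 1, 0)" by (simp add: gmat_def mmul_def)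
    finally have "wmat (altw 1 (k # ks)) = mmul (tprod (k # ks)) D" by (simp only: tprod.simps mmul_assoc)
    then show ?case using D(1) by blast
  next
    case 2
    obtain D where D: "D \<in> edge_stab" "wmat (altw 1 ks) = mmul (tprod ks) D" using Cons.IH(1) by blast
    obtain a b c d e f g h where m: "tprod ks = (a, b, c, d)" "D = (e, f, g, h)" by (metis prod_cases4)
    have "wmat (altw 2 (k # ks)) = mmul (gmat 2 k) (mmul (tprod ks) D)"
      unfolding D(2)[symmetric] by (simp add: other_gen_def)
    also have "\<dots> = mmul (0, -1, 1, 0) (mmul (tprod (k # ks)) (mmul (-1, 0, 0, -1) D))"
      unfolding tprod.simps m by (simp add: gmat_def mmul_def algebra_simps)
    finally have "wmat (altw 2 (k # ks)) = mmul (0, -1, 1, 0) (mmul (tprod (k # ks)) (mmul (-1, 0, 0, -1) D))" .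
    moreover have "mmul (-1, 0, 0, -1) D \<in> edge_stab" by (rule edge_stab_mmul[OF _ D(1)]) (simp add: edge_stab_def)
    ultimately show ?case by blast
  }
qed

lemma b1_word_altw: "j \<in> {1, 2} \<Longrightarrow> b1_word j ms = altw (other_gen j) (map (\<lambda>m. 2 * m) ms)"
proof (induction ms arbitrary: j)
  case Nil
  then show ?case by (simp add: b1_word_def)
next
  case (Cons m ms)
  have o: "other_gen j \<in> {1, 2}" "other_gen (other_gen j) = j" using Cons.prems by (auto simp: other_gen_def)
  have "b1_word j (m # ms) = (other_gen j, 2 * m) # b1_word (other_gen j) ms"
  proof -
    have "[0..<length (m # ms)] = 0 # map Suc [0..<length ms]"
      unfolding list.size(4) add_Suc_right add_0_right upt_conv_Cons[OF zero_less_Suc] map_Suc_upt ..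
    then show ?thesis unfolding b1_word_def by (simp add: o(2) del: upt_Suc)
  qed
  then show ?case using Cons.IH[OF o(1)] by simp
qed

lemma wmat_braid:
  assumes j: "j \<in> {1, 2}"
  obtains A D where "A \<in> edge_stab" "D \<in> edge_stab"
    "wmat (braid_word j k ms l) = mmul A (mmul (tprod (k # map (\<lambda>m. 2 * m) ms)) D)"
proof -
  let ?ks = "k # map (\<lambda>m. 2 * m) ms"
  have "braid_word j k ms l = altw j ?ks @ delta_word l" by (simp add: braid_word_def b1_word_altw[OF j])
  then have w: "wmat (braid_word j k ms l) = mmul (wmat (altw j ?ks)) (wmat (delta_word l))" by (simp only: wmat_append)
  obtain A D where AD: "A \<in> edge_stab" "D \<in> edge_stab" "wmat (altw j ?ks) = mmul A (mmul (tprod ?ks) D)"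
  proof (cases "j = 1")
    case True
    obtain D where D: "D \<in> edge_stab" "wmat (altw 1 ?ks) = mmul (tprod ?ks) D" using wmat_altw(1) by blast
    show ?thesis by (rule that[of "(1, 0, 0, 1)" D]) (use D True in \<open>simp_all only: mmul_one\<close>, simp add: edge_stab_def)
  next
    case False
    then have j2: "j = 2" using j by simp
    obtain D where D: "D \<in> edge_stab" "wmat (altw 2 ?ks) = mmul (0, -1, 1, 0) (mmul (tprod ?ks) D)" using wmat_altw(2) by blast
    show ?thesis by (rule that[of "(0, -1, 1, 0)" D]) (use D j2 in \<open>simp_all only:\<close>, simp add: edge_stab_def)
  qed
  have "wmat (braid_word j k ms l) = mmul A (mmul (tprod ?ks) (mmul D (wmat (delta_word l))))"
    unfolding w AD(3) mmul_assoc ..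
  then show ?thesis by (rule that[OF AD(1) edge_stab_mmul[OF AD(2) wmat_delta]])
qed

text \<open>Both notions depend on the pair of geodesics only, \<open>Kof\<close> being the
  hyperbolic cosine of their distance. In entries, the inversion exchanges a d and b c up to a
  common sign.\<close>

lemma edge_stab_invariance:
  assumes "A \<in> edge_stab" "D \<in> edge_stab"
  shows "generic (mmul A (mmul M D)) \<longleftrightarrow> generic M" "Kof (mmul A (mmul M D)) = Kof M"
proof -
  have 1: "generic (mmul X N) \<longleftrightarrow> generic N" "Kof (mmul X N) = Kof N"
    "generic (mmul N X) \<longleftrightarrow> generic N" "Kof (mmul N X) = Kof N" if X: "X \<in> edge_stab" for X N
  proof -
    obtain a b c d where N: "N = (a, b, c, d)" by (metis prod_cases4)
    have k: "\<bar>- (u * v) - w * z\<bar> = \<bar>u * v + w * z\<bar>" for u v w z :: int by linarith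
    show "generic (mmul X N) \<longleftrightarrow> generic N" "generic (mmul N X) \<longleftrightarrow> generic N"
      using X unfolding N edge_stab_def by (elim insertE emptyE; hypsubst; simp add: generic_def mmul_def conj_ac)+
    show "Kof (mmul X N) = Kof N" "Kof (mmul N X) = Kof N"
      using X unfolding N edge_stab_def by (elim insertE emptyE; hypsubst; simp add: Kof_def mmul_def k algebra_simps)+
  qed
  show "generic (mmul A (mmul M D)) \<longleftrightarrow> generic M" "Kof (mmul A (mmul M D)) = Kof M"
    using 1[OF assms(1)] 1[OF assms(2)] by simp_all
qed

section \<open>Continuants and syllables\<close>

text \<open>The action of the matrix (2n, -1, 1, 0) on a column; iterating it yields the continuants
  of the doubled exponents.\<close>

definition step :: "int \<Rightarrow> int \<times> int \<Rightarrow> int \<times> int" where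
  "step n = (\<lambda>(x, y). (2 * n * x - y, x))"
definition col :: "int \<times> int \<Rightarrow> int list \<Rightarrow> int \<times> int" where
  "col v ns = foldr step ns v"

lemma col_simps [simp]: "col v [] = v" "col v (n # ns) = step n (col v ns)"
  by (simp_all add: col_def)

lemma tprod_col:
  "tprod (map (\<lambda>m. 2 * m) ms) = (fst (col (1, 0) ms), fst (col (0, 1) ms), snd (col (1, 0) ms), snd (col (0, 1) ms))"
  by (induction ms) (simp, auto simp: mmul_def step_def split: prod.splits)

lemma mult_abs_ge:
  fixes n x :: int
  assumes "n \<noteq> 0" shows "\<bar>x\<bar> \<le> \<bar>n * x\<bar>"
  using assms mult_right_mono[of 1 "\<bar>n\<bar>" "\<bar>x\<bar>"] by (simp add: abs_mult)

lemma col_dominant: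
  assumes "\<forall>n\<in>set ns. n \<noteq> 0" "\<bar>snd v\<bar> < \<bar>fst v\<bar>"
  shows "\<bar>snd (col v ns)\<bar> < \<bar>fst (col v ns)\<bar>"
  using assms(1)
proof (induction ns)
  case (Cons n ns)
  obtain x y where xy: "col v ns = (x, y)" by force
  have "\<bar>y\<bar> < \<bar>x\<bar>" using Cons xy by simp
  moreover have "\<bar>x\<bar> \<le> \<bar>n * x\<bar>" using Cons.prems by (intro mult_abs_ge) auto
  ultimately show ?case using xy by (simp add: step_def)
qed (use assms(2) in simp)

lemma step_lower:
  assumes "\<bar>y\<bar> \<le> \<bar>x\<bar>" shows "(2 * \<bar>n\<bar> - 1) * \<bar>x\<bar> \<le> \<bar>fst (step n (x, y))\<bar>"
proof -
  have "2 * (\<bar>n\<bar> * \<bar>x\<bar>) = \<bar>2 * n * x\<bar>" by (simp add: abs_mult)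
  then show ?thesis using assms by (simp add: step_def algebra_simps)
qed

text \<open>The term 2 n x outweighs y, so the new first entry has the sign of n x.\<close>

lemma step_sign:
  assumes "\<bar>y\<bar> < \<bar>x\<bar>" "n \<noteq> 0" shows "0 < n * x * fst (step n (x, y))"
proof -
  have "n * x * fst (step n (x, y)) = 2 * ((n * x) * (n * x)) - (n * x) * y" by (simp add: step_def algebra_simps)
  moreover have "\<bar>(n * x) * y\<bar> < \<bar>n * x\<bar> * \<bar>n * x\<bar>"
    using assms mult_abs_ge[OF assms(2), of x] mult_strict_left_mono[of "\<bar>y\<bar>" "\<bar>n * x\<bar>" "\<bar>n * x\<bar>"] by (simp add: abs_mult)
  moreover have "\<bar>n * x\<bar> * \<bar>n * x\<bar> = (n * x) * (n * x)" by simp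
  moreover have "0 \<le> (n * x) * (n * x)" by simp
  ultimately show ?thesis by linarith
qed

text \<open>For n = 1 or -1 the step is n times a unipotent map, so along a run the entries grow
  only linearly in its length; s collects the signs. This linear growth is the reason why a run
  counts as a single syllable.\<close>

lemma col_run:
  assumes n: "\<bar>n\<bar> = 1" and xy: "col v ns = (x, y)"
  shows "\<exists>s. \<bar>s\<bar> = 1 \<and> col v (replicate d n @ ns) = (s * (x + int d * (x - n * y)), s * n * (x + (int d - 1) * (x - n * y)))"
proof (induction d)
  case 0
  have "n * n = 1" using n by (simp add: abs_if split: if_splits)
  then show ?case using xy by (intro exI[of _ 1]) (simp add: algebra_simps flip: mult.assoc)
next
  case (Suc d)
  then obtain s where s: "\<bar>s\<bar> = 1" "col v (replicate d n @ ns) = (s * (x + int d * (x - n * y)), s * n * (x + (int d - 1) * (x - n * y)))" by blast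
  have nn: "s * n * n = s" using n by (simp add: abs_if split: if_splits)
  have "2 * n * (s * (x + int d * (x - n * y))) - s * n * (x + (int d - 1) * (x - n * y)) = s * n * (x + int (Suc d) * (x - n * y))"
    by (simp add: algebra_simps)
  moreover have "s * (x + int d * (x - n * y)) = s * n * n * (x + (int (Suc d) - 1) * (x - n * y))" using nn by simp
  moreover have "col v (replicate (Suc d) n @ ns) = (2 * n * (s * (x + int d * (x - n * y))) - s * n * (x + (int d - 1) * (x - n * y)), s * (x + int d * (x - n * y)))"
    using s(2) by (simp add: step_def)
  ultimately have "col v (replicate (Suc d) n @ ns) = ((s * n) * (x + int (Suc d) * (x - n * y)), (s * n) * n * (x + (int (Suc d) - 1) * (x - n * y)))"
    by (simp only:)
  then show ?case using s(1) n by (intro exI[of _ "s * n"]) (simp add: abs_mult)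
qed

text \<open>The exponential of \<open>Lw\<close>, an integer, computed from the exponents alone; the
  letters alternate and carry no further information.\<close>

function Pi_syl :: "int list \<Rightarrow> int" where
  "Pi_syl [] = 1"
| "Pi_syl (n # ns) = (if 2 \<le> \<bar>n\<bar> then (4 * \<bar>n\<bar> - 1) * Pi_syl ns
     else (4 * int (Suc (length (takeWhile ((=) n) ns))) - 1) * Pi_syl (dropWhile ((=) n) ns))"
  by pat_completeness auto
termination
  by (relation "Wellfounded.measure length") (auto simp: le_imp_less_Suc length_dropWhile_le)

lemma Pi_syl_pos: "1 \<le> Pi_syl ns" "ns \<noteq> [] \<Longrightarrow> 3 \<le> Pi_syl ns"
proof -
  have m: "3 \<le> a * b" if "3 \<le> a" "1 \<le> b" for a b :: int using that mult_mono[of 3 a 1 b] by simp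
  have "1 \<le> Pi_syl ns \<and> (ns \<noteq> [] \<longrightarrow> 3 \<le> Pi_syl ns)"
  proof (induction ns rule: Pi_syl.induct)
    case (2 n ns)
    have "3 \<le> Pi_syl (n # ns)" using 2 by (auto intro!: m)
    then show ?case by simp
  qed simp
  then show "1 \<le> Pi_syl ns" "ns \<noteq> [] \<Longrightarrow> 3 \<le> Pi_syl ns" by auto
qed

lemma Lw_Pi_syl:
  assumes "\<forall>p\<in>set w. snd p \<noteq> 0"
  shows "Lw w = ln (of_int (Pi_syl (map snd w)))"
  using assms
proof (induction w rule: syllables.induct)
  case 1
  then show ?case by (simp add: Lw_def)
next
  case (2 a n rest)
  have lnm: "ln (of_int (x * y)) = ln (real_of_int x) + ln (of_int y)" if "3 \<le> x" "1 \<le> y" for x y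
    using that by (simp add: ln_mult)
  have Lc: "Lw w = ln (4 * real_of_int (syl_degree s) - 1) + Lw w'" if "syllables w = s # syllables w'" for w s w'
    using that by (simp add: Lw_def)
  show ?case
  proof (cases "2 \<le> \<bar>n\<bar>")
    case True
    have "Lw ((a, n) # rest) = ln (4 * real_of_int \<bar>n\<bar> - 1) + Lw rest"
      using Lc[of "(a, n) # rest" "[(a, n)]" rest] True by (simp add: syl_degree_def)
    moreover have "ln (of_int (Pi_syl (map snd ((a, n) # rest)))) = ln (real_of_int (4 * \<bar>n\<bar> - 1)) + ln (of_int (Pi_syl (map snd rest)))"
      using True Pi_syl_pos(1)[of "map snd rest"] lnm[of "4 * \<bar>n\<bar> - 1" "Pi_syl (map snd rest)"] by simp
    ultimately show ?thesis using 2 True by simp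
  next
    case False
    define s where "s = takeWhile (\<lambda>(b, m). m = n) rest"
    have n: "\<bar>n\<bar> = 1" using False "2.prems" by auto
    have eq: "(\<lambda>(b, m). m = n) = (=) n \<circ> (snd :: nat \<times> int \<Rightarrow> int)" by auto
    have deg: "syl_degree ((a, n) # s) = int (Suc (length s))"
    proof -
      have "\<forall>p\<in>set s. snd p = n" unfolding s_def by (auto dest: set_takeWhileD)
      then have "(\<Sum>(a, n) \<leftarrow> s. \<bar>n\<bar>) = int (length s)" using n by (induction s) auto
      then show ?thesis using n by (simp add: syl_degree_def)
    qed
    have len: "length (takeWhile ((=) n) (map snd rest)) = length s" by (simp add: takeWhile_map s_def eq)
    have dr: "dropWhile ((=) n) (map snd rest) = map snd (dropWhile (\<lambda>(b, m). m = n) rest)" by (simp add: dropWhile_map eq)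
    have "Lw ((a, n) # rest) = ln (4 * real_of_int (syl_degree ((a, n) # s)) - 1) + Lw (dropWhile (\<lambda>(b, m). m = n) rest)"
      using Lc[of "(a, n) # rest" "(a, n) # s" "dropWhile (\<lambda>(b, m). m = n) rest"] False by (simp add: s_def)
    moreover have "Lw (dropWhile (\<lambda>(b, m). m = n) rest) = ln (of_int (Pi_syl (map snd (dropWhile (\<lambda>(b, m). m = n) rest))))"
      using False "2.prems" by (intro "2.IH"(2)) (auto dest: set_dropWhileD)
    moreover have "ln (of_int (Pi_syl (map snd ((a, n) # rest)))) = ln (real_of_int (4 * int (Suc (length s)) - 1)) + ln (of_int (Pi_syl (map snd (dropWhile (\<lambda>(b, m). m = n) rest))))"
      using False n Pi_syl_pos(1) lnm[of "4 * int (Suc (length s)) - 1" "Pi_syl (map snd (dropWhile (\<lambda>(b, m). m = n) rest))"]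
      by (simp add: len dr)
    ultimately show ?thesis unfolding deg by simp
  qed
qed

lemma run_decomposition:
  obtains d where "0 < d" "n # ns = replicate d n @ dropWhile ((=) n) ns" "int d = int (Suc (length (takeWhile ((=) n) ns)))"
proof -
  let ?t = "takeWhile ((=) n) ns"
  have "?t = replicate (length ?t) n" by (intro replicate_length_same[symmetric]) (auto dest: set_takeWhileD)
  then have "n # ns = replicate (Suc (length ?t)) n @ dropWhile ((=) n) ns"
    by (metis append_Cons replicate_Suc takeWhile_dropWhile_id)
  then show ?thesis using that[of "Suc (length ?t)"] by simp
qed

text \<open>The leading syllable is removed. A term with |n| >= 2 enlarges the first entry by 2|n| -
  1 or more. A run of d units enlarges it by 1 + d or more if n x y <= 0. Otherwise the next term
  has the sign of the run; maximality of the run makes it at least 2 in modulus, and the run and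
  this term are removed together, because the run alone may gain too little.\<close>

lemma col_lower_bound:
  assumes "\<forall>n\<in>set ns. n \<noteq> 0"
  shows "Pi_syl ns \<le> fst (col (1, 0) ns) ^ 2"
  using assms
proof (induction "length ns" arbitrary: ns rule: less_induct)
  case less
  have dom: "\<bar>snd (col (1, 0) ms)\<bar> < \<bar>fst (col (1, 0) ms)\<bar>" if "\<forall>n\<in>set ms. n \<noteq> 0" for ms
    using that by (rule col_dominant) simp
  have combine: "P * Q' \<le> X\<^sup>2" if "Q' \<le> x\<^sup>2" "P \<le> c\<^sup>2" "0 \<le> Q'" "0 \<le> c" "c * \<bar>x\<bar> \<le> \<bar>X\<bar>" for P Q' X x c :: int
  proof -
    have "P * Q' \<le> c\<^sup>2 * x\<^sup>2" using that by (intro mult_mono) auto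
    also have "\<dots> = (c * \<bar>x\<bar>)\<^sup>2" by (simp add: power_mult_distrib)
    also have "\<dots> \<le> \<bar>X\<bar>\<^sup>2" using that by (intro power_mono) auto
    finally show ?thesis by simp
  qed
  show ?case
  proof (cases ns)
    case Nil
    then show ?thesis by simp
  next
    case (Cons n ms)
    have nz: "n \<noteq> 0" "\<forall>m\<in>set ms. m \<noteq> 0" using less.prems Cons by auto
    show ?thesis
    proof (cases "2 \<le> \<bar>n\<bar>")
      case True
      obtain x y where xy: "col (1, 0) ms = (x, y)" by force
      have IH: "Pi_syl ms \<le> x\<^sup>2" using less.hyps[of ms] nz Cons xy by simp
      have coef: "4 * \<bar>n\<bar> - 1 \<le> (2 * \<bar>n\<bar> - 1)\<^sup>2"
      proof -
        have "0 \<le> \<bar>n\<bar> * (\<bar>n\<bar> - 2)" using True by (intro mult_nonneg_nonneg) auto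
        then show ?thesis by (simp add: power2_eq_square algebra_simps)
      qed
      have lower: "(2 * \<bar>n\<bar> - 1) * \<bar>x\<bar> \<le> \<bar>fst (step n (x, y))\<bar>" using dom[OF nz(2)] xy by (intro step_lower) simp
      have "0 \<le> Pi_syl ms" "0 \<le> 2 * \<bar>n\<bar> - 1" using Pi_syl_pos(1)[of ms] True by auto
      then have "(4 * \<bar>n\<bar> - 1) * Pi_syl ms \<le> fst (step n (x, y)) ^ 2"
        by (rule combine[OF IH coef _ _ lower])
      then show ?thesis using True Cons xy by simp
    next
      case False
      define R where "R = dropWhile ((=) n) ms"
      have n1: "\<bar>n\<bar> = 1" using False nz by auto
      obtain d where d: "0 < d" "n # ms = replicate d n @ R" "int d = int (Suc (length (takeWhile ((=) n) ms)))"
        unfolding R_def by (rule run_decomposition)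
      have P: "Pi_syl ns = (4 * int d - 1) * Pi_syl R" using False Cons d(3) by (simp add: R_def)
      have Rnz: "\<forall>m\<in>set R. m \<noteq> 0" using nz(2) by (auto simp: R_def dest: set_dropWhileD)
      have Rl: "length R < length ns" using Cons by (simp add: R_def le_imp_less_Suc length_dropWhile_le)
      obtain x y where xy: "col (1, 0) R = (x, y)" by force
      obtain s where "\<bar>s\<bar> = 1" "col (1, 0) (replicate d n @ R) = (s * (x + int d * (x - n * y)), s * n * (x + (int d - 1) * (x - n * y)))"
        using col_run[OF n1 xy] by blast
      then have X: "\<bar>fst (col (1, 0) ns)\<bar> = \<bar>x + int d * (x - n * y)\<bar>" using Cons d(2) by (simp add: abs_mult)
      have X2: "fst (col (1, 0) ns) ^ 2 = (x + int d * (x - n * y))\<^sup>2" using X by (simp only: abs_eq_iff power2_eq_iff)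
      have IH: "Pi_syl R \<le> x\<^sup>2" using less.hyps[OF Rl Rnz] xy by simp
      have yx: "\<bar>y\<bar> < \<bar>x\<bar>" using dom[OF Rnz] xy by simp
      show ?thesis
      proof (cases "n * x * y \<le> 0")
        case True
        have "\<bar>x\<bar> + int d * \<bar>x\<bar> \<le> \<bar>x + int d * (x - n * y)\<bar>"
        proof (cases "0 \<le> x")
          case True
          then have "n * y \<le> 0" using \<open>n * x * y \<le> 0\<close> yx by (smt (verit) mult.assoc mult.commute mult_pos_pos)
          then have "x \<le> x - n * y" by simp
          then have "int d * x \<le> int d * (x - n * y)" by (intro mult_left_mono) auto
          then show ?thesis using True by simp
        next
          case False
          then have "0 \<le> n * y" using \<open>n * x * y \<le> 0\<close> by (smt (verit) mult.assoc mult.commute mult_neg_neg)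
          then have "x - n * y \<le> x" by simp
          then have "int d * (x - n * y) \<le> int d * x" by (intro mult_left_mono) auto
          then show ?thesis using False by simp
        qed
        then have lower: "(1 + int d) * \<bar>x\<bar> \<le> \<bar>x + int d * (x - n * y)\<bar>" by (simp add: algebra_simps)
        have coef: "4 * int d - 1 \<le> (1 + int d)\<^sup>2"
        proof -
          have "0 \<le> (int d - 1)\<^sup>2" by simp
          then show ?thesis by (simp add: power2_eq_square algebra_simps)
        qed
        have "0 \<le> Pi_syl R" "0 \<le> 1 + int d" using Pi_syl_pos(1)[of R] by auto
        then have "(4 * int d - 1) * Pi_syl R \<le> (x + int d * (x - n * y))\<^sup>2"
          by (rule combine[OF IH coef _ _ lower])
        then show ?thesis unfolding P X2 .
      next
        case False
        obtain m R' where R': "R = m # R'"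
        proof (cases R)
          case Nil
          then have "y = 0" using xy by simp
          then show ?thesis using False by simp
        next
          case (Cons m R')
          then show ?thesis by (rule that)
        qed
        \<comment> \<open>\<open>m\<close> heads what is left after the maximal run of n, hence
          differs from n.\<close>
        have mnz: "m \<noteq> 0" "\<forall>m\<in>set R'. m \<noteq> 0" "m \<noteq> n"
          using Rnz R' hd_dropWhile[of "(=) n" ms] by (auto simp: R_def)
        obtain y' w where yw: "col (1, 0) R' = (y', w)" by force
        have y': "y' = y" "x = fst (step m (y, w))" using xy yw R' by (auto simp: step_def)
        have wy: "\<bar>w\<bar> < \<bar>y\<bar>" using dom[OF mnz(2)] yw y' by simp
        have sg: "0 < m * y * x" using step_sign[OF wy mnz(1)] y' by simp
        have "0 < n * m"
        proof -
          have "0 < (n * x * y) * (m * y * x)" using False sg by (intro mult_pos_pos[of "n * x * y"]) linarith+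
          also have "\<dots> = (n * m) * (x * y)\<^sup>2" by (simp add: power2_eq_square algebra_simps)
          finally show ?thesis by (simp add: zero_less_mult_iff)
        qed
        then have m2: "2 \<le> \<bar>m\<bar>" using n1 mnz by (auto simp: zero_less_mult_iff abs_if split: if_splits)
        have xl: "(2 * \<bar>m\<bar> - 1) * \<bar>y\<bar> \<le> \<bar>x\<bar>" unfolding y'(2) using wy by (intro step_lower) simp
        have ny: "\<bar>n * y\<bar> = \<bar>y\<bar>" using n1 by (simp add: abs_mult)
        have pos: "0 < x * (n * y)" using False by (simp add: mult_ac)
        have D: "\<bar>x + int d * (x - n * y)\<bar> = \<bar>x\<bar> + int d * (\<bar>x\<bar> - \<bar>y\<bar>)"
        proof (cases "0 < x")
          case True
          then have "n * y = \<bar>y\<bar>" using ny zero_less_mult_pos[OF pos] by simp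
          then show ?thesis using True yx by simp
        next
          case xn: False
          then have "n * y < 0" using pos by (auto simp: zero_less_mult_iff[of x])
          then have "n * y = - \<bar>y\<bar>" using ny by simp
          then have "x + int d * (x - n * y) = - (\<bar>x\<bar> + int d * (\<bar>x\<bar> - \<bar>y\<bar>))" using xn by (simp add: algebra_simps)
          moreover have "0 \<le> int d * (\<bar>x\<bar> - \<bar>y\<bar>)" using yx by simp
          ultimately show ?thesis by simp
        qed
        have lower: "(2 * \<bar>m\<bar> - 1 + int d * (2 * \<bar>m\<bar> - 2)) * \<bar>y\<bar> \<le> \<bar>x + int d * (x - n * y)\<bar>"
        proof -
          have "int d * ((2 * \<bar>m\<bar> - 2) * \<bar>y\<bar>) \<le> int d * (\<bar>x\<bar> - \<bar>y\<bar>)" using xl by (intro mult_left_mono) (auto simp: algebra_simps)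
          then show ?thesis unfolding D using xl by (simp add: algebra_simps)
        qed
        have coef: "(4 * int d - 1) * (4 * \<bar>m\<bar> - 1) \<le> (2 * \<bar>m\<bar> - 1 + int d * (2 * \<bar>m\<bar> - 2))\<^sup>2"
        proof -
          define p e where "p = \<bar>m\<bar> - 2" and "e = int d"
          have pe: "0 \<le> p" "1 \<le> e" using m2 d(1) by (auto simp: p_def e_def)
          have mp: "\<bar>m\<bar> = p + 2" by (simp add: p_def)
          \<comment> \<open>For p = 0 the difference is 4 (e - 2)^2, so equality occurs when |m| = d
            = 2: the factor for the two syllables together is then exactly the square root of the
            product of their weights.\<close>
          have "(2 * \<bar>m\<bar> - 1 + e * (2 * \<bar>m\<bar> - 2))\<^sup>2 - (4 * e - 1) * (4 * \<bar>m\<bar> - 1)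
            = 4 * (e - 2)\<^sup>2 + p * (16 + 4 * e + 8 * e\<^sup>2 + 4 * p * (1 + e)\<^sup>2)"
            unfolding mp by (simp add: power2_eq_square algebra_simps)
          moreover have "0 \<le> p * (16 + 4 * e + 8 * e\<^sup>2 + 4 * p * (1 + e)\<^sup>2)" using pe by (intro mult_nonneg_nonneg add_nonneg_nonneg) auto
          ultimately show ?thesis unfolding e_def using zero_le_power2[of "int d - 2"] by linarith
        qed
        have IH': "Pi_syl R' \<le> y\<^sup>2" using less.hyps[of R'] Rl R' mnz(2) yw y' by simp
        have "0 \<le> Pi_syl R'" "0 \<le> 2 * \<bar>m\<bar> - 1 + int d * (2 * \<bar>m\<bar> - 2)" using Pi_syl_pos(1)[of R'] m2 by auto
        then have "((4 * int d - 1) * (4 * \<bar>m\<bar> - 1)) * Pi_syl R' \<le> (x + int d * (x - n * y))\<^sup>2"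
          by (rule combine[OF IH' coef _ _ lower])
        moreover have "Pi_syl ns = ((4 * int d - 1) * (4 * \<bar>m\<bar> - 1)) * Pi_syl R'" unfolding P R' using m2 by simp
        ultimately show ?thesis unfolding X2 by simp
      qed
    qed
  qed
qed

text \<open>A single term enlarges the entries by at most 2|n| + 1 and a run by at most 2d + 1;
  these are at most 4|n| - 1 and 4d - 1.\<close>

lemma col_upper_bound:
  assumes "\<forall>n\<in>set ns. n \<noteq> 0" "\<bar>fst v\<bar> \<le> B" "\<bar>snd v\<bar> \<le> B"
  shows "\<bar>fst (col v ns)\<bar> \<le> Pi_syl ns * B \<and> \<bar>snd (col v ns)\<bar> \<le> Pi_syl ns * B"
  using assms(1)
proof (induction ns rule: Pi_syl.induct)
  case 1
  then show ?case using assms by simp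
next
  case (2 n ns)
  show ?case
  proof (cases "2 \<le> \<bar>n\<bar>")
    case True
    obtain x y where xy: "col v ns = (x, y)" by force
    define C where "C = Pi_syl ns * B"
    have xyC: "\<bar>x\<bar> \<le> C" "\<bar>y\<bar> \<le> C" using "2.IH"(1)[OF True] "2.prems" xy by (simp_all add: C_def)
    have "\<bar>2 * n * x\<bar> \<le> (2 * \<bar>n\<bar>) * C" using xyC unfolding abs_mult by (intro mult_mono) auto
    then have "\<bar>2 * n * x - y\<bar> \<le> (2 * \<bar>n\<bar> + 1) * C" using xyC by (simp add: algebra_simps)
    moreover have "(2 * \<bar>n\<bar> + 1) * C \<le> (4 * \<bar>n\<bar> - 1) * C" "1 * C \<le> (4 * \<bar>n\<bar> - 1) * C"
      using True xyC by (intro mult_right_mono; linarith)+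
    ultimately show ?thesis using True xy xyC by (simp add: step_def C_def mult.assoc)
  next
    case False
    define R where "R = dropWhile ((=) n) ns"
    have n1: "\<bar>n\<bar> = 1" using False "2.prems" by auto
    obtain d where d: "0 < d" "n # ns = replicate d n @ R" "int d = int (Suc (length (takeWhile ((=) n) ns)))"
      unfolding R_def by (rule run_decomposition)
    have P: "Pi_syl (n # ns) = (4 * int d - 1) * Pi_syl R" using False d(3) by (simp add: R_def)
    obtain x y where xy: "col v R = (x, y)" by force
    define C where "C = Pi_syl R * B"
    have xyC: "\<bar>x\<bar> \<le> C" "\<bar>y\<bar> \<le> C" using "2.IH"(2)[OF False] "2.prems" xy by (auto simp: C_def R_def dest: set_dropWhileD)
    obtain s where s: "\<bar>s\<bar> = 1" "col v (replicate d n @ R) = (s * (x + int d * (x - n * y)), s * n * (x + (int d - 1) * (x - n * y)))"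
      using col_run[OF n1 xy] by blast
    have "\<bar>n * y\<bar> \<le> C" using n1 xyC by (simp add: abs_mult)
    then have z: "\<bar>x - n * y\<bar> \<le> 2 * C" using xyC by linarith
    have b: "\<bar>x + e * (x - n * y)\<bar> \<le> (4 * int d - 1) * C" if e: "0 \<le> e" "e \<le> int d" for e
    proof -
      have "\<bar>e * (x - n * y)\<bar> \<le> int d * (2 * C)" using z e unfolding abs_mult by (intro mult_mono) auto
      then have "\<bar>x + e * (x - n * y)\<bar> \<le> (2 * int d + 1) * C" using xyC by (simp add: algebra_simps)
      also have "\<dots> \<le> (4 * int d - 1) * C" using xyC d(1) by (intro mult_right_mono) linarith+
      finally show ?thesis .
    qed
    have "\<bar>fst (col v (n # ns))\<bar> \<le> (4 * int d - 1) * C" "\<bar>snd (col v (n # ns))\<bar> \<le> (4 * int d - 1) * C"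
      unfolding d(2) s(2) using s(1) n1 b[of "int d"] b[of "int d - 1"] d(1) by (simp_all add: abs_mult)
    then show ?thesis unfolding P C_def mult.assoc by (rule conjI)
  qed
qed

lemma tprod_SL2: "tprod ks \<in> SL2"
proof (induction ks)
  case (Cons k ks)
  then show ?case using mmul_SL2[of "(k, -1, 1, 0)"] by (simp add: SL2_def)
qed (simp add: SL2_def)

lemma q_half: "2 * (q k div 2) = q k"
proof -
  have "even (q k)" by (auto simp: q_def sgn_if)
  then show ?thesis by simp
qed

section \<open>Matrix entries against syllable degrees\<close>

text \<open>The leading exponent k enters undoubled, while P is formed with q(k). As k and q(k)
  differ by at most 1, the first row changes by at most one copy of the second, and
  \<open>Kof\<close> absorbs this because it is at least |a| + |x1|.\<close>

lemma core_bounds: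
  assumes k: "k \<noteq> 0" and ms: "ms \<noteq> []" "\<forall>m\<in>set ms. m \<noteq> 0"
  defines "P \<equiv> Pi_syl ((if q k = 0 then [] else [q k div 2]) @ ms)" and "M \<equiv> tprod (k # map (\<lambda>m. 2 * m) ms)"
  shows "generic M" "P \<le> (Kof M)\<^sup>2" "Kof M \<le> 8 * P\<^sup>2"
proof -
  obtain x1 y1 x2 y2 where xy: "col (1, 0) ms = (x1, y1)" "col (0, 1) ms = (x2, y2)" by force
  have d1: "\<bar>y1\<bar> < \<bar>x1\<bar>" using col_dominant[OF ms(2), of "(1, 0)"] xy by simp
  have d2: "\<bar>y2\<bar> < \<bar>x2\<bar>"
  proof -
    \<comment> \<open>The innermost step takes (0, 1) to (-1, 0), so the second column is a dominant
      column of the word shortened by its last term.\<close>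
    have "ms = butlast ms @ [last ms]" using ms(1) by simp
    then have "col (0, 1) ms = foldr step (butlast ms @ [last ms]) (0, 1)" unfolding col_def by simp
    also have "\<dots> = col (-1, 0) (butlast ms)" by (simp add: col_def step_def)
    finally have "col (-1, 0) (butlast ms) = (x2, y2)" using xy(2) by simp
    moreover have "\<forall>m\<in>set (butlast ms). m \<noteq> 0" using ms(2) by (auto dest: in_set_butlastD)
    ultimately show ?thesis using col_dominant[of "butlast ms" "(-1, 0)"] by simp
  qed
  define a b where "a = k * x1 - y1" and "b = k * x2 - y2"
  have M: "M = (a, b, x1, x2)" unfolding M_def tprod.simps tprod_col by (simp add: xy mmul_def a_def b_def)
  have nz: "a \<noteq> 0" "b \<noteq> 0" "x1 \<noteq> 0" "x2 \<noteq> 0"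
    using mult_abs_ge[OF k, of x1] mult_abs_ge[OF k, of x2] d1 d2 by (auto simp: a_def b_def)
  have det: "a * x2 - b * x1 = 1" using tprod_SL2[of "k # map (\<lambda>m. 2 * m) ms"] unfolding M_def[symmetric] M by (simp add: SL2_def)
  show "generic M" using nz by (simp add: M generic_def)
  have K: "Kof M = \<bar>a\<bar> * \<bar>x2\<bar> + \<bar>b\<bar> * \<bar>x1\<bar>"
    using generic_signs(1)[OF det nz(1,2,3,4)] by (auto simp: M Kof_def zero_less_mult_iff[of "a * x2"] simp flip: abs_mult)
  have "\<bar>a\<bar> * 1 \<le> \<bar>a\<bar> * \<bar>x2\<bar>" "1 * \<bar>x1\<bar> \<le> \<bar>b\<bar> * \<bar>x1\<bar>"
    using nz by (intro mult_left_mono mult_right_mono; simp)+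
  then have Kl: "\<bar>a\<bar> + \<bar>x1\<bar> \<le> Kof M" unfolding K by simp
  have up: "\<bar>fst (col v ns)\<bar> \<le> Pi_syl ns" "\<bar>snd (col v ns)\<bar> \<le> Pi_syl ns"
    if "\<forall>n\<in>set ns. n \<noteq> 0" "v = (1, 0) \<or> v = (0, 1)" for v ns
    using col_upper_bound[OF that(1), of v 1] that(2) by auto
  have sq: "p \<le> Z\<^sup>2" if "p \<le> X\<^sup>2" "\<bar>X\<bar> \<le> Z" for p X Z :: int
  proof -
    have "\<bar>X\<bar>\<^sup>2 \<le> Z\<^sup>2" using that(2) by (intro power_mono) auto
    then show ?thesis using that(1) by simp
  qed
  have "P \<le> (Kof M)\<^sup>2 \<and> \<bar>a\<bar> \<le> 2 * P \<and> \<bar>b\<bar> \<le> 2 * P \<and> \<bar>x1\<bar> \<le> P \<and> \<bar>x2\<bar> \<le> P"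
  proof (cases "q k = 0")
    case True
    \<comment> \<open>Here the leading exponent disappears from the reduced word, and the second row
      of the matrix already carries the continuant of \<open>ms\<close>.\<close>
    have "k = 1 \<or> k = -1" using True k by (auto simp: q_def sgn_if split: if_splits)
    moreover have P: "P = Pi_syl ms" using True by (simp add: P_def)
    moreover have "P \<le> (Kof M)\<^sup>2" using sq[OF col_lower_bound[OF ms(2)]] xy Kl unfolding P by simp
    moreover have "\<bar>x1\<bar> \<le> P" "\<bar>y1\<bar> \<le> P" "\<bar>x2\<bar> \<le> P" "\<bar>y2\<bar> \<le> P"
      using up[OF ms(2), of "(1, 0)"] up[OF ms(2), of "(0, 1)"] xy P by simp_all
    ultimately have "\<bar>a\<bar> \<le> 2 * P" "\<bar>b\<bar> \<le> 2 * P" unfolding a_def b_def by (elim disjE; simp; linarith)+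
    then show ?thesis using \<open>P \<le> (Kof M)\<^sup>2\<close> \<open>\<bar>x1\<bar> \<le> P\<close> \<open>\<bar>x2\<bar> \<le> P\<close> by blast
  next
    case False
    define n where "n = q k div 2"
    have n: "2 * n = q k" unfolding n_def by (rule q_half)
    have n0: "\<forall>m\<in>set (n # ms). m \<noteq> 0" using n False ms(2) by auto
    have P: "P = Pi_syl (n # ms)" using False by (simp add: P_def n_def)
    define s where "s = k - q k"
    have s: "\<bar>s\<bar> \<le> 1" by (auto simp: s_def q_def sgn_if)
    have c: "col (1, 0) (n # ms) = (a - s * x1, x1)" "col (0, 1) (n # ms) = (b - s * x2, x2)"
      unfolding col_simps xy step_def n prod.case by (simp_all add: a_def b_def s_def algebra_simps)
    have sx: "\<bar>s * x\<bar> \<le> \<bar>x\<bar>" for x using mult_right_mono[OF s, of "\<bar>x\<bar>"] by (simp add: abs_mult)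
    have "P \<le> (Kof M)\<^sup>2" unfolding P
    proof (rule sq)
      show "Pi_syl (n # ms) \<le> (a - s * x1)\<^sup>2" using col_lower_bound[OF n0] unfolding c by simp
      show "\<bar>a - s * x1\<bar> \<le> Kof M" using Kl sx[of x1] by linarith
    qed
    moreover have "\<bar>a - s * x1\<bar> \<le> P" "\<bar>x1\<bar> \<le> P" "\<bar>b - s * x2\<bar> \<le> P" "\<bar>x2\<bar> \<le> P"
      using up[OF n0, of "(1, 0)"] up[OF n0, of "(0, 1)"] unfolding c P by simp_all
    ultimately show ?thesis using sx[of x1] sx[of x2] by linarith
  qed
  then have 1: "P \<le> (Kof M)\<^sup>2" and 2: "\<bar>a\<bar> \<le> 2 * P" "\<bar>b\<bar> \<le> 2 * P" "\<bar>x1\<bar> \<le> P" "\<bar>x2\<bar> \<le> P" by auto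
  show "P \<le> (Kof M)\<^sup>2" by (rule 1)
  have "\<bar>a\<bar> * \<bar>x2\<bar> \<le> (2 * P) * P" "\<bar>b\<bar> * \<bar>x1\<bar> \<le> (2 * P) * P" using 2 by (intro mult_mono; simp)+
  then have "Kof M \<le> 4 * P\<^sup>2" unfolding K by (simp add: power2_eq_square)
  then show "Kof M \<le> 8 * P\<^sup>2" using zero_le_power2[of P] by linarith
qed

theorem theorem3:
  fixes j :: nat and k :: int and ms :: "int list" and l :: int
  assumes "j \<in> {1, 2}" and "k \<noteq> 0" and "\<forall>m \<in> set ms. m \<noteq> 0"
  shows "(ms = [] \<longrightarrow> Lambda_tr (braid_word j k ms l) = 0) \<and>
         (ms \<noteq> [] \<longrightarrow>
            Lw (theta_word j k ms) / (2 * pi) \<le> Lambda_tr (braid_word j k ms l) \<and>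
            Lambda_tr (braid_word j k ms l) \<le> 300 * Lw (theta_word j k ms))"
proof -
  define \<rho> where "\<rho> = word_path (braid_word j k ms l)"
  define \<gamma> where "\<gamma> = wmat (braid_word j k ms l)"
  have letters: "\<forall>(i, k)\<in>set (braid_word j k ms l). i \<in> {1, 2}"
    using assms(1) by (auto simp: braid_word_def b1_word_def delta_word_def other_gen_def split: if_splits)
  have mon: "Mon \<rho> \<gamma>" unfolding \<rho>_def \<gamma>_def by (rule Mon_word) (use letters in auto)
  have L: "Lambda_tr (braid_word j k ms l) = Inf (ratios \<rho>)" by (simp add: Lambda_ratios \<rho>_def)
  have bdd: "bdd_below (ratios \<rho>)" using ratios_nonneg by (intro bdd_belowI)
  have "Inf (ratios \<rho>) = 0" if "ms = []"
  proof (rule antisym)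
    \<comment> \<open>A single generator power followed by a stabiliser of the axis: the geodesics
      share an end point or coincide, and rectangles of every width W exist.\<close>
    have "\<gamma> = mmul (gmat j k) (wmat (delta_word l))" by (simp add: \<gamma>_def braid_word_def b1_word_def that)
    then have mem: "1 / W \<in> ratios \<rho>" if "0 < W" for W using upper_parabolic[OF assms(1) wmat_delta _ that] mon by simp
    show "Inf (ratios \<rho>) \<le> 0"
    proof (rule field_le_epsilon)
      fix e :: real assume "0 < e"
      then show "Inf (ratios \<rho>) \<le> 0 + e" using cInf_lower[OF mem[of "1 / e"] bdd] by simp
    qed
    show "0 \<le> Inf (ratios \<rho>)" by (rule cInf_greatest) (use mem[of 1] ratios_nonneg in auto)
  qed
  moreover have "Lw (theta_word j k ms) / (2 * pi) \<le> Inf (ratios \<rho>) \<and> Inf (ratios \<rho>) \<le> 300 * Lw (theta_word j k ms)" if ms: "ms \<noteq> []"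
  proof -
    let ?M = "tprod (k # map (\<lambda>m. 2 * m) ms)"
    let ?es = "(if q k = 0 then [] else [q k div 2]) @ ms"
    define P where "P = Pi_syl ?es"
    note cb = core_bounds[OF assms(2) ms assms(3), folded P_def]
    obtain A D where AD: "A \<in> edge_stab" "D \<in> edge_stab" "\<gamma> = mmul A (mmul ?M D)"
      unfolding \<gamma>_def by (rule wmat_braid[OF assms(1)])
    have gen: "generic \<gamma>" and K: "Kof \<gamma> = Kof ?M" using edge_stab_invariance[OF AD(1,2)] cb(1) by (simp_all add: AD(3))
    have g: "\<gamma> \<in> SL2" using mon by (simp add: Mon_def)
    note kb = kappa_bounds[OF g gen]
    have es: "map snd (theta_word j k ms) = ?es"
    proof -
      have "map (\<lambda>p. ms ! p) [0..<length ms] = ms" by (rule map_nth)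
      then show ?thesis by (simp add: theta_word_def o_def)
    qed
    have "q k div 2 \<noteq> 0" if "q k \<noteq> 0" using that q_half[of k] by auto
    then have "\<forall>n\<in>set ?es. n \<noteq> 0" using assms(3) by auto
    then have "\<forall>p\<in>set (theta_word j k ms). snd p \<noteq> 0" unfolding es[symmetric] by simp
    then have Lw: "Lw (theta_word j k ms) = ln (of_int P)" unfolding P_def es[symmetric] by (rule Lw_Pi_syl)
    have P3: "3 \<le> P" unfolding P_def using ms by (intro Pi_syl_pos(2)) auto
    have lower: "Lw (theta_word j k ms) / (2 * pi) \<le> r" if "r \<in> ratios \<rho>" for r
    proof -
      obtain z0 z1 f where f: "holo_rect_represents z0 z1 f \<rho>" "r = (Im z1 - Im z0) / (Re z1 - Re z0)"
        using \<open>r \<in> ratios \<rho>\<close> by (auto simp: ratios_def)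
      \<comment> \<open>The entries reach only the square root of P, which accounts for the 2 in the
        denominator 2 \<pi>; the \<pi> comes from the flux.\<close>
      have "real_of_int P \<le> real_of_int (Kof \<gamma>) ^ 2" using cb(2) unfolding K by (metis of_int_le_iff of_int_power)
      then have "ln (of_int P) \<le> ln (real_of_int (Kof \<gamma>) ^ 2)" using P3 by (intro ln_mono) auto
      also have "\<dots> = 2 * ln (of_int (Kof \<gamma>))" using kb(4) by (simp add: ln_realpow)
      finally have "ln (of_int P) / (2 * pi) \<le> ln (of_int (Kof \<gamma>)) / pi" by (simp add: field_simps)
      also have "\<dots> \<le> r" using lower_bound[OF f(1) mon gen] f(2) by simp
      finally show ?thesis unfolding Lw .
    qed
    have mem: "2 * - ln (kappa \<gamma>) / pi \<in> ratios \<rho>" by (rule upper_generic[OF mon gen])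
    \<comment> \<open>From 1 / \<open>kappa\<close> <= 2 \<open>Kof\<close> <= 16 P^2 and 16 <= 27
      <= P^3 follows the bound P^5. The ratio 2 \<delta> / \<pi> is thus at most (10 / \<pi>) ln P,
      well inside the constant 300.\<close>
    have "- ln (kappa \<gamma>) \<le> 5 * ln (of_int P)"
    proof -
      have P3r: "3 \<le> real_of_int P" using P3 by simp
      have "1 / kappa \<gamma> \<le> 2 * real_of_int (8 * P\<^sup>2)" using kb(3) cb(3) unfolding K by (smt (verit) of_int_le_iff)
      also have "\<dots> = 16 * real_of_int P ^ 2" by simp
      also have "\<dots> \<le> real_of_int P ^ 3 * real_of_int P ^ 2"
        using power_mono[OF P3r, of 3] by (intro mult_right_mono) auto
      also have "\<dots> = real_of_int P ^ 5" by (simp flip: power_add)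
      finally have "ln (1 / kappa \<gamma>) \<le> ln (real_of_int P ^ 5)" using kb(1) P3r by (intro ln_mono) auto
      then show ?thesis using kb(1) P3r by (simp add: ln_div ln_realpow)
    qed
    moreover have "0 \<le> ln (real_of_int P)" using P3 by simp
    ultimately have "2 * - ln (kappa \<gamma>) \<le> 300 * ln (of_int P) * 1" by linarith
    also have "\<dots> \<le> 300 * ln (of_int P) * pi" using P3 pi_gt3 by (intro mult_left_mono) auto
    finally have "2 * - ln (kappa \<gamma>) / pi \<le> 300 * ln (of_int P)" by (simp add: field_simps)
    then have "Inf (ratios \<rho>) \<le> 300 * Lw (theta_word j k ms)" unfolding Lw using cInf_lower[OF mem bdd] by linarith
    moreover have "Lw (theta_word j k ms) / (2 * pi) \<le> Inf (ratios \<rho>)" using mem lower by (intro cInf_greatest) auto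
    ultimately show ?thesis by blast
  qed
  ultimately show ?thesis unfolding L by blast
qed

end
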